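(* Let $\mathcal{O}$ be a valuation domain with fraction field $K$, let $\Gamma=K^\times/\mathcal{O}^\times$ be its divisibility group and $v:K^\times\to\Gamma$ the valuation (the quotient map). Let $G$ be a finitely presented smooth group scheme over $S=\mathrm{Spec}(\mathcal{O})$. Then the image of $G(\mathcal{O})\to G(K)$ is contained in the kernel of the homomorphism $$\nu_G:G(K)\to \mathrm{Hom}(X(G_K),\Gamma),\qquad g\mapsto \bigl(\chi\mapsto v(\chi(g))\bigr).$$
   Context: $X(G_K)=\mathrm{Hom}_{\mathrm{Grp}/K}(G_K,\mathbb{G}_{m,K})$ is the abelian group of characters of the generic fiber $G_K$ defined over $K$; for $\chi\in X(G_K)$ and $g\in G(K)$, $\chi(g)\in \mathbb{G}_m(K)=K^\times$. $\mathrm{Hom}(X(G_K),\Gamma)$ is the group of homomorphisms of abelian groups. *)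

theory Defs
  imports "HOL-Algebra.Algebra"
begin

text \<open>
  Schemes are defined as functors of points, as by Demazure and Gabriel: a scheme
  over a commutative ring \<open>k\<close> is a set-valued functor on commutative \<open>k\<close>-algebras that is a
  Zariski sheaf and is covered by affine open subfunctors.
  Fibre products are then formed pointwise, a group scheme is a scheme together with a
  functorial group structure on its points, and base change is restriction of scalars on test
  algebras.

  The universe of test algebras consists of all algebras whose carrier is a set of elements of
  one fixed type \<open>'u\<close>, which is also the type of the elements of \<open>k\<close>. If \<open>'u\<close> is infinite then the
  universe contains, up to isomorphism, every \<open>k\<close>-algebra of cardinality at most that of \<open>'u\<close>; in
  particular it contains all finitely generated \<open>k\<close>-algebras and it is closed under quotients,
  localizations and tensor products.  Every \<open>k\<close> is isomorphic to a ring on an infinite type.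
  The values of the functors live in an arbitrary second type \<open>'g\<close>.
\<close>


section \<open>Commutative algebras\<close>

text \<open>A \<open>k\<close>-algebra is a ring together with its structure map. Structure maps and homomorphisms
  are required to be extensional, so that equality of functions is equality of morphisms.\<close>

type_synonym 'u alg = "'u ring \<times> ('u \<Rightarrow> 'u)"

definition algebras :: "'u ring \<Rightarrow> 'u alg set" where
  "algebras k = {(R, \<phi>). cring R \<and> \<phi> \<in> ring_hom k R \<and> \<phi> \<in> extensional (carrier k)}"

definition alg_hom :: "'u ring \<Rightarrow> 'u alg \<Rightarrow> 'u alg \<Rightarrow> ('u \<Rightarrow> 'u) set" where
  "alg_hom k A B = {f \<in> ring_hom (fst A) (fst B). f \<in> extensional (carrier (fst A)) \<and>
     (\<forall>x \<in> carrier k. f (snd A x) = snd B x)}"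

definition base_alg :: "'u ring \<Rightarrow> 'u alg" where
  "base_alg k = (k, \<lambda>x \<in> carrier k. x)"

definition is_localization_at :: "'u ring \<Rightarrow> 'u alg \<Rightarrow> 'u \<Rightarrow> 'u alg \<Rightarrow> ('u \<Rightarrow> 'u) \<Rightarrow> bool" where
  "is_localization_at k A e B l \<longleftrightarrow>
     B \<in> algebras k \<and> l \<in> alg_hom k A B \<and> l e \<in> Units (fst B) \<and>
     (\<forall>b \<in> carrier (fst B). \<exists>a \<in> carrier (fst A). \<exists>n::nat.
        b \<otimes>\<^bsub>fst B\<^esub> (l e [^]\<^bsub>fst B\<^esub> n) = l a) \<and>
     (\<forall>a \<in> carrier (fst A). l a = \<zero>\<^bsub>fst B\<^esub> \<longrightarrow>
        (\<exists>n::nat. a \<otimes>\<^bsub>fst A\<^esub> (e [^]\<^bsub>fst A\<^esub> n) = \<zero>\<^bsub>fst A\<^esub>))"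

definition is_polynomial_algebra :: "'u ring \<Rightarrow> 'u alg \<Rightarrow> 'u list \<Rightarrow> bool" where
  "is_polynomial_algebra k P xs \<longleftrightarrow>
     P \<in> algebras k \<and> set xs \<subseteq> carrier (fst P) \<and>
     (\<forall>A \<in> algebras k. \<forall>as. set as \<subseteq> carrier (fst A) \<and> length as = length xs \<longrightarrow>
        (\<exists>!f. f \<in> alg_hom k P A \<and> map f xs = as))"

definition finitely_presented_algebra :: "'u ring \<Rightarrow> 'u alg \<Rightarrow> bool" where
  "finitely_presented_algebra k B \<longleftrightarrow>
     (\<exists>P xs f E. is_polynomial_algebra k P xs \<and> f \<in> alg_hom k P B \<and>
        f ` carrier (fst P) = carrier (fst B) \<and>
        finite E \<and> E \<subseteq> carrier (fst P) \<and>
        a_kernel (fst P) (fst B) f = Idl\<^bsub>fst P\<^esub> E)"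


section \<open>Functors and schemes\<close>

record ('u, 'g) kfun =
  obj :: "'u alg \<Rightarrow> 'g set"
  arr :: "'u alg \<Rightarrow> 'u alg \<Rightarrow> ('u \<Rightarrow> 'u) \<Rightarrow> 'g \<Rightarrow> 'g"

definition kfunctor :: "'u ring \<Rightarrow> ('u, 'g) kfun \<Rightarrow> bool" where
  "kfunctor k F \<longleftrightarrow>
     (\<forall>A \<in> algebras k. \<forall>B \<in> algebras k. \<forall>f \<in> alg_hom k A B. arr F A B f \<in> obj F A \<rightarrow> obj F B) \<and>
     (\<forall>A \<in> algebras k. \<forall>x \<in> obj F A. arr F A A (\<lambda>a \<in> carrier (fst A). a) x = x) \<and>
     (\<forall>A \<in> algebras k. \<forall>B \<in> algebras k. \<forall>C \<in> algebras k.
        \<forall>f \<in> alg_hom k A B. \<forall>g \<in> alg_hom k B C. \<forall>x \<in> obj F A.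
        arr F A C (compose (carrier (fst A)) g f) x = arr F B C g (arr F A B f x))"

text \<open>Sheaf condition for the Zariski coverings of \<open>Spec A\<close> by finitely many basic open sets
  \<open>Spec (A\<^sub>e)\<close>.  Agreement on the overlaps is tested on all \<open>C\<close> that receive compatible maps
  from \<open>A\<^sub>e\<close> and \<open>A\<^sub>e\<^sub>'\<close>, the universal one being the localization at the product of \<open>e\<close>
  and \<open>e'\<close>.\<close>

definition zariski_sheaf :: "'u ring \<Rightarrow> ('u, 'g) kfun \<Rightarrow> bool" where
  "zariski_sheaf k F \<longleftrightarrow>
     (\<forall>A \<in> algebras k. \<forall>E L l x.
        finite E \<and> E \<subseteq> carrier (fst A) \<and> Idl\<^bsub>fst A\<^esub> E = carrier (fst A) \<and>
        (\<forall>e \<in> E. is_localization_at k A e (L e) (l e) \<and> x e \<in> obj F (L e)) \<and>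
        (\<forall>e \<in> E. \<forall>e' \<in> E. \<forall>C \<in> algebras k. \<forall>p \<in> alg_hom k (L e) C. \<forall>q \<in> alg_hom k (L e') C.
           compose (carrier (fst A)) p (l e) = compose (carrier (fst A)) q (l e') \<longrightarrow>
           arr F (L e) C p (x e) = arr F (L e') C q (x e')) \<longrightarrow>
        (\<exists>!y. y \<in> obj F A \<and> (\<forall>e \<in> E. arr F A (L e) (l e) y = x e)))"

definition subfunctor :: "'u ring \<Rightarrow> ('u, 'g) kfun \<Rightarrow> ('u alg \<Rightarrow> 'g set) \<Rightarrow> bool" where
  "subfunctor k F U \<longleftrightarrow>
     (\<forall>A \<in> algebras k. U A \<subseteq> obj F A) \<and>
     (\<forall>A \<in> algebras k. \<forall>B \<in> algebras k. \<forall>f \<in> alg_hom k A B. arr F A B f \<in> U A \<rightarrow> U B)"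

text \<open>\<open>U\<close> is open if its pullback along every \<open>x : Spec A \<rightarrow> F\<close> is the open subscheme \<open>D(I)\<close> of
  \<open>Spec A\<close> for some ideal \<open>I\<close>; a map \<open>Spec B \<rightarrow> Spec A\<close> factors through \<open>D(I)\<close> iff \<open>I\<close> generates
  the unit ideal of \<open>B\<close>.\<close>

definition open_subfunctor :: "'u ring \<Rightarrow> ('u, 'g) kfun \<Rightarrow> ('u alg \<Rightarrow> 'g set) \<Rightarrow> bool" where
  "open_subfunctor k F U \<longleftrightarrow> subfunctor k F U \<and>
     (\<forall>A \<in> algebras k. \<forall>x \<in> obj F A. \<exists>I. ideal I (fst A) \<and>
        (\<forall>B \<in> algebras k. \<forall>f \<in> alg_hom k A B.
           arr F A B f x \<in> U B \<longleftrightarrow> Idl\<^bsub>fst B\<^esub> (f ` I) = carrier (fst B)))"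

text \<open>A family of open subfunctors covers \<open>V\<close> if it does so on points with values in fields.\<close>

definition covers :: "'u ring \<Rightarrow> ('u alg \<Rightarrow> 'g set) set \<Rightarrow> ('u alg \<Rightarrow> 'g set) \<Rightarrow> bool" where
  "covers k \<U> V \<longleftrightarrow> (\<forall>A \<in> algebras k. field (fst A) \<longrightarrow> V A \<subseteq> (\<Union>U \<in> \<U>. U A))"

text \<open>\<open>U\<close> is represented by \<open>B\<close>, that is, isomorphic to \<open>Spec B\<close>; by Yoneda's lemma an
  isomorphism is the same as a universal element \<open>u\<close>.\<close>

definition represented_by ::
  "'u ring \<Rightarrow> ('u, 'g) kfun \<Rightarrow> ('u alg \<Rightarrow> 'g set) \<Rightarrow> 'u alg \<Rightarrow> bool" where
  "represented_by k F U B \<longleftrightarrow> B \<in> algebras k \<and>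
     (\<exists>u \<in> U B. \<forall>A \<in> algebras k. bij_betw (\<lambda>f. arr F B A f u) (alg_hom k B A) (U A))"

definition affine_open :: "'u ring \<Rightarrow> ('u, 'g) kfun \<Rightarrow> ('u alg \<Rightarrow> 'g set) \<Rightarrow> bool" where
  "affine_open k F U \<longleftrightarrow> open_subfunctor k F U \<and> (\<exists>B. represented_by k F U B)"

definition scheme :: "'u ring \<Rightarrow> ('u, 'g) kfun \<Rightarrow> bool" where
  "scheme k F \<longleftrightarrow> kfunctor k F \<and> zariski_sheaf k F \<and>
     (\<exists>\<U>. (\<forall>U \<in> \<U>. affine_open k F U) \<and> covers k \<U> (obj F))"


section \<open>Finite presentation and smoothness over the base\<close>

definition quasi_compact :: "'u ring \<Rightarrow> ('u, 'g) kfun \<Rightarrow> ('u alg \<Rightarrow> 'g set) \<Rightarrow> bool" where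
  "quasi_compact k F V \<longleftrightarrow>
     (\<forall>\<U>. (\<forall>U \<in> \<U>. open_subfunctor k F U) \<and> covers k \<U> V \<longrightarrow>
        (\<exists>\<U>' \<subseteq> \<U>. finite \<U>' \<and> covers k \<U>' V))"

definition quasi_separated :: "'u ring \<Rightarrow> ('u, 'g) kfun \<Rightarrow> bool" where
  "quasi_separated k F \<longleftrightarrow>
     (\<forall>U V. open_subfunctor k F U \<and> quasi_compact k F U \<and>
        open_subfunctor k F V \<and> quasi_compact k F V \<longrightarrow> quasi_compact k F (\<lambda>A. U A \<inter> V A))"

definition locally_finitely_presented :: "'u ring \<Rightarrow> ('u, 'g) kfun \<Rightarrow> bool" where
  "locally_finitely_presented k F \<longleftrightarrow>
     (\<exists>\<U>. covers k \<U> (obj F) \<and>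
        (\<forall>U \<in> \<U>. open_subfunctor k F U \<and>
           (\<exists>B. represented_by k F U B \<and> finitely_presented_algebra k B)))"

definition finitely_presented :: "'u ring \<Rightarrow> ('u, 'g) kfun \<Rightarrow> bool" where
  "finitely_presented k F \<longleftrightarrow>
     locally_finitely_presented k F \<and> quasi_compact k F (obj F) \<and> quasi_separated k F"

text \<open>The infinitesimal lifting property: \<open>F(A) \<rightarrow> F(A/I)\<close> is surjective if \<open>I\<^sup>2 = 0\<close>.\<close>

definition formally_smooth :: "'u ring \<Rightarrow> ('u, 'g) kfun \<Rightarrow> bool" where
  "formally_smooth k F \<longleftrightarrow>
     (\<forall>A \<in> algebras k. \<forall>B \<in> algebras k. \<forall>p \<in> alg_hom k A B.
        p ` carrier (fst A) = carrier (fst B) \<and>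
        (\<forall>a \<in> a_kernel (fst A) (fst B) p. \<forall>b \<in> a_kernel (fst A) (fst B) p.
           a \<otimes>\<^bsub>fst A\<^esub> b = \<zero>\<^bsub>fst A\<^esub>) \<longrightarrow>
        arr F A B p ` obj F A = obj F B)"

definition smooth :: "'u ring \<Rightarrow> ('u, 'g) kfun \<Rightarrow> bool" where
  "smooth k F \<longleftrightarrow> locally_finitely_presented k F \<and> formally_smooth k F"


section \<open>Group schemes and characters\<close>

record ('u, 'g) gfun =
  gobj :: "'u alg \<Rightarrow> 'g monoid"
  garr :: "'u alg \<Rightarrow> 'u alg \<Rightarrow> ('u \<Rightarrow> 'u) \<Rightarrow> 'g \<Rightarrow> 'g"

definition underlying :: "('u, 'g) gfun \<Rightarrow> ('u, 'g) kfun" where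
  "underlying G = \<lparr>obj = (\<lambda>A. carrier (gobj G A)), arr = garr G\<rparr>"

definition group_functor :: "'u ring \<Rightarrow> ('u, 'g) gfun \<Rightarrow> bool" where
  "group_functor k G \<longleftrightarrow> kfunctor k (underlying G) \<and>
     (\<forall>A \<in> algebras k. group (gobj G A)) \<and>
     (\<forall>A \<in> algebras k. \<forall>B \<in> algebras k. \<forall>f \<in> alg_hom k A B.
        garr G A B f \<in> hom (gobj G A) (gobj G B))"

definition group_scheme :: "'u ring \<Rightarrow> ('u, 'g) gfun \<Rightarrow> bool" where
  "group_scheme k G \<longleftrightarrow> group_functor k G \<and> scheme k (underlying G)"

definition Gm :: "('u, 'u) gfun" where
  "Gm = \<lparr>gobj = (\<lambda>A. units_of (fst A)), garr = (\<lambda>A B f. f)\<rparr>"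

text \<open>The base change of \<open>G\<close> along \<open>\<iota> : k \<rightarrow> K\<close> takes a \<open>K\<close>-algebra \<open>A\<close> to the value of \<open>G\<close> at \<open>A\<close>
  regarded as a \<open>k\<close>-algebra.\<close>

definition restrict_scalars :: "'u ring \<Rightarrow> ('u \<Rightarrow> 'u) \<Rightarrow> 'u alg \<Rightarrow> 'u alg" where
  "restrict_scalars k \<iota> A = (fst A, compose (carrier k) (snd A) \<iota>)"

definition base_change :: "'u ring \<Rightarrow> ('u \<Rightarrow> 'u) \<Rightarrow> ('u, 'g) gfun \<Rightarrow> ('u, 'g) gfun" where
  "base_change k \<iota> G =
     \<lparr>gobj = (\<lambda>A. gobj G (restrict_scalars k \<iota> A)),
      garr = (\<lambda>A B. garr G (restrict_scalars k \<iota> A) (restrict_scalars k \<iota> B))\<rparr>"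

text \<open>\<open>group_functor_hom k G H\<close> is \<open>Hom(G, H)\<close> in the category of group functors over \<open>k\<close>;
  again, extensionality makes equality of functions equality of natural transformations.\<close>

definition group_functor_hom ::
  "'u ring \<Rightarrow> ('u, 'g) gfun \<Rightarrow> ('u, 'h) gfun \<Rightarrow> ('u alg \<Rightarrow> 'g \<Rightarrow> 'h) set" where
  "group_functor_hom k G H = {\<chi>. \<chi> \<in> extensional (algebras k) \<and>
     (\<forall>A \<in> algebras k. \<chi> A \<in> hom (gobj G A) (gobj H A) \<and>
        \<chi> A \<in> extensional (carrier (gobj G A))) \<and>
     (\<forall>A \<in> algebras k. \<forall>B \<in> algebras k. \<forall>f \<in> alg_hom k A B. \<forall>x \<in> carrier (gobj G A).
        \<chi> B (garr G A B f x) = garr H A B f (\<chi> A x))}"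

definition char_group :: "'u ring \<Rightarrow> ('u, 'g) gfun \<Rightarrow> ('u alg \<Rightarrow> 'g \<Rightarrow> 'u) monoid" where
  "char_group k G =
     \<lparr>carrier = group_functor_hom k G Gm,
      monoid.mult = (\<lambda>\<chi> \<psi>. \<lambda>A \<in> algebras k. \<lambda>x \<in> carrier (gobj G A). \<chi> A x \<otimes>\<^bsub>fst A\<^esub> \<psi> A x),
      one = (\<lambda>A \<in> algebras k. \<lambda>x \<in> carrier (gobj G A). \<one>\<^bsub>fst A\<^esub>)\<rparr>"

definition hom_group :: "('a, 'm) monoid_scheme \<Rightarrow> ('b, 'n) monoid_scheme \<Rightarrow> ('a \<Rightarrow> 'b) monoid" where
  "hom_group M N =
     \<lparr>carrier = hom M N \<inter> extensional (carrier M),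
      monoid.mult = (\<lambda>h h'. \<lambda>x \<in> carrier M. h x \<otimes>\<^bsub>N\<^esub> h' x),
      one = (\<lambda>x \<in> carrier M. \<one>\<^bsub>N\<^esub>)\<rparr>"


section \<open>Valuation domains\<close>

definition valuation_domain :: "('a, 'm) ring_scheme \<Rightarrow> bool" where
  "valuation_domain R \<longleftrightarrow> domain R \<and>
     (\<forall>a \<in> carrier R. \<forall>b \<in> carrier R. a divides\<^bsub>R\<^esub> b \<or> b divides\<^bsub>R\<^esub> a)"

definition is_fraction_field :: "'u ring \<Rightarrow> 'u alg \<Rightarrow> bool" where
  "is_fraction_field R A \<longleftrightarrow> A \<in> algebras R \<and> field (fst A) \<and>
     inj_on (snd A) (carrier R) \<and>
     (\<forall>x \<in> carrier (fst A). \<exists>a \<in> carrier R. \<exists>b \<in> carrier R - {\<zero>\<^bsub>R\<^esub>}.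
        x \<otimes>\<^bsub>fst A\<^esub> snd A b = snd A a)"

definition value_group :: "'u ring \<Rightarrow> 'u ring \<Rightarrow> ('u \<Rightarrow> 'u) \<Rightarrow> 'u set monoid" where
  "value_group R K \<iota> = units_of K Mod (\<iota> ` Units R)"

definition valuation :: "'u ring \<Rightarrow> 'u ring \<Rightarrow> ('u \<Rightarrow> 'u) \<Rightarrow> 'u \<Rightarrow> 'u set" where
  "valuation R K \<iota> x = (\<iota> ` Units R) #>\<^bsub>units_of K\<^esub> x"

text \<open>The map \<open>\<nu>\<^sub>G\<close>.  Here \<open>g\<close> is an element of \<open>G(K)\<close>, and \<open>G(K)\<close> is the group of points of the
  generic fibre with values in the initial \<open>K\<close>-algebra.\<close>

definition nu :: "'u ring \<Rightarrow> 'u ring \<Rightarrow> ('u \<Rightarrow> 'u) \<Rightarrow> ('u, 'g) gfun \<Rightarrow>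
    'g \<Rightarrow> ('u alg \<Rightarrow> 'g \<Rightarrow> 'u) \<Rightarrow> 'u set" where
  "nu R K \<iota> G g = (\<lambda>\<chi> \<in> carrier (char_group K (base_change R \<iota> G)).
     valuation R K \<iota> (\<chi> (base_alg K) g))"


section \<open>The map \<open>\<nu>\<^sub>G\<close> is a homomorphism of groups\<close>

lemma comm_group_hom_group:
  assumes "comm_group N" "group M"
  shows "comm_group (hom_group M N)"
proof -
  interpret N: comm_group N by fact
  interpret M: group M by fact
  show ?thesis
  proof (rule comm_groupI)
    fix x y assume "x \<in> carrier (hom_group M N)" "y \<in> carrier (hom_group M N)"
    then show "x \<otimes>\<^bsub>hom_group M N\<^esub> y \<in> carrier (hom_group M N)"
      by (auto simp: hom_group_def hom_def Pi_iff N.m_ac)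
  next
    show "\<one>\<^bsub>hom_group M N\<^esub> \<in> carrier (hom_group M N)"
      by (auto simp: hom_group_def hom_def)
  next
    fix x y z assume "x \<in> carrier (hom_group M N)" "y \<in> carrier (hom_group M N)"
      "z \<in> carrier (hom_group M N)"
    then show "x \<otimes>\<^bsub>hom_group M N\<^esub> y \<otimes>\<^bsub>hom_group M N\<^esub> z =
        x \<otimes>\<^bsub>hom_group M N\<^esub> (y \<otimes>\<^bsub>hom_group M N\<^esub> z)"
      by (auto simp: hom_group_def hom_def Pi_iff N.m_assoc intro!: restrict_ext)
  next
    fix x y assume "x \<in> carrier (hom_group M N)" "y \<in> carrier (hom_group M N)"
    then show "x \<otimes>\<^bsub>hom_group M N\<^esub> y = y \<otimes>\<^bsub>hom_group M N\<^esub> x"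
      by (auto simp: hom_group_def hom_def Pi_iff N.m_comm intro!: restrict_ext)
  next
    fix x assume x: "x \<in> carrier (hom_group M N)"
    then have "(\<lambda>a \<in> carrier M. x a) = x" "\<And>a. a \<in> carrier M \<Longrightarrow> x a \<in> carrier N"
      by (auto simp: hom_group_def hom_def extensional_restrict)
    then show "\<one>\<^bsub>hom_group M N\<^esub> \<otimes>\<^bsub>hom_group M N\<^esub> x = x"
      by (auto simp: hom_group_def cong: restrict_cong)
  next
    fix x assume x: "x \<in> carrier (hom_group M N)"
    then have "(\<lambda>a \<in> carrier M. inv\<^bsub>N\<^esub> x a) \<in> carrier (hom_group M N)"
      by (auto simp: hom_group_def hom_def Pi_iff N.inv_mult)
    moreover have "(\<lambda>a \<in> carrier M. inv\<^bsub>N\<^esub> x a) \<otimes>\<^bsub>hom_group M N\<^esub> x = \<one>\<^bsub>hom_group M N\<^esub>"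
      using x by (auto simp: hom_group_def hom_def Pi_iff intro!: restrict_ext)
    ultimately show "\<exists>y \<in> carrier (hom_group M N). y \<otimes>\<^bsub>hom_group M N\<^esub> x = \<one>\<^bsub>hom_group M N\<^esub>"
      by blast
  qed
qed

lemma ring_hom_Units:
  assumes "f \<in> ring_hom R S" "x \<in> Units R"
  shows "f x \<in> Units S"
proof -
  from assms(2) obtain y where x: "x \<in> carrier R"
    and y: "y \<in> carrier R" "y \<otimes>\<^bsub>R\<^esub> x = \<one>\<^bsub>R\<^esub>" "x \<otimes>\<^bsub>R\<^esub> y = \<one>\<^bsub>R\<^esub>"
    by (auto simp: Units_def)
  have "f y \<otimes>\<^bsub>S\<^esub> f x = \<one>\<^bsub>S\<^esub>" "f x \<otimes>\<^bsub>S\<^esub> f y = \<one>\<^bsub>S\<^esub>"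
    using x y ring_hom_mult[OF assms(1)] ring_hom_one[OF assms(1)] by metis+
  then show ?thesis
    using x y ring_hom_closed[OF assms(1)] by (auto simp: Units_def)
qed

lemma comm_group_value_group:
  assumes "cring R" "is_fraction_field R (K, \<iota>)"
  shows "comm_group (value_group R K \<iota>)" "subgroup (\<iota> ` Units R) (units_of K)"
    "group (units_of K)"
proof -
  interpret R: cring R by fact
  interpret K: field K using assms by (simp add: is_fraction_field_def)
  have \<iota>: "\<iota> \<in> ring_hom R K"
    using assms(2) by (simp add: is_fraction_field_def algebras_def)
  interpret U: comm_group "units_of K" by (rule K.units_comm_group)
  show "group (units_of K)" by (rule U.is_group)
  interpret V: group "units_of R" by (rule R.units_group)
  have "\<iota> \<in> hom (units_of R) (units_of K)"
    using ring_hom_Units[OF \<iota>] ring_hom_mult[OF \<iota>] R.Units_closed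
    by (auto simp: hom_def units_of_def)
  then interpret h: group_hom "units_of R" "units_of K" \<iota>
    by unfold_locales
  show s: "subgroup (\<iota> ` Units R) (units_of K)"
    using h.img_is_subgroup by (simp add: units_of_def)
  then show "comm_group (value_group R K \<iota>)"
    unfolding value_group_def by (rule U.abelian_FactGroup)
qed

lemma restrict_scalars_base_alg:
  assumes "(K, \<iota>) \<in> algebras R"
  shows "restrict_scalars R \<iota> (base_alg K) = (K, \<iota>)"
  using assms ring_hom_closed[of \<iota> R K]
  by (auto simp: restrict_scalars_def base_alg_def algebras_def compose_def extensional_def fun_eq_iff)

lemma base_alg_in_algebras: "cring k \<Longrightarrow> base_alg k \<in> algebras k"
  by (auto simp: base_alg_def algebras_def ring_hom_def cring_def ring.ring_simprules)

lemma restrict_scalars_algebras: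
  assumes "cring R" "(K, \<iota>) \<in> algebras R" "A \<in> algebras K"
  shows "restrict_scalars R \<iota> A \<in> algebras R"
proof -
  interpret R: cring R by fact
  have "compose (carrier R) (snd A) \<iota> \<in> ring_hom R (fst A)"
    using assms(2,3) by (auto simp: algebras_def ring_hom_def Pi_iff compose_def)
  then show ?thesis
    using assms(2,3) by (auto simp: restrict_scalars_def algebras_def compose_def)
qed

lemma restrict_scalars_alg_hom:
  assumes "(K, \<iota>) \<in> algebras R" "f \<in> alg_hom K A B"
  shows "f \<in> alg_hom R (restrict_scalars R \<iota> A) (restrict_scalars R \<iota> B)"
  using assms ring_hom_closed[of \<iota> R K]
  by (auto simp: restrict_scalars_def algebras_def alg_hom_def compose_def)

lemma group_functor_base_change:
  assumes "cring R" "(K, \<iota>) \<in> algebras R" "group_functor R G"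
  shows "group_functor K (base_change R \<iota> G)"
proof -
  note alg = restrict_scalars_algebras[OF assms(1,2)]
  note mor = restrict_scalars_alg_hom[OF assms(2)]
  have fst: "fst (restrict_scalars R \<iota> A) = fst A" for A
    by (simp add: restrict_scalars_def)
  have F: "kfunctor R (underlying G)"
    using assms(3) by (simp add: group_functor_def)
  have "kfunctor K (underlying (base_change R \<iota> G))"
    unfolding kfunctor_def
  proof (intro conjI ballI)
    fix A B f assume "A \<in> algebras K" "B \<in> algebras K" "f \<in> alg_hom K A B"
    then show "arr (underlying (base_change R \<iota> G)) A B f
        \<in> obj (underlying (base_change R \<iota> G)) A \<rightarrow> obj (underlying (base_change R \<iota> G)) B"
      using F alg mor by (simp add: kfunctor_def underlying_def base_change_def)
  next
    fix A x assume A: "A \<in> algebras K" "x \<in> obj (underlying (base_change R \<iota> G)) A"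
    have "\<forall>A \<in> algebras R. \<forall>x \<in> carrier (gobj G A). garr G A A (\<lambda>a \<in> carrier (fst A). a) x = x"
      using F by (simp add: kfunctor_def underlying_def)
    from bspec[OF bspec[OF this alg[OF A(1)]]] A(2)
    show "arr (underlying (base_change R \<iota> G)) A A (\<lambda>a \<in> carrier (fst A). a) x = x"
      by (simp add: underlying_def base_change_def fst)
  next
    fix A B C f g x
    assume A: "A \<in> algebras K" "B \<in> algebras K" "C \<in> algebras K"
      "f \<in> alg_hom K A B" "g \<in> alg_hom K B C"
      "x \<in> obj (underlying (base_change R \<iota> G)) A"
    have *: "garr G A C (compose (carrier (fst A)) g f) x = garr G B C g (garr G A B f x)"
      if "A \<in> algebras R" "B \<in> algebras R" "C \<in> algebras R" "f \<in> alg_hom R A B"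
        "g \<in> alg_hom R B C" "x \<in> carrier (gobj G A)" for A B C
      using F that by (simp add: kfunctor_def underlying_def)
    show "arr (underlying (base_change R \<iota> G)) A C (compose (carrier (fst A)) g f) x =
        arr (underlying (base_change R \<iota> G)) B C g (arr (underlying (base_change R \<iota> G)) A B f x)"
      using *[OF alg[OF A(1)] alg[OF A(2)] alg[OF A(3)] mor[OF A(4)] mor[OF A(5)]] A(6)
      by (simp add: underlying_def base_change_def fst)
  qed
  then show ?thesis
    using assms(3) alg mor by (simp add: group_functor_def base_change_def)
qed

lemma alg_comm_group_units:
  assumes "A \<in> algebras k"
  shows "comm_group (units_of (fst A))"
  using assms comm_monoid.units_comm_group[of "fst A"]
  by (auto simp: algebras_def cring_def)

lemma group_functor_homD:
  assumes "\<chi> \<in> group_functor_hom k G Gm" "A \<in> algebras k" "x \<in> carrier (gobj G A)"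
  shows "\<chi> A x \<in> Units (fst A)"
  using assms by (auto simp: group_functor_hom_def Gm_def hom_def units_of_def)

lemma comm_group_char_group:
  assumes "group_functor k G"
  shows "comm_group (char_group k G)"
proof -
  let ?X = "char_group k G" and ?H = "group_functor_hom k G Gm"
  have cr: "cring (fst A)" if "A \<in> algebras k" for A
    using that by (auto simp: algebras_def)
  then have cm: "comm_monoid (fst A)" "monoid (fst A)" if "A \<in> algebras k" for A
    using that by (auto simp: cring_def ring_def)
  have closed: "garr G A B f x \<in> carrier (gobj G B)"
    if "A \<in> algebras k" "B \<in> algebras k" "f \<in> alg_hom k A B" "x \<in> carrier (gobj G A)" for A B f x
    using assms that by (fastforce simp: group_functor_def hom_def)
  have gr: "group (gobj G A)" if "A \<in> algebras k" for A
    using assms that by (simp add: group_functor_def)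
  have hom: "\<chi> A \<in> hom (gobj G A) (units_of (fst A))" if "\<chi> \<in> ?H" "A \<in> algebras k" for \<chi> A
    using that by (simp add: group_functor_hom_def Gm_def)
  have nat: "\<chi> B (garr G A B f x) = f (\<chi> A x)"
    if "\<chi> \<in> ?H" "A \<in> algebras k" "B \<in> algebras k" "f \<in> alg_hom k A B" "x \<in> carrier (gobj G A)"
    for \<chi> A B f x
    using that by (simp add: group_functor_hom_def Gm_def)
  have ext: "\<chi> = (\<lambda>A \<in> algebras k. \<lambda>x \<in> carrier (gobj G A). \<chi> A x)" if "\<chi> \<in> ?H" for \<chi>
    using that by (auto simp: group_functor_hom_def extensional_def fun_eq_iff)
  have lift: "(\<lambda>A \<in> algebras k. \<lambda>x \<in> carrier (gobj G A). \<theta> A x) \<in> ?H"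
    if h: "\<And>A. A \<in> algebras k \<Longrightarrow> \<theta> A \<in> hom (gobj G A) (units_of (fst A))"
      and n: "\<And>A B f x. \<lbrakk>A \<in> algebras k; B \<in> algebras k; f \<in> alg_hom k A B;
        x \<in> carrier (gobj G A)\<rbrakk> \<Longrightarrow> \<theta> B (garr G A B f x) = f (\<theta> A x)" for \<theta>
  proof -
    have "(\<lambda>x \<in> carrier (gobj G A). \<theta> A x) \<in> hom (gobj G A) (units_of (fst A))"
      if "A \<in> algebras k" for A
    proof -
      interpret group "gobj G A" using gr[OF that] .
      show ?thesis using h[OF that] by (auto simp: hom_def)
    qed
    then show ?thesis
      using n closed by (simp add: group_functor_hom_def Gm_def)
  qed
  show ?thesis
  proof (rule comm_groupI)
    fix \<chi> \<psi> assume *: "\<chi> \<in> carrier ?X" "\<psi> \<in> carrier ?X"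
    then have H: "\<chi> \<in> ?H" "\<psi> \<in> ?H" by (auto simp: char_group_def)
    have "(\<lambda>A \<in> algebras k. \<lambda>x \<in> carrier (gobj G A). \<chi> A x \<otimes>\<^bsub>fst A\<^esub> \<psi> A x) \<in> ?H"
    proof (rule lift)
      fix A assume A: "A \<in> algebras k"
      interpret comm_group "units_of (fst A)" by (rule alg_comm_group_units[OF A])
      have "(\<lambda>x. \<chi> A x \<otimes>\<^bsub>units_of (fst A)\<^esub> \<psi> A x) \<in> hom (gobj G A) (units_of (fst A))"
        using hom[OF H(1) A] hom[OF H(2) A] by (auto simp: hom_def Pi_iff m_ac)
      then show "(\<lambda>x. \<chi> A x \<otimes>\<^bsub>fst A\<^esub> \<psi> A x) \<in> hom (gobj G A) (units_of (fst A))"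
        by (simp add: units_of_def)
    next
      fix A B f x
      assume A: "A \<in> algebras k" "B \<in> algebras k" "f \<in> alg_hom k A B" "x \<in> carrier (gobj G A)"
      have "f \<in> ring_hom (fst A) (fst B)" using A(3) by (simp add: alg_hom_def)
      moreover have "\<chi> A x \<in> carrier (fst A)" "\<psi> A x \<in> carrier (fst A)"
        using group_functor_homD[OF H(1) A(1,4)] group_functor_homD[OF H(2) A(1,4)]
        by (auto simp: Units_def)
      ultimately show "\<chi> B (garr G A B f x) \<otimes>\<^bsub>fst B\<^esub> \<psi> B (garr G A B f x) = f (\<chi> A x \<otimes>\<^bsub>fst A\<^esub> \<psi> A x)"
        using nat[OF H(1) A] nat[OF H(2) A] by (simp add: ring_hom_mult)
    qed
    then show "\<chi> \<otimes>\<^bsub>?X\<^esub> \<psi> \<in> carrier ?X" by (simp add: char_group_def)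
    show "\<chi> \<otimes>\<^bsub>?X\<^esub> \<psi> = \<psi> \<otimes>\<^bsub>?X\<^esub> \<chi>"
      using group_functor_homD[OF H(1)] group_functor_homD[OF H(2)] cm
      by (auto simp: char_group_def Units_def intro!: restrict_ext comm_monoid.m_comm)
  next
    have "(\<lambda>A \<in> algebras k. \<lambda>x \<in> carrier (gobj G A). \<one>\<^bsub>fst A\<^esub>) \<in> ?H"
    proof (rule lift)
      fix A assume A: "A \<in> algebras k"
      interpret monoid "fst A" using cm[OF A] by simp
      show "(\<lambda>x. \<one>\<^bsub>fst A\<^esub>) \<in> hom (gobj G A) (units_of (fst A))"
        by (auto simp: hom_def units_of_def)
    qed (auto simp: alg_hom_def ring_hom_one)
    then show "\<one>\<^bsub>?X\<^esub> \<in> carrier ?X" by (simp add: char_group_def)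
  next
    fix \<chi> \<psi> \<omega> assume "\<chi> \<in> carrier ?X" "\<psi> \<in> carrier ?X" "\<omega> \<in> carrier ?X"
    then have H: "\<chi> \<in> ?H" "\<psi> \<in> ?H" "\<omega> \<in> ?H" by (auto simp: char_group_def)
    show "\<chi> \<otimes>\<^bsub>?X\<^esub> \<psi> \<otimes>\<^bsub>?X\<^esub> \<omega> = \<chi> \<otimes>\<^bsub>?X\<^esub> (\<psi> \<otimes>\<^bsub>?X\<^esub> \<omega>)"
      using group_functor_homD[OF H(1)] group_functor_homD[OF H(2)] group_functor_homD[OF H(3)] cm
      by (auto simp: char_group_def Units_def intro!: restrict_ext monoid.m_assoc)
  next
    fix \<chi> assume "\<chi> \<in> carrier ?X"
    then have H: "\<chi> \<in> ?H" by (simp add: char_group_def)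
    have "\<one>\<^bsub>?X\<^esub> \<otimes>\<^bsub>?X\<^esub> \<chi> = (\<lambda>A \<in> algebras k. \<lambda>x \<in> carrier (gobj G A). \<chi> A x)"
      using group_functor_homD[OF H] cm
      by (auto simp: char_group_def Units_def intro!: restrict_ext monoid.l_one)
    then show "\<one>\<^bsub>?X\<^esub> \<otimes>\<^bsub>?X\<^esub> \<chi> = \<chi>" using ext[OF H] by simp
    let ?i = "\<lambda>A \<in> algebras k. \<lambda>x \<in> carrier (gobj G A). inv\<^bsub>units_of (fst A)\<^esub> (\<chi> A x)"
    have "?i \<in> ?H"
    proof (rule lift)
      fix A assume A: "A \<in> algebras k"
      interpret comm_group "units_of (fst A)" by (rule alg_comm_group_units[OF A])
      show "(\<lambda>x. inv\<^bsub>units_of (fst A)\<^esub> (\<chi> A x)) \<in> hom (gobj G A) (units_of (fst A))"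
        using hom[OF H A] by (auto simp: hom_def Pi_iff inv_mult)
    next
      fix A B f x
      assume A: "A \<in> algebras k" "B \<in> algebras k" "f \<in> alg_hom k A B" "x \<in> carrier (gobj G A)"
      interpret A: group "units_of (fst A)"
        using alg_comm_group_units[OF A(1)] by (simp add: comm_group_def)
      interpret B: group "units_of (fst B)"
        using alg_comm_group_units[OF A(2)] by (simp add: comm_group_def)
      have f: "f \<in> ring_hom (fst A) (fst B)" using A(3) by (simp add: alg_hom_def)
      have "f \<in> hom (units_of (fst A)) (units_of (fst B))"
        using ring_hom_Units[OF f] ring_hom_mult[OF f]
        by (auto simp: hom_def units_of_def Units_def)
      then interpret group_hom "units_of (fst A)" "units_of (fst B)" f
        by unfold_locales
      have "\<chi> A x \<in> carrier (units_of (fst A))"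
        using group_functor_homD[OF H A(1,4)] by (simp add: units_of_def)
      then show "inv\<^bsub>units_of (fst B)\<^esub> (\<chi> B (garr G A B f x)) = f (inv\<^bsub>units_of (fst A)\<^esub> (\<chi> A x))"
        using nat[OF H A] by simp
    qed
    moreover have "?i \<otimes>\<^bsub>?X\<^esub> \<chi> = \<one>\<^bsub>?X\<^esub>"
    proof -
      have "inv\<^bsub>units_of (fst A)\<^esub> (\<chi> A x) \<otimes>\<^bsub>fst A\<^esub> \<chi> A x = \<one>\<^bsub>fst A\<^esub>"
        if "A \<in> algebras k" "x \<in> carrier (gobj G A)" for A x
      proof -
        interpret comm_group "units_of (fst A)" by (rule alg_comm_group_units[OF that(1)])
        show ?thesis
          using l_inv[of "\<chi> A x"] group_functor_homD[OF H that] by (simp add: units_of_def)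
      qed
      then show ?thesis by (auto simp: char_group_def intro!: restrict_ext)
    qed
    ultimately show "\<exists>\<psi> \<in> carrier ?X. \<psi> \<otimes>\<^bsub>?X\<^esub> \<chi> = \<one>\<^bsub>?X\<^esub>"
      by (auto simp: char_group_def intro!: bexI[of _ ?i])
  qed
qed

lemma nu_hom:
  assumes "cring R" "is_fraction_field R (K, \<iota>)" "group_functor R G"
  shows "nu R K \<iota> G \<in> hom (gobj G (K, \<iota>))
    (hom_group (char_group K (base_change R \<iota> G)) (value_group R K \<iota>))"
proof -
  let ?N = "\<iota> ` Units R" and ?X = "char_group K (base_change R \<iota> G)" and ?G = "gobj G (K, \<iota>)"
  have alg: "(K, \<iota>) \<in> algebras R" and "field K"
    using assms(2) by (auto simp: is_fraction_field_def)
  then interpret K: field K by simp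
  interpret U: comm_group "units_of K" by (rule K.units_comm_group)
  have "?N \<lhd> units_of K"
    using comm_group_value_group(2)[OF assms(1,2)] by (rule U.subgroup_imp_normal)
  then interpret N: normal ?N "units_of K" .
  have v: "valuation R K \<iota> \<in> hom (units_of K) (value_group R K \<iota>)"
    using N.r_coset_hom_Mod by (simp add: valuation_def [abs_def] value_group_def)
  interpret \<Gamma>: comm_group "value_group R K \<iota>"
    by (rule comm_group_value_group(1)[OF assms(1,2)])
  have baseK: "base_alg K \<in> algebras K"
    by (rule base_alg_in_algebras) (rule K.is_cring)
  have GK: "gobj (base_change R \<iota> G) (base_alg K) = ?G"
    using restrict_scalars_base_alg[OF alg] by (simp add: base_change_def)
  have X: "\<chi> (base_alg K) \<in> hom ?G (units_of K)" if "\<chi> \<in> carrier ?X" for \<chi>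
    using that baseK GK
    by (force simp: char_group_def group_functor_hom_def Gm_def base_alg_def)
  have group_G: "group ?G" using assms(3) alg by (simp add: group_functor_def)
  have X_group: "comm_group ?X"
    by (rule comm_group_char_group) (rule group_functor_base_change[OF assms(1) alg assms(3)])
  interpret M: comm_group ?X by fact
  have "nu R K \<iota> G g \<in> carrier (hom_group ?X (value_group R K \<iota>))" if g: "g \<in> carrier ?G" for g
  proof -
    have "nu R K \<iota> G g \<in> hom ?X (value_group R K \<iota>)"
    proof (rule homI)
      fix \<chi> assume \<chi>: "\<chi> \<in> carrier ?X"
      then show "nu R K \<iota> G g \<chi> \<in> carrier (value_group R K \<iota>)"
        using hom_in_carrier[OF v hom_in_carrier[OF X[OF \<chi>] g]] by (simp add: nu_def)
    next
      fix \<chi> \<psi> assume *: "\<chi> \<in> carrier ?X" "\<psi> \<in> carrier ?X"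
      have "(\<chi> \<otimes>\<^bsub>?X\<^esub> \<psi>) (base_alg K) g = \<chi> (base_alg K) g \<otimes>\<^bsub>units_of K\<^esub> \<psi> (base_alg K) g"
        using baseK g GK by (simp add: char_group_def units_of_def) (simp add: base_alg_def)
      then show "nu R K \<iota> G g (\<chi> \<otimes>\<^bsub>?X\<^esub> \<psi>) =
          nu R K \<iota> G g \<chi> \<otimes>\<^bsub>value_group R K \<iota>\<^esub> nu R K \<iota> G g \<psi>"
        using * hom_mult[OF v] hom_in_carrier[OF X[OF *(1)] g] hom_in_carrier[OF X[OF *(2)] g]
        by (simp add: nu_def)
    qed
    then show ?thesis by (simp add: hom_group_def nu_def)
  qed
  moreover have "nu R K \<iota> G (g \<otimes>\<^bsub>?G\<^esub> h) =
      nu R K \<iota> G g \<otimes>\<^bsub>hom_group ?X (value_group R K \<iota>)\<^esub> nu R K \<iota> G h"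
    if "g \<in> carrier ?G" "h \<in> carrier ?G" for g h
  proof -
    have "valuation R K \<iota> (\<chi> (base_alg K) (g \<otimes>\<^bsub>?G\<^esub> h)) = valuation R K \<iota> (\<chi> (base_alg K) g)
        \<otimes>\<^bsub>value_group R K \<iota>\<^esub> valuation R K \<iota> (\<chi> (base_alg K) h)" if "\<chi> \<in> carrier ?X" for \<chi>
      using hom_mult[OF X[OF that] \<open>g \<in> carrier ?G\<close> \<open>h \<in> carrier ?G\<close>]
        hom_in_carrier[OF X[OF that]] \<open>g \<in> carrier ?G\<close> \<open>h \<in> carrier ?G\<close> hom_mult[OF v] by simp
    then show ?thesis
      by (auto simp: nu_def hom_group_def intro!: restrict_ext)
  qed
  ultimately show ?thesis by (auto simp: hom_def)
qed

end

theory Submission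
  imports Defs
begin

text \<open>
  Let \<open>g \<in> G(\<O>)\<close>, let \<open>\<chi>\<close> be a character and \<open>\<lambda> = \<chi>(g) \<in> K\<close>. Let \<open>Spec B\<close> be an affine neighbourhood of the unit
  section, with coordinates \<open>t\<close> that are etale at this section.  A formal arc that leaves the unit section
  in a generic direction provides a valuation ring \<open>\<O>'\<close> that dominates \<open>\<O>\<close> and a point \<open>x \<in> Spec B(\<O>')\<close>
  such that a polynomial in \<open>t\<close> over \<open>\<O>\<close> with a unit among its coefficients is a unit at \<open>x\<close>.

  The special fibre is noetherian, so the points \<open>x g\<^sup>n\<close> recur: for some \<open>m\<close> and for most \<open>n\<close> (with respect to an
  ultrafilter) the point \<open>x g\<^sup>n\<^sup>-\<^sup>m\<close> is in \<open>Spec B(\<O>')\<close>, and a given function that is a unit at \<open>x\<close> is a unit there.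
  On \<open>Spec B\<close> the character is \<open>F / d\<close> with \<open>F \<in> B\<close> and \<open>d \<in> \<O>\<close>. As \<open>t\<close> is etale, \<open>F\<close> is algebraic over \<open>\<O>[t]\<close> along
  these points, that is, \<open>\<Sum> c\<^sub>j v\<^sub>j F\<^sup>j = 0\<close> with \<open>c\<^sub>j \<in> \<O>\<close> not all zero and with \<open>v\<^sub>j\<close> that are units at \<open>x\<close>. At \<open>x g\<^sup>n\<^sup>-\<^sup>m\<close> the
  function \<open>F\<close> takes the value \<open>a \<lambda>\<^sup>n\<^sup>-\<^sup>m\<close> with \<open>a\<close> independent of \<open>n\<close>, and two of the summands have the same valuation.
  For two different \<open>n\<close> these are the same two summands, so a power of \<open>\<lambda>\<close> is a unit, and then so is \<open>\<lambda>\<close>.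
\<close>


section \<open>Localization\<close>

text \<open>The obstacle: \<open>\<chi>\<close> exists on the generic fibre only and may degenerate
  on the special fibre, while \<open>\<O>\<close> need not be noetherian and \<open>\<Gamma>\<close>
  may have any rank, so no divisor theory measures the degeneration. Instead, an algebraic relation
  for \<open>F\<close> whose coefficients have fixed valuations leaves finitely many possible
  valuations of \<open>F\<close>, whereas those of \<open>a \<lambda>^n\<close> would be pairwise
  distinct if \<open>\<lambda>\<close> were not a unit. A coefficient in \<open>\<O>[t]\<close> is a
  constant times a unit only where no primitive polynomial in t reduces to zero, hence the generic
  direction of the arc; Chevalley's extension theorem turns the arc into a valuation ring. The
  relation must hold at the recurrent points rather than at x, so it is sought modulo the functions
  that vanish at most of these points; they form a prime ideal because an ultrafilter decides what
  most means. Every auxiliary ring must be a test algebra, that is, live on the type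
  \<open>'u\<close>: if \<open>'u\<close> is infinite the rings are transported there, and if
  \<open>'u\<close> is finite then \<open>\<O>\<close> is a field.\<close>

locale mult_set = cring R for R (structure) +
  fixes S
  assumes S_sub: "S \<subseteq> carrier R"
    and S_one: "\<one> \<in> S"
    and S_mult: "\<lbrakk>s \<in> S; t \<in> S\<rbrakk> \<Longrightarrow> s \<otimes> t \<in> S"
begin

text \<open>The class of the fraction a/s as the set of all pairs that represent it. The factor
  \<open>u\<close> keeps the relation transitive when \<open>S\<close> contains zero divisors, and
  it is the reason why localization kills exactly the \<open>S\<close>-torsion.\<close>

definition fr :: "'a \<Rightarrow> 'a \<Rightarrow> ('a \<times> 'a) set" where
  "fr a s = {(b, t). b \<in> carrier R \<and> t \<in> S \<and> (\<exists>u \<in> S. u \<otimes> (a \<otimes> t) = u \<otimes> (b \<otimes> s))}"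

text \<open>The operations take the union over all representatives. By \<open>fr_mult\<close> and
  \<open>fr_add\<close> every member of the union is the same class, so the union is that class and
  no representative has to be chosen.\<close>

definition fractions :: "('a \<times> 'a) set ring" where
  "fractions = \<lparr>carrier = {fr a s | a s. a \<in> carrier R \<and> s \<in> S},
     monoid.mult = (\<lambda>A B. \<Union>x \<in> A. \<Union>y \<in> B. fr (fst x \<otimes> fst y) (snd x \<otimes> snd y)),
     one = fr \<one> \<one>, ring.zero = fr \<zero> \<one>,
     ring.add = (\<lambda>A B. \<Union>x \<in> A. \<Union>y \<in> B. fr (fst x \<otimes> snd y \<oplus> fst y \<otimes> snd x) (snd x \<otimes> snd y))\<rparr>"

lemma fr_mem_iff:
  "(b, t) \<in> fr a s \<longleftrightarrow> b \<in> carrier R \<and> t \<in> S \<and> (\<exists>u \<in> S. u \<otimes> (a \<otimes> t) = u \<otimes> (b \<otimes> s))"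
  by (simp add: fr_def)

lemma S_carrier [simp]: "s \<in> S \<Longrightarrow> s \<in> carrier R"
  using S_sub by auto

lemmas [simp] = S_one S_mult

lemma fr_eqI:
  assumes "a \<in> carrier R" "b \<in> carrier R" "s \<in> S" "t \<in> S" "u \<in> S"
    and "u \<otimes> (a \<otimes> t) = u \<otimes> (b \<otimes> s)"
  shows "fr a s = fr b t"
proof -
  have "fr a s \<subseteq> fr b t"
    if *: "a \<in> carrier R" "b \<in> carrier R" "s \<in> S" "t \<in> S" "u \<in> S"
      "u \<otimes> (a \<otimes> t) = u \<otimes> (b \<otimes> s)" for a b s t u
  proof
    fix x assume "x \<in> fr a s"
    then obtain c v w where x: "x = (c, v)" "c \<in> carrier R" "v \<in> S" "w \<in> S"
      "w \<otimes> (a \<otimes> v) = w \<otimes> (c \<otimes> s)"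
      by (auto simp: fr_def)
    \<comment> \<open>The two relations are compared through the middle fraction a/s, so its
      denominator \<open>s\<close> has to enter the multiplier besides \<open>u\<close> and
      \<open>w\<close>.\<close>
    have "(u \<otimes> w \<otimes> s) \<otimes> (b \<otimes> v) = (w \<otimes> v) \<otimes> (u \<otimes> (b \<otimes> s))"
      using *(1-5) x(2-4) by (simp add: m_ac)
    also have "\<dots> = (u \<otimes> t) \<otimes> (w \<otimes> (a \<otimes> v))"
      unfolding *(6)[symmetric] using *(1-5) x(2-4) by (simp add: m_ac)
    also have "\<dots> = (u \<otimes> w \<otimes> s) \<otimes> (c \<otimes> t)"
      unfolding x(5) using *(1-5) x(2-4) by (simp add: m_ac)
    finally show "x \<in> fr b t"
      using * x by (auto simp: fr_def intro!: bexI[of _ "u \<otimes> w \<otimes> s"])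
  qed
  from this[OF assms] this[OF assms(2,1,4,3,5) assms(6)[symmetric]] show ?thesis by blast
qed

lemma fr_mem: "a \<in> carrier R \<Longrightarrow> s \<in> S \<Longrightarrow> (a, s) \<in> fr a s"
  by (auto simp: fr_def)

lemma fr_eq_iff:
  assumes "a \<in> carrier R" "b \<in> carrier R" "s \<in> S" "t \<in> S"
  shows "fr a s = fr b t \<longleftrightarrow> (\<exists>u \<in> S. u \<otimes> (a \<otimes> t) = u \<otimes> (b \<otimes> s))"
proof
  assume "fr a s = fr b t"
  then have "(b, t) \<in> fr a s" using fr_mem[OF assms(2,4)] by simp
  then show "\<exists>u \<in> S. u \<otimes> (a \<otimes> t) = u \<otimes> (b \<otimes> s)" by (auto simp: fr_def)
qed (use assms fr_eqI in blast)

lemma union_const: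
  assumes "A \<noteq> {}" "\<And>x. x \<in> A \<Longrightarrow> f x = c"
  shows "(\<Union>x \<in> A. f x) = c"
  using assms by auto

lemma fr_mult:
  assumes "a \<in> carrier R" "b \<in> carrier R" "s \<in> S" "t \<in> S"
  shows "fr a s \<otimes>\<^bsub>fractions\<^esub> fr b t = fr (a \<otimes> b) (s \<otimes> t)"
proof -
  have "fr (a' \<otimes> b') (s' \<otimes> t') = fr (a \<otimes> b) (s \<otimes> t)"
    if m: "(a', s') \<in> fr a s" "(b', t') \<in> fr b t" for a' b' s' t'
  proof -
    obtain u where u: "u \<in> S" "u \<otimes> (a \<otimes> s') = u \<otimes> (a' \<otimes> s)" and 1: "a' \<in> carrier R" "s' \<in> S"
      using m(1) unfolding fr_mem_iff by blast
    obtain v where v: "v \<in> S" "v \<otimes> (b \<otimes> t') = v \<otimes> (b' \<otimes> t)" and 2: "b' \<in> carrier R" "t' \<in> S"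
      using m(2) unfolding fr_mem_iff by blast
    have "(u \<otimes> v) \<otimes> ((a' \<otimes> b') \<otimes> (s \<otimes> t)) = (u \<otimes> (a' \<otimes> s)) \<otimes> (v \<otimes> (b' \<otimes> t))"
      using assms u(1) v(1) 1 2 by (simp add: m_ac)
    also have "\<dots> = (u \<otimes> v) \<otimes> ((a \<otimes> b) \<otimes> (s' \<otimes> t'))"
      unfolding u(2)[symmetric] v(2)[symmetric] using assms u(1) v(1) 1 2 by (simp add: m_ac)
    finally show ?thesis
      by (rule fr_eqI[rotated 5]) (use assms u(1) v(1) 1 2 in simp_all)
  qed
  then have "(\<Union>x \<in> fr a s. \<Union>y \<in> fr b t. fr (fst x \<otimes> fst y) (snd x \<otimes> snd y)) = fr (a \<otimes> b) (s \<otimes> t)"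
    using fr_mem[OF assms(1,3)] fr_mem[OF assms(2,4)]
    by (intro union_const; metis empty_iff prod.collapse)
  then show ?thesis by (simp add: fractions_def)
qed

lemma fr_add:
  assumes "a \<in> carrier R" "b \<in> carrier R" "s \<in> S" "t \<in> S"
  shows "fr a s \<oplus>\<^bsub>fractions\<^esub> fr b t = fr (a \<otimes> t \<oplus> b \<otimes> s) (s \<otimes> t)"
proof -
  have "fr (a' \<otimes> t' \<oplus> b' \<otimes> s') (s' \<otimes> t') = fr (a \<otimes> t \<oplus> b \<otimes> s) (s \<otimes> t)"
    if m: "(a', s') \<in> fr a s" "(b', t') \<in> fr b t" for a' b' s' t'
  proof -
    obtain u where u: "u \<in> S" "u \<otimes> (a \<otimes> s') = u \<otimes> (a' \<otimes> s)" and 1: "a' \<in> carrier R" "s' \<in> S"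
      using m(1) unfolding fr_mem_iff by blast
    obtain v where v: "v \<in> S" "v \<otimes> (b \<otimes> t') = v \<otimes> (b' \<otimes> t)" and 2: "b' \<in> carrier R" "t' \<in> S"
      using m(2) unfolding fr_mem_iff by blast
    have "(u \<otimes> v) \<otimes> ((a' \<otimes> t' \<oplus> b' \<otimes> s') \<otimes> (s \<otimes> t)) =
        (v \<otimes> t' \<otimes> t) \<otimes> (u \<otimes> (a' \<otimes> s)) \<oplus> (u \<otimes> s \<otimes> s') \<otimes> (v \<otimes> (b' \<otimes> t))"
      using assms u(1) v(1) 1 2 by (simp add: m_ac l_distr r_distr)
    also have "\<dots> = (u \<otimes> v) \<otimes> ((a \<otimes> t \<oplus> b \<otimes> s) \<otimes> (s' \<otimes> t'))"
      unfolding u(2)[symmetric] v(2)[symmetric]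
      using assms u(1) v(1) 1 2 by (simp add: m_ac l_distr r_distr)
    finally show ?thesis
      by (rule fr_eqI[rotated 5]) (use assms u(1) v(1) 1 2 in simp_all)
  qed
  then have "(\<Union>x \<in> fr a s. \<Union>y \<in> fr b t. fr (fst x \<otimes> snd y \<oplus> fst y \<otimes> snd x) (snd x \<otimes> snd y))
      = fr (a \<otimes> t \<oplus> b \<otimes> s) (s \<otimes> t)"
    using fr_mem[OF assms(1,3)] fr_mem[OF assms(2,4)]
    by (intro union_const; metis empty_iff prod.collapse)
  then show ?thesis by (simp add: fractions_def)
qed

lemma fractions_cases:
  assumes "x \<in> carrier fractions"
  obtains a s where "a \<in> carrier R" "s \<in> S" "x = fr a s"
  using assms by (auto simp: fractions_def)

lemma fr_closed: "a \<in> carrier R \<Longrightarrow> s \<in> S \<Longrightarrow> fr a s \<in> carrier fractions"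
  by (auto simp: fractions_def)

lemma fractions_one: "\<one>\<^bsub>fractions\<^esub> = fr \<one> \<one>"
  and fractions_zero: "\<zero>\<^bsub>fractions\<^esub> = fr \<zero> \<one>"
  by (auto simp: fractions_def)

lemma cring_fractions: "cring fractions"
proof (rule cringI)
  show "abelian_group fractions"
  proof (rule abelian_groupI)
    fix x y assume "x \<in> carrier fractions" "y \<in> carrier fractions"
    then show "x \<oplus>\<^bsub>fractions\<^esub> y \<in> carrier fractions"
      by (elim fractions_cases) (auto simp: fr_add intro!: fr_closed)
  next
    show "\<zero>\<^bsub>fractions\<^esub> \<in> carrier fractions" by (simp add: fractions_zero fr_closed)
  next
    fix x y z assume "x \<in> carrier fractions" "y \<in> carrier fractions" "z \<in> carrier fractions"
    then show "x \<oplus>\<^bsub>fractions\<^esub> y \<oplus>\<^bsub>fractions\<^esub> z = x \<oplus>\<^bsub>fractions\<^esub> (y \<oplus>\<^bsub>fractions\<^esub> z)"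
      by (elim fractions_cases) (auto simp: fr_add m_ac l_distr r_distr a_ac)
  next
    fix x y assume "x \<in> carrier fractions" "y \<in> carrier fractions"
    then show "x \<oplus>\<^bsub>fractions\<^esub> y = y \<oplus>\<^bsub>fractions\<^esub> x"
      by (elim fractions_cases) (auto simp: fr_add m_ac a_ac)
  next
    fix x assume "x \<in> carrier fractions"
    then show "\<zero>\<^bsub>fractions\<^esub> \<oplus>\<^bsub>fractions\<^esub> x = x"
      by (elim fractions_cases) (auto simp: fr_add fractions_zero)
  next
    fix x assume "x \<in> carrier fractions"
    then obtain a s where x: "a \<in> carrier R" "s \<in> S" "x = fr a s" by (rule fractions_cases)
    then have "fr (\<ominus> a) s \<oplus>\<^bsub>fractions\<^esub> x = fr (\<ominus> a \<otimes> s \<oplus> a \<otimes> s) (s \<otimes> s)"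
      by (simp add: fr_add)
    also have "\<ominus> a \<otimes> s \<oplus> a \<otimes> s = \<zero>" using x by (simp add: l_distr[symmetric] l_neg)
    also have "fr \<zero> (s \<otimes> s) = fr \<zero> \<one>"
      using x by (intro fr_eqI[of _ _ _ _ \<one>]) auto
    finally show "\<exists>y \<in> carrier fractions. y \<oplus>\<^bsub>fractions\<^esub> x = \<zero>\<^bsub>fractions\<^esub>"
      using x fr_closed[of "\<ominus> a" s] by (auto simp: fractions_zero)
  qed
next
  show "comm_monoid fractions"
  proof (rule comm_monoidI)
    fix x y assume "x \<in> carrier fractions" "y \<in> carrier fractions"
    then show "x \<otimes>\<^bsub>fractions\<^esub> y \<in> carrier fractions"
      by (elim fractions_cases) (auto simp: fr_mult intro!: fr_closed)
  next
    show "\<one>\<^bsub>fractions\<^esub> \<in> carrier fractions" by (simp add: fractions_one fr_closed)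
  next
    fix x y z assume "x \<in> carrier fractions" "y \<in> carrier fractions" "z \<in> carrier fractions"
    then show "x \<otimes>\<^bsub>fractions\<^esub> y \<otimes>\<^bsub>fractions\<^esub> z = x \<otimes>\<^bsub>fractions\<^esub> (y \<otimes>\<^bsub>fractions\<^esub> z)"
      by (elim fractions_cases) (auto simp: fr_mult m_ac)
  next
    fix x assume "x \<in> carrier fractions"
    then show "\<one>\<^bsub>fractions\<^esub> \<otimes>\<^bsub>fractions\<^esub> x = x"
      by (elim fractions_cases) (auto simp: fr_mult fractions_one)
  next
    fix x y assume "x \<in> carrier fractions" "y \<in> carrier fractions"
    then show "x \<otimes>\<^bsub>fractions\<^esub> y = y \<otimes>\<^bsub>fractions\<^esub> x"
      by (elim fractions_cases) (auto simp: fr_mult m_ac)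
  qed
next
  fix x y z assume "x \<in> carrier fractions" "y \<in> carrier fractions" "z \<in> carrier fractions"
  then obtain a s b t c v where *: "a \<in> carrier R" "s \<in> S" "b \<in> carrier R" "t \<in> S" "c \<in> carrier R" "v \<in> S"
    and x: "x = fr a s" "y = fr b t" "z = fr c v"
    by (metis fractions_cases)
  have "fr ((a \<otimes> t \<oplus> b \<otimes> s) \<otimes> c) ((s \<otimes> t) \<otimes> v)
      = fr ((a \<otimes> c) \<otimes> (t \<otimes> v) \<oplus> (b \<otimes> c) \<otimes> (s \<otimes> v)) ((s \<otimes> v) \<otimes> (t \<otimes> v))"
    using * by (intro fr_eqI[of _ _ _ _ \<one>]) (auto simp: m_ac l_distr r_distr)
  then show "(x \<oplus>\<^bsub>fractions\<^esub> y) \<otimes>\<^bsub>fractions\<^esub> z = x \<otimes>\<^bsub>fractions\<^esub> z \<oplus>\<^bsub>fractions\<^esub> y \<otimes>\<^bsub>fractions\<^esub> z"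
    using * x by (simp add: fr_add fr_mult)
qed

lemma fr_hom: "(\<lambda>a. fr a \<one>) \<in> ring_hom R fractions"
  by (rule ring_hom_memI) (auto simp: fr_closed fr_mult fr_add fractions_one)

lemma fr_eq_zero_iff:
  assumes "a \<in> carrier R"
  shows "fr a \<one> = \<zero>\<^bsub>fractions\<^esub> \<longleftrightarrow> (\<exists>u \<in> S. u \<otimes> a = \<zero>)"
  using assms by (simp add: fractions_zero fr_eq_iff)

lemma fr_denominator:
  assumes "a \<in> carrier R" "s \<in> S"
  shows "fr a s \<otimes>\<^bsub>fractions\<^esub> fr s \<one> = fr a \<one>"
  using assms by (simp add: fr_mult fr_eq_iff) (auto simp: m_ac)

lemma fr_Units:
  assumes "s \<in> S"
  shows "fr s \<one> \<in> Units fractions"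
proof -
  interpret F: cring fractions by (rule cring_fractions)
  have "fr \<one> s \<otimes>\<^bsub>fractions\<^esub> fr s \<one> = \<one>\<^bsub>fractions\<^esub>"
    using fr_denominator[of \<one> s] assms by (simp add: fractions_one)
  then show ?thesis using assms fr_closed[of \<one> s] fr_closed[of s \<one>] F.m_comm[of "fr \<one> s" "fr s \<one>"]
    by (auto simp: Units_def)
qed

end

section \<open>Commutative rings, quotients and transport to another type\<close>

lemma Units_cringI:
  assumes "cring R" "a \<in> carrier R" "b \<in> carrier R" "a \<otimes>\<^bsub>R\<^esub> b = \<one>\<^bsub>R\<^esub>"
  shows "a \<in> Units R" "b \<in> Units R"
proof -
  interpret cring R by fact
  show "a \<in> Units R" "b \<in> Units R" using assms m_comm[of a b] by (auto simp: Units_def)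
qed

lemma (in cring) ideal_commI:
  assumes "I \<subseteq> carrier R" "\<zero> \<in> I" "\<And>a b. a \<in> I \<Longrightarrow> b \<in> I \<Longrightarrow> a \<oplus> b \<in> I"
    and mult: "\<And>a x. a \<in> I \<Longrightarrow> x \<in> carrier R \<Longrightarrow> x \<otimes> a \<in> I"
  shows "ideal I R"
proof (rule idealI)
  show "subgroup I (add_monoid R)"
  proof (rule add.subgroupI)
    fix a assume a: "a \<in> I"
    have "(\<ominus> \<one>) \<otimes> a \<in> I" by (rule mult[OF a]) simp
    then show "\<ominus> a \<in> I" using assms(1) a by (auto simp: l_minus)
  qed (use assms in auto)
  show "a \<otimes> x \<in> I" if "a \<in> I" "x \<in> carrier R" for a x
    using mult[OF that] m_comm[of a x] assms(1) that by auto
qed (use mult ring_axioms in auto)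

text \<open>Serves arguments by generators: to show that \<open>h\<close> maps a ring into a
  subring, it is enough to look at elements that generate the ring.\<close>

lemma subring_vimage:
  assumes "cring R" "cring S" "h \<in> ring_hom R S" "subring T S"
  shows "subring {r \<in> carrier R. h r \<in> T} R"
proof -
  interpret h: ring_hom_cring R S h using assms by (intro ring_hom_cringI)
  show ?thesis by (rule h.R.subringI) (use subringE[OF assms(4)] in auto)
qed

lemma ideal_image:
  assumes "cring R" "cring S" "f \<in> ring_hom R S" "f ` carrier R = carrier S" "ideal I R"
  shows "ideal (f ` I) S"
proof -
  interpret f: ring_hom_cring R S f using assms by (intro ring_hom_cringI)
  interpret I: ideal I R by fact
  have sub: "subgroup (f ` I) (add_monoid S)"
    by (rule ring_hom_ring.img_is_add_subgroup[OF ring_hom_ringI2[OF f.R.ring_axioms f.S.ring_axioms assms(3)] I.a_subgroup])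
  show ?thesis
  proof (rule f.S.ideal_commI)
    fix a x assume a: "a \<in> f ` I" and x: "x \<in> carrier S"
    from a obtain i where i: "a = f i" "i \<in> I" by (rule imageE)
    from x have "x \<in> f ` carrier R" using assms(4) by simp
    then obtain r where r: "x = f r" "r \<in> carrier R" by (rule imageE)
    have "f (r \<otimes>\<^bsub>R\<^esub> i) \<in> f ` I" by (rule imageI[OF I.I_l_closed[OF i(2) r(2)]])
    then show "x \<otimes>\<^bsub>S\<^esub> a \<in> f ` I" using i r I.Icarr by simp
  qed (use subgroup.subset[OF sub] subgroup.one_closed[OF sub] subgroup.m_closed[OF sub] in auto)
qed

lemma image_ring_cring:
  assumes "cring R" "inj_on f (carrier R)"
  shows "cring (image_ring f R)" "f \<in> ring_hom R (image_ring f R)"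
    "bij_betw f (carrier R) (carrier (image_ring f R))"
proof -
  interpret cring R by fact
  have iso: "f \<in> ring_iso R (image_ring f R)"
    by (rule inj_imp_image_ring_iso) fact
  then show "f \<in> ring_hom R (image_ring f R)" "bij_betw f (carrier R) (carrier (image_ring f R))"
    by (auto simp: ring_iso_def)
  have h: "f \<in> ring_hom R (image_ring f R)" using iso by (simp add: ring_iso_def)
  have c: "carrier (image_ring f R) = f ` carrier R" by (rule image_ring_carrier)
  interpret I: ring "image_ring f R" by (rule inj_imp_image_ring_is_ring) fact
  show "cring (image_ring f R)"
  proof (intro cring.intro comm_monoid.intro)
    show "Ring.ring (image_ring f R)" by (rule I.ring_axioms)
    show "Group.monoid (image_ring f R)" by (rule I.is_monoid)
    show "comm_monoid_axioms (image_ring f R)"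
    proof
      fix x y assume "x \<in> carrier (image_ring f R)" "y \<in> carrier (image_ring f R)"
      then obtain a b where "a \<in> carrier R" "b \<in> carrier R" "x = f a" "y = f b"
        using c by auto
      then show "x \<otimes>\<^bsub>image_ring f R\<^esub> y = y \<otimes>\<^bsub>image_ring f R\<^esub> x"
        by (simp add: ring_hom_mult[OF h, symmetric] m_comm)
    qed
  qed
qed

text \<open>Test algebras have their carrier in the type \<open>'u\<close>, so quotients, localizations and polynomial
  rings have to be transported to this type.\<close>

lemma realize:
  fixes R :: "('a, 'm) ring_scheme" and g :: "'b \<Rightarrow> 'a" and e :: "'b \<Rightarrow> 'u"
  assumes "cring R" "carrier R \<subseteq> range g" "inj e"
  shows "\<exists>(C :: 'u ring) h. cring C \<and> h \<in> ring_hom R C \<and> bij_betw h (carrier R) (carrier C)"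
proof -
  have "inj_on (e \<circ> inv_into UNIV g) (carrier R)"
    using assms(2,3) inj_on_inv_into[of "carrier R" g UNIV]
    by (auto intro!: comp_inj_on intro: inj_on_subset)
  from image_ring_cring[OF assms(1) this] show ?thesis by blast
qed

lemma inj_hom_zero:
  assumes "ring R" "ring S" "h \<in> ring_hom R S" "inj_on h (carrier R)" "x \<in> carrier R"
  shows "h x = \<zero>\<^bsub>S\<^esub> \<longleftrightarrow> x = \<zero>\<^bsub>R\<^esub>"
proof -
  have "h \<zero>\<^bsub>R\<^esub> = \<zero>\<^bsub>S\<^esub>" using assms by (intro ring_hom_zero)
  then show ?thesis using assms(4,5) inj_onD[OF assms(4), of x "\<zero>\<^bsub>R\<^esub>"] ring.ring_simprules(2)[OF assms(1)] by metis
qed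

text \<open>The ring of cosets lives in the wrong type, so the quotient is known only through a
  surjection with the prescribed kernel. Cosets have representatives in \<open>B\<close>, which
  gives the injection back into the type of \<open>B\<close>.\<close>

lemma realize_quotient:
  fixes B :: "'u ring"
  assumes "cring B" "ideal I B"
  shows "\<exists>(C :: 'u ring) \<pi>. cring C \<and> \<pi> \<in> ring_hom B C \<and> \<pi> ` carrier B = carrier C \<and>
    (\<forall>b \<in> carrier B. \<pi> b = \<zero>\<^bsub>C\<^esub> \<longleftrightarrow> b \<in> I)"
proof -
  interpret B: cring B by fact
  interpret I: ideal I B by fact
  have c: "carrier (B Quot I) = (\<lambda>b. I +>\<^bsub>B\<^esub> b) ` carrier B"
    by (auto simp: FactRing_def A_RCOSETS_def')
  have q: "cring (B Quot I)" using I.quotient_is_cring[OF assms(1)] .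
  obtain C :: "'u ring" and h where C: "cring C" "h \<in> ring_hom (B Quot I) C"
    "bij_betw h (carrier (B Quot I)) (carrier C)"
    using realize[OF q, of "\<lambda>b. I +>\<^bsub>B\<^esub> b" id] c by auto
  have h: "(h \<circ> (+>\<^bsub>B\<^esub>) I) \<in> ring_hom B C"
    using ring_hom_trans[OF I.rcos_ring_hom C(2)] .
  have s: "(h \<circ> (+>\<^bsub>B\<^esub>) I) ` carrier B = carrier C"
    using C(3) c unfolding bij_betw_def image_comp[symmetric] by simp
  have z: "(h \<circ> (+>\<^bsub>B\<^esub>) I) b = \<zero>\<^bsub>C\<^esub> \<longleftrightarrow> b \<in> I" if "b \<in> carrier B" for b
  proof -
    have "(h \<circ> (+>\<^bsub>B\<^esub>) I) b = \<zero>\<^bsub>C\<^esub> \<longleftrightarrow> I +>\<^bsub>B\<^esub> b = \<zero>\<^bsub>B Quot I\<^esub>"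
      using inj_hom_zero[OF cring.axioms(1)[OF q] cring.axioms(1)[OF C(1)] C(2), of "I +>\<^bsub>B\<^esub> b"]
        C(3) c that by (auto simp: bij_betw_def)
    also have "\<dots> \<longleftrightarrow> b \<in> I"
      using that I.a_rcos_self[OF that] B.a_coset_join2[OF that I.additive_subgroup_axioms[THEN additive_subgroup.a_subgroup]]
      by (auto simp: FactRing_def I.a_rcos_const)
    finally show ?thesis .
  qed
  show ?thesis
    by (rule exI[of _ C], rule exI[of _ "h \<circ> (+>\<^bsub>B\<^esub>) I"]) (use C(1) h s z in blast)
qed

text \<open>The universal property of a quotient, in the form that fits quotients given by a
  surjection and its kernel. With a trivial kernel it also provides the inverse of a bijective
  homomorphism.\<close>

lemma hom_factor:
  assumes "cring B" "cring C" "cring D" "\<pi> \<in> ring_hom B C" "carrier C = \<pi> ` carrier B" "f \<in> ring_hom B D"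
    and "\<And>b. b \<in> carrier B \<Longrightarrow> \<pi> b = \<zero>\<^bsub>C\<^esub> \<Longrightarrow> f b = \<zero>\<^bsub>D\<^esub>"
  shows "\<exists>g \<in> ring_hom C D. \<forall>b \<in> carrier B. g (\<pi> b) = f b"
proof -
  interpret p: ring_hom_cring B C \<pi> using assms by (intro ring_hom_cringI)
  interpret f: ring_hom_cring B D f using assms by (intro ring_hom_cringI)
  have eq: "f b = f b'" if "b \<in> carrier B" "b' \<in> carrier B" "\<pi> b = \<pi> b'" for b b'
  proof -
    have "\<pi> (b \<ominus>\<^bsub>B\<^esub> b') = \<zero>\<^bsub>C\<^esub>"
      using that by (simp add: p.R.minus_eq p.S.r_neg)
    then have "f (b \<ominus>\<^bsub>B\<^esub> b') = \<zero>\<^bsub>D\<^esub>" using assms(7) that by simp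
    then show ?thesis
      using that f.S.r_right_minus_eq[of "f b" "f b'"] by (simp add: p.R.minus_eq f.S.minus_eq)
  qed
  define g where "g = (\<lambda>c. f (inv_into (carrier B) \<pi> c))"
  have g: "g (\<pi> b) = f b" if "b \<in> carrier B" for b
    unfolding g_def using that by (intro eq) (auto intro: inv_into_into f_inv_into_f)
  have "g \<in> ring_hom C D"
  proof (rule ring_hom_memI)
    show "g \<one>\<^bsub>C\<^esub> = \<one>\<^bsub>D\<^esub>" using g[of "\<one>\<^bsub>B\<^esub>"] by simp
  next
    fix x assume "x \<in> carrier C" then show "g x \<in> carrier D" using assms(5) g by auto
  next
    fix x y assume "x \<in> carrier C" "y \<in> carrier C"
    then obtain a b where "a \<in> carrier B" "b \<in> carrier B" "x = \<pi> a" "y = \<pi> b" using assms(5) by auto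
    then show "g (x \<otimes>\<^bsub>C\<^esub> y) = g x \<otimes>\<^bsub>D\<^esub> g y" "g (x \<oplus>\<^bsub>C\<^esub> y) = g x \<oplus>\<^bsub>D\<^esub> g y"
      using g[of "a \<otimes>\<^bsub>B\<^esub> b"] g[of "a \<oplus>\<^bsub>B\<^esub> b"] g[of a] g[of b] by simp_all
  qed
  then show ?thesis using g by blast
qed

text \<open>Localizations are characterized by fractions and torsion and not tied to one
  construction. Thus a fraction field that is given in advance and a localization transported to
  \<open>'u\<close> are treated alike.\<close>

definition is_localization :: "('a, 'm) ring_scheme \<Rightarrow> 'a set \<Rightarrow> ('b, 'n) ring_scheme \<Rightarrow> ('a \<Rightarrow> 'b) \<Rightarrow> bool" where
  "is_localization B S C l \<longleftrightarrow> cring B \<and> cring C \<and> S \<subseteq> carrier B \<and> \<one>\<^bsub>B\<^esub> \<in> S \<and> (\<forall>s \<in> S. \<forall>t \<in> S. s \<otimes>\<^bsub>B\<^esub> t \<in> S) \<and>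
     l \<in> ring_hom B C \<and> l ` S \<subseteq> Units C \<and>
     (\<forall>c \<in> carrier C. \<exists>b \<in> carrier B. \<exists>s \<in> S. c \<otimes>\<^bsub>C\<^esub> l s = l b) \<and>
     (\<forall>b \<in> carrier B. l b = \<zero>\<^bsub>C\<^esub> \<longleftrightarrow> (\<exists>s \<in> S. s \<otimes>\<^bsub>B\<^esub> b = \<zero>\<^bsub>B\<^esub>))"

lemma ex_inj_pair:
  assumes "infinite (UNIV :: 'u set)"
  shows "\<exists>e :: 'u \<times> 'u \<Rightarrow> 'u. inj e"
proof -
  have "|UNIV \<times> UNIV :: ('u \<times> 'u) set| \<le>o |UNIV :: 'u set|"
    using card_of_Times_same_infinite[OF assms] ordIso_iff_ordLeq by blast
  then show ?thesis by (auto simp: card_of_ordLeq[symmetric])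
qed

text \<open>Folding a pairing function is injective only on lists of equal length, so the length is
  encoded as well.\<close>

lemma ex_inj_list:
  assumes "infinite (UNIV :: 'u set)"
  shows "\<exists>e :: 'u list \<Rightarrow> 'u. inj e"
proof -
  obtain p :: "'u \<times> 'u \<Rightarrow> 'u" where p: "inj p" using ex_inj_pair[OF assms] by blast
  obtain c :: "nat \<Rightarrow> 'u" where c: "inj c" using infinite_countable_subset[OF assms] by blast
  define f :: "'u list \<Rightarrow> 'u" where "f xs = foldr (\<lambda>x y. p (x, y)) xs undefined" for xs
  have f: "xs = ys" if "length xs = length ys" "f xs = f ys" for xs ys
    using that by (induction xs ys rule: list_induct2) (auto simp: f_def dest: injD[OF p])
  have "inj (\<lambda>xs. p (c (length xs), f xs))"
    by (rule injI) (auto dest!: injD[OF p] injD[OF c] intro: f)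
  then show ?thesis by blast
qed

lemma ex_localization:
  fixes B :: "'u ring"
  assumes "infinite (UNIV :: 'u set)" "cring B" "S \<subseteq> carrier B" "\<one>\<^bsub>B\<^esub> \<in> S"
    "\<And>s t. s \<in> S \<Longrightarrow> t \<in> S \<Longrightarrow> s \<otimes>\<^bsub>B\<^esub> t \<in> S"
  shows "\<exists>(C :: 'u ring) l. is_localization B S C l"
proof -
  interpret B: cring B by fact
  interpret mult_set B S by unfold_locales (use assms in auto)
  interpret F: cring fractions by (rule cring_fractions)
  obtain e :: "'u \<times> 'u \<Rightarrow> 'u" where e: "inj e" using ex_inj_pair[OF assms(1)] by blast
  have "carrier fractions \<subseteq> range (\<lambda>x. fr (fst x) (snd x))"
  proof
    fix x assume "x \<in> carrier fractions"
    then obtain a s where "x = fr a s" by (rule fractions_cases)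
    then show "x \<in> range (\<lambda>x. fr (fst x) (snd x))" by (auto intro: range_eqI[of _ _ "(a, s)"])
  qed
  from realize[OF cring_fractions this e]
  obtain C :: "'u ring" and h where C: "cring C" and h: "h \<in> ring_hom fractions C"
    and b: "bij_betw h (carrier fractions) (carrier C)" by blast
  interpret h: ring_hom_cring fractions C h using C h F.is_cring by (intro ring_hom_cringI)
  let ?l = "h \<circ> (\<lambda>a. fr a \<one>\<^bsub>B\<^esub>)"
  have z: "?l x = \<zero>\<^bsub>C\<^esub> \<longleftrightarrow> (\<exists>s \<in> S. s \<otimes>\<^bsub>B\<^esub> x = \<zero>\<^bsub>B\<^esub>)" if "x \<in> carrier B" for x
    using inj_hom_zero[OF F.ring_axioms h.S.ring_axioms h, of "fr x \<one>\<^bsub>B\<^esub>"] b that fr_eq_zero_iff[OF that]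
    by (auto simp: bij_betw_def fr_closed)
  have d: "\<exists>x \<in> carrier B. \<exists>s \<in> S. c \<otimes>\<^bsub>C\<^esub> ?l s = ?l x" if c: "c \<in> carrier C" for c
  proof -
    obtain f where "f \<in> carrier fractions" "c = h f" using b c by (auto simp: bij_betw_def)
    then obtain x s where x: "x \<in> carrier B" "s \<in> S" "c = h (fr x s)" by (auto elim: fractions_cases)
    then have "c \<otimes>\<^bsub>C\<^esub> ?l s = ?l x"
      using h.hom_mult[of "fr x s" "fr s \<one>\<^bsub>B\<^esub>"] by (simp add: fr_closed fr_denominator)
    then show ?thesis using x by blast
  qed
  have "is_localization B S C ?l"
    unfolding is_localization_def
  proof (intro conjI)
    show "?l ` S \<subseteq> Units C" using fr_Units ring_hom_Units[OF h] by auto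
    show "?l \<in> ring_hom B C" by (rule ring_hom_trans[OF fr_hom h])
    show "\<forall>c \<in> carrier C. \<exists>x \<in> carrier B. \<exists>s \<in> S. c \<otimes>\<^bsub>C\<^esub> ?l s = ?l x" using d by blast
    show "\<forall>b \<in> carrier B. ?l b = \<zero>\<^bsub>C\<^esub> \<longleftrightarrow> (\<exists>s \<in> S. s \<otimes>\<^bsub>B\<^esub> b = \<zero>\<^bsub>B\<^esub>)" using z by blast
  qed (use assms C in blast)+
  then show ?thesis by blast
qed

lemma localization_lift:
  assumes "is_localization B S C l" "cring D" "f \<in> ring_hom B D" "f ` S \<subseteq> Units D"
  shows "\<exists>g \<in> ring_hom C D. \<forall>b \<in> carrier B. g (l b) = f b"
proof -
  have BC: "cring B" "cring C" "l \<in> ring_hom B C" and S: "S \<subseteq> carrier B" "\<one>\<^bsub>B\<^esub> \<in> S"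
    and Sm: "\<And>s t. s \<in> S \<Longrightarrow> t \<in> S \<Longrightarrow> s \<otimes>\<^bsub>B\<^esub> t \<in> S"
    and D: "\<And>c. c \<in> carrier C \<Longrightarrow> \<exists>b \<in> carrier B. \<exists>s \<in> S. c \<otimes>\<^bsub>C\<^esub> l s = l b"
    and Z: "\<And>b. b \<in> carrier B \<Longrightarrow> l b = \<zero>\<^bsub>C\<^esub> \<Longrightarrow> \<exists>s \<in> S. s \<otimes>\<^bsub>B\<^esub> b = \<zero>\<^bsub>B\<^esub>"
    using assms(1) by (auto simp: is_localization_def)
  interpret l: ring_hom_cring B C l using BC by (intro ring_hom_cringI)
  interpret f: ring_hom_cring B D f using BC assms by (intro ring_hom_cringI)
  have Sc [simp]: "s \<in> carrier B" if "s \<in> S" for s using that S by auto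
  have fU: "f s \<in> Units D" if "s \<in> S" for s using that assms(4) by auto
  have eq: "f a = f b" if ab: "a \<in> carrier B" "b \<in> carrier B" "l a = l b" for a b
  proof -
    have "l (a \<ominus>\<^bsub>B\<^esub> b) = \<zero>\<^bsub>C\<^esub>" using ab by (simp add: l.R.minus_eq l.S.r_neg)
    then obtain t where t: "t \<in> S" "t \<otimes>\<^bsub>B\<^esub> (a \<ominus>\<^bsub>B\<^esub> b) = \<zero>\<^bsub>B\<^esub>" using Z ab by (metis l.R.minus_closed)
    have "f t \<otimes>\<^bsub>D\<^esub> f (a \<ominus>\<^bsub>B\<^esub> b) = f (t \<otimes>\<^bsub>B\<^esub> (a \<ominus>\<^bsub>B\<^esub> b))" using ab t(1) by (intro f.hom_mult[symmetric]) simp_all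
    then have "f t \<otimes>\<^bsub>D\<^esub> f (a \<ominus>\<^bsub>B\<^esub> b) = f t \<otimes>\<^bsub>D\<^esub> \<zero>\<^bsub>D\<^esub>" using t by simp
    then have "f (a \<ominus>\<^bsub>B\<^esub> b) = \<zero>\<^bsub>D\<^esub>" using f.S.Units_l_cancel[OF fU[OF t(1)]] ab by simp
    then show ?thesis using f.S.r_right_minus_eq[of "f a" "f b"] ab by (simp add: l.R.minus_eq f.S.minus_eq)
  qed
  \<comment> \<open>\<open>R c y\<close> says that \<open>y\<close> is the value of \<open>c\<close>
    computed from some presentation as a fraction. Since every \<open>c\<close> has exactly one such
    \<open>y\<close>, the laws of a homomorphism need only one suitable presentation of each sum and
    product.\<close>
  define R where "R c y \<longleftrightarrow> y \<in> carrier D \<and> (\<exists>b \<in> carrier B. \<exists>s \<in> S. c \<otimes>\<^bsub>C\<^esub> l s = l b \<and> y \<otimes>\<^bsub>D\<^esub> f s = f b)" for c y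
  have ex: "\<exists>y. R c y" if c: "c \<in> carrier C" for c
  proof -
    obtain b s where "b \<in> carrier B" "s \<in> S" "c \<otimes>\<^bsub>C\<^esub> l s = l b" using D[OF c] by blast
    moreover have "f b \<otimes>\<^bsub>D\<^esub> inv\<^bsub>D\<^esub> (f s) \<otimes>\<^bsub>D\<^esub> f s = f b" "f b \<otimes>\<^bsub>D\<^esub> inv\<^bsub>D\<^esub> (f s) \<in> carrier D"
      using calculation fU by (simp_all add: f.S.m_assoc)
    ultimately show ?thesis unfolding R_def by blast
  qed
  have uniq: "y = y'" if c: "c \<in> carrier C" and y: "R c y" "R c y'" for c y y'
  proof -
    obtain b s where 1: "y \<in> carrier D" "b \<in> carrier B" "s \<in> S" "c \<otimes>\<^bsub>C\<^esub> l s = l b" "y \<otimes>\<^bsub>D\<^esub> f s = f b"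
      using y(1) by (auto simp: R_def)
    obtain b' s' where 2: "y' \<in> carrier D" "b' \<in> carrier B" "s' \<in> S" "c \<otimes>\<^bsub>C\<^esub> l s' = l b'" "y' \<otimes>\<^bsub>D\<^esub> f s' = f b'"
      using y(2) by (auto simp: R_def)
    have "l (b \<otimes>\<^bsub>B\<^esub> s') = (c \<otimes>\<^bsub>C\<^esub> l s) \<otimes>\<^bsub>C\<^esub> l s'" using 1 2 by simp
    also have "\<dots> = (c \<otimes>\<^bsub>C\<^esub> l s') \<otimes>\<^bsub>C\<^esub> l s" using 1(3) 2(3) c by (simp add: l.S.m_ac)
    also have "\<dots> = l (b' \<otimes>\<^bsub>B\<^esub> s)" using 1 2 by simp
    finally have "f (b \<otimes>\<^bsub>B\<^esub> s') = f (b' \<otimes>\<^bsub>B\<^esub> s)" using 1 2 by (intro eq) simp_all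
    then have "(y \<otimes>\<^bsub>D\<^esub> f s) \<otimes>\<^bsub>D\<^esub> f s' = (y' \<otimes>\<^bsub>D\<^esub> f s') \<otimes>\<^bsub>D\<^esub> f s" using 1 2 by simp
    then have "(f s \<otimes>\<^bsub>D\<^esub> f s') \<otimes>\<^bsub>D\<^esub> y = (f s \<otimes>\<^bsub>D\<^esub> f s') \<otimes>\<^bsub>D\<^esub> y'" using 1(1-3) 2(1-3) by (simp add: f.S.m_ac)
    then show ?thesis using f.S.Units_l_cancel[OF f.S.Units_m_closed[OF fU[OF 1(3)] fU[OF 2(3)]]] 1(1) 2(1) by simp
  qed
  define g where "g c = (SOME y. R c y)" for c
  have gR: "R c (g c)" if "c \<in> carrier C" for c unfolding g_def using ex[OF that] by (rule someI_ex)
  have gI: "g c = y" if "c \<in> carrier C" "R c y" for c y using uniq gR that by blast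
  have gl: "g (l b) = f b" if "b \<in> carrier B" for b
  proof (rule gI)
    have "l b \<otimes>\<^bsub>C\<^esub> l \<one>\<^bsub>B\<^esub> = l b" "f b \<otimes>\<^bsub>D\<^esub> f \<one>\<^bsub>B\<^esub> = f b" using that by simp_all
    then show "R (l b) (f b)" unfolding R_def using that S(2) f.hom_closed by blast
  qed (use that in simp)
  have "g \<in> ring_hom C D"
  proof (rule ring_hom_memI)
    show "g \<one>\<^bsub>C\<^esub> = \<one>\<^bsub>D\<^esub>" using gl[of "\<one>\<^bsub>B\<^esub>"] by simp
    show gc: "g x \<in> carrier D" if "x \<in> carrier C" for x using gR[OF that] by (simp add: R_def)
    fix x y assume xy: "x \<in> carrier C" "y \<in> carrier C"
    obtain a s where 1: "a \<in> carrier B" "s \<in> S" "x \<otimes>\<^bsub>C\<^esub> l s = l a" "g x \<otimes>\<^bsub>D\<^esub> f s = f a"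
      using gR[OF xy(1)] by (auto simp: R_def)
    obtain b t where 2: "b \<in> carrier B" "t \<in> S" "y \<otimes>\<^bsub>C\<^esub> l t = l b" "g y \<otimes>\<^bsub>D\<^esub> f t = f b"
      using gR[OF xy(2)] by (auto simp: R_def)
    note c = 1(1,2) 2(1,2) xy gc[OF xy(1)] gc[OF xy(2)]
    have "(x \<oplus>\<^bsub>C\<^esub> y) \<otimes>\<^bsub>C\<^esub> l (s \<otimes>\<^bsub>B\<^esub> t) = (x \<otimes>\<^bsub>C\<^esub> l s) \<otimes>\<^bsub>C\<^esub> l t \<oplus>\<^bsub>C\<^esub> (y \<otimes>\<^bsub>C\<^esub> l t) \<otimes>\<^bsub>C\<^esub> l s"
      using c by (simp add: l.S.l_distr l.S.r_distr l.S.m_ac)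
    moreover have "(g x \<oplus>\<^bsub>D\<^esub> g y) \<otimes>\<^bsub>D\<^esub> f (s \<otimes>\<^bsub>B\<^esub> t) = (g x \<otimes>\<^bsub>D\<^esub> f s) \<otimes>\<^bsub>D\<^esub> f t \<oplus>\<^bsub>D\<^esub> (g y \<otimes>\<^bsub>D\<^esub> f t) \<otimes>\<^bsub>D\<^esub> f s"
      using c by (simp add: f.S.l_distr f.S.r_distr f.S.m_ac)
    ultimately have "R (x \<oplus>\<^bsub>C\<^esub> y) (g x \<oplus>\<^bsub>D\<^esub> g y)" unfolding R_def
      using c 1(3,4) 2(3,4) Sm
      by (intro conjI bexI[of _ "s \<otimes>\<^bsub>B\<^esub> t"] bexI[of _ "a \<otimes>\<^bsub>B\<^esub> t \<oplus>\<^bsub>B\<^esub> b \<otimes>\<^bsub>B\<^esub> s"]) (simp_all del: l.hom_mult f.hom_mult add: l.hom_mult[of a t] l.hom_mult[of b s] f.hom_mult[of a t] f.hom_mult[of b s])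
    then show "g (x \<oplus>\<^bsub>C\<^esub> y) = g x \<oplus>\<^bsub>D\<^esub> g y" using xy by (intro gI) simp_all
    have "(x \<otimes>\<^bsub>C\<^esub> y) \<otimes>\<^bsub>C\<^esub> l (s \<otimes>\<^bsub>B\<^esub> t) = (x \<otimes>\<^bsub>C\<^esub> l s) \<otimes>\<^bsub>C\<^esub> (y \<otimes>\<^bsub>C\<^esub> l t)"
      using c by (simp add: l.S.m_ac)
    moreover have "(g x \<otimes>\<^bsub>D\<^esub> g y) \<otimes>\<^bsub>D\<^esub> f (s \<otimes>\<^bsub>B\<^esub> t) = (g x \<otimes>\<^bsub>D\<^esub> f s) \<otimes>\<^bsub>D\<^esub> (g y \<otimes>\<^bsub>D\<^esub> f t)"
      using c by (simp add: f.S.m_ac)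
    ultimately have "R (x \<otimes>\<^bsub>C\<^esub> y) (g x \<otimes>\<^bsub>D\<^esub> g y)" unfolding R_def
      using c 1(3,4) 2(3,4) Sm
      by (intro conjI bexI[of _ "s \<otimes>\<^bsub>B\<^esub> t"] bexI[of _ "a \<otimes>\<^bsub>B\<^esub> b"]) (simp_all del: l.hom_mult f.hom_mult add: l.hom_mult[of a b] f.hom_mult[of a b])
    then show "g (x \<otimes>\<^bsub>C\<^esub> y) = g x \<otimes>\<^bsub>D\<^esub> g y" using xy by (intro gI) simp_all
  qed
  then show ?thesis using gl by blast
qed

lemma localization_hom_eq:
  assumes "is_localization B S C l" "cring D" "f \<in> ring_hom C D" "g \<in> ring_hom C D"
    and eq: "\<And>b. b \<in> carrier B \<Longrightarrow> f (l b) = g (l b)" and c: "c \<in> carrier C"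
  shows "f c = g c"
proof -
  have BC: "cring B" "cring C" "l \<in> ring_hom B C" and S: "S \<subseteq> carrier B" 
    using assms(1) by (auto simp: is_localization_def)
  interpret l: ring_hom_cring B C l using BC by (intro ring_hom_cringI)
  interpret f: ring_hom_cring C D f using BC assms by (intro ring_hom_cringI)
  interpret g: ring_hom_cring C D g using BC assms by (intro ring_hom_cringI)
  obtain b s where bs: "b \<in> carrier B" "s \<in> S" "c \<otimes>\<^bsub>C\<^esub> l s = l b" and U: "l s \<in> Units C"
    using assms(1) c unfolding is_localization_def by blast
  have s: "s \<in> carrier B" using bs S by auto
  have "f (l s) \<otimes>\<^bsub>D\<^esub> f c = f (l b)"
    using c s f.hom_mult[of "l s" c] l.S.m_comm[of "l s" c] bs(3) by simp
  moreover have "f (l s) \<otimes>\<^bsub>D\<^esub> g c = f (l b)"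
    using c s g.hom_mult[of "l s" c] l.S.m_comm[of "l s" c] bs(1,3) eq by simp
  ultimately show ?thesis
    using f.S.Units_l_cancel[OF ring_hom_Units[OF assms(3) U], of "f c" "g c"] c by simp
qed

lemma ex_fraction_field:
  fixes D :: "'u ring"
  assumes "infinite (UNIV :: 'u set)" "domain D"
  shows "\<exists>(L :: 'u ring) l. field L \<and> is_localization D (carrier D - {\<zero>\<^bsub>D\<^esub>}) L l \<and> inj_on l (carrier D)"
proof -
  interpret D: domain D by fact
  obtain L :: "'u ring" and l where L: "is_localization D (carrier D - {\<zero>\<^bsub>D\<^esub>}) L l"
    using ex_localization[OF assms(1) D.is_cring, of "carrier D - {\<zero>\<^bsub>D\<^esub>}"] D.integral_iff by auto
  then have "cring L" and h: "l \<in> ring_hom D L" by (auto simp: is_localization_def)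
  interpret L: cring L by fact
  interpret l: ring_hom_cring D L l by (intro ring_hom_cringI) (use h D.is_cring L.is_cring in auto)
  have z: "l x = \<zero>\<^bsub>L\<^esub> \<longleftrightarrow> x = \<zero>\<^bsub>D\<^esub>" if "x \<in> carrier D" for x
  proof -
    have "l x = \<zero>\<^bsub>L\<^esub> \<longleftrightarrow> (\<exists>s \<in> carrier D - {\<zero>\<^bsub>D\<^esub>}. s \<otimes>\<^bsub>D\<^esub> x = \<zero>\<^bsub>D\<^esub>)"
      using L that unfolding is_localization_def by blast
    also have "\<dots> \<longleftrightarrow> x = \<zero>\<^bsub>D\<^esub>"
      using that D.integral_iff[of _ x] D.one_not_zero by (metis DiffD1 DiffD2 DiffI D.one_closed singletonD singletonI D.r_null)
    finally show ?thesis .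
  qed
  have "inj_on l (carrier D)"
  proof (rule inj_onI)
    fix x y assume xy: "x \<in> carrier D" "y \<in> carrier D" "l x = l y"
    then have "l (x \<ominus>\<^bsub>D\<^esub> y) = \<zero>\<^bsub>L\<^esub>" by (simp add: D.minus_eq L.r_neg)
    then have "x \<ominus>\<^bsub>D\<^esub> y = \<zero>\<^bsub>D\<^esub>" using z xy by blast
    then show "x = y" using xy(1,2) D.r_right_minus_eq by blast
  qed
  moreover have "field L"
  proof (rule L.cring_fieldI)
    have "x \<in> Units L" if x: "x \<in> carrier L" "x \<noteq> \<zero>\<^bsub>L\<^esub>" for x
    proof -
      obtain b s where b: "b \<in> carrier D" "s \<in> carrier D - {\<zero>\<^bsub>D\<^esub>}" "x \<otimes>\<^bsub>L\<^esub> l s = l b"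
        using L[unfolded is_localization_def] x(1) by meson
      have "b \<noteq> \<zero>\<^bsub>D\<^esub>"
      proof
        assume "b = \<zero>\<^bsub>D\<^esub>"
        then have "l s \<otimes>\<^bsub>L\<^esub> x = l s \<otimes>\<^bsub>L\<^esub> \<zero>\<^bsub>L\<^esub>" using b x L.m_comm[of "l s" x] by simp
        moreover have "l s \<in> Units L" using L b unfolding is_localization_def by blast
        ultimately show False using x L.Units_l_cancel[of "l s" x "\<zero>\<^bsub>L\<^esub>"] by simp
      qed
      then have "l b \<in> Units L" using L b unfolding is_localization_def by blast
      then obtain y where "y \<in> carrier L" "l b \<otimes>\<^bsub>L\<^esub> y = \<one>\<^bsub>L\<^esub>" by (auto simp: Units_def)
      then have "x \<otimes>\<^bsub>L\<^esub> (l s \<otimes>\<^bsub>L\<^esub> y) = \<one>\<^bsub>L\<^esub>" using b(1,2) x by (simp add: L.m_assoc[symmetric] b(3))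
      then show ?thesis using b \<open>y \<in> carrier L\<close> by (intro Units_cringI(1)[OF L.is_cring x(1)]) auto
    qed
    moreover have "\<zero>\<^bsub>L\<^esub> \<notin> Units L"
      using z[of "\<one>\<^bsub>D\<^esub>"] L.r_null by (auto simp: Units_def)
    ultimately show "Units L = carrier L - {\<zero>\<^bsub>L\<^esub>}" by auto
  qed
  ultimately show ?thesis using L by blast
qed

section \<open>Ultrafilters and valuation rings\<close>

text \<open>Zorn's lemma gives a minimal proper filter below \<open>sequentially\<close>.
  Restricting it to a predicate either makes it trivial or, by minimality, changes nothing; in both
  cases the predicate is decided.\<close>

lemma ex_ultrafilter:
  "\<exists>F :: nat filter. F \<noteq> bot \<and> F \<le> sequentially \<and> (\<forall>P. eventually P F \<or> eventually (\<lambda>x. \<not> P x) F)"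
proof -
  let ?A = "{F :: nat filter. F \<noteq> bot \<and> F \<le> sequentially}" and ?P = "\<lambda>F G :: nat filter. G \<le> F"
  have "\<exists>m \<in> ?A. \<forall>a \<in> ?A. ?P m a \<longrightarrow> a = m"
  proof (rule predicate_Zorn)
    show "partial_order_on ?A (relation_of ?P ?A)"
      by (rule partial_order_on_relation_ofI) auto
  next
    fix C assume C: "C \<in> Chains (relation_of ?P ?A)"
    then have sub: "C \<subseteq> ?A" and tot: "\<And>F G. F \<in> C \<Longrightarrow> G \<in> C \<Longrightarrow> F \<le> G \<or> G \<le> F"
      unfolding Chains_def relation_of_def by blast+
    show "\<exists>u \<in> ?A. \<forall>a \<in> C. ?P a u"
    proof (cases "C = {}")
      case True
      then show ?thesis by (intro bexI[of _ sequentially]) auto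
    next
      case False
      \<comment> \<open>The infimum of a chain of filters is trivial only if a member of the chain
        is, so it stays proper.\<close>
      have "eventually (\<lambda>_. False) (Inf C) \<longleftrightarrow> (\<exists>b \<in> C. eventually (\<lambda>_. False) b)"
        using tot by (intro eventually_Inf_base[OF False]) (metis inf.orderE inf.commute order_refl)
      then have "Inf C \<noteq> bot"
        using sub by (auto simp: trivial_limit_def)
      moreover have "Inf C \<le> sequentially"
      proof -
        obtain F where "F \<in> C" using False by blast
        then show ?thesis using sub by (auto intro: Inf_lower2)
      qed
      ultimately show ?thesis by (intro bexI[of _ "Inf C"]) (auto intro: Inf_lower)
    qed
  qed
  then obtain F where F: "F \<noteq> bot" "F \<le> sequentially"
    and max: "\<And>G. G \<noteq> bot \<Longrightarrow> G \<le> F \<Longrightarrow> G = F" by (auto intro: order_trans)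
  have "eventually P F \<or> eventually (\<lambda>x. \<not> P x) F" for P
  proof (cases "inf F (principal {x. P x}) = bot")
    case True
    then have "eventually (\<lambda>_. False) (inf F (principal {x. P x}))" by simp
    then show ?thesis by (auto simp: eventually_inf_principal)
  next
    case False
    then have "inf F (principal {x. P x}) = F" by (intro max) auto
    then have "eventually P (inf F (principal {x. P x})) \<longleftrightarrow> eventually P F" by simp
    then show ?thesis by (simp add: eventually_inf_principal)
  qed
  then show ?thesis using F by blast
qed

text \<open>This is how a choice among finitely many possibilities that depends on n is made
  constant: first the choice of a chart, later that of a pair of indices.\<close>

lemma ultrafilter_bex:
  assumes "\<And>P. eventually P F \<or> eventually (\<lambda>x. \<not> P x) F"
    and "finite A" "eventually (\<lambda>n. \<exists>a \<in> A. P a n) F" "F \<noteq> bot"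
  shows "\<exists>a \<in> A. eventually (P a) F"
proof (rule ccontr)
  assume "\<not> ?thesis"
  then have "\<forall>a \<in> A. eventually (\<lambda>n. \<not> P a n) F" using assms(1) by blast
  then have "eventually (\<lambda>n. \<forall>a \<in> A. \<not> P a n) F" using assms(2) by (simp add: eventually_ball_finite)
  with assms(3) have "eventually (\<lambda>n. False) F" by eventually_elim blast
  then show False using assms(4) by simp
qed

text \<open>Values at \<open>x\<close> of polynomials of degree at most \<open>n\<close> over
  \<open>S\<close>, in Horner form. Degree bounds are attached to values and not to polynomials, so
  nothing has to be assumed about relations that \<open>x\<close> satisfies.\<close>

primrec (in ring) poly_vals :: "'a set \<Rightarrow> 'a \<Rightarrow> nat \<Rightarrow> 'a set" where
  "poly_vals S x 0 = S"
| "poly_vals S x (Suc n) = {s \<oplus> x \<otimes> d | s d. s \<in> S \<and> d \<in> poly_vals S x n}"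

declare (in ring) poly_vals.simps(2) [simp del]

context cring
begin

lemma poly_vals_SucI:
  "s \<in> S \<Longrightarrow> d \<in> poly_vals S x n \<Longrightarrow> y = s \<oplus> x \<otimes> d \<Longrightarrow> y \<in> poly_vals S x (Suc n)"
  unfolding poly_vals.simps by blast

lemma poly_vals_SucE:
  assumes "y \<in> poly_vals S x (Suc n)"
  obtains s d where "s \<in> S" "d \<in> poly_vals S x n" "y = s \<oplus> x \<otimes> d"
  using assms unfolding poly_vals.simps by blast

context
  fixes S x
  assumes S: "subring S R" and x: "x \<in> carrier R"
begin

lemma S_sub: "s \<in> S \<Longrightarrow> s \<in> carrier R"
  using subringE(1)[OF S] by auto

lemmas S_intros = subringE(2,3,5-7)[OF S]

lemma poly_vals_closed: "d \<in> poly_vals S x n \<Longrightarrow> d \<in> carrier R"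
  using S_sub x by (induction n arbitrary: d) (auto elim!: poly_vals_SucE)

lemma poly_vals_add:
  "d \<in> poly_vals S x n \<Longrightarrow> d' \<in> poly_vals S x n \<Longrightarrow> d \<oplus> d' \<in> poly_vals S x n"
proof (induction n arbitrary: d d')
  case (Suc n)
  then obtain s e s' e' where *: "s \<in> S" "e \<in> poly_vals S x n" "d = s \<oplus> x \<otimes> e"
    "s' \<in> S" "e' \<in> poly_vals S x n" "d' = s' \<oplus> x \<otimes> e'" by (metis poly_vals_SucE)
  then have "d \<oplus> d' = (s \<oplus> s') \<oplus> x \<otimes> (e \<oplus> e')"
    using S_sub poly_vals_closed x by (simp add: r_distr a_ac)
  then show ?case using * Suc.IH S_intros(5) by (intro poly_vals_SucI) auto
qed (auto simp: S_intros)

lemma poly_vals_smult: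
  "t \<in> S \<Longrightarrow> d \<in> poly_vals S x n \<Longrightarrow> t \<otimes> d \<in> poly_vals S x n"
proof (induction n arbitrary: d)
  case (Suc n)
  then obtain s e where *: "s \<in> S" "e \<in> poly_vals S x n" "d = s \<oplus> x \<otimes> e" by (auto elim: poly_vals_SucE)
  then have "t \<otimes> d = t \<otimes> s \<oplus> x \<otimes> (t \<otimes> e)"
    using S_sub poly_vals_closed x Suc.prems(1) by (simp add: r_distr m_lcomm)
  then show ?case using * Suc.IH Suc.prems(1) S_intros(4) by (intro poly_vals_SucI) auto
qed (auto simp: S_intros)

lemma poly_vals_shift:
  "d \<in> poly_vals S x n \<Longrightarrow> x \<otimes> d \<in> poly_vals S x (Suc n)"
  using S_intros(1) poly_vals_closed[of d n] x by (intro poly_vals_SucI[of \<zero>]) auto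

lemma zero_in_poly_vals: "\<zero> \<in> poly_vals S x n"
proof (induction n)
  case (Suc n) then show ?case using S_intros(1) x by (intro poly_vals_SucI[of \<zero> _ \<zero>]) auto
qed (auto simp: S_intros)

lemma poly_vals_const: "s \<in> S \<Longrightarrow> s \<in> poly_vals S x n"
proof (cases n)
  case (Suc m)
  assume "s \<in> S"
  then have "s = s \<oplus> x \<otimes> \<zero>" using S_sub x by simp
  then show ?thesis using zero_in_poly_vals[of m] \<open>s \<in> S\<close> Suc poly_vals_SucI by blast
qed auto

lemma poly_vals_mono_Suc: "d \<in> poly_vals S x n \<Longrightarrow> d \<in> poly_vals S x (Suc n)"
proof (induction n arbitrary: d)
  case 0 then show ?case using poly_vals_const by simp
next
  case (Suc n)
  then obtain s e where "s \<in> S" "e \<in> poly_vals S x n" "d = s \<oplus> x \<otimes> e" by (auto elim: poly_vals_SucE)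
  then show ?case using Suc.IH[of e] by (blast intro: poly_vals_SucI)
qed

lemma poly_vals_mono: "m \<le> n \<Longrightarrow> d \<in> poly_vals S x m \<Longrightarrow> d \<in> poly_vals S x n"
  by (induction n rule: dec_induct) (auto intro: poly_vals_mono_Suc)

lemma poly_vals_pow: "s \<in> S \<Longrightarrow> s \<otimes> x [^] n \<in> poly_vals S x n"
proof (induction n)
  case 0 then show ?case using S_sub by simp
next
  case (Suc n)
  then have "s \<otimes> x [^] Suc n = x \<otimes> (s \<otimes> x [^] n)" using S_sub x by (simp add: m_ac)
  then show ?case using poly_vals_shift Suc by simp
qed

lemma poly_vals_mult:
  "d \<in> poly_vals S x m \<Longrightarrow> d' \<in> poly_vals S x n \<Longrightarrow> d \<otimes> d' \<in> poly_vals S x (m + n)"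
proof (induction m arbitrary: d)
  case 0 then show ?case using poly_vals_smult by simp
next
  case (Suc m)
  then obtain s e where *: "s \<in> S" "e \<in> poly_vals S x m" "d = s \<oplus> x \<otimes> e" by (auto elim: poly_vals_SucE)
  have "d \<otimes> d' = s \<otimes> d' \<oplus> x \<otimes> (e \<otimes> d')"
    using * S_sub poly_vals_closed[OF *(2)] poly_vals_closed[OF Suc.prems(2)] x by (simp add: l_distr m_assoc)
  moreover have "s \<otimes> d' \<in> poly_vals S x (Suc m + n)"
    using poly_vals_smult[OF *(1) Suc.prems(2)] by (rule poly_vals_mono[rotated]) simp
  moreover have "x \<otimes> (e \<otimes> d') \<in> poly_vals S x (Suc m + n)"
    using poly_vals_shift[OF Suc.IH[OF *(2) Suc.prems(2)]] by simp
  ultimately show ?case using poly_vals_add by simp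
qed

lemma poly_vals_top:
  "d \<in> poly_vals S x (Suc n) \<Longrightarrow> \<exists>e \<in> poly_vals S x n. \<exists>a \<in> S. d = e \<oplus> a \<otimes> x [^] Suc n"
proof (induction n arbitrary: d)
  case 0
  then obtain s e where "s \<in> S" "e \<in> S" "d = s \<oplus> x \<otimes> e" by (auto elim: poly_vals_SucE)
  then show ?case using S_sub x m_comm by (intro bexI[of _ s] bexI[of _ e]) auto
next
  case (Suc n)
  then obtain s e where *: "s \<in> S" "e \<in> poly_vals S x (Suc n)" "d = s \<oplus> x \<otimes> e"
    using poly_vals_SucE by blast
  then obtain e' a where **: "e' \<in> poly_vals S x n" "a \<in> S" "e = e' \<oplus> a \<otimes> x [^] Suc n"
    using Suc.IH by blast
  have "d = (s \<oplus> x \<otimes> e') \<oplus> a \<otimes> x [^] Suc (Suc n)"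
    using * ** S_sub poly_vals_closed x by (simp add: r_distr m_ac a_assoc)
  moreover have "s \<oplus> x \<otimes> e' \<in> poly_vals S x (Suc n)" using * ** by (intro poly_vals_SucI) auto
  ultimately show ?case using ** by blast
qed

lemma subring_poly_vals: "subring (\<Union>n. poly_vals S x n) R"
proof (rule subringI)
  show "(\<Union>n. poly_vals S x n) \<subseteq> carrier R" using poly_vals_closed by blast
  show "\<one> \<in> (\<Union>n. poly_vals S x n)" using S_intros(2) by (auto intro: poly_vals_const)
next
  fix h assume "h \<in> (\<Union>n. poly_vals S x n)"
  then obtain n where n: "h \<in> poly_vals S x n" by blast
  have "\<ominus> \<one> \<in> S" using S_intros by blast
  then have "\<ominus> \<one> \<otimes> h \<in> poly_vals S x n" using n poly_vals_smult by blast
  then show "\<ominus> h \<in> (\<Union>n. poly_vals S x n)"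
    using poly_vals_closed[OF n] by (auto simp: l_minus)
next
  fix h k assume "h \<in> (\<Union>n. poly_vals S x n)" "k \<in> (\<Union>n. poly_vals S x n)"
  then obtain m n where "h \<in> poly_vals S x m" "k \<in> poly_vals S x n" by blast
  then show "h \<otimes> k \<in> (\<Union>n. poly_vals S x n)" "h \<oplus> k \<in> (\<Union>n. poly_vals S x n)"
    using poly_vals_mult[of h m k n] poly_vals_add[of h "max m n" k]
      poly_vals_mono[of m "max m n" h] poly_vals_mono[of n "max m n" k] by auto
qed

lemma poly_vals_sub: "S \<subseteq> (\<Union>n. poly_vals S x n)" "x \<in> (\<Union>n. poly_vals S x n)"
proof -
  show "S \<subseteq> (\<Union>n. poly_vals S x n)" using poly_vals_const by blast
  have "\<one> \<otimes> x [^] (1::nat) \<in> poly_vals S x 1" using poly_vals_pow S_intros(2) by blast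
  then show "x \<in> (\<Union>n. poly_vals S x n)" using x by (auto)
qed

text \<open>Multiplication by x^m reverses the coefficients: a polynomial in 1/x of degree at most m
  becomes one in x of degree at most m.\<close>

lemma poly_vals_reverse:
  assumes "y \<in> carrier R" "x \<otimes> y = \<one>"
  shows "d \<in> poly_vals S y j \<Longrightarrow> j \<le> m \<Longrightarrow> x [^] m \<otimes> d \<in> poly_vals S x m"
proof (induction j arbitrary: d m)
  case 0
  then show ?case using poly_vals_pow[of d m] S_sub x by (simp add: m_comm)
next
  case (Suc j)
  then obtain s e k where *: "s \<in> S" "e \<in> poly_vals S y j" "d = s \<oplus> y \<otimes> e" "m = Suc k"
    by (cases m) (auto elim: poly_vals_SucE)
  have e: "e \<in> carrier R" using *(2) S_sub assms(1) by (induction j arbitrary: e) (auto elim!: poly_vals_SucE)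
  have "x [^] m \<otimes> d = s \<otimes> x [^] m \<oplus> (x \<otimes> y) \<otimes> (x [^] k \<otimes> e)"
    using *(1,3,4) e S_sub x assms(1) by (simp add: r_distr m_ac)
  then have "x [^] m \<otimes> d = s \<otimes> x [^] m \<oplus> x [^] k \<otimes> e"
    using assms e x by simp
  moreover have "x [^] k \<otimes> e \<in> poly_vals S x m"
    using Suc.IH[OF *(2), of k] Suc.prems(2) *(4) poly_vals_mono_Suc by simp
  ultimately show ?case using poly_vals_add poly_vals_pow[OF *(1)] by simp
qed

end

end

text \<open>Chevalley's reduction of the degree. Write d' = b + y d'' with b in \<open>S\<close>.
  Then 1 - \<mu> b = \<mu> y d'', so (1 - \<mu> b) x^(n+1) equals \<open>\<mu>\<close> times a value
  of degree at most n. This identity removes the leading term of \<open>d\<close>.\<close>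

lemma (in cring) poly_vals_reduce:
  assumes S: "subring S R" and xy: "x \<in> carrier R" "y \<in> carrier R" "x \<otimes> y = \<one>" and \<mu>: "\<mu> \<in> S"
    and d: "d \<in> poly_vals S x (Suc n)" "\<mu> \<otimes> d = \<one>"
    and d': "d' \<in> poly_vals S y k" "\<mu> \<otimes> d' = \<one>" and "k \<le> Suc n"
  shows "\<exists>d \<in> poly_vals S x n. \<mu> \<otimes> d = \<one>"
proof (cases k)
  case 0
  then show ?thesis using d' poly_vals_const[OF S xy(1)] by auto
next
  case (Suc j)
  then have j: "j \<le> n" using assms by simp
  note c = subringE(1)[OF S, THEN subsetD] poly_vals_closed[OF S xy(1)] poly_vals_closed[OF S xy(2)]
  obtain e a where ea: "e \<in> poly_vals S x n" "a \<in> S" "d = e \<oplus> a \<otimes> x [^] Suc n"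
    using poly_vals_top[OF S xy(1) d(1)] by blast
  obtain b d'' where b: "b \<in> S" "d'' \<in> poly_vals S y j" "d' = b \<oplus> y \<otimes> d''"
    using d'(1) Suc by (auto elim: poly_vals_SucE)
  define z where "z = x [^] n \<otimes> d''"
  define u where "u = \<one> \<ominus> \<mu> \<otimes> b"
  define p where "p = x [^] Suc n"
  have z: "z \<in> poly_vals S x n" unfolding z_def
    using poly_vals_reverse[OF S xy(1,2,3) b(2) j] .
  have u: "u \<in> S" unfolding u_def a_minus_def
    using \<mu> b(1) by (intro subringE(3,5-7)[OF S])
  have [simp]: "\<mu> \<in> carrier R" "b \<in> carrier R" "d'' \<in> carrier R" "a \<in> carrier R" "e \<in> carrier R"
    "z \<in> carrier R" "u \<in> carrier R" "p \<in> carrier R" "x \<in> carrier R" "y \<in> carrier R"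
    using c \<mu> b ea z u xy by (auto simp: p_def)
  have "p \<otimes> (\<mu> \<otimes> (y \<otimes> d'')) = (x \<otimes> y) \<otimes> (\<mu> \<otimes> z)"
    unfolding p_def z_def by (simp add: m_ac)
  then have 1: "p \<otimes> (\<mu> \<otimes> (y \<otimes> d'')) = \<mu> \<otimes> z" using xy by simp
  have "\<mu> \<otimes> (y \<otimes> d'') = u"
  proof -
    have "\<mu> \<otimes> b \<oplus> \<mu> \<otimes> (y \<otimes> d'') = \<one>" using d'(2) b(3) by (simp add: r_distr)
    then have "u = (\<mu> \<otimes> b \<oplus> \<mu> \<otimes> (y \<otimes> d'')) \<ominus> \<mu> \<otimes> b" by (simp only: u_def)
    also have "\<dots> = \<mu> \<otimes> (y \<otimes> d'') \<oplus> (\<mu> \<otimes> b \<oplus> \<ominus> (\<mu> \<otimes> b))" by (simp add: minus_eq a_ac)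
    also have "\<dots> = \<mu> \<otimes> (y \<otimes> d'')" by (simp add: r_neg)
    finally show ?thesis by simp
  qed
  then have 2: "p \<otimes> u = \<mu> \<otimes> z" using 1 by simp
  \<comment> \<open>Start from 1 = \<mu> b + u = \<mu> b + u (\<mu> d) and replace the leading part
    u a x^(n+1) of u d by \<mu> a z.\<close>
  have "\<mu> \<otimes> (b \<oplus> (u \<otimes> e \<oplus> \<mu> \<otimes> (a \<otimes> z))) = \<mu> \<otimes> b \<oplus> (u \<otimes> (\<mu> \<otimes> e) \<oplus> (\<mu> \<otimes> a) \<otimes> (p \<otimes> u))"
    unfolding 2 by (simp add: r_distr m_ac)
  also have "\<dots> = \<mu> \<otimes> b \<oplus> u \<otimes> (\<mu> \<otimes> d)"
    unfolding ea(3) p_def[symmetric] by (simp add: r_distr m_ac)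
  also have "\<dots> = \<one>"
    unfolding d(2) u_def by (simp add: minus_eq a_lcomm r_neg)
  finally have "\<mu> \<otimes> (b \<oplus> (u \<otimes> e \<oplus> \<mu> \<otimes> (a \<otimes> z))) = \<one>" .
  moreover have "b \<oplus> (u \<otimes> e \<oplus> \<mu> \<otimes> (a \<otimes> z)) \<in> poly_vals S x n"
    using b(1) u ea \<mu> z poly_vals_add[OF S xy(1)] poly_vals_smult[OF S xy(1)] poly_vals_const[OF S xy(1)] by simp
  ultimately show ?thesis by blast
qed

text \<open>The larger of the two degrees can always be lowered, exchanging \<open>x\<close> and
  \<open>y\<close> if necessary. Once it is 0 the value lies in \<open>S\<close>.\<close>

lemma (in cring) poly_vals_reciprocal:
  assumes S: "subring S R" and "x \<in> carrier R" "y \<in> carrier R" "x \<otimes> y = \<one>" and \<mu>: "\<mu> \<in> S"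
    and "d \<in> poly_vals S x n" "\<mu> \<otimes> d = \<one>" "d' \<in> poly_vals S y k" "\<mu> \<otimes> d' = \<one>"
  shows "\<exists>s \<in> S. \<mu> \<otimes> s = \<one>"
  using assms
proof (induction "n + k" arbitrary: n k x y d d' rule: less_induct)
  case less
  show ?case
  proof (cases "k \<le> n")
    case True
    show ?thesis
    proof (cases n)
      case 0 then show ?thesis using less.prems by auto
    next
      case (Suc m)
      then obtain e where "e \<in> poly_vals S x m" "\<mu> \<otimes> e = \<one>"
        using poly_vals_reduce[OF S less.prems(2-5), of d m d' k] less.prems True by auto
      then show ?thesis using less.hyps[of m k x y e d'] less.prems Suc by auto
    qed
  next
    case False
    then obtain m where m: "k = Suc m" by (cases k) auto
    have yx: "y \<otimes> x = \<one>" using less.prems m_comm by simp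
    obtain e where "e \<in> poly_vals S y m" "\<mu> \<otimes> e = \<one>"
      using poly_vals_reduce[OF S less.prems(3,2) yx \<mu>, of d' m d n] less.prems m False by auto
    then show ?thesis using less.hyps[of m n y x e d] less.prems m yx by auto
  qed
qed

text \<open>Chevalley's extension theorem: a ring that is maximal among those in which no element of
  \<open>M\<close> becomes invertible is a valuation ring. \<open>M\<close> is a set totally ordered
  by divisibility and takes the place of the maximal ideal. If m is invertible in S[x] and m' in
  S[1/x], the one that divides the other is invertible in both, which
  \<open>poly_vals_reciprocal\<close> excludes.\<close>

lemma (in field) ex_valuation_overring:
  assumes S0: "subring S0 R" and M: "M \<subseteq> S0"
    and chain: "\<And>m m'. m \<in> M \<Longrightarrow> m' \<in> M \<Longrightarrow> \<exists>c \<in> S0. m = m' \<otimes> c \<or> m' = m \<otimes> c"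
    and nu: "\<And>m s. m \<in> M \<Longrightarrow> s \<in> S0 \<Longrightarrow> m \<otimes> s \<noteq> \<one>"
  shows "\<exists>S. subring S R \<and> S0 \<subseteq> S \<and> (\<forall>m \<in> M. \<forall>s \<in> S. m \<otimes> s \<noteq> \<one>) \<and>
    (\<forall>x \<in> carrier R. x \<in> S \<or> (\<exists>y \<in> S. x \<otimes> y = \<one>))"
proof -
  let ?A = "{S. subring S R \<and> S0 \<subseteq> S \<and> (\<forall>m \<in> M. \<forall>s \<in> S. m \<otimes> s \<noteq> \<one>)}"
  have "\<exists>S \<in> ?A. \<forall>T \<in> ?A. S \<subseteq> T \<longrightarrow> T = S"
  proof (rule subset_Zorn_nonempty)
    show "?A \<noteq> {}" using assms by auto
  next
    fix C assume "C \<noteq> {}" and ch: "subset.chain ?A C"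
    then have C: "C \<subseteq> ?A" and tot: "\<And>S T. S \<in> C \<Longrightarrow> T \<in> C \<Longrightarrow> S \<subseteq> T \<or> T \<subseteq> S"
      by (auto simp: subset_chain_def)
    obtain T where T: "T \<in> C" using \<open>C \<noteq> {}\<close> by blast
    have sub: "subring S R" if "S \<in> C" for S using C that by blast
    have two: "\<exists>S \<in> C. h \<in> S \<and> k \<in> S" if "h \<in> \<Union>C" "k \<in> \<Union>C" for h k
      using that tot by blast
    have "subring (\<Union>C) R"
    proof (rule subringI)
      show "\<Union>C \<subseteq> carrier R" using sub subringE(1) by blast
      show "\<one> \<in> \<Union>C" using subringE(3)[OF sub[OF T]] T by blast
    next
      fix h assume "h \<in> \<Union>C"
      then obtain S where "S \<in> C" "h \<in> S" by blast
      then show "\<ominus> h \<in> \<Union>C" using subringE(5)[OF sub[of S], of h] by blast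
    next
      fix h k assume "h \<in> \<Union>C" "k \<in> \<Union>C"
      then obtain S where "S \<in> C" "h \<in> S" "k \<in> S" using two by blast
      then show "h \<otimes> k \<in> \<Union>C" "h \<oplus> k \<in> \<Union>C" using subringE(6,7)[OF sub[of S], of h k] by blast+
    qed
    then show "\<Union>C \<in> ?A" using C T by blast
  qed
  then obtain S where "S \<in> ?A" and max: "\<forall>T \<in> ?A. S \<subseteq> T \<longrightarrow> T = S" by blast
  then have S: "subring S R" "S0 \<subseteq> S" and nS: "\<And>m s. m \<in> M \<Longrightarrow> s \<in> S \<Longrightarrow> m \<otimes> s \<noteq> \<one>" by auto
  \<comment> \<open>Maximality: adjoining an element outside \<open>S\<close> must make some element
    of \<open>M\<close> invertible.\<close>
  have ext: "\<exists>m \<in> M. \<exists>n. \<exists>d \<in> poly_vals S x n. m \<otimes> d = \<one>" if x: "x \<in> carrier R" "x \<notin> S" for x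
  proof (rule ccontr)
    assume "\<not> ?thesis"
    then have "(\<Union>n. poly_vals S x n) \<in> ?A"
      using subring_poly_vals[OF S(1) x(1)] poly_vals_sub(1)[OF S(1) x(1)] S(2) by blast
    then have "(\<Union>n. poly_vals S x n) = S" using max poly_vals_sub(1)[OF S(1) x(1)] by blast
    then show False using x poly_vals_sub(2)[OF S(1) x(1)] by blast
  qed
  have "x \<in> S \<or> (\<exists>y \<in> S. x \<otimes> y = \<one>)" if x: "x \<in> carrier R" for x
  proof (rule ccontr)
    assume no: "\<not> ?thesis"
    then have "x \<noteq> \<zero>" using subringE(2)[OF S(1)] by auto
    then have "x \<in> Units R" using field_Units x by simp
    then have y: "inv x \<in> carrier R" "x \<otimes> inv x = \<one>" by auto
    then have "inv x \<notin> S" using no by blast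
    from ext[OF y(1) this] obtain m' k d' where m': "m' \<in> M" "d' \<in> poly_vals S (inv x) k" "m' \<otimes> d' = \<one>"
      by blast
    from ext[OF x] no obtain m n d where m: "m \<in> M" "d \<in> poly_vals S x n" "m \<otimes> d = \<one>" by blast
    obtain c where c: "c \<in> S0" "m = m' \<otimes> c \<or> m' = m \<otimes> c" using chain[OF m(1) m'(1)] by blast
    have "c \<in> S" "m \<in> S" "m' \<in> S" using c S m m' M by auto
    have cl: "c \<in> carrier R" "m \<in> carrier R" "m' \<in> carrier R" "d \<in> carrier R" "d' \<in> carrier R"
      using \<open>c \<in> S\<close> \<open>m \<in> S\<close> \<open>m' \<in> S\<close> subringE(1)[OF S(1)] poly_vals_closed[OF S(1) x m(2)]
        poly_vals_closed[OF S(1) y(1) m'(2)] by auto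
    have "\<exists>\<mu> \<in> M. (\<exists>d \<in> poly_vals S x n. \<mu> \<otimes> d = \<one>) \<and> (\<exists>d' \<in> poly_vals S (inv x) k. \<mu> \<otimes> d' = \<one>)"
      using c(2)
    proof
      assume "m = m' \<otimes> c"
      then have "m' \<otimes> (c \<otimes> d) = \<one>" using m cl by (simp add: m_assoc)
      then show ?thesis using m' poly_vals_smult[OF S(1) x \<open>c \<in> S\<close> m(2)] by blast
    next
      assume "m' = m \<otimes> c"
      then have "m \<otimes> (c \<otimes> d') = \<one>" using m' cl by (simp add: m_assoc)
      then show ?thesis using m poly_vals_smult[OF S(1) y(1) \<open>c \<in> S\<close> m'(2)] by blast
    qed
    then obtain \<mu> e e' where \<mu>: "\<mu> \<in> M" and e: "e \<in> poly_vals S x n" "\<mu> \<otimes> e = \<one>"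
      and e': "e' \<in> poly_vals S (inv x) k" "\<mu> \<otimes> e' = \<one>" by blast
    have "\<mu> \<in> S" using \<mu> S M by auto
    from poly_vals_reciprocal[OF S(1) x y this e e'] nS \<mu> show False by blast
  qed
  then show ?thesis using S nS by blast
qed

section \<open>Arithmetic of valuation subrings of a field\<close>

definition nonunits :: "('a, 'm) ring_scheme \<Rightarrow> 'a set \<Rightarrow> 'a set" where
  "nonunits R S = {s \<in> S. \<forall>t \<in> S. s \<otimes>\<^bsub>R\<^esub> t \<noteq> \<one>\<^bsub>R\<^esub>}"

locale valuation_subring = field R for R (structure) +
  fixes S
  assumes S: "subring S R"
    and val: "x \<in> carrier R \<Longrightarrow> x \<in> S \<or> (\<exists>y \<in> S. x \<otimes> y = \<one>)"
begin

lemma S_closed [simp]: "s \<in> S \<Longrightarrow> s \<in> carrier R"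
  using subringE(1)[OF S] by auto

lemma dvd_total:
  assumes "a \<in> carrier R" "b \<in> carrier R"
  shows "(\<exists>s \<in> S. a = s \<otimes> b) \<or> (\<exists>s \<in> S. b = s \<otimes> a)"
proof (cases "b = \<zero>")
  case True
  then show ?thesis using subringE(2)[OF S] assms by (intro disjI2 bexI[of _ \<zero>]) auto
next
  case False
  then have b: "b \<in> Units R" using assms field_Units by simp
  then have "a \<otimes> inv b \<in> carrier R" using assms by simp
  then consider "a \<otimes> inv b \<in> S" | y where "y \<in> S" "a \<otimes> inv b \<otimes> y = \<one>" using val by blast
  then show ?thesis
  proof cases
    case 1
    have "a = a \<otimes> inv b \<otimes> b" using assms b by (simp add: m_assoc)
    then show ?thesis using 1 by blast
  next
    case 2
    have "a \<otimes> inv b \<otimes> y \<otimes> b = y \<otimes> a \<otimes> (inv b \<otimes> b)"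
      using assms b 2(1) S_closed by (simp only: m_ac Units_inv_closed m_closed)
    then have "y \<otimes> a = a \<otimes> inv b \<otimes> y \<otimes> b" using assms b 2(1) by simp
    then have "b = y \<otimes> a" using 2 assms by simp
    then show ?thesis using 2 by blast
  qed
qed

lemma nonunits_mult:
  assumes "s \<in> nonunits R S" "t \<in> S"
  shows "s \<otimes> t \<in> nonunits R S" "t \<otimes> s \<in> nonunits R S"
proof -
  have s: "s \<in> S" using assms by (simp add: nonunits_def)
  have "s \<otimes> t \<otimes> r \<noteq> \<one>" if "r \<in> S" for r
  proof -
    have "s \<otimes> (t \<otimes> r) \<noteq> \<one>" using assms that subringE(6)[OF S] by (auto simp: nonunits_def)
    then show ?thesis using s assms that by (simp add: m_assoc)
  qed
  then show "s \<otimes> t \<in> nonunits R S" using s assms subringE(6)[OF S] by (auto simp: nonunits_def)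
  then show "t \<otimes> s \<in> nonunits R S" using s assms by (simp add: m_comm)
qed

lemma zero_nonunit: "\<zero> \<in> nonunits R S"
  using subringE(2)[OF S] by (auto simp: nonunits_def)

lemma nonunits_add:
  assumes "s \<in> nonunits R S" "t \<in> nonunits R S"
  shows "s \<oplus> t \<in> nonunits R S"
proof -
  have st: "s \<in> S" "t \<in> S" using assms by (auto simp: nonunits_def)
  then consider c where "c \<in> S" "s = c \<otimes> t" | c where "c \<in> S" "t = c \<otimes> s"
    using dvd_total[of s t] by auto
  then show ?thesis
  proof cases
    case 1
    then have "s \<oplus> t = t \<otimes> (c \<oplus> \<one>)" using st by (simp add: r_distr m_comm)
    moreover have "c \<oplus> \<one> \<in> S" using 1 subringE[OF S] by blast
    ultimately show ?thesis using nonunits_mult(1)[OF assms(2)] by simp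
  next
    case 2
    then have "s \<oplus> t = s \<otimes> (\<one> \<oplus> c)" using st by (simp add: r_distr m_comm)
    moreover have "\<one> \<oplus> c \<in> S" using 2 subringE[OF S] by blast
    ultimately show ?thesis using nonunits_mult(1)[OF assms(1)] by simp
  qed
qed

lemma nonunits_prime:
  assumes "s \<in> S" "t \<in> S" "s \<otimes> t \<in> nonunits R S"
  shows "s \<in> nonunits R S \<or> t \<in> nonunits R S"
proof (rule ccontr)
  assume "\<not> ?thesis"
  then obtain s' t' where 1: "s' \<in> S" "t' \<in> S" "s \<otimes> s' = \<one>" "t \<otimes> t' = \<one>"
    using assms by (auto simp: nonunits_def)
  have "s \<otimes> t \<otimes> (s' \<otimes> t') = (s \<otimes> s') \<otimes> (t \<otimes> t')" using assms(1,2) 1(1,2) by (simp add: m_ac)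
  then have "s \<otimes> t \<otimes> (s' \<otimes> t') = \<one>" using 1 by simp
  then show False using assms(3) 1 subringE(6)[OF S] by (auto simp: nonunits_def)
qed

lemma one_not_nonunit: "\<one> \<notin> nonunits R S"
  using subringE(3)[OF S] by (auto simp: nonunits_def)

text \<open>If a single summand had the smallest valuation, dividing by it would turn the sum into 1
  + s with s a nonunit, and this is not zero. So the smallest valuation is attained twice, and two
  summands of equal valuation differ by a unit of \<open>S\<close>.\<close>

lemma zero_sum_associates:
  assumes "finite A" "f \<in> A \<rightarrow> carrier R" "finsum R f A = \<zero>" "\<exists>a \<in> A. f a \<noteq> \<zero>"
  shows "\<exists>a \<in> A. \<exists>b \<in> A. a \<noteq> b \<and> f a \<noteq> \<zero> \<and> f b \<noteq> \<zero> \<and> (\<exists>u \<in> S - nonunits R S. f a = u \<otimes> f b)"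
proof -
  have min: "\<exists>a \<in> B. \<forall>b \<in> B. \<exists>s \<in> S. f b = s \<otimes> f a" if "finite B" "B \<noteq> {}" "B \<subseteq> A" for B
    using that
  proof (induction B rule: finite_ne_induct)
    case (singleton x)
    then show ?case using assms(2) subringE(3)[OF S] by (intro bexI[of _ x]) (auto intro!: bexI[of _ \<one>] simp: Pi_iff)
  next
    case (insert x B)
    then obtain a where a: "a \<in> B" "\<forall>b \<in> B. \<exists>s \<in> S. f b = s \<otimes> f a" by blast
    have c: "f a \<in> carrier R" "f x \<in> carrier R" using a insert.prems assms(2) by auto
    have o: "\<exists>s \<in> S. f x = s \<otimes> f x" using c subringE(3)[OF S] by (intro bexI[of _ \<one>]) auto
    from dvd_total[OF c] show ?case
    proof
      assume "\<exists>s \<in> S. f a = s \<otimes> f x"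
      then obtain s where s: "s \<in> S" "f a = s \<otimes> f x" by blast
      have "\<exists>r \<in> S. f b = r \<otimes> f x" if b: "b \<in> B" for b
      proof -
        obtain r where "r \<in> S" "f b = r \<otimes> f a" using a b by blast
        then have "f b = (r \<otimes> s) \<otimes> f x" using s c by (simp add: m_assoc)
        then show ?thesis using \<open>r \<in> S\<close> s subringE(6)[OF S] by blast
      qed
      then show ?thesis using o by blast
    next
      assume "\<exists>s \<in> S. f x = s \<otimes> f a"
      then show ?thesis using a by blast
    qed
  qed
  let ?A = "{a \<in> A. f a \<noteq> \<zero>}"
  obtain a where a: "a \<in> ?A" "\<forall>b \<in> ?A. \<exists>s \<in> S. f b = s \<otimes> f a"
    using min[of ?A] assms by auto
  have fa: "f a \<in> carrier R" "f a \<noteq> \<zero>" "a \<in> A" using a assms(2) by auto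
  show ?thesis
  proof (rule ccontr)
    assume no: "\<not> ?thesis"
    have nu: "\<exists>s \<in> nonunits R S. f b = s \<otimes> f a" if b: "b \<in> A - {a}" for b
    proof (cases "f b = \<zero>")
      case True
      then show ?thesis using zero_nonunit fa by (intro bexI[of _ \<zero>]) auto
    next
      case False
      then obtain s where s: "s \<in> S" "f b = s \<otimes> f a" using a b by blast
      have "s \<in> nonunits R S" using no b fa False s by blast
      then show ?thesis using s by blast
    qed
    have "\<exists>s \<in> nonunits R S. finsum R f B = s \<otimes> f a" if "finite B" "B \<subseteq> A - {a}" for B
      using that
    proof (induction B)
      case empty
      then show ?case using zero_nonunit fa by (intro bexI[of _ \<zero>]) auto
    next
      case (insert b B)
      obtain s where s: "s \<in> nonunits R S" "finsum R f B = s \<otimes> f a" using insert by blast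
      obtain t where t: "t \<in> nonunits R S" "f b = t \<otimes> f a" using nu insert.prems by blast
      have "finsum R f (insert b B) = f b \<oplus> finsum R f B"
        using insert assms(2) by (intro finsum_insert) auto
      also have "\<dots> = (t \<oplus> s) \<otimes> f a"
        using s t fa by (simp add: l_distr nonunits_def)
      finally show ?case using nonunits_add[OF t(1) s(1)] by blast
    qed
    then obtain s where s: "s \<in> nonunits R S" "finsum R f (A - {a}) = s \<otimes> f a" using assms(1) by blast
    have "finsum R f (insert a (A - {a})) = f a \<oplus> finsum R f (A - {a})"
      using assms(1,2) fa by (intro finsum_insert) auto
    then have "f a \<oplus> s \<otimes> f a = \<zero>" using s assms(3) fa by (simp add: insert_absorb)
    then have "(\<one> \<oplus> s) \<otimes> f a = \<zero>" using fa s by (simp add: l_distr nonunits_def)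
    then have "\<one> \<oplus> s = \<zero>" using fa s integral[of "\<one> \<oplus> s" "f a"] by (auto simp: nonunits_def)
    then have "\<ominus> \<one> = s" using s minus_equality[of s \<one>] by (simp add: a_comm nonunits_def)
    moreover have "(\<ominus> \<one>) \<otimes> (\<ominus> \<one>) = \<one>" by (simp add: l_minus)
    ultimately have "s \<otimes> (\<ominus> \<one>) = \<one>" by simp
    then show False using s subringE(3,5)[OF S] by (auto simp: nonunits_def)
  qed
qed

end

section \<open>Finitely generated ideals and Nakayama's lemma\<close>

text \<open>\<open>N\<close> is carried along as the set of starting values, so that linear algebra
  modulo \<open>N\<close> takes place without a quotient ring. The induction rule adds one generator
  at a time.\<close>

inductive_set (in ring) span_mod :: "'a set \<Rightarrow> 'a set \<Rightarrow> 'a set \<Rightarrow> 'a set" for S N G where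
  span_mod_base: "n \<in> N \<Longrightarrow> n \<in> span_mod S N G"
| span_mod_step: "s \<in> S \<Longrightarrow> g \<in> G \<Longrightarrow> d \<in> span_mod S N G \<Longrightarrow> s \<otimes> g \<oplus> d \<in> span_mod S N G"

text \<open>For a subring \<open>S\<close> and an ideal \<open>N\<close> this says that the image of
  \<open>S\<close> modulo \<open>N\<close> is noetherian. It is phrased for arbitrary subsets, from
  which the generators are taken, and not for ideals.\<close>

definition (in ring) noetherian_mod :: "'a set \<Rightarrow> 'a set \<Rightarrow> bool" where
  "noetherian_mod N S \<longleftrightarrow> (\<forall>A \<subseteq> S. \<exists>G \<subseteq> A. finite G \<and> A \<subseteq> span_mod S N G)"

context cring
begin

lemma span_mod_mono:
  assumes "G \<subseteq> H" "d \<in> span_mod S N G" shows "d \<in> span_mod S N H"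
  using assms(2,1) by (induction rule: span_mod.induct) (auto intro: span_mod.intros)

context
  fixes S N
  assumes S: "subring S R" and N: "ideal N R"
begin

lemma span_mod_closed:
  assumes "G \<subseteq> carrier R" "d \<in> span_mod S N G" shows "d \<in> carrier R"
  using assms(2)
proof (induction rule: span_mod.induct)
  case (span_mod_base n) then show ?case using ideal.Icarr[OF N] by blast
next
  case (span_mod_step s g d) then show ?case using subringE(1)[OF S] assms(1) by auto
qed

lemma span_mod_add:
  assumes G: "G \<subseteq> carrier R" and "d \<in> span_mod S N G" and e: "e \<in> span_mod S N G"
  shows "d \<oplus> e \<in> span_mod S N G"
  using assms(2)
proof (induction rule: span_mod.induct)
  case (span_mod_base n)
  show ?case using e
  proof (induction rule: span_mod.induct)
    case (span_mod_base m)
    then show ?case using \<open>n \<in> N\<close> additive_subgroup.a_closed[OF ideal.axioms(1)[OF N]]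
      by (auto intro: span_mod.intros)
  next
    case (span_mod_step s g d)
    have "s \<in> carrier R" "g \<in> carrier R" "d \<in> carrier R" "n \<in> carrier R"
      using span_mod_step subringE(1)[OF S] G span_mod_closed[OF G] \<open>n \<in> N\<close> ideal.Icarr[OF N] by auto
    then have "n \<oplus> (s \<otimes> g \<oplus> d) = s \<otimes> g \<oplus> (n \<oplus> d)" by (simp add: a_lcomm)
    then show ?case using span_mod_step by (auto intro: span_mod.intros)
  qed
next
  case (span_mod_step s g d)
  have "s \<in> carrier R" "g \<in> carrier R" "d \<in> carrier R" "e \<in> carrier R"
    using span_mod_step subringE(1)[OF S] G span_mod_closed[OF G] e by auto
  then have "s \<otimes> g \<oplus> d \<oplus> e = s \<otimes> g \<oplus> (d \<oplus> e)" by (simp add: a_assoc)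
  then show ?case using span_mod_step by (auto intro: span_mod.intros)
qed

lemma span_mod_smult:
  assumes G: "G \<subseteq> carrier R" and t: "t \<in> S" and "d \<in> span_mod S N G"
  shows "t \<otimes> d \<in> span_mod S N G"
  using assms(3)
proof (induction rule: span_mod.induct)
  case (span_mod_base n)
  then have "t \<otimes> n \<in> N" using ideal.I_l_closed[OF N] t subringE(1)[OF S] by auto
  then show ?case by (auto intro: span_mod.intros)
next
  case (span_mod_step s g d)
  have "t \<in> carrier R" "s \<in> carrier R" "g \<in> carrier R" "d \<in> carrier R"
    using span_mod_step subringE(1)[OF S] G span_mod_closed[OF G] t by auto
  then have "t \<otimes> (s \<otimes> g \<oplus> d) = (t \<otimes> s) \<otimes> g \<oplus> t \<otimes> d" by (simp add: r_distr m_assoc)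
  moreover have "t \<otimes> s \<in> S" using subringE(6)[OF S] t span_mod_step by auto
  ultimately show ?case using span_mod_step by (auto intro: span_mod.intros)
qed

lemma span_mod_zero: "\<zero> \<in> span_mod S N G"
  using additive_subgroup.zero_closed[OF ideal.axioms(1)[OF N]] by (auto intro: span_mod.intros)

lemma span_mod_gen:
  assumes "G \<subseteq> carrier R" "g \<in> G" shows "g \<in> span_mod S N G"
  using span_mod_step[of \<one> S g G \<zero> N] assms subringE(3)[OF S] span_mod_zero by auto

lemma span_mod_trans:
  assumes "H \<subseteq> carrier R" "G \<subseteq> span_mod S N H" "d \<in> span_mod S N G"
  shows "d \<in> span_mod S N H"
  using assms(3)
proof (induction rule: span_mod.induct)
  case (span_mod_step s g d)
  then show ?case using span_mod_add[OF assms(1)] span_mod_smult[OF assms(1)] assms(2) by blast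
qed (auto intro: span_mod.intros)

lemma span_mod_finite:
  assumes "d \<in> span_mod S N G"
  shows "\<exists>F \<subseteq> G. finite F \<and> d \<in> span_mod S N F"
  using assms
proof (induction rule: span_mod.induct)
  case (span_mod_base n)
  then show ?case by (intro exI[of _ "{}"]) (auto intro: span_mod.intros)
next
  case (span_mod_step s g d)
  then obtain F where "F \<subseteq> G" "finite F" "d \<in> span_mod S N F" by blast
  then show ?case using span_mod_step span_mod_mono[of F "insert g F" d S N]
    by (intro exI[of _ "insert g F"]) (auto intro: span_mod.intros)
qed

lemma span_mod_finite_set:
  assumes "finite D" "D \<subseteq> span_mod S N G"
  shows "\<exists>F \<subseteq> G. finite F \<and> D \<subseteq> span_mod S N F"
  using assms
proof (induction D)
  case (insert d D)
  then obtain F where F: "F \<subseteq> G" "finite F" "D \<subseteq> span_mod S N F" by auto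
  obtain F' where F': "F' \<subseteq> G" "finite F'" "d \<in> span_mod S N F'" using span_mod_finite[of d G] insert.prems by blast
  show ?case
    using F F' span_mod_mono[of F "F \<union> F'"] span_mod_mono[of F' "F \<union> F'"]
    by (intro exI[of _ "F \<union> F'"]) blast
qed auto

end

text \<open>Hilbert's basis theorem: a set \<open>A\<close> that is not finitely generated yields a sequence \<open>g\<close> of
  elements of minimal degree outside the span of their predecessors, and a relation between their
  leading coefficients lowers the degree.\<close>

lemma noetherian_mod_adjoin:
  assumes S: "subring S R" and N: "ideal N R" and y: "y \<in> carrier R" and noeth: "noetherian_mod N S"
  shows "noetherian_mod N (\<Union>n. poly_vals S y n)"
  unfolding noetherian_mod_def
proof (intro allI impI, rule ccontr)
  define T where "T = (\<Union>n. poly_vals S y n)"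
  fix A assume A: "A \<subseteq> (\<Union>n. poly_vals S y n)"
    and contra: "\<not> (\<exists>G \<subseteq> A. finite G \<and> A \<subseteq> span_mod (\<Union>n. poly_vals S y n) N G)"
  have T: "subring T R" unfolding T_def by (rule subring_poly_vals[OF S y])
  note Tc = subringE(1)[OF T, THEN subsetD]
  have Ac: "A \<subseteq> carrier R" using A Tc T_def by blast
  \<comment> \<open>Differences that lower the degree leave \<open>A\<close>, hence the passage to
    the ideal of \<open>T\<close> generated by it. The intersection with \<open>T\<close> is taken
    because \<open>N\<close> is an ideal of the whole ring and degrees make sense in
    \<open>T\<close> only.\<close>
  define J where "J = span_mod T N A \<inter> T"
  have ex: "\<exists>g. g \<in> J \<and> g \<notin> span_mod T N G" if G: "finite G" "G \<subseteq> J" for G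
  proof (rule ccontr)
    assume no: "\<not> ?thesis"
    obtain F where F: "F \<subseteq> A" "finite F" "G \<subseteq> span_mod T N F"
      using span_mod_finite_set[OF T N G(1), of A] G(2) J_def by blast
    have "A \<subseteq> span_mod T N G" using no A span_mod_gen[OF T N Ac] unfolding J_def T_def by blast
    then have "A \<subseteq> span_mod T N F" using span_mod_trans[OF T N _ F(3)] F(1) Ac by blast
    then show False using contra F T_def by blast
  qed
  define dg where "dg g = (LEAST n. g \<in> poly_vals S y n)" for g
  have dg: "g \<in> poly_vals S y (dg g)" if g: "g \<in> T" for g
    unfolding dg_def using g T_def by (auto intro: LeastI)
  have dg_le: "g \<in> poly_vals S y n \<Longrightarrow> dg g \<le> n" for g n
    unfolding dg_def by (rule Least_le)
  define pick where "pick G = (ARG_MIN dg g. g \<in> J \<and> g \<notin> span_mod T N G)" for G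
  have pick: "pick G \<in> J" "pick G \<notin> span_mod T N G"
    and pick_le: "\<And>g. g \<in> J \<Longrightarrow> g \<notin> span_mod T N G \<Longrightarrow> dg (pick G) \<le> dg g"
    if G: "finite G" "G \<subseteq> J" for G
  proof -
    obtain g where "g \<in> J \<and> g \<notin> span_mod T N G" using ex[OF G] by blast
    then show "pick G \<in> J" "pick G \<notin> span_mod T N G"
      unfolding pick_def using arg_min_natI[of "\<lambda>g. g \<in> J \<and> g \<notin> span_mod T N G" g dg] by auto
    show "dg (pick G) \<le> dg g" if "g \<in> J" "g \<notin> span_mod T N G" for g
      unfolding pick_def using that by (intro arg_min_nat_le) auto
  qed
  define l where "l = rec_nat [] (\<lambda>_ xs. xs @ [pick (set xs)])"
  have l_Suc: "l (Suc k) = l k @ [pick (set (l k))]" and l_0: "l 0 = []" for k by (simp_all add: l_def)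
  define g where "g k = pick (set (l k))" for k
  have l_set: "set (l k) = g ` {..<k}" for k
    by (induction k) (auto simp: l_0 l_Suc g_def lessThan_Suc)
  have gJ: "set (l k) \<subseteq> J" for k
    by (induction k) (use pick(1) in \<open>auto simp: l_0 l_Suc\<close>)
  have g: "g k \<in> J" "g k \<notin> span_mod T N (g ` {..<k})" for k
    using pick(1,2)[OF _ gJ[of k]] unfolding g_def l_set[symmetric] by auto
  have g_le: "dg (g k) \<le> dg h" if "h \<in> J" "h \<notin> span_mod T N (g ` {..<k})" for h k
    using pick_le[OF _ gJ[of k], of h] that unfolding g_def l_set[symmetric] by auto
  have gT: "g k \<in> T" for k using g(1) J_def by blast
  have gc: "g ` {..<k} \<subseteq> carrier R" for k using gT Tc by blast
  have dg_mono: "dg (g i) \<le> dg (g k)" if "i \<le> k" for i k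
  proof (rule g_le)
    show "g k \<in> J" by (rule g)
    show "g k \<notin> span_mod T N (g ` {..<i})"
      using g(2)[of k] span_mod_mono[of "g ` {..<i}" "g ` {..<k}"] that by (meson image_mono lessThan_subset_iff)
  qed
  \<comment> \<open>Elements of degree below \<open>n\<close>. Below degree 0 there is only zero,
    which makes the final difference \<open>w\<close> vanish in the case where \<open>g k\<close> is
    a constant.\<close>
  define low where "low n = (case n of 0 \<Rightarrow> {\<zero>} | Suc m \<Rightarrow> poly_vals S y m)" for n
  have low_add: "d \<oplus> e \<in> low n" if "d \<in> low n" "e \<in> low n" for d e n
    using that poly_vals_add[OF S y] by (auto simp: low_def split: nat.splits)
  have low_smult: "s \<otimes> d \<in> low n" if "s \<in> S" "d \<in> low n" for s d n
    using that poly_vals_smult[OF S y] subringE(1)[OF S] by (auto simp: low_def split: nat.splits)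
  have low_0: "\<zero> \<in> low n" for n
    using zero_in_poly_vals[OF S y] by (auto simp: low_def split: nat.splits)
  have low_c: "low n \<subseteq> carrier R" for n
    using poly_vals_closed[OF S y] by (auto simp: low_def split: nat.splits)
  have low_pow: "y [^] j \<otimes> d \<in> low (j + n)" if "d \<in> low n" for d n j
  proof (cases n)
    case 0
    then show ?thesis using that low_0 y by (auto simp: low_def)
  next
    case (Suc m)
    have "\<one> \<otimes> y [^] j \<in> poly_vals S y j" by (rule poly_vals_pow[OF S y subringE(3)[OF S]])
    then show ?thesis
      using that Suc y poly_vals_mult[OF S y, of "y [^] j" j d m] by (simp add: low_def)
  qed
  have "\<exists>e \<in> low (dg (g k)). \<exists>a \<in> S. g k = e \<oplus> a \<otimes> y [^] dg (g k)" for k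
  proof (cases "dg (g k)")
    case 0
    then have "g k \<in> S" using dg[OF gT[of k]] by simp
    then show ?thesis using 0 subringE(1)[OF S] by (auto simp: low_def intro!: bexI[of _ "g k"])
  next
    case (Suc m)
    then show ?thesis using poly_vals_top[OF S y, of "g k" m] dg[OF gT[of k]] by (auto simp: low_def)
  qed
  then obtain e a where e: "\<And>k. e k \<in> low (dg (g k))" and a: "\<And>k. a k \<in> S"
    and ga: "\<And>k. g k = e k \<oplus> a k \<otimes> y [^] dg (g k)" by metis
  have ac: "a k \<in> carrier R" and ec: "e k \<in> carrier R" and gkc: "g k \<in> carrier R" for k
    using a subringE(1)[OF S] e low_c gT Tc by blast+
  have "range a \<subseteq> S" using a by blast
  then obtain G where G: "G \<subseteq> range a" "finite G" "range a \<subseteq> span_mod S N G"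
    using noeth unfolding noetherian_mod_def by meson
  obtain I where I: "finite I" "G = a ` I" using finite_subset_image[OF G(2,1)] by blast
  then obtain k where "I \<subseteq> {..<k}" using finite_nat_bounded by blast
  then have ak: "a k \<in> span_mod S N (a ` {..<k})"
    using span_mod_mono[of G "a ` {..<k}"] G(3) I by blast
  \<comment> \<open>Lifts a relation between leading coefficients to one between the
    \<open>g i\<close>: a power of \<open>y\<close> brings \<open>g i\<close> to the degree of
    \<open>g k\<close>, which is not smaller by \<open>dg_mono\<close>.\<close>
  have lift: "\<exists>h \<in> span_mod T N (g ` {..<k}). \<exists>l \<in> low (dg (g k)). h = l \<oplus> c \<otimes> y [^] dg (g k)"
    if "c \<in> span_mod S N (a ` {..<k})" for c
    using that
  proof (induction rule: span_mod.induct)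
    case (span_mod_base n)
    then have "n \<otimes> y [^] dg (g k) \<in> N" using ideal.I_r_closed[OF N] y by blast
    then show ?case
      using low_0 y ideal.Icarr[OF N span_mod_base]
      by (intro bexI[of _ "n \<otimes> y [^] dg (g k)"] bexI[of _ \<zero>]) (auto intro: span_mod.intros)
  next
    case (span_mod_step s b d)
    then obtain i where i: "i < k" "b = a i" by blast
    obtain h l where h: "h \<in> span_mod T N (g ` {..<k})" "l \<in> low (dg (g k))" "h = l \<oplus> d \<otimes> y [^] dg (g k)"
      using span_mod_step by blast
    define j where "j = dg (g k) - dg (g i)"
    have j: "dg (g k) = j + dg (g i)" using dg_mono[of i k] i by (simp add: j_def)
    have dc: "d \<in> carrier R" using span_mod_closed[OF S N _ span_mod_step(3)] ac by blast
    have sc: "s \<in> carrier R" using span_mod_step(1) subringE(1)[OF S] by blast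
    have lc: "l \<in> carrier R" using h(2) low_c by blast
    have "s \<otimes> y [^] j \<in> T" unfolding T_def using poly_vals_pow[OF S y span_mod_step(1)] by blast
    then have 1: "(s \<otimes> y [^] j) \<otimes> g i \<oplus> h \<in> span_mod T N (g ` {..<k})"
      using h(1) i by (auto intro: span_mod.intros)
    have 2: "s \<otimes> (y [^] j \<otimes> e i) \<oplus> l \<in> low (dg (g k))"
      using low_add low_smult[OF span_mod_step(1)] low_pow[OF e[of i], of j] h(2) j by simp
    have "(s \<otimes> y [^] j) \<otimes> (e i \<oplus> a i \<otimes> y [^] dg (g i)) \<oplus> (l \<oplus> d \<otimes> y [^] dg (g k))
        = (s \<otimes> (y [^] j \<otimes> e i) \<oplus> l) \<oplus> (s \<otimes> a i \<oplus> d) \<otimes> y [^] dg (g k)"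
      unfolding j using sc dc lc ac[of i] ec[of i] y
      by (simp add: nat_pow_mult[symmetric] l_distr r_distr m_ac a_ac)
    then have "(s \<otimes> y [^] j) \<otimes> g i \<oplus> h
        = (s \<otimes> (y [^] j \<otimes> e i) \<oplus> l) \<oplus> (s \<otimes> b \<oplus> d) \<otimes> y [^] dg (g k)"
      unfolding h(3) i(2) ga[symmetric] .
    then show ?case using 1 2 by blast
  qed
  obtain h l where h: "h \<in> span_mod T N (g ` {..<k})" "l \<in> low (dg (g k))" "h = l \<oplus> a k \<otimes> y [^] dg (g k)"
    using lift[OF ak] by blast
  have hc: "h \<in> carrier R" using span_mod_closed[OF T N gc h(1)] .
  have lc: "l \<in> carrier R" using h(2) low_c by blast
  \<comment> \<open>\<open>w\<close> is \<open>g k\<close> minus an element of the span of its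
    predecessors. It lies outside that span as \<open>g k\<close> does, but has smaller degree,
    against the choice of \<open>g k\<close>.\<close>
  define w where "w = e k \<oplus> \<ominus> \<one> \<otimes> l"
  have w: "w \<in> low (dg (g k))"
    unfolding w_def using low_add[OF e low_smult[OF _ h(2)]] subringE(3,5)[OF S] by blast
  have wc: "w \<in> carrier R" using w low_c by blast
  have gw: "g k = w \<oplus> h"
  proof -
    have "w \<oplus> h = e k \<oplus> (l \<oplus> \<ominus> l) \<oplus> a k \<otimes> y [^] dg (g k)"
      unfolding w_def h(3) using ec lc ac y by (simp add: l_minus a_ac)
    then show ?thesis using ga[of k] lc ec by (simp add: r_neg)
  qed
  have wn: "w \<notin> span_mod T N (g ` {..<k})"
    using g(2)[of k] gw span_mod_add[OF T N gc _ h(1)] by metis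
  show False
  proof (cases "dg (g k)")
    case 0
    then show False using w wn span_mod_zero[OF T N] by (simp add: low_def)
  next
    case (Suc m)
    then have wm: "w \<in> poly_vals S y m" using w by (simp add: low_def)
    then have wT: "w \<in> T" unfolding T_def by blast
    have "w = g k \<oplus> \<ominus> \<one> \<otimes> h" unfolding gw using wc hc by (simp add: l_minus a_assoc r_neg)
    moreover have "g k \<in> span_mod T N A" using g(1) J_def by blast
    moreover have "h \<in> span_mod T N A"
      using span_mod_trans[OF T N Ac _ h(1)] g(1) unfolding J_def by blast
    ultimately have "w \<in> span_mod T N A"
      using span_mod_add[OF T N Ac] span_mod_smult[OF T N Ac] subringE(3,5)[OF T] by metis
    then have "w \<in> J" using wT J_def by blast
    then have "dg (g k) \<le> dg w" using g_le wn by blast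
    then show False using dg_le[OF wm] Suc by simp
  qed
qed

lemma noetherian_mod_adjoin_list:
  assumes "subring S R" "ideal N R" "set ys \<subseteq> carrier R" "noetherian_mod N S"
  shows "\<exists>T. subring T R \<and> S \<union> set ys \<subseteq> T \<and> noetherian_mod N T"
  using assms(3)
proof (induction ys)
  case Nil then show ?case using assms by auto
next
  case (Cons y ys)
  then obtain T where T: "subring T R" "S \<union> set ys \<subseteq> T" "noetherian_mod N T" and y: "y \<in> carrier R" by auto
  show ?case
    using subring_poly_vals[OF T(1) y] poly_vals_sub[OF T(1) y] noetherian_mod_adjoin[OF T(1) assms(2) y T(3)] T(2)
    by (intro exI[of _ "\<Union>n. poly_vals T y n"]) auto
qed

text \<open>Modulo \<open>N\<close> every element of \<open>S\<close> is zero or invertible, so a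
  set not contained in \<open>N\<close> is generated by any one of its invertible elements.\<close>

lemma noetherian_mod_base:
  assumes S: "subring S R" and N: "ideal N R" and inv: "\<And>s. s \<in> S \<Longrightarrow> s \<in> N \<or> (\<exists>t \<in> S. s \<otimes> t = \<one>)"
  shows "noetherian_mod N S"
  unfolding noetherian_mod_def
proof (intro allI impI)
  fix A assume A: "A \<subseteq> S"
  show "\<exists>G \<subseteq> A. finite G \<and> A \<subseteq> span_mod S N G"
  proof (cases "A \<subseteq> N")
    case True
    then show ?thesis by (intro exI[of _ "{}"]) (auto intro: span_mod.intros)
  next
    case False
    then obtain a where a: "a \<in> A" "a \<notin> N" by blast
    then obtain t where t: "t \<in> S" "a \<otimes> t = \<one>" using inv A by blast
    have "b \<in> span_mod S N {a}" if b: "b \<in> A" for b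
    proof -
      have "a \<in> carrier R" "b \<in> carrier R" "t \<in> carrier R" using a b t A subringE(1)[OF S] by auto
      then have "(b \<otimes> t) \<otimes> a \<oplus> \<zero> = b" using t by (simp add: m_assoc m_comm[of t a])
      moreover have "b \<otimes> t \<in> S" using b t A subringE(6)[OF S] by blast
      ultimately show ?thesis using span_mod_step[of "b \<otimes> t" S a "{a}" \<zero> N] span_mod_zero[OF S N] by simp
    qed
    then show ?thesis using a by (intro exI[of _ "{a}"]) auto
  qed
qed

end

text \<open>The usual proof multiplies by the adjugate of a - M. Here the unknowns are eliminated
  one by one instead; all pivots are congruent to 1 modulo \<open>I\<close>, and \<open>h\<close>
  collects them. What counts is the order of quantifiers: \<open>h\<close> is found from the matrix
  before the ring \<open>C\<close>, the homomorphism and the solution are given.\<close>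

lemma nakayama_elimination:
  fixes B :: "('a, 'm) ring_scheme" and N :: nat
  assumes B: "cring B" and I: "ideal I B" and "a \<in> carrier B" "a \<ominus>\<^bsub>B\<^esub> \<one>\<^bsub>B\<^esub> \<in> I"
    and "\<And>i j. i < N \<Longrightarrow> j < N \<Longrightarrow> M i j \<in> I"
  shows "\<exists>h \<in> carrier B. h \<ominus>\<^bsub>B\<^esub> \<one>\<^bsub>B\<^esub> \<in> I \<and>
    (\<forall>(C :: 'c ring) \<psi> v. cring C \<and> \<psi> \<in> ring_hom B C \<and> (\<forall>i < N. v i \<in> carrier C) \<and>
      (\<forall>i < N. \<psi> a \<otimes>\<^bsub>C\<^esub> v i = (\<Oplus>\<^bsub>C\<^esub>j \<in> {..<N}. \<psi> (M i j) \<otimes>\<^bsub>C\<^esub> v j)) \<longrightarrow>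
      (\<forall>i < N. \<psi> h \<otimes>\<^bsub>C\<^esub> v i = \<zero>\<^bsub>C\<^esub>))"
  using assms(3-)
proof (induction N arbitrary: a M)
  case 0
  then show ?case by blast
next
  case (Suc N)
  interpret B: cring B by fact
  interpret I: ideal I B by fact
  note M = Suc.prems(3)
  have one: "x \<otimes>\<^bsub>B\<^esub> y \<ominus>\<^bsub>B\<^esub> \<one>\<^bsub>B\<^esub> \<in> I"
    if "x \<in> carrier B" "y \<in> carrier B" "x \<ominus>\<^bsub>B\<^esub> \<one>\<^bsub>B\<^esub> \<in> I" "y \<ominus>\<^bsub>B\<^esub> \<one>\<^bsub>B\<^esub> \<in> I" for x y
  proof -
    have "x \<otimes>\<^bsub>B\<^esub> (y \<ominus>\<^bsub>B\<^esub> \<one>\<^bsub>B\<^esub>) \<oplus>\<^bsub>B\<^esub> (x \<ominus>\<^bsub>B\<^esub> \<one>\<^bsub>B\<^esub>) \<in> I"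
      using that by (intro I.a_closed I.I_l_closed)
    moreover have "x \<otimes>\<^bsub>B\<^esub> (y \<ominus>\<^bsub>B\<^esub> \<one>\<^bsub>B\<^esub>) \<oplus>\<^bsub>B\<^esub> (x \<ominus>\<^bsub>B\<^esub> \<one>\<^bsub>B\<^esub>)
        = x \<otimes>\<^bsub>B\<^esub> y \<oplus>\<^bsub>B\<^esub> (\<ominus>\<^bsub>B\<^esub> x \<oplus>\<^bsub>B\<^esub> x) \<ominus>\<^bsub>B\<^esub> \<one>\<^bsub>B\<^esub>"
      using that(1,2) by (simp add: B.minus_eq B.r_distr B.r_minus B.a_assoc)
    ultimately show ?thesis using that(1,2) by (simp add: B.l_neg)
  qed
  have MB [simp]: "M i j \<in> carrier B" if "i < Suc N" "j < Suc N" for i j using M[OF that] I.Icarr by blast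
  \<comment> \<open>The pivot: the last equation expresses b v_N through the v_j with j < N.\<close>
  define b where "b = a \<ominus>\<^bsub>B\<^esub> M N N"
  have a: "a \<in> carrier B" and b: "b \<in> carrier B" using Suc.prems by (auto simp: b_def)
  have "(a \<ominus>\<^bsub>B\<^esub> \<one>\<^bsub>B\<^esub>) \<oplus>\<^bsub>B\<^esub> (\<ominus>\<^bsub>B\<^esub> M N N) \<in> I" using Suc.prems by (intro I.a_closed I.a_inv_closed) auto
  then have b1: "b \<ominus>\<^bsub>B\<^esub> \<one>\<^bsub>B\<^esub> \<in> I"
    using a unfolding b_def by (simp add: B.minus_eq B.a_ac)
  \<comment> \<open>Equation i multiplied by the pivot, after b v_N has been substituted. The
    entries stay in \<open>I\<close>, and the scalar on the left becomes b a, which is still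
    congruent to 1.\<close>
  let ?M = "\<lambda>i j. b \<otimes>\<^bsub>B\<^esub> M i j \<oplus>\<^bsub>B\<^esub> M i N \<otimes>\<^bsub>B\<^esub> M N j"
  have "?M i j \<in> I" if "i < N" "j < N" for i j
    using that M b by (intro I.a_closed I.I_l_closed) auto
  from Suc.IH[of "b \<otimes>\<^bsub>B\<^esub> a" ?M, OF _ one[OF b a b1 Suc.prems(2)] this] obtain h where h: "h \<in> carrier B" "h \<ominus>\<^bsub>B\<^esub> \<one>\<^bsub>B\<^esub> \<in> I"
    and *: "\<And>(C :: 'c ring) \<psi> v. cring C \<Longrightarrow> \<psi> \<in> ring_hom B C \<Longrightarrow> (\<forall>i < N. v i \<in> carrier C) \<Longrightarrow>
      (\<forall>i < N. \<psi> (b \<otimes>\<^bsub>B\<^esub> a) \<otimes>\<^bsub>C\<^esub> v i = (\<Oplus>\<^bsub>C\<^esub>j \<in> {..<N}. \<psi> (?M i j) \<otimes>\<^bsub>C\<^esub> v j)) \<Longrightarrow>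
      (\<forall>i < N. \<psi> h \<otimes>\<^bsub>C\<^esub> v i = \<zero>\<^bsub>C\<^esub>)"
    using a b by auto
  have "\<forall>i < Suc N. \<psi> (h \<otimes>\<^bsub>B\<^esub> b) \<otimes>\<^bsub>C\<^esub> v i = \<zero>\<^bsub>C\<^esub>"
    if C: "cring C" and \<psi>: "\<psi> \<in> ring_hom B C" and v: "\<forall>i < Suc N. v i \<in> carrier C"
      and eq: "\<forall>i < Suc N. \<psi> a \<otimes>\<^bsub>C\<^esub> v i = (\<Oplus>\<^bsub>C\<^esub>j \<in> {..<Suc N}. \<psi> (M i j) \<otimes>\<^bsub>C\<^esub> v j)"
    for C :: "'c ring" and \<psi> v
  proof -
    interpret C: cring C by fact
    interpret h: ring_hom_cring B C \<psi> using B C \<psi> by (intro ring_hom_cringI)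
    have vc [simp]: "v i \<in> carrier C" if "i < Suc N" for i using v that by blast
    have F: "(\<lambda>j. \<psi> (M i j) \<otimes>\<^bsub>C\<^esub> v j) \<in> {..<N} \<rightarrow> carrier C" if "i < Suc N" for i
      using that by auto
    define s where "s i = (\<Oplus>\<^bsub>C\<^esub>j \<in> {..<N}. \<psi> (M i j) \<otimes>\<^bsub>C\<^esub> v j)" for i
    have sc [simp]: "s i \<in> carrier C" if "i < Suc N" for i
      unfolding s_def using F[OF that] by (rule C.finsum_closed)
    have eq': "\<psi> a \<otimes>\<^bsub>C\<^esub> v i = \<psi> (M i N) \<otimes>\<^bsub>C\<^esub> v N \<oplus>\<^bsub>C\<^esub> s i" if "i < Suc N" for i
      unfolding s_def using eq that F[OF that] by (simp add: lessThan_Suc C.finsum_insert)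
    have "\<psi> b \<otimes>\<^bsub>C\<^esub> v N = (\<psi> (M N N) \<otimes>\<^bsub>C\<^esub> v N \<oplus>\<^bsub>C\<^esub> s N) \<oplus>\<^bsub>C\<^esub> \<ominus>\<^bsub>C\<^esub> (\<psi> (M N N) \<otimes>\<^bsub>C\<^esub> v N)"
      unfolding eq'[symmetric, OF lessI] b_def using a by (simp add: B.minus_eq C.l_distr C.l_minus)
    also have "\<dots> = s N \<oplus>\<^bsub>C\<^esub> (\<psi> (M N N) \<otimes>\<^bsub>C\<^esub> v N \<oplus>\<^bsub>C\<^esub> \<ominus>\<^bsub>C\<^esub> (\<psi> (M N N) \<otimes>\<^bsub>C\<^esub> v N))"
      by (simp add: C.a_ac)
    finally have N: "\<psi> b \<otimes>\<^bsub>C\<^esub> v N = s N" by (simp add: C.r_neg)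
    have "\<psi> (b \<otimes>\<^bsub>B\<^esub> a) \<otimes>\<^bsub>C\<^esub> v i = (\<Oplus>\<^bsub>C\<^esub>j \<in> {..<N}. \<psi> (?M i j) \<otimes>\<^bsub>C\<^esub> v j)" if i: "i < N" for i
    proof -
      have "\<psi> (b \<otimes>\<^bsub>B\<^esub> a) \<otimes>\<^bsub>C\<^esub> v i = \<psi> b \<otimes>\<^bsub>C\<^esub> (\<psi> (M i N) \<otimes>\<^bsub>C\<^esub> v N \<oplus>\<^bsub>C\<^esub> s i)"
        using i a b by (simp add: eq'[symmetric] C.m_assoc)
      also have "\<dots> = \<psi> b \<otimes>\<^bsub>C\<^esub> s i \<oplus>\<^bsub>C\<^esub> \<psi> (M i N) \<otimes>\<^bsub>C\<^esub> s N"
        unfolding N[symmetric] using i b by (simp add: C.r_distr C.m_ac C.a_ac)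
      also have "\<dots> = (\<Oplus>\<^bsub>C\<^esub>j \<in> {..<N}. \<psi> b \<otimes>\<^bsub>C\<^esub> (\<psi> (M i j) \<otimes>\<^bsub>C\<^esub> v j) \<oplus>\<^bsub>C\<^esub> \<psi> (M i N) \<otimes>\<^bsub>C\<^esub> (\<psi> (M N j) \<otimes>\<^bsub>C\<^esub> v j))"
        unfolding s_def using i b F by (subst C.finsum_addf) (auto simp: C.finsum_rdistr)
      also have "\<dots> = (\<Oplus>\<^bsub>C\<^esub>j \<in> {..<N}. \<psi> (?M i j) \<otimes>\<^bsub>C\<^esub> v j)"
        using i b by (intro C.finsum_cong') (auto simp: C.l_distr C.m_assoc)
      finally show ?thesis .
    qed
    then have 0: "\<psi> h \<otimes>\<^bsub>C\<^esub> v i = \<zero>\<^bsub>C\<^esub>" if "i < N" for i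
      using *[OF C \<psi>, of v] v that by simp
    have 1: "\<psi> (h \<otimes>\<^bsub>B\<^esub> b) \<otimes>\<^bsub>C\<^esub> v i = \<zero>\<^bsub>C\<^esub>" if "i < N" for i
    proof -
      have "\<psi> (h \<otimes>\<^bsub>B\<^esub> b) \<otimes>\<^bsub>C\<^esub> v i = \<psi> b \<otimes>\<^bsub>C\<^esub> (\<psi> h \<otimes>\<^bsub>C\<^esub> v i)" using that h b by (simp add: C.m_ac)
      then show ?thesis using 0 that b by simp
    qed
    have "\<psi> (h \<otimes>\<^bsub>B\<^esub> b) \<otimes>\<^bsub>C\<^esub> v N = \<psi> h \<otimes>\<^bsub>C\<^esub> s N" using h b N by (simp add: C.m_assoc)
    also have "\<dots> = (\<Oplus>\<^bsub>C\<^esub>j \<in> {..<N}. \<psi> h \<otimes>\<^bsub>C\<^esub> (\<psi> (M N j) \<otimes>\<^bsub>C\<^esub> v j))"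
      unfolding s_def using h F by (simp add: C.finsum_rdistr)
    also have "\<dots> = (\<Oplus>\<^bsub>C\<^esub>j \<in> {..<N}. \<zero>\<^bsub>C\<^esub>)"
    proof (rule C.finsum_cong')
      fix j assume "j \<in> {..<N}"
      then have "\<psi> h \<otimes>\<^bsub>C\<^esub> (\<psi> (M N j) \<otimes>\<^bsub>C\<^esub> v j) = \<psi> (M N j) \<otimes>\<^bsub>C\<^esub> (\<psi> h \<otimes>\<^bsub>C\<^esub> v j)"
        using h by (simp add: C.m_ac)
      then show "\<psi> h \<otimes>\<^bsub>C\<^esub> (\<psi> (M N j) \<otimes>\<^bsub>C\<^esub> v j) = \<zero>\<^bsub>C\<^esub>" using 0 \<open>j \<in> {..<N}\<close> by simp
    qed auto
    finally show ?thesis using 1 by (auto simp: less_Suc_eq)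
  qed
  moreover have "h \<otimes>\<^bsub>B\<^esub> b \<in> carrier B" using h b by simp
  ultimately show ?case using one[OF h(1) b h(2) b1] by blast
qed

section \<open>Extension of derivations\<close>

text \<open>\<open>R\<close> extended by \<open>d\<close> infinitesimals all of whose products
  vanish. For d = 1 these are the dual numbers, which encode derivations; for general
  \<open>d\<close> it is a model of the first-order neighbourhood of a section with \<open>d\<close>
  coordinates.\<close>

definition trivial_ext :: "('a, 'm) ring_scheme \<Rightarrow> nat \<Rightarrow> ('a \<times> (nat \<Rightarrow> 'a)) ring" where
  "trivial_ext R d =
     \<lparr>carrier = carrier R \<times> ({..<d} \<rightarrow>\<^sub>E carrier R),
      monoid.mult = (\<lambda>x y. (fst x \<otimes>\<^bsub>R\<^esub> fst y, \<lambda>i \<in> {..<d}. fst x \<otimes>\<^bsub>R\<^esub> snd y i \<oplus>\<^bsub>R\<^esub> fst y \<otimes>\<^bsub>R\<^esub> snd x i)),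
      one = (\<one>\<^bsub>R\<^esub>, \<lambda>i \<in> {..<d}. \<zero>\<^bsub>R\<^esub>),
      ring.zero = (\<zero>\<^bsub>R\<^esub>, \<lambda>i \<in> {..<d}. \<zero>\<^bsub>R\<^esub>),
      ring.add = (\<lambda>x y. (fst x \<oplus>\<^bsub>R\<^esub> fst y, \<lambda>i \<in> {..<d}. snd x i \<oplus>\<^bsub>R\<^esub> snd y i))\<rparr>"

lemma cring_trivial_ext:
  assumes "cring R" shows "cring (trivial_ext R d)"
proof -
  interpret cring R by fact
  have [simp]: "v i \<in> carrier R" if "v \<in> {..<d} \<rightarrow>\<^sub>E carrier R" "i < d" for v i using that by auto
  have rr: "restrict f {..<d} = restrict g {..<d} \<longleftrightarrow> (\<forall>i < d. f i = g i)" for f g :: "nat \<Rightarrow> 'a"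
    by (auto simp: fun_eq_iff restrict_def)
  have r: "restrict f {..<d} = v \<longleftrightarrow> (\<forall>i < d. f i = v i)" if "v \<in> {..<d} \<rightarrow>\<^sub>E carrier R" for f v
    using that by (metis rr PiE_restrict)
  show ?thesis
  proof (rule cringI)
    show "abelian_group (trivial_ext R d)"
    proof (rule abelian_groupI)
      fix x assume x: "x \<in> carrier (trivial_ext R d)"
      show "\<exists>y \<in> carrier (trivial_ext R d). y \<oplus>\<^bsub>trivial_ext R d\<^esub> x = \<zero>\<^bsub>trivial_ext R d\<^esub>"
      proof (rule bexI[of _ "(\<ominus>\<^bsub>R\<^esub> fst x, \<lambda>i \<in> {..<d}. \<ominus>\<^bsub>R\<^esub> snd x i)"])
      qed (use x in \<open>simp_all add: trivial_ext_def mem_Times_iff l_neg rr\<close>)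
    qed (simp_all add: trivial_ext_def mem_Times_iff prod_eq_iff restrict_PiE_iff a_ac rr r)
    show "comm_monoid (trivial_ext R d)"
      by (rule comm_monoidI) (simp_all add: trivial_ext_def mem_Times_iff prod_eq_iff restrict_PiE_iff m_ac a_ac r_distr rr r)
  qed (simp_all add: trivial_ext_def mem_Times_iff prod_eq_iff m_ac a_ac r_distr l_distr rr)
qed

lemma fst_trivial_ext: "fst \<in> ring_hom (trivial_ext R d) R"
  by (rule ring_hom_memI) (simp_all add: trivial_ext_def mem_Times_iff)

text \<open>\<open>\<Omega>\<close> is regarded as a module over the source through
  \<open>\<psi>\<close>. The domain is a bare subset \<open>S\<close>, so that a derivation can be
  extended along a chain of subrings of one field.\<close>

definition derivation :: "('a, 'm) ring_scheme \<Rightarrow> 'b set \<Rightarrow> ('b, 'n) ring_scheme \<Rightarrow> ('b \<Rightarrow> 'a) \<Rightarrow> ('b \<Rightarrow> 'a) \<Rightarrow> bool" where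
  "derivation \<Omega> S B \<psi> \<delta> \<longleftrightarrow> \<delta> \<in> S \<rightarrow> carrier \<Omega> \<and>
     (\<forall>a \<in> S. \<forall>b \<in> S. \<delta> (a \<oplus>\<^bsub>B\<^esub> b) = \<delta> a \<oplus>\<^bsub>\<Omega>\<^esub> \<delta> b) \<and>
     (\<forall>a \<in> S. \<forall>b \<in> S. \<delta> (a \<otimes>\<^bsub>B\<^esub> b) = \<psi> a \<otimes>\<^bsub>\<Omega>\<^esub> \<delta> b \<oplus>\<^bsub>\<Omega>\<^esub> \<psi> b \<otimes>\<^bsub>\<Omega>\<^esub> \<delta> a)"

locale poly_derivation = cring \<Omega> for \<Omega> (structure) +
  fixes S y
  assumes S: "subring S \<Omega>" and y: "y \<in> carrier \<Omega>"
begin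

abbreviation "R\<^sub>S \<equiv> \<Omega>\<lparr>carrier := S\<rparr>"
abbreviation "P \<equiv> UP R\<^sub>S"
abbreviation "T \<equiv> trivial_ext \<Omega> 1"
definition "ev = UnivPoly.eval R\<^sub>S \<Omega> (\<lambda>x. x) y"

lemma cring_RS: "cring R\<^sub>S"
  using S subcring_iff[of S] subringE(1)[OF S] by (simp add: subcringI' )

sublocale P: UP_pre_univ_prop R\<^sub>S \<Omega> "\<lambda>x. x" P
  using cring_RS subringE(1)[OF S] is_cring
  by (intro UP_pre_univ_propI) (auto intro!: ring_hom_memI)

lemma S_closed [simp]: "s \<in> S \<Longrightarrow> s \<in> carrier \<Omega>"
  using subringE(1)[OF S] by auto

lemma ev_hom: "ev \<in> ring_hom P \<Omega>"
  unfolding ev_def by (rule P.eval_ring_hom[OF y])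

sublocale ev: ring_hom_cring P \<Omega> ev
  by (intro ring_hom_cringI P.P.is_cring is_cring ev_hom)

lemma ev_const [simp]: "s \<in> S \<Longrightarrow> ev (up_ring.monom P s 0) = s"
  unfolding ev_def using P.eval_const[OF y] by simp

lemma ev_X [simp]: "ev (up_ring.monom P \<one> (Suc 0)) = y"
  unfolding ev_def using P.eval_monom1[OF y] by simp

text \<open>Derivations with values in \<open>\<Omega>\<close> are ring homomorphisms to the dual numbers, so the
  universal property of the polynomial ring extends them.\<close>

lemma ex_poly_derivation:
  assumes \<delta>: "derivation \<Omega> S \<Omega> (\<lambda>x. x) \<delta>" and a: "a \<in> carrier \<Omega>"
  shows "\<exists>D. derivation \<Omega> (carrier P) P ev D \<and> (\<forall>s \<in> S. D (up_ring.monom P s 0) = \<delta> s) \<and> D (up_ring.monom P \<one> (Suc 0)) = a"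
proof -
  interpret T: cring T by (rule cring_trivial_ext) (rule is_cring)
  define h where "h s = (s, \<lambda>i \<in> {..<1::nat}. \<delta> s)" for s
  have d1: "\<delta> \<one> = \<zero>"
  proof -
    have "\<delta> (\<one> \<otimes> \<one>) = \<one> \<otimes> \<delta> \<one> \<oplus> \<one> \<otimes> \<delta> \<one>" "\<delta> \<one> \<in> carrier \<Omega>"
      using \<delta> subringE(3)[OF S] unfolding derivation_def by blast+
    then show ?thesis by simp
  qed
  have h: "h \<in> ring_hom R\<^sub>S T"
    using \<delta> d1 by (intro ring_hom_memI) (auto simp: h_def trivial_ext_def derivation_def fun_eq_iff)
  interpret h: UP_pre_univ_prop "R\<^sub>S" T h P
    by (intro UP_pre_univ_propI cring_RS T.is_cring h) simp
  define s where "s = (y, \<lambda>i \<in> {..<1::nat}. a)"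
  have s: "s \<in> carrier T" using y a by (auto simp: s_def trivial_ext_def)
  define E where "E = UnivPoly.eval R\<^sub>S T h s"
  have E: "E \<in> ring_hom P T" unfolding E_def by (rule h.eval_ring_hom[OF s])
  have f: "fst \<circ> E \<in> ring_hom P \<Omega>" by (rule ring_hom_trans[OF E fst_trivial_ext])
  have fE: "fst (E p) = ev p" if "p \<in> carrier P" for p
  proof -
    have "(fst \<circ> E) p = ev p"
    proof (rule P.UP_hom_unique[where s = y and Phi = "fst \<circ> E" and Psi = ev])
      show "ring_hom_cring P \<Omega> (fst \<circ> E)" using f by (intro ring_hom_cringI P.P.is_cring is_cring)
      show "(fst \<circ> E) (up_ring.monom P \<one>\<^bsub>R\<^sub>S\<^esub> (Suc 0)) = y"
        using h.eval_monom1[OF s] by (simp add: E_def s_def)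
      show "(fst \<circ> E) (up_ring.monom P r 0) = r" if "r \<in> carrier R\<^sub>S" for r
        using h.eval_const[OF s that] by (simp add: E_def h_def)
    qed (use that y ev.ring_hom_cring_axioms in auto)
    then show ?thesis by simp
  qed
  define D where "D p = snd (E p) 0" for p
  have "derivation \<Omega> (carrier P) P ev D"
    unfolding derivation_def
  proof (intro conjI ballI)
    show "D \<in> carrier P \<rightarrow> carrier \<Omega>"
    proof
      fix p assume "p \<in> carrier P"
      then have "snd (E p) \<in> {..<1} \<rightarrow>\<^sub>E carrier \<Omega>"
        using ring_hom_closed[OF E] by (simp add: trivial_ext_def mem_Times_iff)
      then show "D p \<in> carrier \<Omega>" unfolding D_def by (rule PiE_mem) simp
    qed
  next
    fix p q assume pq: "p \<in> carrier P" "q \<in> carrier P"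
    show "D (p \<oplus>\<^bsub>P\<^esub> q) = D p \<oplus> D q"
      unfolding D_def ring_hom_add[OF E pq] by (simp add: trivial_ext_def)
    show "D (p \<otimes>\<^bsub>P\<^esub> q) = ev p \<otimes> D q \<oplus> ev q \<otimes> D p"
      unfolding D_def ring_hom_mult[OF E pq] by (simp add: trivial_ext_def fE pq)
  qed
  moreover have "D (up_ring.monom P r 0) = \<delta> r" if "r \<in> S" for r
    using h.eval_const[OF s, of r] that by (simp add: E_def h_def D_def)
  moreover have "D (up_ring.monom P \<one> (Suc 0)) = a"
    using h.eval_monom1[OF s] by (simp add: E_def s_def D_def)
  ultimately show ?thesis by blast
qed

lemma monom_X_closed: "up_ring.monom P \<one> (Suc 0) \<in> carrier P"
  using P.monom_closed[of "\<one>" "Suc 0"] subringE(3)[OF S] by simp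

text \<open>Together with evaluation, each derivation is a homomorphism to the dual numbers, and
  homomorphisms on a polynomial ring are determined by their values at the constants and the
  variable.\<close>

lemma poly_derivation_unique:
  assumes D: "derivation \<Omega> (carrier P) P ev D" and D': "derivation \<Omega> (carrier P) P ev D'"
    and c: "\<And>s. s \<in> S \<Longrightarrow> D (up_ring.monom P s 0) = D' (up_ring.monom P s 0)"
    and X: "D (up_ring.monom P \<one> (Suc 0)) = D' (up_ring.monom P \<one> (Suc 0))"
    and p: "p \<in> carrier P"
  shows "D p = D' p"
proof -
  interpret T: cring T by (rule cring_trivial_ext) (rule is_cring)
  have hom: "(\<lambda>p. (ev p, \<lambda>i \<in> {..<1::nat}. D p)) \<in> ring_hom P T" if "derivation \<Omega> (carrier P) P ev D" for D
  proof -
    have "D (\<one>\<^bsub>P\<^esub> \<otimes>\<^bsub>P\<^esub> \<one>\<^bsub>P\<^esub>) = ev \<one>\<^bsub>P\<^esub> \<otimes> D \<one>\<^bsub>P\<^esub> \<oplus> ev \<one>\<^bsub>P\<^esub> \<otimes> D \<one>\<^bsub>P\<^esub>" "D \<one>\<^bsub>P\<^esub> \<in> carrier \<Omega>"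
      using that P.P.one_closed unfolding derivation_def by blast+
    then have "D \<one>\<^bsub>P\<^esub> = \<zero>" by simp
    then show ?thesis
      using that by (intro ring_hom_memI) (auto simp: trivial_ext_def derivation_def fun_eq_iff)
  qed
  let ?E = "\<lambda>p. (ev p, \<lambda>i \<in> {..<1::nat}. D p)" and ?E' = "\<lambda>p. (ev p, \<lambda>i \<in> {..<1::nat}. D' p)"
  let ?h = "\<lambda>s. ?E (up_ring.monom P s 0)"
  have "(\<lambda>s. up_ring.monom P s 0) \<in> ring_hom R\<^sub>S P" by (rule P.const_ring_hom)
  then have h: "?h \<in> ring_hom R\<^sub>S T" using ring_hom_trans[OF _ hom[OF D]] by (simp add: comp_def)
  interpret h: UP_pre_univ_prop "R\<^sub>S" T ?h P
    by (intro UP_pre_univ_propI cring_RS T.is_cring h) simp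
  have X': "D' (up_ring.monom P \<one> (Suc 0)) \<in> carrier \<Omega>"
    using D' monom_X_closed unfolding derivation_def by blast
  have "?E p = ?E' p"
  proof (rule h.UP_hom_unique[where s = "?E (up_ring.monom P \<one> (Suc 0))" and Phi = ?E and Psi = ?E'])
    show "ring_hom_cring P T ?E" "ring_hom_cring P T ?E'"
      by (intro ring_hom_cringI P.P.is_cring T.is_cring hom[OF D] hom[OF D'])+
  qed (use c X p in \<open>auto simp: trivial_ext_def y X'\<close>)
  then have "(\<lambda>i \<in> {..<1::nat}. D p) 0 = (\<lambda>i \<in> {..<1::nat}. D' p) 0" by (simp only: prod.inject)
  then show ?thesis by simp
qed

text \<open>The ring S[y] is the polynomial ring modulo the relations of \<open>y\<close>, so a
  derivation descends to it as soon as it vanishes on these relations.\<close>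

lemma derivation_factor:
  assumes D: "derivation \<Omega> (carrier P) P ev D" and 0: "\<And>p. p \<in> carrier P \<Longrightarrow> ev p = \<zero> \<Longrightarrow> D p = \<zero>"
  shows "\<exists>\<delta>. derivation \<Omega> (ev ` carrier P) \<Omega> (\<lambda>x. x) \<delta> \<and> (\<forall>p \<in> carrier P. \<delta> (ev p) = D p)"
proof -
  have Dc [simp]: "D p \<in> carrier \<Omega>" if "p \<in> carrier P" for p using D that by (auto simp: derivation_def)
  have Da: "D (p \<oplus>\<^bsub>P\<^esub> q) = D p \<oplus> D q" if "p \<in> carrier P" "q \<in> carrier P" for p q
    using D that by (auto simp: derivation_def)
  have eq: "D p = D q" if pq: "p \<in> carrier P" "q \<in> carrier P" and "ev p = ev q" for p q
  proof -
    have "ev (p \<oplus>\<^bsub>P\<^esub> \<ominus>\<^bsub>P\<^esub> q) = \<zero>" using that by (simp add: r_neg)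
    then have *: "D p \<oplus> D (\<ominus>\<^bsub>P\<^esub> q) = \<zero>" using 0[of "p \<oplus>\<^bsub>P\<^esub> \<ominus>\<^bsub>P\<^esub> q"] Da[of p "\<ominus>\<^bsub>P\<^esub> q"] pq by simp
    have "ev (q \<oplus>\<^bsub>P\<^esub> \<ominus>\<^bsub>P\<^esub> q) = \<zero>" using that by (simp add: r_neg)
    then have "D q \<oplus> D (\<ominus>\<^bsub>P\<^esub> q) = \<zero>" using 0[of "q \<oplus>\<^bsub>P\<^esub> \<ominus>\<^bsub>P\<^esub> q"] Da[of q "\<ominus>\<^bsub>P\<^esub> q"] pq by simp
    then show ?thesis using * pq add.right_cancel[of "D (\<ominus>\<^bsub>P\<^esub> q)" "D p" "D q"] by simp
  qed
  define \<delta> where "\<delta> x = D (inv_into (carrier P) ev x)" for x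
  have \<delta>: "\<delta> (ev p) = D p" if "p \<in> carrier P" for p
    unfolding \<delta>_def using that by (intro eq) (simp_all add: inv_into_into f_inv_into_f)
  have "derivation \<Omega> (ev ` carrier P) \<Omega> (\<lambda>x. x) \<delta>"
    unfolding derivation_def
  proof (intro conjI ballI)
    show "\<delta> \<in> ev ` carrier P \<rightarrow> carrier \<Omega>" using \<delta> by auto
  next
    fix a b assume "a \<in> ev ` carrier P" "b \<in> ev ` carrier P"
    then obtain p q where pq: "p \<in> carrier P" "q \<in> carrier P" "a = ev p" "b = ev q" by blast
    show "\<delta> (a \<oplus> b) = \<delta> a \<oplus> \<delta> b"
      using pq \<delta>[of "p \<oplus>\<^bsub>P\<^esub> q"] Da by (simp add: \<delta>)
    show "\<delta> (a \<otimes> b) = a \<otimes> \<delta> b \<oplus> b \<otimes> \<delta> a"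
      using pq \<delta>[of "p \<otimes>\<^bsub>P\<^esub> q"] D by (simp add: \<delta> derivation_def)
  qed
  then show ?thesis using \<delta> by blast
qed

lemma subring_ev: "subring (ev ` carrier P) \<Omega>"
  using ring_hom_ring.img_is_subring[OF ring_hom_ringI2[OF P.P.ring_axioms ring_axioms ev_hom] P.P.carrier_is_subring] .

lemma S_sub_ev: "S \<subseteq> ev ` carrier P"
proof
  fix s assume "s \<in> S"
  then show "s \<in> ev ` carrier P" by (intro image_eqI[of _ _ "up_ring.monom P s 0"]) auto
qed

lemma y_in_ev: "y \<in> ev ` carrier P"
  using monom_X_closed by (intro image_eqI[of _ _ "up_ring.monom P \<one> (Suc 0)"]) auto

lemma zero_derivation: "derivation \<Omega> S \<Omega> (\<lambda>x. x) (\<lambda>_. \<zero>)"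
  by (auto simp: derivation_def)

lemma ex_derivation_transcendental:
  assumes "\<And>p. p \<in> carrier P \<Longrightarrow> ev p = \<zero> \<Longrightarrow> p = \<zero>\<^bsub>P\<^esub>"
  shows "\<exists>S' \<delta>. subring S' \<Omega> \<and> S \<subseteq> S' \<and> y \<in> S' \<and> derivation \<Omega> S' \<Omega> (\<lambda>x. x) \<delta> \<and> (\<forall>s \<in> S. \<delta> s = \<zero>) \<and> \<delta> y = \<one>"
proof -
  obtain D where D: "derivation \<Omega> (carrier P) P ev D" "\<forall>s \<in> S. D (up_ring.monom P s 0) = \<zero>" "D (up_ring.monom P \<one> (Suc 0)) = \<one>"
    using ex_poly_derivation[OF zero_derivation one_closed] by auto
  have "D (up_ring.monom P \<zero> 0) = \<zero>" using D(2) subringE(2)[OF S] by blast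
  then have "D \<zero>\<^bsub>P\<^esub> = \<zero>" using P.monom_zero[of 0] by simp
  then obtain \<delta> where \<delta>: "derivation \<Omega> (ev ` carrier P) \<Omega> (\<lambda>x. x) \<delta>" "\<forall>p \<in> carrier P. \<delta> (ev p) = D p"
    using derivation_factor[OF D(1)] assms by metis
  have "\<delta> y = \<one>" using \<delta>(2) D(3) monom_X_closed ev_X by metis
  moreover have "\<delta> s = \<zero>" if "s \<in> S" for s
  proof -
    have "up_ring.monom P s 0 \<in> carrier P" using P.monom_closed[of s 0] that by simp
    then have "\<delta> (ev (up_ring.monom P s 0)) = D (up_ring.monom P s 0)" using \<delta>(2) by blast
    then show ?thesis using D(2) that by simp
  qed
  ultimately show ?thesis using \<delta>(1) subring_ev S_sub_ev y_in_ev by blast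
qed

end

locale poly_derivation_field = poly_derivation + field \<Omega>
begin

text \<open>If \<open>y\<close> is algebraic with minimal relation \<open>m\<close>, either \<open>m'(y) \<noteq> 0\<close> and the derivation extends
  to \<open>S[y]\<close>, or \<open>m'(y) = 0\<close> and formal differentiation with respect to \<open>y\<close> is well defined.\<close>

lemma extend_derivation:
  assumes \<delta>: "derivation \<Omega> S \<Omega> (\<lambda>x. x) \<delta>" and K: "K \<subseteq> S" "\<And>s. s \<in> K \<Longrightarrow> \<delta> s = \<zero>"
    and G: "G \<subseteq> S" "\<exists>g \<in> G. \<delta> g \<noteq> \<zero>"
  shows "\<exists>S' \<delta>'. subring S' \<Omega> \<and> S \<subseteq> S' \<and> y \<in> S' \<and> derivation \<Omega> S' \<Omega> (\<lambda>x. x) \<delta>' \<and>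
    (\<forall>s \<in> K. \<delta>' s = \<zero>) \<and> (\<exists>g \<in> insert y G. \<delta>' g \<noteq> \<zero>)"
proof -
  let ?c = "\<lambda>s. up_ring.monom P s 0" and ?X = "up_ring.monom P \<one> (Suc 0)"
  have cc: "?c s \<in> carrier P" if "s \<in> S" for s using P.monom_closed[of s 0] that by simp
  have finish: ?thesis
    if D: "derivation \<Omega> (carrier P) P ev D" and 0: "\<And>p. p \<in> carrier P \<Longrightarrow> ev p = \<zero> \<Longrightarrow> D p = \<zero>"
      and DK: "\<And>s. s \<in> K \<Longrightarrow> D (?c s) = \<zero>"
      and nz: "D ?X \<noteq> \<zero> \<or> (\<exists>g \<in> G. D (?c g) \<noteq> \<zero>)" for D
  proof -
    obtain \<delta>' where \<delta>': "derivation \<Omega> (ev ` carrier P) \<Omega> (\<lambda>x. x) \<delta>'" "\<forall>p \<in> carrier P. \<delta>' (ev p) = D p"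
      using derivation_factor[OF D 0] by blast
    have c: "\<delta>' s = D (?c s)" if "s \<in> S" for s using \<delta>'(2) cc[OF that] ev_const[OF that] by metis
    have X: "\<delta>' y = D ?X" using \<delta>'(2) monom_X_closed ev_X by metis
    have "\<forall>s \<in> K. \<delta>' s = \<zero>" using c DK K(1) by auto
    moreover have "\<exists>g \<in> insert y G. \<delta>' g \<noteq> \<zero>"
      using nz
    proof
      assume "\<exists>g \<in> G. D (?c g) \<noteq> \<zero>"
      then obtain g where g: "g \<in> G" "D (?c g) \<noteq> \<zero>" by blast
      then have "\<delta>' g \<noteq> \<zero>" using c[of g] G(1) by auto
      then show ?thesis using g by blast
    qed (use X in auto)
    ultimately show ?thesis using \<delta>'(1) subring_ev S_sub_ev y_in_ev by blast
  qed
  obtain D\<^sub>1 where D1: "derivation \<Omega> (carrier P) P ev D\<^sub>1" "\<forall>s \<in> S. D\<^sub>1 (?c s) = \<zero>" "D\<^sub>1 ?X = \<one>"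
    using ex_poly_derivation[OF zero_derivation one_closed] by auto
  obtain D\<^sub>0 where D0: "derivation \<Omega> (carrier P) P ev D\<^sub>0" "\<forall>s \<in> S. D\<^sub>0 (?c s) = \<delta> s" "D\<^sub>0 ?X = \<zero>"
    using ex_poly_derivation[OF \<delta> zero_closed] by auto
  have Dc: "D p \<in> carrier \<Omega>" if "derivation \<Omega> (carrier P) P ev D" "p \<in> carrier P" for D p
    using that by (auto simp: derivation_def)
  have Dz: "D \<zero>\<^bsub>P\<^esub> = \<zero>" if "derivation \<Omega> (carrier P) P ev D" for D
  proof -
    have "D (\<zero>\<^bsub>P\<^esub> \<oplus>\<^bsub>P\<^esub> \<zero>\<^bsub>P\<^esub>) = D \<zero>\<^bsub>P\<^esub> \<oplus> D \<zero>\<^bsub>P\<^esub>" using that P.P.zero_closed unfolding derivation_def by blast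
    then have "D \<zero>\<^bsub>P\<^esub> = D \<zero>\<^bsub>P\<^esub> \<oplus> D \<zero>\<^bsub>P\<^esub>" by simp
    then show ?thesis using Dc[OF that P.P.zero_closed] by simp
  qed
  show ?thesis
  proof (cases "\<forall>p \<in> carrier P. ev p = \<zero> \<longrightarrow> p = \<zero>\<^bsub>P\<^esub>")
    case True
    have "\<exists>g \<in> G. D\<^sub>0 (?c g) \<noteq> \<zero>" using G D0(2) by (metis subsetD)
    then show ?thesis using True K D0(2) Dz[OF D0(1)] by (intro finish[OF D0(1)]) auto
  next
    case False
    let ?Q = "\<lambda>p. p \<in> carrier P \<and> ev p = \<zero> \<and> p \<noteq> \<zero>\<^bsub>P\<^esub>"
    define m where "m = (ARG_MIN (deg R\<^sub>S) p. ?Q p)"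
    obtain p0 where "?Q p0" using False by blast
    then have mQ: "?Q m" unfolding m_def by (rule arg_min_natI[where P = ?Q])
    have m_le: "deg R\<^sub>S m \<le> deg R\<^sub>S p" if "?Q p" for p
      unfolding m_def using that by (rule arg_min_nat_le[where P = ?Q])
    \<comment> \<open>It suffices to treat the minimal relation \<open>m\<close>. As
      \<open>S\<close> is not a field, division of p by \<open>m\<close> works only after
      multiplication by a power \<open>u\<close> of the leading coefficient; then u D(p) = 0 in the
      field \<open>\<Omega>\<close>, and u is not zero.\<close>
    have kill: "D p = \<zero>" if D: "derivation \<Omega> (carrier P) P ev D" and Dm: "D m = \<zero>"
      and p: "p \<in> carrier P" "ev p = \<zero>" for D p
    proof -
      obtain q r k where q: "q \<in> carrier P" and r: "r \<in> carrier P"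
        and eq: "up_ring.coeff P m (deg R\<^sub>S m) [^]\<^bsub>R\<^sub>S\<^esub> (k::nat) \<odot>\<^bsub>P\<^esub> p = m \<otimes>\<^bsub>P\<^esub> q \<oplus>\<^bsub>P\<^esub> r"
        and dr: "r = \<zero>\<^bsub>P\<^esub> \<or> deg R\<^sub>S r < deg R\<^sub>S m"
        using P.long_div_theorem[of m p] mQ p by blast
      define l where "l = up_ring.coeff P m (deg R\<^sub>S m)"
      define u where "u = l [^]\<^bsub>R\<^sub>S\<^esub> k"
      have l: "l \<in> S" "l \<noteq> \<zero>" unfolding l_def
        using P.lcoeff_nonzero2[of m] P.coeff_closed[of m] mQ by auto
      have u: "u \<in> S" "u \<noteq> \<zero>"
      proof -
        show "u \<in> S" unfolding u_def using P.R.nat_pow_closed[of l k] l by simp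
        have "u = l [^] k" unfolding u_def by (rule nat_pow_consistent[symmetric])
        moreover have "l [^] k \<noteq> \<zero>" using l by (induction k) (auto simp: integral_iff)
        ultimately show "u \<noteq> \<zero>" by simp
      qed
      have e: "?c u \<otimes>\<^bsub>P\<^esub> p = m \<otimes>\<^bsub>P\<^esub> q \<oplus>\<^bsub>P\<^esub> r"
        using eq P.monom_mult_is_smult[of u p] u p by (simp add: u_def l_def)
      have "ev (?c u \<otimes>\<^bsub>P\<^esub> p) = \<zero>" using p u cc[OF u(1)] by simp
      then have "ev r = \<zero>" unfolding e using mQ q r by simp
      then have "r = \<zero>\<^bsub>P\<^esub>" using dr m_le[of r] r by (metis leD)
      then have "D (?c u \<otimes>\<^bsub>P\<^esub> p) = D (m \<otimes>\<^bsub>P\<^esub> q)" using e mQ q by simp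
      also have "\<dots> = \<zero>" using D mQ q Dm Dc[OF D q] unfolding derivation_def by simp
      finally have "ev (?c u) \<otimes> D p \<oplus> ev p \<otimes> D (?c u) = \<zero>"
        using D cc[OF u(1)] p unfolding derivation_def by simp
      then have "u \<otimes> D p = \<zero>" using p u Dc[OF D] cc[OF u(1)] by simp
      then show ?thesis using u Dc[OF D p(1)] integral_iff by auto
    qed
    show ?thesis
    proof (cases "D\<^sub>1 m = \<zero>")
      case True
      show ?thesis
      proof (rule finish[OF D1(1)])
        show "D\<^sub>1 p = \<zero>" if "p \<in> carrier P" "ev p = \<zero>" for p by (rule kill[OF D1(1) True that])
        show "D\<^sub>1 (?c s) = \<zero>" if "s \<in> K" for s using D1(2) K(1) that by blast
      qed (simp add: D1(3))
    next
      case False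
      have c1: "D\<^sub>1 m \<in> Units \<Omega>" using False Dc[OF D1(1)] mQ field_Units by auto
      have c0: "D\<^sub>0 m \<in> carrier \<Omega>" using Dc[OF D0(1)] mQ by auto
      \<comment> \<open>The value at \<open>y\<close> is forced: it solves D0(m) + a D1(m) = 0, so
        that the new derivation kills \<open>m\<close>.\<close>
      define a where "a = \<ominus> (D\<^sub>0 m \<otimes> inv (D\<^sub>1 m))"
      have a: "a \<in> carrier \<Omega>" unfolding a_def using c1 c0 by simp
      obtain D where D: "derivation \<Omega> (carrier P) P ev D" "\<forall>s \<in> S. D (?c s) = \<delta> s" "D ?X = a"
        using ex_poly_derivation[OF \<delta> a] by auto
      have lin: "derivation \<Omega> (carrier P) P ev (\<lambda>p. D\<^sub>0 p \<oplus> a \<otimes> D\<^sub>1 p)"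
        unfolding derivation_def
      proof (intro conjI ballI)
        fix p q assume pq: "p \<in> carrier P" "q \<in> carrier P"
        note [simp] = Dc[OF D0(1) pq(1)] Dc[OF D0(1) pq(2)] Dc[OF D1(1) pq(1)] Dc[OF D1(1) pq(2)] a pq
        have "D\<^sub>0 (p \<oplus>\<^bsub>P\<^esub> q) = D\<^sub>0 p \<oplus> D\<^sub>0 q" "D\<^sub>1 (p \<oplus>\<^bsub>P\<^esub> q) = D\<^sub>1 p \<oplus> D\<^sub>1 q"
          using D0(1) D1(1) pq unfolding derivation_def by blast+
        then show "D\<^sub>0 (p \<oplus>\<^bsub>P\<^esub> q) \<oplus> a \<otimes> D\<^sub>1 (p \<oplus>\<^bsub>P\<^esub> q) = (D\<^sub>0 p \<oplus> a \<otimes> D\<^sub>1 p) \<oplus> (D\<^sub>0 q \<oplus> a \<otimes> D\<^sub>1 q)"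
          by (simp add: r_distr a_ac)
        have "D\<^sub>0 (p \<otimes>\<^bsub>P\<^esub> q) = ev p \<otimes> D\<^sub>0 q \<oplus> ev q \<otimes> D\<^sub>0 p" "D\<^sub>1 (p \<otimes>\<^bsub>P\<^esub> q) = ev p \<otimes> D\<^sub>1 q \<oplus> ev q \<otimes> D\<^sub>1 p"
          using D0(1) D1(1) pq unfolding derivation_def by blast+
        then show "D\<^sub>0 (p \<otimes>\<^bsub>P\<^esub> q) \<oplus> a \<otimes> D\<^sub>1 (p \<otimes>\<^bsub>P\<^esub> q) =
            ev p \<otimes> (D\<^sub>0 q \<oplus> a \<otimes> D\<^sub>1 q) \<oplus> ev q \<otimes> (D\<^sub>0 p \<oplus> a \<otimes> D\<^sub>1 p)"
          by (simp add: r_distr a_ac m_ac)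
      qed (use Dc[OF D0(1)] Dc[OF D1(1)] a in auto)
      have "D m = D\<^sub>0 m \<oplus> a \<otimes> D\<^sub>1 m"
      proof (rule poly_derivation_unique[OF D(1) lin])
        show "D (?c s) = D\<^sub>0 (?c s) \<oplus> a \<otimes> D\<^sub>1 (?c s)" if "s \<in> S" for s
          using D(2) D0(2) D1(2) that a Dc[OF D0(1) cc[OF that]] by auto
      qed (use D(3) D0(3) D1(3) a mQ in auto)
      also have "\<dots> = \<zero>" unfolding a_def using c0 c1 Units_closed[OF c1] Units_inv_closed[OF c1] Units_l_inv[OF c1]
        by (simp add: l_minus m_assoc r_neg)
      finally have "D m = \<zero>" .
      moreover have "\<exists>g \<in> G. D (?c g) \<noteq> \<zero>" using G D(2) by (metis subsetD)
      ultimately show ?thesis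
      proof (intro finish[OF D(1)] disjI2)
        show "D p = \<zero>" if "p \<in> carrier P" "ev p = \<zero>" for p by (rule kill[OF D(1) \<open>D m = \<zero>\<close> that])
        show "D (?c s) = \<zero>" if "s \<in> K" for s using D(2) K that by auto
      qed
    qed
  qed
qed

end

text \<open>The result need not restrict to \<open>\<delta>\<close>, since an inseparable generator
  replaces the derivation by differentiation with respect to that generator. What survives every
  step is vanishing on \<open>K\<close> and nonvanishing at some element of the growing set
  \<open>G\<close>.\<close>

lemma (in field) extend_derivation_list:
  assumes "subring S R" "K \<subseteq> S" "G \<subseteq> S" "derivation R S R (\<lambda>x. x) \<delta>" "\<And>s. s \<in> K \<Longrightarrow> \<delta> s = \<zero>"
    and "\<exists>g \<in> G. \<delta> g \<noteq> \<zero>" "set zs \<subseteq> carrier R"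
  shows "\<exists>S' \<delta>'. subring S' R \<and> S \<subseteq> S' \<and> set zs \<subseteq> S' \<and> derivation R S' R (\<lambda>x. x) \<delta>' \<and>
    (\<forall>s \<in> K. \<delta>' s = \<zero>) \<and> (\<exists>g \<in> G \<union> set zs. \<delta>' g \<noteq> \<zero>)"
  using assms
proof (induction zs arbitrary: S G \<delta>)
  case Nil
  then show ?case by (intro exI[of _ S] exI[of _ \<delta>]) auto
next
  case (Cons z zs)
  have pd: "poly_derivation_field R S z"
    by (intro poly_derivation_field.intro poly_derivation.intro poly_derivation_axioms.intro
        is_cring field_axioms) (use Cons.prems in auto)
  obtain S1 \<delta>1 where 1: "subring S1 R" "S \<subseteq> S1" "z \<in> S1" "derivation R S1 R (\<lambda>x. x) \<delta>1"
    "\<forall>s \<in> K. \<delta>1 s = \<zero>" "\<exists>g \<in> insert z G. \<delta>1 g \<noteq> \<zero>"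
    using poly_derivation_field.extend_derivation[OF pd Cons.prems(4,2,5,3,6)] by blast
  have "insert z G \<subseteq> S1" "K \<subseteq> S1" "set zs \<subseteq> carrier R" using 1 Cons.prems by auto
  from Cons.IH[OF 1(1) this(2,1) 1(4) _ 1(6) this(3)] 1(5)
  obtain S2 \<delta>2 where 2: "subring S2 R" "S1 \<subseteq> S2" "set zs \<subseteq> S2" "derivation R S2 R (\<lambda>x. x) \<delta>2"
    "\<forall>s \<in> K. \<delta>2 s = \<zero>" "\<exists>g \<in> insert z G \<union> set zs. \<delta>2 g \<noteq> \<zero>" by blast
  then show ?case using 1 by (intro exI[of _ S2] exI[of _ \<delta>2]) auto
qed

section \<open>Formal arcs\<close>

lemma (in ideal) finsum_in_ideal:
  assumes "finite A" "\<And>a. a \<in> A \<Longrightarrow> f a \<in> I"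
  shows "finsum R f A \<in> I"
  using assms
proof (induction A)
  case (insert a A)
  then have "finsum R f (insert a A) = f a \<oplus> finsum R f A"
    by (intro finsum_insert) (auto intro: Icarr)
  then show ?case using insert by (auto intro: a_closed)
qed auto

text \<open>\<open>\<phi> b i\<close> is the \<open>i\<close>-th coefficient of the image of \<open>b\<close> under a homomorphism from \<open>B\<close> to the power
  series ring over \<open>R\<close>.\<close>

definition ps_hom :: "('b, 'n) ring_scheme \<Rightarrow> ('a, 'm) ring_scheme \<Rightarrow> ('b \<Rightarrow> nat \<Rightarrow> 'a) \<Rightarrow> bool" where
  "ps_hom B R \<phi> \<longleftrightarrow>
     (\<forall>b \<in> carrier B. \<forall>i. \<phi> b i \<in> carrier R) \<and>
     (\<forall>a \<in> carrier B. \<forall>b \<in> carrier B. \<forall>i. \<phi> (a \<oplus>\<^bsub>B\<^esub> b) i = \<phi> a i \<oplus>\<^bsub>R\<^esub> \<phi> b i) \<and>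
     (\<forall>a \<in> carrier B. \<forall>b \<in> carrier B. \<forall>i. \<phi> (a \<otimes>\<^bsub>B\<^esub> b) i = (\<Oplus>\<^bsub>R\<^esub>j \<in> {..i}. \<phi> a j \<otimes>\<^bsub>R\<^esub> \<phi> b (i - j))) \<and>
     (\<forall>i. \<phi> \<one>\<^bsub>B\<^esub> i = (if i = 0 then \<one>\<^bsub>R\<^esub> else \<zero>\<^bsub>R\<^esub>))"

lemma ps_homD:
  assumes "ps_hom B R \<phi>" "a \<in> carrier B" "b \<in> carrier B"
  shows "\<phi> a i \<in> carrier R" "\<phi> (a \<oplus>\<^bsub>B\<^esub> b) i = \<phi> a i \<oplus>\<^bsub>R\<^esub> \<phi> b i"
    "\<phi> (a \<otimes>\<^bsub>B\<^esub> b) i = (\<Oplus>\<^bsub>R\<^esub>j \<in> {..i}. \<phi> a j \<otimes>\<^bsub>R\<^esub> \<phi> b (i - j))"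
    "\<phi> \<one>\<^bsub>B\<^esub> i = (if i = 0 then \<one>\<^bsub>R\<^esub> else \<zero>\<^bsub>R\<^esub>)"
  using assms by (auto simp: ps_hom_def)

lemma ps_hom_zero:
  assumes "cring B" "cring R" "ps_hom B R \<phi>"
  shows "\<phi> \<zero>\<^bsub>B\<^esub> i = \<zero>\<^bsub>R\<^esub>"
proof -
  interpret B: cring B by fact
  interpret R: cring R by fact
  have "\<phi> (\<zero>\<^bsub>B\<^esub> \<oplus>\<^bsub>B\<^esub> \<zero>\<^bsub>B\<^esub>) i = \<phi> \<zero>\<^bsub>B\<^esub> i \<oplus>\<^bsub>R\<^esub> \<phi> \<zero>\<^bsub>B\<^esub> i"
    using ps_homD(2)[OF assms(3)] by blast
  then show ?thesis using ps_homD(1)[OF assms(3) B.zero_closed B.zero_closed, of i] by simp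
qed

text \<open>After reduction of the coefficients modulo \<open>M\<close> this is the kernel of a
  homomorphism to power series over a domain. Modulo \<open>M\<close>, the coefficient of a product
  at the sum of the two lowest indices is the product of the two lowest coefficients.\<close>

lemma ps_hom_primeideal:
  assumes B: "cring B" and M: "primeideal M R" and \<phi>: "ps_hom B R \<phi>"
  shows "primeideal {b \<in> carrier B. \<forall>i. \<phi> b i \<in> M} B"
proof -
  interpret B: cring B by fact
  interpret M: primeideal M R by fact
  let ?I = "{b \<in> carrier B. \<forall>i. \<phi> b i \<in> M}"
  note D = ps_homD[OF \<phi>]
  have I: "ideal ?I B"
  proof (rule B.ideal_commI)
    show "\<zero>\<^bsub>B\<^esub> \<in> ?I" using ps_hom_zero[OF B M.is_cring \<phi>] by auto
    fix a x assume a: "a \<in> ?I" and x: "x \<in> carrier B"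
    have "\<phi> (x \<otimes>\<^bsub>B\<^esub> a) i \<in> M" for i
      using a x D by (auto intro!: M.finsum_in_ideal M.I_l_closed)
    then show "x \<otimes>\<^bsub>B\<^esub> a \<in> ?I" using a x by auto
  qed (use D in auto)
  show ?thesis
  proof (rule primeidealI[OF I B])
    have "\<one>\<^bsub>R\<^esub> \<notin> M" using M.I_notcarr M.one_imp_carrier by auto
    then have "\<one>\<^bsub>B\<^esub> \<notin> ?I" using D(4)[OF B.one_closed B.one_closed, of 0] by (auto intro!: exI[of _ 0])
    then show "carrier B \<noteq> ?I" by auto
  next
    fix a b assume ab: "a \<in> carrier B" "b \<in> carrier B" "a \<otimes>\<^bsub>B\<^esub> b \<in> ?I"
    show "a \<in> ?I \<or> b \<in> ?I"
    proof (rule ccontr)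
      assume "\<not> ?thesis"
      then have ex: "\<exists>i. \<phi> a i \<notin> M" "\<exists>j. \<phi> b j \<notin> M" using ab by auto
      define i where "i = (LEAST i. \<phi> a i \<notin> M)"
      define j where "j = (LEAST j. \<phi> b j \<notin> M)"
      have i: "\<phi> a i \<notin> M" "\<And>l. l < i \<Longrightarrow> \<phi> a l \<in> M"
        using LeastI_ex[OF ex(1)] not_less_Least[of _ "\<lambda>i. \<phi> a i \<notin> M"] unfolding i_def by blast+
      have j: "\<phi> b j \<notin> M" "\<And>l. l < j \<Longrightarrow> \<phi> b l \<in> M"
        using LeastI_ex[OF ex(2)] not_less_Least[of _ "\<lambda>i. \<phi> b i \<notin> M"] unfolding j_def by blast+
      note c = D(1)[OF ab(1) ab(1)] D(1)[OF ab(2) ab(2)]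
      let ?f = "\<lambda>l. \<phi> a l \<otimes>\<^bsub>R\<^esub> \<phi> b (i + j - l)"
      have "?f l \<in> M" if "l \<in> {..i + j} - {i}" for l
      proof (cases "l < i")
        case True then show ?thesis using i c by (intro M.I_r_closed) auto
      next
        case False
        then have "i + j - l < j" using that by auto
        then show ?thesis using j c by (intro M.I_l_closed) auto
      qed
      then have s: "finsum R ?f ({..i + j} - {i}) \<in> M" by (intro M.finsum_in_ideal) auto
      have "\<phi> (a \<otimes>\<^bsub>B\<^esub> b) (i + j) = finsum R ?f (insert i ({..i + j} - {i}))"
        using D(3)[OF ab(1,2)] by (simp add: insert_absorb)
      also have "\<dots> = ?f i \<oplus>\<^bsub>R\<^esub> finsum R ?f ({..i + j} - {i})"
        using c by (intro M.finsum_insert) auto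
      finally have eq: "\<phi> (a \<otimes>\<^bsub>B\<^esub> b) (i + j) = ?f i \<oplus>\<^bsub>R\<^esub> finsum R ?f ({..i + j} - {i})" .
      have "\<phi> (a \<otimes>\<^bsub>B\<^esub> b) (i + j) \<in> M" using ab(3) by blast
      then have e: "?f i \<oplus>\<^bsub>R\<^esub> finsum R ?f ({..i + j} - {i}) \<in> M" by (simp only: eq)
      have "(?f i \<oplus>\<^bsub>R\<^esub> finsum R ?f ({..i + j} - {i})) \<oplus>\<^bsub>R\<^esub> \<ominus>\<^bsub>R\<^esub> finsum R ?f ({..i + j} - {i}) \<in> M"
        by (rule additive_subgroup.a_closed[OF M.additive_subgroup_axioms e
            additive_subgroup.a_inv_closed[OF M.additive_subgroup_axioms s]])
      moreover have "(?f i \<oplus>\<^bsub>R\<^esub> finsum R ?f ({..i + j} - {i})) \<oplus>\<^bsub>R\<^esub> \<ominus>\<^bsub>R\<^esub> finsum R ?f ({..i + j} - {i}) = ?f i"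
        using M.Icarr[OF s] c by (simp add: M.a_assoc M.r_neg)
      ultimately have "\<phi> a i \<otimes>\<^bsub>R\<^esub> \<phi> b j \<in> M" by simp
      then show False using M.I_prime[of "\<phi> a i" "\<phi> b j"] c i j by auto
    qed
  qed
qed

section \<open>Monomials, polynomial rings and generic sequences\<close>

fun mon :: "('a, 'm) ring_scheme \<Rightarrow> 'a list \<Rightarrow> nat list \<Rightarrow> 'a" where
  "mon R (t # ts) (n # ns) = t [^]\<^bsub>R\<^esub> n \<otimes>\<^bsub>R\<^esub> mon R ts ns"
| "mon R _ _ = \<one>\<^bsub>R\<^esub>"

lemma mon_closed:
  assumes "cring R" "set ts \<subseteq> carrier R"
  shows "mon R ts ns \<in> carrier R"
proof -
  interpret cring R by fact
  show ?thesis using assms(2)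
  proof (induction ts arbitrary: ns)
    case (Cons t ts) then show ?case by (cases ns) auto
  qed simp
qed

lemma mon_hom:
  assumes "cring R" "cring S" "h \<in> ring_hom R S" "set ts \<subseteq> carrier R"
  shows "h (mon R ts ns) = mon S (map h ts) ns"
proof -
  interpret h: ring_hom_cring R S h using assms by (intro ring_hom_cringI)
  show ?thesis
    using assms(4)
  proof (induction ts arbitrary: ns)
    case Nil then show ?case by simp
  next
    case (Cons t ts) then show ?case
      using mon_closed[OF h.R.is_cring, of ts] by (cases ns) auto
  qed
qed

lemma UP_simps:
  assumes "cring R"
  shows "p \<in> carrier (UP R) \<Longrightarrow> p n \<in> carrier R"
    "p \<in> carrier (UP R) \<Longrightarrow> q \<in> carrier (UP R) \<Longrightarrow> (p \<oplus>\<^bsub>UP R\<^esub> q) n = p n \<oplus>\<^bsub>R\<^esub> q n"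
    "p \<in> carrier (UP R) \<Longrightarrow> q \<in> carrier (UP R) \<Longrightarrow> (p \<otimes>\<^bsub>UP R\<^esub> q) n = (\<Oplus>\<^bsub>R\<^esub>i \<in> {..n}. p i \<otimes>\<^bsub>R\<^esub> q (n - i))"
    "\<one>\<^bsub>UP R\<^esub> n = (if n = 0 then \<one>\<^bsub>R\<^esub> else \<zero>\<^bsub>R\<^esub>)"
    "\<zero>\<^bsub>UP R\<^esub> n = \<zero>\<^bsub>R\<^esub>"
    "a \<in> carrier R \<Longrightarrow> up_ring.monom (UP R) a m n = (if n = m then a else \<zero>\<^bsub>R\<^esub>)"
    "p \<in> carrier (UP R) \<Longrightarrow> up_ring.coeff (UP R) p n = p n"
  by (auto simp: UP_def)

lemma UP_cringI: "cring R \<Longrightarrow> UP_cring R"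
  by (rule UP_cring.intro)

lemma UP_is_cring: "cring R \<Longrightarrow> cring (UP R)"
  using UP_cring.UP_cring[OF UP_cringI] by blast

lemma UP_ps_hom:
  assumes "cring R" shows "ps_hom (UP R) R (\<lambda>p. p)"
  using UP_simps[OF assms] by (simp add: ps_hom_def)

text \<open>A polynomial is determined by a finite list of coefficients, and lists over an infinite
  type can be encoded in that type.\<close>

lemma realize_UP:
  fixes R :: "'u ring"
  assumes "infinite (UNIV :: 'u set)" "cring R"
  shows "\<exists>(C :: 'u ring) h. cring C \<and> h \<in> ring_hom (UP R) C \<and> bij_betw h (carrier (UP R)) (carrier C)"
proof -
  obtain e :: "'u list \<Rightarrow> 'u" where e: "inj e" using ex_inj_list[OF assms(1)] by blast
  let ?g = "\<lambda>xs i. if i < length xs then xs ! i else \<zero>\<^bsub>R\<^esub>"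
  have "carrier (UP R) \<subseteq> range ?g"
  proof
    fix p assume "p \<in> carrier (UP R)"
    then obtain n where "bound \<zero>\<^bsub>R\<^esub> n p" by (auto simp: UP_def up_def)
    then have n: "\<And>i. n < i \<Longrightarrow> p i = \<zero>\<^bsub>R\<^esub>" by (auto simp: bound_def)
    have "p = ?g (map p [0..<Suc n])"
    proof
      fix i show "p i = ?g (map p [0..<Suc n]) i"
        using n[of i] by (cases "i < Suc n") (auto simp del: upt_Suc)
    qed
    then show "p \<in> range ?g" by (rule range_eqI)
  qed
  from realize[OF UP_is_cring[OF assms(2)] this e] show ?thesis .
qed

lemma ring_hom_finsum:
  assumes "cring R" "cring S" "h \<in> ring_hom R S" "\<And>a. a \<in> A \<Longrightarrow> f a \<in> carrier R"
  shows "h (finsum R f A) = finsum S (\<lambda>a. h (f a)) A"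
proof -
  interpret h: ring_hom_cring R S h using assms by (intro ring_hom_cringI)
  show ?thesis using assms(4) by (subst h.hom_finsum) (auto simp: comp_def)
qed

text \<open>The residues of \<open>Ts\<close> in \<open>R / MM\<close> are algebraically independent over \<open>k / M\<close>.\<close>

definition generic_seq :: "('u, 'k) ring_scheme \<Rightarrow> 'u set \<Rightarrow> ('a, 'm) ring_scheme \<Rightarrow> ('u \<Rightarrow> 'a) \<Rightarrow> 'a set \<Rightarrow> 'a list \<Rightarrow> bool" where
  "generic_seq k M R \<rho> MM Ts \<longleftrightarrow>
     (\<forall>A c. finite A \<and> (\<forall>\<alpha> \<in> A. length \<alpha> = length Ts) \<and> c \<in> A \<rightarrow> carrier k \<and>
        (\<Oplus>\<^bsub>R\<^esub>\<alpha> \<in> A. \<rho> (c \<alpha>) \<otimes>\<^bsub>R\<^esub> mon R Ts \<alpha>) \<in> MM \<longrightarrow> (\<forall>\<alpha> \<in> A. c \<alpha> \<in> M))"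

text \<open>\<open>R\<close> is the polynomial ring over \<open>k\<close> in \<open>d\<close>
  variables, \<open>Ts\<close> are the variables, and \<open>MM\<close> consists of the polynomials
  with all coefficients in \<open>M\<close>. The variables are adjoined one at a time, so that only
  polynomial rings in one variable have to be transported to \<open>'u\<close>.\<close>

lemma ex_generic_seq:
  fixes k :: "'u ring"
  assumes inf: "infinite (UNIV :: 'u set)" and k: "domain k" and M: "primeideal M k"
  shows "\<exists>(R :: 'u ring) \<rho> MM Ts. domain R \<and> \<rho> \<in> ring_hom k R \<and> inj_on \<rho> (carrier k) \<and> primeideal MM R \<and>
    \<rho> ` M \<subseteq> MM \<and> set Ts \<subseteq> carrier R \<and> length Ts = d \<and> generic_seq k M R \<rho> MM Ts"
proof (induction d)
  case 0
  interpret k: domain k by fact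
  have "generic_seq k M k (\<lambda>x. x) M []"
    unfolding generic_seq_def
  proof (intro allI impI ballI, elim conjE)
    fix A :: "nat list set" and c \<alpha>
    assume A: "\<forall>\<alpha> \<in> A. length \<alpha> = length []" "c \<in> A \<rightarrow> carrier k" "\<alpha> \<in> A"
      "(\<Oplus>\<^bsub>k\<^esub>\<alpha> \<in> A. c \<alpha> \<otimes>\<^bsub>k\<^esub> mon k [] \<alpha>) \<in> M"
    then have "A = {[]}" "\<alpha> = []" by auto
    then show "c \<alpha> \<in> M" using A by simp
  qed
  then show ?case using k M by (intro exI[of _ k] exI[of _ "\<lambda>x. x"] exI[of _ M] exI[of _ "[]"]) (auto simp: id_ring_hom[unfolded id_def])
next
  case (Suc d)
  then obtain R :: "'u ring" and \<rho> MM Ts where R: "domain R" and \<rho>: "\<rho> \<in> ring_hom k R" "inj_on \<rho> (carrier k)"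
    and MM: "primeideal MM R" "\<rho> ` M \<subseteq> MM" and Ts: "set Ts \<subseteq> carrier R" "length Ts = d"
    and gen: "generic_seq k M R \<rho> MM Ts" by blast
  interpret R: domain R by fact
  interpret k: domain k by fact
  interpret MM: primeideal MM R by fact
  interpret U: UP_domain R "UP R" by (rule UP_domain.intro[OF R])
  obtain C :: "'u ring" and h where C: "cring C" "h \<in> ring_hom (UP R) C" "bij_betw h (carrier (UP R)) (carrier C)"
    using realize_UP[OF inf R.is_cring] by blast
  interpret C: cring C by fact
  interpret h: ring_hom_cring "UP R" C h using C U.P.is_cring by (intro ring_hom_cringI)
  have hinj: "inj_on h (carrier (UP R))" and hsurj: "h ` carrier (UP R) = carrier C"
    using C(3) by (auto simp: bij_betw_def)
  have hE: "\<exists>p \<in> carrier (UP R). x = h p" if "x \<in> carrier C" for x using that hsurj by blast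
  let ?c = "\<lambda>a. up_ring.monom (UP R) a 0" and ?X = "up_ring.monom (UP R) \<one>\<^bsub>R\<^esub> (Suc 0)"
  define P where "P = {p \<in> carrier (UP R). \<forall>i. p i \<in> MM}"
  have P: "primeideal P (UP R)"
    unfolding P_def by (rule ps_hom_primeideal[OF U.P.is_cring MM(1) UP_ps_hom[OF R.is_cring]])
  interpret P: primeideal P "UP R" by fact
  define \<rho>' where "\<rho>' = (\<lambda>x. h (?c (\<rho> x)))"
  define Ts' where "Ts' = h ?X # map (\<lambda>a. h (?c a)) Ts"
  have cR: "(\<lambda>a. h (?c a)) \<in> ring_hom R C"
    using ring_hom_trans[OF U.const_ring_hom C(2)] by (simp add: comp_def)
  have \<rho>': "\<rho>' \<in> ring_hom k C" unfolding \<rho>'_def using ring_hom_trans[OF \<rho>(1) cR] by (simp add: comp_def)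
  have "inj_on \<rho>' (carrier k)"
  proof (rule inj_onI)
    fix x y assume "x \<in> carrier k" "y \<in> carrier k" "\<rho>' x = \<rho>' y"
    moreover from this have "\<rho> x \<in> carrier R" "\<rho> y \<in> carrier R" using ring_hom_closed[OF \<rho>(1)] by auto
    ultimately have "?c (\<rho> x) = ?c (\<rho> y)" unfolding \<rho>'_def by (intro inj_onD[OF hinj]) auto
    then have "\<rho> x = \<rho> y" using U.monom_inj[of 0] \<open>\<rho> x \<in> carrier R\<close> \<open>\<rho> y \<in> carrier R\<close> by (auto dest: inj_onD)
    then show "x = y" using \<rho>(2) \<open>x \<in> carrier k\<close> \<open>y \<in> carrier k\<close> by (auto dest: inj_onD)
  qed
  moreover have "domain C"
  proof (rule domainI[OF C(1)])
    have "h \<one>\<^bsub>UP R\<^esub> \<noteq> h \<zero>\<^bsub>UP R\<^esub>" using inj_onD[OF hinj, of "\<one>\<^bsub>UP R\<^esub>" "\<zero>\<^bsub>UP R\<^esub>"] by auto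
    then show "\<one>\<^bsub>C\<^esub> \<noteq> \<zero>\<^bsub>C\<^esub>" by simp
    fix a b assume ab: "a \<otimes>\<^bsub>C\<^esub> b = \<zero>\<^bsub>C\<^esub>" "a \<in> carrier C" "b \<in> carrier C"
    obtain p where p: "p \<in> carrier (UP R)" "a = h p" using hE[OF ab(2)] by blast
    obtain q where q: "q \<in> carrier (UP R)" "b = h q" using hE[OF ab(3)] by blast
    note pq = p(1) q(1) p(2) q(2)
    then have "h (p \<otimes>\<^bsub>UP R\<^esub> q) = h \<zero>\<^bsub>UP R\<^esub>" using ab by simp
    then have "p \<otimes>\<^bsub>UP R\<^esub> q = \<zero>\<^bsub>UP R\<^esub>" using pq by (intro inj_onD[OF hinj]) auto
    then show "a = \<zero>\<^bsub>C\<^esub> \<or> b = \<zero>\<^bsub>C\<^esub>" using pq U.UP_integral[of p q] by auto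
  qed
  moreover
  obtain g where g: "g \<in> ring_hom C (UP R)" "\<And>p. p \<in> carrier (UP R) \<Longrightarrow> g (h p) = p"
  proof -
    have "p = \<zero>\<^bsub>UP R\<^esub>" if "p \<in> carrier (UP R)" "h p = \<zero>\<^bsub>C\<^esub>" for p
      using inj_onD[OF hinj, of p "\<zero>\<^bsub>UP R\<^esub>"] that by simp
    then show thesis
      using hom_factor[OF U.P.is_cring C(1) U.P.is_cring C(2) hsurj[symmetric], of "\<lambda>x. x"] id_ring_hom[of "UP R"] that
      by (auto simp: id_def)
  qed
  define P' where "P' = {x \<in> carrier C. g x \<in> P}"
  have hP: "h p \<in> P' \<longleftrightarrow> p \<in> P" if "p \<in> carrier (UP R)" for p using that g(2) by (simp add: P'_def)
  have "primeideal P' C"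
    unfolding P'_def by (rule ring_hom_ring.primeideal_vimage[OF ring_hom_ringI2[OF C.ring_axioms U.P.ring_axioms g(1)] C(1) P])
  moreover have "\<rho>' ` M \<subseteq> P'"
  proof
    fix y assume "y \<in> \<rho>' ` M"
    then obtain m where m: "m \<in> M" "y = \<rho>' m" by blast
    then have "\<rho> m \<in> MM" using MM by auto
    then have "?c (\<rho> m) \<in> P" unfolding P_def using MM.Icarr UP_simps(6)[OF R.is_cring] by auto
    then show "y \<in> P'" using m hP[OF P.Icarr] by (simp add: \<rho>'_def)
  qed
  moreover have "set Ts' \<subseteq> carrier C" using Ts unfolding Ts'_def by auto
  moreover have "length Ts' = Suc d" using Ts by (simp add: Ts'_def)
  moreover have "generic_seq k M C \<rho>' (P') Ts'"
    unfolding generic_seq_def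
  proof (intro allI impI ballI, elim conjE)
    fix A c \<alpha>
    assume A: "finite A" "\<forall>\<alpha> \<in> A. length \<alpha> = length Ts'" "c \<in> A \<rightarrow> carrier k" "\<alpha> \<in> A"
      and s: "(\<Oplus>\<^bsub>C\<^esub>\<alpha> \<in> A. \<rho>' (c \<alpha>) \<otimes>\<^bsub>C\<^esub> mon C Ts' \<alpha>) \<in> P'"
    have cc: "\<rho> (c \<beta>) \<in> carrier R" if "\<beta> \<in> A" for \<beta> using A(3) that ring_hom_closed[OF \<rho>(1)] by auto
    have mc: "mon R Ts \<beta> \<in> carrier R" for \<beta> by (rule mon_closed[OF R.is_cring Ts(1)])
    let ?t = "\<lambda>\<beta>. up_ring.monom (UP R) (\<rho> (c \<beta>) \<otimes>\<^bsub>R\<^esub> mon R Ts (tl \<beta>)) (hd \<beta>)"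
    have tm: "\<rho>' (c \<beta>) \<otimes>\<^bsub>C\<^esub> mon C Ts' \<beta> = h (?t \<beta>)" if \<beta>: "\<beta> \<in> A" for \<beta>
    proof -
      obtain j \<gamma> where j: "\<beta> = j # \<gamma>" using A(2) \<beta> Ts by (cases \<beta>) (auto simp: Ts'_def)
      have "mon C Ts' \<beta> = h (?X [^]\<^bsub>UP R\<^esub> j \<otimes>\<^bsub>UP R\<^esub> ?c (mon R Ts \<gamma>))"
        unfolding j Ts'_def using mon_hom[OF R.is_cring C(1) cR Ts(1), of \<gamma>] mc by simp
      then have "\<rho>' (c \<beta>) \<otimes>\<^bsub>C\<^esub> mon C Ts' \<beta> = h (?c (\<rho> (c \<beta>)) \<otimes>\<^bsub>UP R\<^esub> (?X [^]\<^bsub>UP R\<^esub> j \<otimes>\<^bsub>UP R\<^esub> ?c (mon R Ts \<gamma>)))"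
        unfolding \<rho>'_def using cc[OF \<beta>] mc by simp
      also have "?X [^]\<^bsub>UP R\<^esub> j = up_ring.monom (UP R) \<one>\<^bsub>R\<^esub> j" using U.monom_pow[of "\<one>\<^bsub>R\<^esub>" 1 j] by simp
      also have "?c (\<rho> (c \<beta>)) \<otimes>\<^bsub>UP R\<^esub> (up_ring.monom (UP R) \<one>\<^bsub>R\<^esub> j \<otimes>\<^bsub>UP R\<^esub> ?c (mon R Ts \<gamma>)) = ?t \<beta>"
        using cc[OF \<beta>] mc by (simp add: U.monom_mult[symmetric] j del: U.monom_mult)
      finally show ?thesis .
    qed
    have tc: "?t \<beta> \<in> carrier (UP R)" if "\<beta> \<in> A" for \<beta> using cc[OF that] mc by simp
    have "(\<Oplus>\<^bsub>C\<^esub>\<alpha> \<in> A. \<rho>' (c \<alpha>) \<otimes>\<^bsub>C\<^esub> mon C Ts' \<alpha>) = (\<Oplus>\<^bsub>C\<^esub>\<alpha> \<in> A. h (?t \<alpha>))"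
      using tm tc by (intro C.finsum_cong') auto
    also have "\<dots> = h (\<Oplus>\<^bsub>UP R\<^esub>\<alpha> \<in> A. ?t \<alpha>)"
      using ring_hom_finsum[OF U.P.is_cring C(1,2), of A ?t] tc by simp
    finally have hs: "h (\<Oplus>\<^bsub>UP R\<^esub>\<alpha> \<in> A. ?t \<alpha>) \<in> P'" using s by simp
    define p where "p = (\<Oplus>\<^bsub>UP R\<^esub>\<alpha> \<in> A. ?t \<alpha>)"
    have pc: "p \<in> carrier (UP R)" unfolding p_def using tc by (intro U.P.finsum_closed) blast
    then have "p \<in> P" using hP[OF pc] hs by (simp add: p_def)
    then have "p i \<in> MM" for i unfolding P_def by blast
    then have coeff: "up_ring.coeff (UP R) p i \<in> MM" for i
      by (subst UP_simps(7)[OF R.is_cring pc])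
    obtain j \<gamma> where j: "\<alpha> = j # \<gamma>" using A(2,4) Ts by (cases \<alpha>) (auto simp: Ts'_def)
    define A' where "A' = {\<beta>. j # \<beta> \<in> A}"
    have fA': "finite A'" unfolding A'_def
      using finite_vimageI[OF A(1), of "(#) j"] by (simp add: vimage_def)
    have inA': "j # \<beta> \<in> A" if "\<beta> \<in> A'" for \<beta> using that by (simp add: A'_def)
    \<comment> \<open>The coefficient at the j-th power of the new variable collects the terms whose
      exponent list starts with j. It is a polynomial in the old variables, to which the induction
      hypothesis applies.\<close>
    have "up_ring.coeff (UP R) p j = (\<Oplus>\<^bsub>R\<^esub>\<alpha> \<in> A. up_ring.coeff (UP R) (?t \<alpha>) j)"
      unfolding p_def using tc by (intro U.coeff_finsum[OF A(1)]) blast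
    also have "\<dots> = (\<Oplus>\<^bsub>R\<^esub>\<alpha> \<in> A. if hd \<alpha> = j then \<rho> (c \<alpha>) \<otimes>\<^bsub>R\<^esub> mon R Ts (tl \<alpha>) else \<zero>\<^bsub>R\<^esub>)"
      using cc mc by (intro R.finsum_cong') auto
    also have "\<dots> = (\<Oplus>\<^bsub>R\<^esub>\<alpha> \<in> (#) j ` A'. \<rho> (c \<alpha>) \<otimes>\<^bsub>R\<^esub> mon R Ts (tl \<alpha>))"
    proof (rule R.add.finprod_mono_neutral_cong_right)
      show "finite A" by fact
      show "(#) j ` A' \<subseteq> A" by (auto simp: A'_def)
      show "(if hd \<beta> = j then \<rho> (c \<beta>) \<otimes>\<^bsub>R\<^esub> mon R Ts (tl \<beta>) else \<zero>\<^bsub>R\<^esub>) = \<zero>\<^bsub>R\<^esub>"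
        if "\<beta> \<in> A - (#) j ` A'" for \<beta>
        using that A(2) by (cases \<beta>) (auto simp: A'_def Ts'_def)
    qed (use cc mc in \<open>auto simp: A'_def\<close>)
    also have "\<dots> = (\<Oplus>\<^bsub>R\<^esub>\<beta> \<in> A'. \<rho> (c (j # \<beta>)) \<otimes>\<^bsub>R\<^esub> mon R Ts \<beta>)"
      using cc[OF inA'] mc by (subst R.finsum_reindex) auto
    finally have "(\<Oplus>\<^bsub>R\<^esub>\<beta> \<in> A'. \<rho> (c (j # \<beta>)) \<otimes>\<^bsub>R\<^esub> mon R Ts \<beta>) \<in> MM" using coeff[of j] by simp
    moreover have "\<forall>\<beta> \<in> A'. length \<beta> = length Ts" using inA' A(2) by (fastforce simp: Ts'_def)
    moreover have "(\<lambda>\<beta>. c (j # \<beta>)) \<in> A' \<rightarrow> carrier k" using inA' A(3) by auto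
    ultimately have "\<forall>\<beta> \<in> A'. c (j # \<beta>) \<in> M"
      using gen[unfolded generic_seq_def, rule_format, of A' "\<lambda>\<beta>. c (j # \<beta>)"] fA' by blast
    then show "c \<alpha> \<in> M" using A(4) j by (auto simp: A'_def)
  qed
  ultimately show ?case using \<rho>' by blast
qed

section \<open>From first-order arcs to power series arcs\<close>

lemma algebras_restrictI:
  assumes "cring C" "\<rho> \<in> ring_hom k C" "cring k"
  shows "(C, restrict \<rho> (carrier k)) \<in> algebras k"
proof -
  interpret k: cring k by fact
  show ?thesis using assms(1,2) by (auto simp: algebras_def ring_hom_def Pi_iff)
qed

lemma restrict_ring_hom:
  assumes "ring R" "f \<in> ring_hom R S" shows "restrict f (carrier R) \<in> ring_hom R S"
proof -
  interpret ring R by fact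
  show ?thesis using assms(2) by (auto simp: ring_hom_def Pi_iff)
qed

lemma alg_hom_restrictI:
  assumes "A \<in> algebras k" "f \<in> ring_hom (fst A) (fst B)" "\<And>x. x \<in> carrier k \<Longrightarrow> f (snd A x) = snd B x"
  shows "restrict f (carrier (fst A)) \<in> alg_hom k A B"
proof -
  have "ring (fst A)" "\<And>x. x \<in> carrier k \<Longrightarrow> snd A x \<in> carrier (fst A)"
    using assms(1) by (auto simp: algebras_def ring_hom_def cring_def)
  then show ?thesis using assms restrict_ring_hom[of "fst A" f "fst B"] by (auto simp: alg_hom_def)
qed

lemma algebrasD:
  assumes "B \<in> algebras k"
  shows "cring (fst B)" "snd B \<in> ring_hom k (fst B)" "x \<in> carrier k \<Longrightarrow> snd B x \<in> carrier (fst B)"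
  using assms by (auto simp: algebras_def ring_hom_def)

lemma alg_homD:
  assumes "f \<in> alg_hom k A B"
  shows "f \<in> ring_hom (fst A) (fst B)" "x \<in> carrier k \<Longrightarrow> f (snd A x) = snd B x"
    "a \<in> carrier (fst A) \<Longrightarrow> f a \<in> carrier (fst B)"
  using assms by (auto simp: alg_hom_def ring_hom_def)

text \<open>Formal smoothness of the affine scheme \<open>Spec B\<close>, written for homomorphisms
  out of \<open>B\<close> in place of points.\<close>

definition lifting_property :: "'u ring \<Rightarrow> 'u alg \<Rightarrow> bool" where
  "lifting_property k B \<longleftrightarrow>
     (\<forall>A \<in> algebras k. \<forall>A' \<in> algebras k. \<forall>p \<in> alg_hom k A A'. \<forall>f \<in> alg_hom k B A'.
        p ` carrier (fst A) = carrier (fst A') \<and>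
        (\<forall>a \<in> a_kernel (fst A) (fst A') p. \<forall>b \<in> a_kernel (fst A) (fst A') p.
           a \<otimes>\<^bsub>fst A\<^esub> b = \<zero>\<^bsub>fst A\<^esub>) \<longrightarrow>
        (\<exists>g \<in> alg_hom k B A. \<forall>b \<in> carrier (fst B). p (g b) = f b))"

lemma lifting_propertyD:
  fixes k C C' :: "'u ring"
  assumes L: "lifting_property k B" and B: "B \<in> algebras k" and k: "cring k"
    and C: "cring C" "cring C'" and \<rho>: "\<rho> \<in> ring_hom k C" and \<pi>: "\<pi> \<in> ring_hom C C'" "\<pi> ` carrier C = carrier C'"
    and sq: "\<And>a b. a \<in> carrier C \<Longrightarrow> b \<in> carrier C \<Longrightarrow> \<pi> a = \<zero>\<^bsub>C'\<^esub> \<Longrightarrow> \<pi> b = \<zero>\<^bsub>C'\<^esub> \<Longrightarrow> a \<otimes>\<^bsub>C\<^esub> b = \<zero>\<^bsub>C\<^esub>"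
    and f: "f \<in> ring_hom (fst B) C'" "\<And>x. x \<in> carrier k \<Longrightarrow> f (snd B x) = \<pi> (\<rho> x)"
  shows "\<exists>g \<in> ring_hom (fst B) C. (\<forall>b \<in> carrier (fst B). \<pi> (g b) = f b) \<and> (\<forall>x \<in> carrier k. g (snd B x) = \<rho> x)"
proof -
  let ?A = "(C, restrict \<rho> (carrier k))" and ?A' = "(C', restrict (\<lambda>x. \<pi> (\<rho> x)) (carrier k))"
  have A: "?A \<in> algebras k" "?A' \<in> algebras k"
    using algebras_restrictI[OF C(1) \<rho> k] algebras_restrictI[OF C(2) ring_hom_trans[OF \<rho> \<pi>(1)] k]
    by (simp_all add: comp_def)
  have \<rho>c: "\<rho> x \<in> carrier C" if "x \<in> carrier k" for x using ring_hom_closed[OF \<rho> that] .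
  let ?p = "restrict \<pi> (carrier C)"
  have p: "?p \<in> alg_hom k ?A ?A'"
    using alg_hom_restrictI[OF A(1), of \<pi> ?A'] \<pi>(1) by simp
  have f': "restrict f (carrier (fst B)) \<in> alg_hom k B ?A'"
    using alg_hom_restrictI[OF B, of f ?A'] f by simp
  have im: "?p ` carrier (fst ?A) = carrier (fst ?A')" using \<pi>(2) by auto
  have ker: "\<forall>a \<in> a_kernel (fst ?A) (fst ?A') ?p. \<forall>b \<in> a_kernel (fst ?A) (fst ?A') ?p.
      a \<otimes>\<^bsub>fst ?A\<^esub> b = \<zero>\<^bsub>fst ?A\<^esub>"
    using sq by (auto simp: a_kernel_def')
  have "\<exists>g \<in> alg_hom k B ?A. \<forall>b \<in> carrier (fst B). ?p (g b) = restrict f (carrier (fst B)) b"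
    using L[unfolded lifting_property_def, rule_format, OF A p f'] im ker by blast
  then obtain g where g: "g \<in> alg_hom k B ?A" "\<And>b. b \<in> carrier (fst B) \<Longrightarrow> ?p (g b) = restrict f (carrier (fst B)) b"
    by blast
  have "g \<in> ring_hom (fst B) C" using alg_homD(1)[OF g(1)] by simp
  moreover have "\<pi> (g b) = f b" if "b \<in> carrier (fst B)" for b
    using g(2)[OF that] that alg_homD(3)[OF g(1) that] by simp
  moreover have "g (snd B x) = \<rho> x" if "x \<in> carrier k" for x
    using alg_homD(2)[OF g(1) that] that by simp
  ultimately show ?thesis by blast
qed

text \<open>The ring \<open>C\<close> is R[s] modulo s^n. It is obtained in two transports, of R[s]
  and of its quotient, and only the projection from R[s] is remembered.\<close>

lemma ex_truncation:
  fixes R :: "'u ring"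
  assumes inf: "infinite (UNIV :: 'u set)" and R: "cring R"
  shows "\<exists>(C :: 'u ring) \<pi>. cring C \<and> \<pi> \<in> ring_hom (UP R) C \<and> \<pi> ` carrier (UP R) = carrier C \<and>
    (\<forall>p \<in> carrier (UP R). \<forall>q \<in> carrier (UP R). \<pi> p = \<pi> q \<longleftrightarrow> (\<forall>i < n. p i = q i))"
proof -
  interpret R: cring R by fact
  interpret U: UP_cring R "UP R" by (rule UP_cringI[OF R])
  obtain D :: "'u ring" and h where D: "cring D" "h \<in> ring_hom (UP R) D" "bij_betw h (carrier (UP R)) (carrier D)"
    using realize_UP[OF inf R] by blast
  interpret D: cring D by fact
  interpret h: ring_hom_cring "UP R" D h using D U.P.is_cring by (intro ring_hom_cringI)
  define I where "I = {p \<in> carrier (UP R). \<forall>i < n. p i = \<zero>\<^bsub>R\<^esub>}"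
  note S = UP_simps[OF R]
  have neg: "(\<ominus>\<^bsub>UP R\<^esub> p) i = \<ominus>\<^bsub>R\<^esub> p i" if "p \<in> carrier (UP R)" for p i
    using U.coeff_a_inv[OF that, of i] S(7)[OF that] S(7)[OF U.P.a_inv_closed[OF that]] by simp
  have mult: "p \<otimes>\<^bsub>UP R\<^esub> q \<in> I" if "p \<in> carrier (UP R)" "q \<in> I" for p q
  proof -
    have q: "q \<in> carrier (UP R)" "\<And>i. i < n \<Longrightarrow> q i = \<zero>\<^bsub>R\<^esub>" using that by (auto simp: I_def)
    have "(p \<otimes>\<^bsub>UP R\<^esub> q) i = \<zero>\<^bsub>R\<^esub>" if i: "i < n" for i
    proof -
      have "(p \<otimes>\<^bsub>UP R\<^esub> q) i = (\<Oplus>\<^bsub>R\<^esub>j \<in> {..i}. p j \<otimes>\<^bsub>R\<^esub> q (i - j))" by (rule S(3)[OF \<open>p \<in> carrier (UP R)\<close> q(1)])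
      also have "\<dots> = (\<Oplus>\<^bsub>R\<^esub>j \<in> {..i}. \<zero>\<^bsub>R\<^esub>)"
        using q(2) i S(1)[OF \<open>p \<in> carrier (UP R)\<close>] by (intro R.finsum_cong') auto
      finally show ?thesis by simp
    qed
    then show ?thesis using that(1) q(1) by (auto simp: I_def)
  qed
  have I: "ideal (h ` I) D"
  proof (rule ideal_image[OF U.P.is_cring D(1,2)])
    show "ideal I (UP R)" by (rule U.P.ideal_commI) (use mult S(2,5) in \<open>auto simp: I_def\<close>)
  qed (use D(3) in \<open>simp add: bij_betw_def\<close>)
  obtain C :: "'u ring" and \<pi> where C: "cring C" "\<pi> \<in> ring_hom D C" "\<pi> ` carrier D = carrier C"
    "\<forall>b \<in> carrier D. \<pi> b = \<zero>\<^bsub>C\<^esub> \<longleftrightarrow> b \<in> h ` I"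
    using realize_quotient[OF D(1) I] by blast
  interpret C: cring C by fact
  have ph: "\<pi> \<circ> h \<in> ring_hom (UP R) C" by (rule ring_hom_trans[OF D(2) C(2)])
  interpret ph: ring_hom_cring "UP R" C "\<pi> \<circ> h" using C ph U.P.is_cring by (intro ring_hom_cringI)
  have z: "(\<pi> \<circ> h) p = \<zero>\<^bsub>C\<^esub> \<longleftrightarrow> (\<forall>i < n. p i = \<zero>\<^bsub>R\<^esub>)" if "p \<in> carrier (UP R)" for p
  proof -
    have "(\<pi> \<circ> h) p = \<zero>\<^bsub>C\<^esub> \<longleftrightarrow> h p \<in> h ` I" using C(4) that by simp
    also have "\<dots> \<longleftrightarrow> p \<in> I"
      using that D(3) inj_on_image_mem_iff[of h "carrier (UP R)" p I] by (auto simp: bij_betw_def I_def)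
    finally show ?thesis using that by (simp add: I_def)
  qed
  have e: "(\<pi> \<circ> h) p = (\<pi> \<circ> h) q \<longleftrightarrow> (\<forall>i < n. p i = q i)" if pq: "p \<in> carrier (UP R)" "q \<in> carrier (UP R)" for p q
  proof -
    have "(\<pi> \<circ> h) p = (\<pi> \<circ> h) q \<longleftrightarrow> (\<pi> \<circ> h) p \<ominus>\<^bsub>C\<^esub> (\<pi> \<circ> h) q = \<zero>\<^bsub>C\<^esub>"
      using C.r_right_minus_eq[of "(\<pi> \<circ> h) p" "(\<pi> \<circ> h) q"] ph.hom_closed pq by blast
    also have "(\<pi> \<circ> h) p \<ominus>\<^bsub>C\<^esub> (\<pi> \<circ> h) q = (\<pi> \<circ> h) (p \<oplus>\<^bsub>UP R\<^esub> \<ominus>\<^bsub>UP R\<^esub> q)"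
      unfolding C.minus_eq ph.hom_a_inv[OF pq(2), symmetric] using pq by (intro ph.hom_add[symmetric]) auto
    also have "\<dots> = \<zero>\<^bsub>C\<^esub> \<longleftrightarrow> (\<forall>i < n. p i \<oplus>\<^bsub>R\<^esub> \<ominus>\<^bsub>R\<^esub> q i = \<zero>\<^bsub>R\<^esub>)"
      using z[of "p \<oplus>\<^bsub>UP R\<^esub> \<ominus>\<^bsub>UP R\<^esub> q"] pq S(2)[OF pq(1) U.P.a_inv_closed[OF pq(2)]] neg[OF pq(2)] by simp
    also have "\<dots> \<longleftrightarrow> (\<forall>i < n. p i = q i)"
      using S(1)[OF pq(1)] S(1)[OF pq(2)] R.r_right_minus_eq by (simp add: R.minus_eq[symmetric])
    finally show ?thesis .
  qed
  have "(\<pi> \<circ> h) ` carrier (UP R) = carrier C"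
    using C(3) D(3) unfolding image_comp[symmetric] by (simp add: bij_betw_def)
  then show ?thesis using C(1) ph e by blast
qed

text \<open>The homomorphism \<open>e + \<delta> s\<close> to the dual numbers lifts step by step to the quotients of the polynomial
  ring \<open>R[s]\<close> by \<open>s\<^sup>n\<close>, because their transition maps have square-zero kernels.\<close>

lemma ex_ps_lift:
  fixes k R :: "'u ring"
  assumes inf: "infinite (UNIV :: 'u set)" and R: "cring R" and k: "cring k" and \<rho>: "\<rho> \<in> ring_hom k R"
    and B: "B \<in> algebras k" and L: "lifting_property k B"
    and e: "e \<in> ring_hom (fst B) R" and \<delta>: "derivation R (carrier (fst B)) (fst B) e \<delta>"
    and ek: "\<And>x. x \<in> carrier k \<Longrightarrow> e (snd B x) = \<rho> x" and \<delta>k: "\<And>x. x \<in> carrier k \<Longrightarrow> \<delta> (snd B x) = \<zero>\<^bsub>R\<^esub>"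
  shows "\<exists>\<phi>. ps_hom (fst B) R \<phi> \<and> (\<forall>b \<in> carrier (fst B). \<phi> b 0 = e b \<and> \<phi> b 1 = \<delta> b) \<and>
    (\<forall>x \<in> carrier k. \<forall>i. \<phi> (snd B x) i = (if i = 0 then \<rho> x else \<zero>\<^bsub>R\<^esub>))"
proof -
  interpret R: cring R by fact
  interpret U: UP_cring R "UP R" by (rule UP_cringI[OF R])
  interpret B: cring "fst B" by (rule algebrasD(1)[OF B])
  note S = UP_simps[OF R]
  have "\<exists>(C :: nat \<Rightarrow> 'u ring) \<pi>. \<forall>n. cring (C n) \<and> \<pi> n \<in> ring_hom (UP R) (C n) \<and>
    \<pi> n ` carrier (UP R) = carrier (C n) \<and>
    (\<forall>p \<in> carrier (UP R). \<forall>q \<in> carrier (UP R). \<pi> n p = \<pi> n q \<longleftrightarrow> (\<forall>i < n. p i = q i))"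
    using ex_truncation[OF inf R] by metis
  then obtain C :: "nat \<Rightarrow> 'u ring" and \<pi> where C: "\<And>n. cring (C n)" and \<pi>: "\<And>n. \<pi> n \<in> ring_hom (UP R) (C n)"
    and sur: "\<And>n. \<pi> n ` carrier (UP R) = carrier (C n)"
    and eq: "\<And>n p q. p \<in> carrier (UP R) \<Longrightarrow> q \<in> carrier (UP R) \<Longrightarrow> \<pi> n p = \<pi> n q \<longleftrightarrow> (\<forall>i < n. p i = q i)"
    by blast
  have \<pi>0: "\<pi> n \<zero>\<^bsub>UP R\<^esub> = \<zero>\<^bsub>C n\<^esub>" for n
    using ring_hom_zero[OF \<pi>[of n] U.P.ring_axioms cring.axioms(1)[OF C]] .
  have \<pi>z: "\<pi> n p = \<zero>\<^bsub>C n\<^esub> \<longleftrightarrow> (\<forall>i < n. p i = \<zero>\<^bsub>R\<^esub>)" if "p \<in> carrier (UP R)" for n p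
    using eq[OF that U.P.zero_closed, of n] \<pi>0 S(5) by simp
  have "\<exists>t. t \<in> ring_hom (C (Suc n)) (C n) \<and> (\<forall>p \<in> carrier (UP R). t (\<pi> (Suc n) p) = \<pi> n p)" for n
  proof -
    have "\<pi> n p = \<zero>\<^bsub>C n\<^esub>" if "p \<in> carrier (UP R)" "\<pi> (Suc n) p = \<zero>\<^bsub>C (Suc n)\<^esub>" for p
      using that \<pi>z[OF that(1)] by simp
    then show ?thesis
      using hom_factor[OF U.P.is_cring C[of "Suc n"] C[of n] \<pi> sur[symmetric] \<pi>] by blast
  qed
  then obtain tr where tr: "\<And>n. tr n \<in> ring_hom (C (Suc n)) (C n)"
    and trp: "\<And>n p. p \<in> carrier (UP R) \<Longrightarrow> tr n (\<pi> (Suc n) p) = \<pi> n p" by metis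
  have tr_sur: "tr n ` carrier (C (Suc n)) = carrier (C n)" for n
  proof -
    have "tr n ` carrier (C (Suc n)) = tr n ` \<pi> (Suc n) ` carrier (UP R)" using sur by simp
    also have "\<dots> = \<pi> n ` carrier (UP R)" unfolding image_image using trp by (intro image_cong) auto
    finally show ?thesis using sur by simp
  qed
  let ?c = "\<lambda>a. up_ring.monom (UP R) a 0"
  have cc: "?c a \<in> carrier (UP R)" if "a \<in> carrier R" for a using that by simp
  have \<rho>c: "\<rho> x \<in> carrier R" if "x \<in> carrier k" for x using ring_hom_closed[OF \<rho> that] .
  have str: "(\<lambda>x. \<pi> n (?c (\<rho> x))) \<in> ring_hom k (C n)" for n
    using ring_hom_trans[OF ring_hom_trans[OF \<rho> U.const_ring_hom] \<pi>[of n]] by (simp add: comp_def)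
  define g where "g b = (\<lambda>i :: nat. if i = 0 then e b else if i = 1 then \<delta> b else \<zero>\<^bsub>R\<^esub>)" for b
  have ec: "e b \<in> carrier R" and \<delta>c: "\<delta> b \<in> carrier R" if "b \<in> carrier (fst B)" for b
    using that ring_hom_closed[OF e] \<delta> by (auto simp: derivation_def)
  have gc: "g b \<in> carrier (UP R)" if "b \<in> carrier (fst B)" for b
  proof -
    have "bound \<zero>\<^bsub>R\<^esub> 1 (g b)" by (rule bound.intro) (auto simp: g_def)
    then show ?thesis using ec[OF that] \<delta>c[OF that] by (auto simp: UP_def up_def g_def)
  qed
  have less2: "(\<forall>i < 2. P i) \<longleftrightarrow> P 0 \<and> P (Suc 0)" for P :: "nat \<Rightarrow> bool" by (auto simp: numeral_2_eq_2 less_Suc_eq)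
  define f2 where "f2 b = \<pi> 2 (g b)" for b
  have f2: "f2 \<in> ring_hom (fst B) (C 2)"
  proof (rule ring_hom_memI)
    fix b assume "b \<in> carrier (fst B)" then show "f2 b \<in> carrier (C 2)"
      unfolding f2_def using gc ring_hom_closed[OF \<pi>] by blast
  next
    fix a b assume ab: "a \<in> carrier (fst B)" "b \<in> carrier (fst B)"
    have s2: "{..Suc 0} = {0, Suc 0}" by auto
    have "\<pi> 2 (g (a \<otimes>\<^bsub>fst B\<^esub> b)) = \<pi> 2 (g a \<otimes>\<^bsub>UP R\<^esub> g b)"
      unfolding eq[OF gc[OF B.m_closed[OF ab]] U.P.m_closed[OF gc gc, OF ab]] less2 S(3)[OF gc gc, OF ab]
      using ring_hom_mult[OF e ab] \<delta> ab ec[OF ab(1)] ec[OF ab(2)] \<delta>c[OF ab(1)] \<delta>c[OF ab(2)]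
      by (simp add: g_def s2 R.finsum_insert derivation_def R.m_comm)
    then show "f2 (a \<otimes>\<^bsub>fst B\<^esub> b) = f2 a \<otimes>\<^bsub>C 2\<^esub> f2 b"
      unfolding f2_def ring_hom_mult[OF \<pi> gc gc, OF ab, symmetric] .
    have "\<pi> 2 (g (a \<oplus>\<^bsub>fst B\<^esub> b)) = \<pi> 2 (g a \<oplus>\<^bsub>UP R\<^esub> g b)"
      unfolding eq[OF gc[OF B.a_closed[OF ab]] U.P.a_closed[OF gc gc, OF ab]] less2 S(2)[OF gc gc, OF ab]
      using ring_hom_add[OF e ab] \<delta> ab by (simp add: g_def derivation_def)
    then show "f2 (a \<oplus>\<^bsub>fst B\<^esub> b) = f2 a \<oplus>\<^bsub>C 2\<^esub> f2 b"
      unfolding f2_def ring_hom_add[OF \<pi> gc gc, OF ab, symmetric] .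
  next
    have "\<delta> (\<one>\<^bsub>fst B\<^esub> \<otimes>\<^bsub>fst B\<^esub> \<one>\<^bsub>fst B\<^esub>) = e \<one>\<^bsub>fst B\<^esub> \<otimes>\<^bsub>R\<^esub> \<delta> \<one>\<^bsub>fst B\<^esub> \<oplus>\<^bsub>R\<^esub> e \<one>\<^bsub>fst B\<^esub> \<otimes>\<^bsub>R\<^esub> \<delta> \<one>\<^bsub>fst B\<^esub>"
      using \<delta> B.one_closed unfolding derivation_def by blast
    then have "\<delta> \<one>\<^bsub>fst B\<^esub> = \<zero>\<^bsub>R\<^esub>" using \<delta>c[OF B.one_closed] ring_hom_one[OF e] by simp
    then have "\<pi> 2 (g \<one>\<^bsub>fst B\<^esub>) = \<pi> 2 \<one>\<^bsub>UP R\<^esub>"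
      unfolding eq[OF gc[OF B.one_closed] U.P.one_closed] less2 S(4)
      using ring_hom_one[OF e] by (simp add: g_def)
    then show "f2 \<one>\<^bsub>fst B\<^esub> = \<one>\<^bsub>C 2\<^esub>" unfolding f2_def using ring_hom_one[OF \<pi>] by simp
  qed
  have snc: "snd B x \<in> carrier (fst B)" if "x \<in> carrier k" for x using algebrasD(3)[OF B that] .
  have f2k: "f2 (snd B x) = \<pi> 2 (?c (\<rho> x))" if x: "x \<in> carrier k" for x
    unfolding f2_def eq[OF gc[OF snc[OF x]] cc[OF \<rho>c[OF x]]] less2
    using ek[OF x] \<delta>k[OF x] S(6)[OF \<rho>c[OF x]] by (simp add: g_def)
  \<comment> \<open>Level \<open>n\<close> lives modulo s^(n+2). The shift by 2 puts the given data,
    a homomorphism to the dual numbers, at level 0.\<close>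
  define P where "P n f \<longleftrightarrow> f \<in> ring_hom (fst B) (C (n + 2)) \<and> (\<forall>x \<in> carrier k. f (snd B x) = \<pi> (n + 2) (?c (\<rho> x))) \<and> (n = 0 \<longrightarrow> f = f2)"
    for n :: nat and f
  have "\<exists>f. \<forall>n. P n (f n) \<and> (\<forall>b \<in> carrier (fst B). tr (n + 2) (f (Suc n) b) = f n b)"
  proof (rule dependent_nat_choice)
    show "\<exists>f. P 0 f" using f2 f2k by (auto simp: P_def numeral_2_eq_2)
  next
    fix f n assume "P n f"
    then have f: "f \<in> ring_hom (fst B) (C (n + 2))" "\<And>x. x \<in> carrier k \<Longrightarrow> f (snd B x) = \<pi> (n + 2) (?c (\<rho> x))"
      by (auto simp: P_def)
    have "\<exists>g \<in> ring_hom (fst B) (C (Suc (n + 2))). (\<forall>b \<in> carrier (fst B). tr (n + 2) (g b) = f b) \<and>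
        (\<forall>x \<in> carrier k. g (snd B x) = \<pi> (Suc (n + 2)) (?c (\<rho> x)))"
    proof (rule lifting_propertyD[OF L B k C C str tr tr_sur _ f(1)])
      show "f (snd B x) = tr (n + 2) (\<pi> (Suc (n + 2)) (?c (\<rho> x)))" if "x \<in> carrier k" for x
        using f(2)[OF that] trp[OF cc[OF \<rho>c[OF that]]] by simp
      fix a b assume ab: "a \<in> carrier (C (Suc (n + 2)))" "b \<in> carrier (C (Suc (n + 2)))"
        "tr (n + 2) a = \<zero>\<^bsub>C (n + 2)\<^esub>" "tr (n + 2) b = \<zero>\<^bsub>C (n + 2)\<^esub>"
      have "a \<in> \<pi> (Suc (n + 2)) ` carrier (UP R)" "b \<in> \<pi> (Suc (n + 2)) ` carrier (UP R)"
        using ab(1,2) sur by simp_all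
      then obtain p q where pq: "p \<in> carrier (UP R)" "a = \<pi> (Suc (n + 2)) p" "q \<in> carrier (UP R)" "b = \<pi> (Suc (n + 2)) q"
        by (elim imageE)
      have p0: "\<And>i. i < n + 2 \<Longrightarrow> p i = \<zero>\<^bsub>R\<^esub>" using ab(3) trp[OF pq(1)] \<pi>z[OF pq(1)] pq(2) by auto
      have q0: "\<And>i. i < n + 2 \<Longrightarrow> q i = \<zero>\<^bsub>R\<^esub>" using ab(4) trp[OF pq(3)] \<pi>z[OF pq(3)] pq(4) by auto
      have "(p \<otimes>\<^bsub>UP R\<^esub> q) i = \<zero>\<^bsub>R\<^esub>" if i: "i < Suc (n + 2)" for i
      proof -
        have "(p \<otimes>\<^bsub>UP R\<^esub> q) i = (\<Oplus>\<^bsub>R\<^esub>j \<in> {..i}. p j \<otimes>\<^bsub>R\<^esub> q (i - j))" by (rule S(3)[OF pq(1,3)])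
        also have "\<dots> = (\<Oplus>\<^bsub>R\<^esub>j \<in> {..i}. \<zero>\<^bsub>R\<^esub>)"
        proof (rule R.finsum_cong')
          fix j assume "j \<in> {..i}"
          then have "j < n + 2 \<or> i - j < n + 2" using i by auto
          then show "p j \<otimes>\<^bsub>R\<^esub> q (i - j) = \<zero>\<^bsub>R\<^esub>"
            using p0 q0 S(1)[OF pq(1)] S(1)[OF pq(3)] by auto
        qed auto
        finally show ?thesis by simp
      qed
      then have "\<pi> (Suc (n + 2)) (p \<otimes>\<^bsub>UP R\<^esub> q) = \<zero>\<^bsub>C (Suc (n + 2))\<^esub>" using \<pi>z[OF U.P.m_closed[OF pq(1,3)]] by blast
      then show "a \<otimes>\<^bsub>C (Suc (n + 2))\<^esub> b = \<zero>\<^bsub>C (Suc (n + 2))\<^esub>"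
        using ring_hom_mult[OF \<pi> pq(1,3)] pq by simp
    qed
    then show "\<exists>g. P (Suc n) g \<and> (\<forall>b \<in> carrier (fst B). tr (n + 2) (g b) = f b)"
      by (auto simp: P_def)
  qed
  then obtain f where fP: "\<And>n. P n (f n)" and ftr: "\<And>n b. b \<in> carrier (fst B) \<Longrightarrow> tr (n + 2) (f (Suc n) b) = f n b"
    by blast
  have f: "f n \<in> ring_hom (fst B) (C (n + 2))" and fk: "\<And>x. x \<in> carrier k \<Longrightarrow> f n (snd B x) = \<pi> (n + 2) (?c (\<rho> x))" for n
    using fP[of n] by (auto simp: P_def)
  have f0: "f 0 = f2" using fP[of 0] by (simp add: P_def)
  define r where "r n b = (SOME p. p \<in> carrier (UP R) \<and> \<pi> (n + 2) p = f n b)" for n b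
  have r: "r n b \<in> carrier (UP R)" "\<pi> (n + 2) (r n b) = f n b" if b: "b \<in> carrier (fst B)" for n b
  proof -
    have "f n b \<in> \<pi> (n + 2) ` carrier (UP R)" using ring_hom_closed[OF f b] sur by simp
    then obtain p where "f n b = \<pi> (n + 2) p" "p \<in> carrier (UP R)" by (rule imageE)
    then have "\<exists>p. p \<in> carrier (UP R) \<and> \<pi> (n + 2) p = f n b" by (intro exI[of _ p]) simp
    from someI_ex[OF this] show "r n b \<in> carrier (UP R)" "\<pi> (n + 2) (r n b) = f n b" by (auto simp: r_def)
  qed
  have r_le: "\<pi> (n + 2) (r m b) = f n b" if b: "b \<in> carrier (fst B)" and "n \<le> m" for n m b
    using \<open>n \<le> m\<close>
  proof (induction n rule: inc_induct)
    case base then show ?case using r(2)[OF b] .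
  next
    case (step n)
    have "\<pi> (n + 2) (r m b) = tr (n + 2) (\<pi> (Suc (n + 2)) (r m b))" using trp[OF r(1)[OF b]] by simp
    also have "\<dots> = tr (n + 2) (f (Suc n) b)" using step by simp
    finally show ?case using ftr[OF b] by simp
  qed
  \<comment> \<open>The representative \<open>r i b\<close> is determined modulo s^(i+2), so its
    i-th coefficient is well defined, and it is the same at every level where it is visible.\<close>
  define \<phi> where "\<phi> b i = r i b i" for b i
  have \<phi>: "\<phi> b i = p i" if b: "b \<in> carrier (fst B)" and p: "p \<in> carrier (UP R)" "\<pi> (n + 2) p = f n b" and i: "i < n + 2" for b i n p
  proof (cases "i \<le> n")
    case True
    have "\<pi> (i + 2) (r i b) = \<pi> (i + 2) (r n b)" using r_le[OF b True] r(2)[OF b] by simp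
    then have "r i b i = r n b i" using eq[OF r(1)[OF b] r(1)[OF b]] by simp
    moreover have "\<pi> (n + 2) (r n b) = \<pi> (n + 2) p" using r(2)[OF b] p by simp
    ultimately show ?thesis using eq[OF r(1)[OF b] p(1), of "n + 2"] i by (simp add: \<phi>_def)
  next
    case False
    then have "n \<le> i" by simp
    then have "\<pi> (n + 2) (r i b) = \<pi> (n + 2) p" using r_le[OF b] p by simp
    then show ?thesis using eq[OF r(1)[OF b] p(1), of "n + 2"] i by (simp add: \<phi>_def)
  qed
  have \<phi>r: "r i b j = \<phi> b j" if "b \<in> carrier (fst B)" "j \<le> i" for b i j
    using \<phi>[OF that(1) r[OF that(1)], of j i] that(2) by simp
  have \<phi>c: "\<phi> b i \<in> carrier R" if "b \<in> carrier (fst B)" for b i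
    unfolding \<phi>_def using S(1) r(1)[OF that] by blast
  have "ps_hom (fst B) R \<phi>"
    unfolding ps_hom_def
  proof (intro conjI ballI allI)
    fix b i assume "b \<in> carrier (fst B)" then show "\<phi> b i \<in> carrier R" by (rule \<phi>c)
  next
    fix a b i assume ab: "a \<in> carrier (fst B)" "b \<in> carrier (fst B)"
    have "\<pi> (i + 2) (r i a \<oplus>\<^bsub>UP R\<^esub> r i b) = f i (a \<oplus>\<^bsub>fst B\<^esub> b)"
      unfolding ring_hom_add[OF \<pi> r(1) r(1), OF ab] ring_hom_add[OF f ab] r(2)[OF ab(1)] r(2)[OF ab(2)] ..
    from \<phi>[OF B.a_closed[OF ab] U.P.a_closed[OF r(1) r(1), OF ab] this, of i]
    show "\<phi> (a \<oplus>\<^bsub>fst B\<^esub> b) i = \<phi> a i \<oplus>\<^bsub>R\<^esub> \<phi> b i"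
      unfolding S(2)[OF r(1) r(1), OF ab] by (simp add: \<phi>_def)
    have "\<pi> (i + 2) (r i a \<otimes>\<^bsub>UP R\<^esub> r i b) = f i (a \<otimes>\<^bsub>fst B\<^esub> b)"
      unfolding ring_hom_mult[OF \<pi> r(1) r(1), OF ab] ring_hom_mult[OF f ab] r(2)[OF ab(1)] r(2)[OF ab(2)] ..
    from \<phi>[OF B.m_closed[OF ab] U.P.m_closed[OF r(1) r(1), OF ab] this, of i]
    have "\<phi> (a \<otimes>\<^bsub>fst B\<^esub> b) i = (\<Oplus>\<^bsub>R\<^esub>j \<in> {..i}. r i a j \<otimes>\<^bsub>R\<^esub> r i b (i - j))"
      unfolding S(3)[OF r(1) r(1), OF ab] by simp
    also have "\<dots> = (\<Oplus>\<^bsub>R\<^esub>j \<in> {..i}. \<phi> a j \<otimes>\<^bsub>R\<^esub> \<phi> b (i - j))"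
      using \<phi>r[OF ab(1)] \<phi>r[OF ab(2)] \<phi>c[OF ab(1)] \<phi>c[OF ab(2)]
      by (intro R.finsum_cong') auto
    finally show "\<phi> (a \<otimes>\<^bsub>fst B\<^esub> b) i = (\<Oplus>\<^bsub>R\<^esub>j \<in> {..i}. \<phi> a j \<otimes>\<^bsub>R\<^esub> \<phi> b (i - j))" .
  next
    fix i
    have "\<pi> (i + 2) \<one>\<^bsub>UP R\<^esub> = f i \<one>\<^bsub>fst B\<^esub>" using ring_hom_one[OF \<pi>] ring_hom_one[OF f] by simp
    from \<phi>[OF B.one_closed U.P.one_closed this, of i]
    show "\<phi> \<one>\<^bsub>fst B\<^esub> i = (if i = 0 then \<one>\<^bsub>R\<^esub> else \<zero>\<^bsub>R\<^esub>)" unfolding S(4) by simp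
  qed
  moreover have "\<phi> b 0 = e b \<and> \<phi> b 1 = \<delta> b" if b: "b \<in> carrier (fst B)" for b
  proof -
    have "\<pi> (0 + 2) (g b) = f 0 b" by (simp add: f0 f2_def numeral_2_eq_2)
    from \<phi>[OF b gc[OF b] this, of 0] \<phi>[OF b gc[OF b] this, of 1] show ?thesis by (simp add: g_def)
  qed
  moreover have "\<phi> (snd B x) i = (if i = 0 then \<rho> x else \<zero>\<^bsub>R\<^esub>)" if x: "x \<in> carrier k" for x i
    using \<phi>[OF snc[OF x] cc[OF \<rho>c[OF x]] fk[OF x, of i, symmetric], of i] S(6)[OF \<rho>c[OF x]] by simp
  ultimately show ?thesis by blast
qed

section \<open>Coordinates at a section of a smooth chart\<close>

definition (in ring) lin :: "nat \<Rightarrow> (nat \<Rightarrow> 'a) \<Rightarrow> (nat \<Rightarrow> 'a) \<Rightarrow> 'a" where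
  "lin n c t = (\<Oplus>i \<in> {..<n}. c i \<otimes> t i)"

context cring
begin

lemma lin_closed: "(\<And>i. i < n \<Longrightarrow> c i \<in> carrier R) \<Longrightarrow> (\<And>i. i < n \<Longrightarrow> t i \<in> carrier R) \<Longrightarrow> lin n c t \<in> carrier R"
  unfolding lin_def by (rule finsum_closed) auto

lemma lin_add:
  assumes "\<And>i. i < n \<Longrightarrow> c i \<in> carrier R" "\<And>i. i < n \<Longrightarrow> c' i \<in> carrier R" "\<And>i. i < n \<Longrightarrow> t i \<in> carrier R"
  shows "lin n (\<lambda>i. c i \<oplus> c' i) t = lin n c t \<oplus> lin n c' t"
proof -
  have "lin n (\<lambda>i. c i \<oplus> c' i) t = (\<Oplus>i \<in> {..<n}. c i \<otimes> t i \<oplus> c' i \<otimes> t i)"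
    unfolding lin_def using assms by (intro finsum_cong') (auto simp: l_distr)
  also have "\<dots> = lin n c t \<oplus> lin n c' t"
    unfolding lin_def using assms by (intro finsum_addf) auto
  finally show ?thesis .
qed

lemma lin_smult:
  assumes "a \<in> carrier R" "\<And>i. i < n \<Longrightarrow> c i \<in> carrier R" "\<And>i. i < n \<Longrightarrow> t i \<in> carrier R"
  shows "lin n (\<lambda>i. a \<otimes> c i) t = a \<otimes> lin n c t"
proof -
  have "lin n (\<lambda>i. a \<otimes> c i) t = (\<Oplus>i \<in> {..<n}. a \<otimes> (c i \<otimes> t i))"
    unfolding lin_def using assms by (intro finsum_cong') (auto simp: m_assoc)
  also have "\<dots> = a \<otimes> lin n c t"
    unfolding lin_def using assms by (intro finsum_rdistr[symmetric]) auto
  finally show ?thesis .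
qed

lemma lin_zero: "(\<And>i. i < n \<Longrightarrow> c i = \<zero>) \<Longrightarrow> (\<And>i. i < n \<Longrightarrow> t i \<in> carrier R) \<Longrightarrow> lin n c t = \<zero>"
proof -
  assume "\<And>i. i < n \<Longrightarrow> c i = \<zero>" "\<And>i. i < n \<Longrightarrow> t i \<in> carrier R"
  then have "lin n c t = (\<Oplus>i \<in> {..<n}. \<zero>)" unfolding lin_def by (intro finsum_cong') auto
  then show ?thesis by simp
qed

lemma lin_unit:
  assumes "j < n" "\<And>i. i < n \<Longrightarrow> t i \<in> carrier R"
  shows "lin n (\<lambda>i. if j = i then \<one> else \<zero>) t = t j"
proof -
  have "lin n (\<lambda>i. if j = i then \<one> else \<zero>) t = (\<Oplus>i \<in> {..<n}. if j = i then t i else \<zero>)"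
    unfolding lin_def using assms by (intro finsum_cong') auto
  also have "\<dots> = t j" using assms by (intro finsum_singleton) auto
  finally show ?thesis .
qed

lemma lin_cong:
  assumes "\<And>i. i < n \<Longrightarrow> c i = c' i" "\<And>i. i < n \<Longrightarrow> t i = t' i"
    "\<And>i. i < n \<Longrightarrow> c' i \<in> carrier R" "\<And>i. i < n \<Longrightarrow> t' i \<in> carrier R"
  shows "lin n c t = lin n c' t'"
  unfolding lin_def using assms by (intro finsum_cong') auto

lemma lin_skip:
  assumes i0: "i0 < Suc n" and c: "\<And>i. i < Suc n \<Longrightarrow> c i \<in> carrier R" and t: "\<And>i. i < Suc n \<Longrightarrow> t i \<in> carrier R"
    and skip: "skip = (\<lambda>i. if i < i0 then i else Suc i)"
  shows "lin (Suc n) c t = c i0 \<otimes> t i0 \<oplus> lin n (c \<circ> skip) (t \<circ> skip)"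
proof -
  have im: "skip ` {..<n} = {..<Suc n} - {i0}"
  proof (intro equalityI subsetI)
    fix x assume "x \<in> {..<Suc n} - {i0}"
    then show "x \<in> skip ` {..<n}"
      using i0 unfolding skip by (intro image_eqI[of _ _ "if x < i0 then x else x - 1"]) auto
  qed (auto simp: skip)
  have inj: "inj_on skip {..<n}" by (auto simp: inj_on_def skip split: if_splits)
  have "lin (Suc n) c t = (\<Oplus>i \<in> insert i0 ({..<Suc n} - {i0}). c i \<otimes> t i)"
    unfolding lin_def using i0 by (simp add: insert_absorb)
  also have "\<dots> = c i0 \<otimes> t i0 \<oplus> (\<Oplus>i \<in> {..<Suc n} - {i0}. c i \<otimes> t i)"
    using i0 c t by (intro finsum_insert) auto
  also have "(\<Oplus>i \<in> {..<Suc n} - {i0}. c i \<otimes> t i) = lin n (c \<circ> skip) (t \<circ> skip)"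
    unfolding lin_def im[symmetric] comp_def using c t im
    by (intro finsum_reindex inj) (auto simp: im)
  finally show ?thesis .
qed

end

text \<open>Taken with the unit ideal as \<open>J\<close>, this is the ideal generated by the
  \<open>t i\<close>. Taken with \<open>J\<close> equal to that ideal, it is the square of that
  ideal.\<close>

lemma (in cring) lin_ideal:
  assumes J: "ideal J R" and t: "\<And>i. i < n \<Longrightarrow> t i \<in> carrier R"
  shows "ideal {b. \<exists>m. (\<forall>i < n. m i \<in> J) \<and> b = lin n m t} R"
proof (rule ideal_commI)
  interpret J: ideal J R by fact
  let ?L = "{b. \<exists>m. (\<forall>i < n. m i \<in> J) \<and> b = lin n m t}"
  show "?L \<subseteq> carrier R" using t J.Icarr by (auto intro!: lin_closed)
  have "\<zero> = lin n (\<lambda>_. \<zero>) t" using t by (simp add: lin_zero)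
  then show "\<zero> \<in> ?L" using additive_subgroup.zero_closed[OF J.additive_subgroup_axioms] by (intro CollectI exI[of _ "\<lambda>_. \<zero>"]) simp
  fix a assume "a \<in> ?L"
  then obtain m where m: "\<forall>i < n. m i \<in> J" "a = lin n m t" by blast
  show "x \<otimes> a \<in> ?L" if x: "x \<in> carrier R" for x
  proof -
    have "lin n (\<lambda>i. x \<otimes> m i) t = x \<otimes> a" unfolding m(2) using m(1) J.Icarr t x by (intro lin_smult) auto
    then show ?thesis using m(1) J.I_l_closed x by (intro CollectI exI[of _ "\<lambda>i. x \<otimes> m i"]) simp
  qed
  fix b assume "b \<in> ?L"
  then obtain m' where m': "\<forall>i < n. m' i \<in> J" "b = lin n m' t" by blast
  have "lin n (\<lambda>i. m i \<oplus> m' i) t = a \<oplus> b" unfolding m(2) m'(2) using m(1) m'(1) J.Icarr t by (intro lin_add) auto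
  then show "a \<oplus> b \<in> ?L" using m(1) m'(1) additive_subgroup.a_closed[OF J.additive_subgroup_axioms]
    by (intro CollectI exI[of _ "\<lambda>i. m i \<oplus> m' i"]) simp
qed

text \<open>An affine neighbourhood \<open>Spec B\<close> of a section \<open>\<epsilon>\<close>
  over a local domain \<open>k\<close> with maximal ideal \<open>M\<close>. The generators
  \<open>z\<close> are translated so that they vanish along the section. Generation is expressed
  through subrings, which reduces a property of all functions to closure under the ring operations
  and a check on constants and generators.\<close>

locale chart =
  fixes k :: "'u ring" and M :: "'u set" and B :: "'u alg" and \<epsilon> :: "'u \<Rightarrow> 'u" and N :: nat and z :: "nat \<Rightarrow> 'u"
  assumes inf: "infinite (UNIV :: 'u set)"
    and k: "domain k" and M: "primeideal M k" and local_units: "\<And>x. x \<in> carrier k \<Longrightarrow> x \<notin> M \<Longrightarrow> x \<in> Units k"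
    and B: "B \<in> algebras k" and \<epsilon>: "\<epsilon> \<in> ring_hom (fst B) k" and \<epsilon>k: "\<And>x. x \<in> carrier k \<Longrightarrow> \<epsilon> (snd B x) = x"
    and z: "\<And>i. i < N \<Longrightarrow> z i \<in> carrier (fst B)" and \<epsilon>z: "\<And>i. i < N \<Longrightarrow> \<epsilon> (z i) = \<zero>\<^bsub>k\<^esub>"
    and gen: "\<And>S. subring S (fst B) \<Longrightarrow> snd B ` carrier k \<subseteq> S \<Longrightarrow> z ` {..<N} \<subseteq> S \<Longrightarrow> carrier (fst B) \<subseteq> S"
    and lift: "lifting_property k B"
begin

sublocale k: domain k by (rule k)
sublocale M: primeideal M k by (rule M)
sublocale B: cring "fst B" by (rule algebrasD(1)[OF B])
sublocale \<epsilon>: ring_hom_cring "fst B" k \<epsilon>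
  by (intro ring_hom_cringI B.is_cring k.is_cring \<epsilon>)
sublocale s: ring_hom_cring k "fst B" "snd B"
  by (intro ring_hom_cringI B.is_cring k.is_cring algebrasD(2)[OF B])

abbreviation "BB \<equiv> carrier (fst B)"

definition "I = {b \<in> BB. \<epsilon> b = \<zero>\<^bsub>k\<^esub>}"

lemma I_ideal: "ideal I (fst B)"
proof -
  have "I = a_kernel (fst B) k \<epsilon>" unfolding I_def a_kernel_def' ..
  then show ?thesis using ring_hom_ring.kernel_is_ideal[OF ring_hom_ringI2[OF B.ring_axioms k.ring_axioms \<epsilon>]] by simp
qed

lemma zI: "i < N \<Longrightarrow> z i \<in> I"
  using z \<epsilon>z by (simp add: I_def)

lemma I_sub: "b \<in> I \<Longrightarrow> b \<in> BB"
  by (simp add: I_def)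

text \<open>As \<open>z\<close> generates \<open>I\<close>, this is the square of \<open>I\<close>.\<close>

definition "I2 = {b. \<exists>m. (\<forall>i < N. m i \<in> I) \<and> b = B.lin N m z}"

text \<open>The functions that differ from their value along the section by an element of the ideal
  generated by \<open>z\<close> form a subring containing the constants and \<open>z\<close>, hence
  they are all functions.\<close>

lemma I_lin:
  assumes "b \<in> I" shows "\<exists>m. (\<forall>i < N. m i \<in> BB) \<and> b = B.lin N m z"
proof -
  define W where "W = {b. \<exists>m. (\<forall>i < N. m i \<in> BB) \<and> b = B.lin N m z}"
  interpret W: ideal W "fst B" unfolding W_def by (rule B.lin_ideal[OF B.oneideal z])
  note Wa = additive_subgroup.a_closed[OF W.additive_subgroup_axioms]
    and W0 = additive_subgroup.zero_closed[OF W.additive_subgroup_axioms]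
  let ?T = "{b \<in> BB. b \<ominus>\<^bsub>fst B\<^esub> snd B (\<epsilon> b) \<in> W}"
  have k_in: "snd B ` carrier k \<subseteq> ?T" using \<epsilon>k W0 by (auto simp: B.minus_eq B.r_neg)
  have mult: "a \<otimes>\<^bsub>fst B\<^esub> b \<in> ?T" if ab: "a \<in> ?T" "b \<in> ?T" for a b
  proof -
    have "a \<otimes>\<^bsub>fst B\<^esub> b \<ominus>\<^bsub>fst B\<^esub> snd B (\<epsilon> (a \<otimes>\<^bsub>fst B\<^esub> b)) =
        a \<otimes>\<^bsub>fst B\<^esub> (b \<ominus>\<^bsub>fst B\<^esub> snd B (\<epsilon> b)) \<oplus>\<^bsub>fst B\<^esub> snd B (\<epsilon> b) \<otimes>\<^bsub>fst B\<^esub> (a \<ominus>\<^bsub>fst B\<^esub> snd B (\<epsilon> a))"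
    proof -
      have c: "a \<in> BB" "b \<in> BB" "snd B (\<epsilon> a) \<in> BB" "snd B (\<epsilon> b) \<in> BB" using ab by auto
      have e: "snd B (\<epsilon> (a \<otimes>\<^bsub>fst B\<^esub> b)) = snd B (\<epsilon> a) \<otimes>\<^bsub>fst B\<^esub> snd B (\<epsilon> b)" using c by simp
      show ?thesis unfolding e using c by algebra
    qed
    moreover have "\<dots> \<in> W" using ab by (intro Wa W.I_l_closed) auto
    ultimately show ?thesis using ab by simp
  qed
  have "subring ?T (fst B)"
  proof (rule B.subringI)
    show "\<one>\<^bsub>fst B\<^esub> \<in> ?T" using subsetD[OF k_in imageI[OF k.one_closed]] unfolding s.hom_one .
    fix b assume b: "b \<in> ?T"
    have "snd B (\<ominus>\<^bsub>k\<^esub> \<one>\<^bsub>k\<^esub>) \<in> ?T" by (rule subsetD[OF k_in imageI]) simp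
    from mult[OF this b] show "\<ominus>\<^bsub>fst B\<^esub> b \<in> ?T" using b by (simp add: B.l_minus)
    fix a assume a: "a \<in> ?T"
    have "(a \<ominus>\<^bsub>fst B\<^esub> snd B (\<epsilon> a)) \<oplus>\<^bsub>fst B\<^esub> (b \<ominus>\<^bsub>fst B\<^esub> snd B (\<epsilon> b)) = a \<oplus>\<^bsub>fst B\<^esub> b \<ominus>\<^bsub>fst B\<^esub> snd B (\<epsilon> (a \<oplus>\<^bsub>fst B\<^esub> b))"
      using a b by (simp add: B.minus_eq B.minus_add B.a_ac)
    then show "a \<oplus>\<^bsub>fst B\<^esub> b \<in> ?T" using a b Wa[of "a \<ominus>\<^bsub>fst B\<^esub> snd B (\<epsilon> a)" "b \<ominus>\<^bsub>fst B\<^esub> snd B (\<epsilon> b)"] by simp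
  qed (use mult in auto)
  moreover have "z j \<in> W" if j: "j < N" for j
  proof -
    have "z j = B.lin N (\<lambda>i. if j = i then \<one>\<^bsub>fst B\<^esub> else \<zero>\<^bsub>fst B\<^esub>) z" using B.lin_unit[OF j, of z] z by simp
    then show ?thesis unfolding W_def by (intro CollectI exI[of _ "\<lambda>i. if j = i then \<one>\<^bsub>fst B\<^esub> else \<zero>\<^bsub>fst B\<^esub>"]) simp
  qed
  then have "z ` {..<N} \<subseteq> ?T" using z \<epsilon>z by (auto simp: B.minus_eq)
  ultimately have "BB \<subseteq> ?T" using gen k_in by blast
  then have "b \<ominus>\<^bsub>fst B\<^esub> snd B (\<epsilon> b) \<in> W" using I_sub[OF assms] by blast
  then have "b \<in> W" using assms by (simp add: I_def B.minus_eq)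
  then show ?thesis unfolding W_def by (rule CollectD)
qed

lemma I2I:
  assumes "\<And>i. i < N \<Longrightarrow> m i \<in> I" shows "B.lin N m z \<in> I2"
  using assms by (auto simp: I2_def)

lemma I2_ideal: "ideal I2 (fst B)"
  unfolding I2_def by (rule B.lin_ideal[OF I_ideal z])

lemma I2_sub: "I2 \<subseteq> I"
proof
  interpret I: ideal I "fst B" by (rule I_ideal)
  fix b assume "b \<in> I2"
  then obtain m where m: "\<forall>i < N. m i \<in> I" "b = B.lin N m z" by (auto simp: I2_def)
  show "b \<in> I" unfolding m(2) B.lin_def
    using m(1) z I.I_r_closed by (intro I.finsum_in_ideal) auto
qed

lemma I_mult_I2: "a \<in> I \<Longrightarrow> b \<in> I \<Longrightarrow> a \<otimes>\<^bsub>fst B\<^esub> b \<in> I2"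
proof -
  interpret I: ideal I "fst B" by (rule I_ideal)
  assume a: "a \<in> I" and b: "b \<in> I"
  obtain n where n: "\<forall>i < N. n i \<in> BB" "b = B.lin N n z" using I_lin[OF b] by blast
  have "a \<otimes>\<^bsub>fst B\<^esub> b = B.lin N (\<lambda>i. a \<otimes>\<^bsub>fst B\<^esub> n i) z"
    unfolding n(2) using n(1) z a I_sub by (intro B.lin_smult[symmetric]) auto
  moreover have "B.lin N (\<lambda>i. a \<otimes>\<^bsub>fst B\<^esub> n i) z \<in> I2" using n(1) a I.I_r_closed by (intro I2I) auto
  ultimately show "a \<otimes>\<^bsub>fst B\<^esub> b \<in> I2" by simp
qed

text \<open>The \<open>k\<close>-derivations of \<open>B\<close> into rings on the type
  \<open>'u\<close>. Fixing this type makes it possible to quantify over all of them, which replaces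
  the module of differentials.\<close>

definition is_der :: "'u ring \<Rightarrow> ('u \<Rightarrow> 'u) \<Rightarrow> ('u \<Rightarrow> 'u) \<Rightarrow> bool" where
  "is_der \<Omega> \<psi> \<delta> \<longleftrightarrow> cring \<Omega> \<and> \<psi> \<in> ring_hom (fst B) \<Omega> \<and> derivation \<Omega> BB (fst B) \<psi> \<delta> \<and>
    (\<forall>x \<in> carrier k. \<delta> (snd B x) = \<zero>\<^bsub>\<Omega>\<^esub>)"

text \<open>\<open>\<beta> i\<close> is a partial derivative of \<open>b\<close> with respect to \<open>z i\<close>; it serves all derivations at once.\<close>

definition der_coeffs :: "'u \<Rightarrow> (nat \<Rightarrow> 'u) \<Rightarrow> bool" where
  "der_coeffs b \<beta> \<longleftrightarrow> (\<forall>i < N. \<beta> i \<in> BB) \<and>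
    (\<forall>\<Omega> \<psi> \<delta>. is_der \<Omega> \<psi> \<delta> \<longrightarrow> \<delta> b = ring.lin \<Omega> N (\<lambda>i. \<psi> (\<beta> i)) (\<lambda>i. \<delta> (z i)))"

lemma is_derD:
  assumes "is_der \<Omega> \<psi> \<delta>"
  shows "cring \<Omega>" "\<psi> \<in> ring_hom (fst B) \<Omega>" "a \<in> BB \<Longrightarrow> \<delta> a \<in> carrier \<Omega>" "a \<in> BB \<Longrightarrow> \<psi> a \<in> carrier \<Omega>"
    "a \<in> BB \<Longrightarrow> b \<in> BB \<Longrightarrow> \<delta> (a \<oplus>\<^bsub>fst B\<^esub> b) = \<delta> a \<oplus>\<^bsub>\<Omega>\<^esub> \<delta> b"
    "a \<in> BB \<Longrightarrow> b \<in> BB \<Longrightarrow> \<delta> (a \<otimes>\<^bsub>fst B\<^esub> b) = \<psi> a \<otimes>\<^bsub>\<Omega>\<^esub> \<delta> b \<oplus>\<^bsub>\<Omega>\<^esub> \<psi> b \<otimes>\<^bsub>\<Omega>\<^esub> \<delta> a"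
    "x \<in> carrier k \<Longrightarrow> \<delta> (snd B x) = \<zero>\<^bsub>\<Omega>\<^esub>"
    "a \<in> BB \<Longrightarrow> b \<in> BB \<Longrightarrow> \<psi> (a \<oplus>\<^bsub>fst B\<^esub> b) = \<psi> a \<oplus>\<^bsub>\<Omega>\<^esub> \<psi> b"
    "a \<in> BB \<Longrightarrow> b \<in> BB \<Longrightarrow> \<psi> (a \<otimes>\<^bsub>fst B\<^esub> b) = \<psi> a \<otimes>\<^bsub>\<Omega>\<^esub> \<psi> b"
    "\<psi> \<zero>\<^bsub>fst B\<^esub> = \<zero>\<^bsub>\<Omega>\<^esub>" "\<psi> \<one>\<^bsub>fst B\<^esub> = \<one>\<^bsub>\<Omega>\<^esub>"
proof -
  have cp: "cring \<Omega>" "\<psi> \<in> ring_hom (fst B) \<Omega>" and d: "derivation \<Omega> BB (fst B) \<psi> \<delta>" and dk: "\<forall>x \<in> carrier k. \<delta> (snd B x) = \<zero>\<^bsub>\<Omega>\<^esub>"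
    using assms unfolding is_der_def by blast+
  then interpret h: ring_hom_cring "fst B" \<Omega> \<psi> by (intro ring_hom_cringI B.is_cring)
  show "cring \<Omega>" "\<psi> \<in> ring_hom (fst B) \<Omega>" "a \<in> BB \<Longrightarrow> \<delta> a \<in> carrier \<Omega>" "a \<in> BB \<Longrightarrow> \<psi> a \<in> carrier \<Omega>"
    "a \<in> BB \<Longrightarrow> b \<in> BB \<Longrightarrow> \<delta> (a \<oplus>\<^bsub>fst B\<^esub> b) = \<delta> a \<oplus>\<^bsub>\<Omega>\<^esub> \<delta> b"
    "a \<in> BB \<Longrightarrow> b \<in> BB \<Longrightarrow> \<delta> (a \<otimes>\<^bsub>fst B\<^esub> b) = \<psi> a \<otimes>\<^bsub>\<Omega>\<^esub> \<delta> b \<oplus>\<^bsub>\<Omega>\<^esub> \<psi> b \<otimes>\<^bsub>\<Omega>\<^esub> \<delta> a"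
    "x \<in> carrier k \<Longrightarrow> \<delta> (snd B x) = \<zero>\<^bsub>\<Omega>\<^esub>"
    "a \<in> BB \<Longrightarrow> b \<in> BB \<Longrightarrow> \<psi> (a \<oplus>\<^bsub>fst B\<^esub> b) = \<psi> a \<oplus>\<^bsub>\<Omega>\<^esub> \<psi> b"
    "a \<in> BB \<Longrightarrow> b \<in> BB \<Longrightarrow> \<psi> (a \<otimes>\<^bsub>fst B\<^esub> b) = \<psi> a \<otimes>\<^bsub>\<Omega>\<^esub> \<psi> b"
    "\<psi> \<zero>\<^bsub>fst B\<^esub> = \<zero>\<^bsub>\<Omega>\<^esub>" "\<psi> \<one>\<^bsub>fst B\<^esub> = \<one>\<^bsub>\<Omega>\<^esub>"
    using cp d dk unfolding derivation_def by (auto simp: Pi_iff)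
qed

lemma der_coeffs_add:
  assumes "der_coeffs a \<alpha>" "der_coeffs b \<beta>" "a \<in> BB" "b \<in> BB"
  shows "der_coeffs (a \<oplus>\<^bsub>fst B\<^esub> b) (\<lambda>i. \<alpha> i \<oplus>\<^bsub>fst B\<^esub> \<beta> i)"
  unfolding der_coeffs_def
proof (intro conjI allI impI)
  fix i assume "i < N" then show "\<alpha> i \<oplus>\<^bsub>fst B\<^esub> \<beta> i \<in> BB" using assms by (simp add: der_coeffs_def)
next
  fix \<Omega> \<psi> \<delta> assume d: "is_der \<Omega> \<psi> \<delta>"
  note D = is_derD[OF d]
  interpret \<Omega>: cring \<Omega> by (rule D(1))
  have c: "\<alpha> i \<in> BB" "\<beta> i \<in> BB" if "i < N" for i using assms that by (auto simp: der_coeffs_def)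
  have "ring.lin \<Omega> N (\<lambda>i. \<psi> (\<alpha> i \<oplus>\<^bsub>fst B\<^esub> \<beta> i)) (\<lambda>i. \<delta> (z i)) = ring.lin \<Omega> N (\<lambda>i. \<psi> (\<alpha> i) \<oplus>\<^bsub>\<Omega>\<^esub> \<psi> (\<beta> i)) (\<lambda>i. \<delta> (z i))"
    using c D(3,4,8) z by (intro \<Omega>.lin_cong) auto
  also have "\<dots> = ring.lin \<Omega> N (\<lambda>i. \<psi> (\<alpha> i)) (\<lambda>i. \<delta> (z i)) \<oplus>\<^bsub>\<Omega>\<^esub> ring.lin \<Omega> N (\<lambda>i. \<psi> (\<beta> i)) (\<lambda>i. \<delta> (z i))"
    using c D(3,4) z by (intro \<Omega>.lin_add) auto
  also have "\<dots> = \<delta> (a \<oplus>\<^bsub>fst B\<^esub> b)" using assms d D(5) by (simp add: der_coeffs_def)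
  finally show "\<delta> (a \<oplus>\<^bsub>fst B\<^esub> b) = ring.lin \<Omega> N (\<lambda>i. \<psi> (\<alpha> i \<oplus>\<^bsub>fst B\<^esub> \<beta> i)) (\<lambda>i. \<delta> (z i))" ..
qed

lemma der_coeffs_mult:
  assumes "der_coeffs a \<alpha>" "der_coeffs b \<beta>" "a \<in> BB" "b \<in> BB"
  shows "der_coeffs (a \<otimes>\<^bsub>fst B\<^esub> b) (\<lambda>i. a \<otimes>\<^bsub>fst B\<^esub> \<beta> i \<oplus>\<^bsub>fst B\<^esub> b \<otimes>\<^bsub>fst B\<^esub> \<alpha> i)"
  unfolding der_coeffs_def
proof (intro conjI allI impI)
  fix i assume "i < N" then show "a \<otimes>\<^bsub>fst B\<^esub> \<beta> i \<oplus>\<^bsub>fst B\<^esub> b \<otimes>\<^bsub>fst B\<^esub> \<alpha> i \<in> BB" using assms by (simp add: der_coeffs_def)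
next
  fix \<Omega> \<psi> \<delta> assume d: "is_der \<Omega> \<psi> \<delta>"
  note D = is_derD[OF d]
  interpret \<Omega>: cring \<Omega> by (rule D(1))
  have c: "\<alpha> i \<in> BB" "\<beta> i \<in> BB" if "i < N" for i using assms that by (auto simp: der_coeffs_def)
  let ?v = "\<lambda>i. \<delta> (z i)"
  have "ring.lin \<Omega> N (\<lambda>i. \<psi> (a \<otimes>\<^bsub>fst B\<^esub> \<beta> i \<oplus>\<^bsub>fst B\<^esub> b \<otimes>\<^bsub>fst B\<^esub> \<alpha> i)) ?v
      = ring.lin \<Omega> N (\<lambda>i. \<psi> a \<otimes>\<^bsub>\<Omega>\<^esub> \<psi> (\<beta> i) \<oplus>\<^bsub>\<Omega>\<^esub> \<psi> b \<otimes>\<^bsub>\<Omega>\<^esub> \<psi> (\<alpha> i)) ?v"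
    using c D(3,4,8,9) z assms(3,4) by (intro \<Omega>.lin_cong) auto
  also have "\<dots> = ring.lin \<Omega> N (\<lambda>i. \<psi> a \<otimes>\<^bsub>\<Omega>\<^esub> \<psi> (\<beta> i)) ?v \<oplus>\<^bsub>\<Omega>\<^esub> ring.lin \<Omega> N (\<lambda>i. \<psi> b \<otimes>\<^bsub>\<Omega>\<^esub> \<psi> (\<alpha> i)) ?v"
    using c D(3,4) z assms(3,4) by (intro \<Omega>.lin_add) auto
  also have "ring.lin \<Omega> N (\<lambda>i. \<psi> a \<otimes>\<^bsub>\<Omega>\<^esub> \<psi> (\<beta> i)) ?v = \<psi> a \<otimes>\<^bsub>\<Omega>\<^esub> ring.lin \<Omega> N (\<lambda>i. \<psi> (\<beta> i)) ?v"
    using c D(3,4) z assms(3,4) by (intro \<Omega>.lin_smult) auto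
  also have "ring.lin \<Omega> N (\<lambda>i. \<psi> b \<otimes>\<^bsub>\<Omega>\<^esub> \<psi> (\<alpha> i)) ?v = \<psi> b \<otimes>\<^bsub>\<Omega>\<^esub> ring.lin \<Omega> N (\<lambda>i. \<psi> (\<alpha> i)) ?v"
    using c D(3,4) z assms(3,4) by (intro \<Omega>.lin_smult) auto
  also have "\<psi> a \<otimes>\<^bsub>\<Omega>\<^esub> ring.lin \<Omega> N (\<lambda>i. \<psi> (\<beta> i)) ?v \<oplus>\<^bsub>\<Omega>\<^esub> \<psi> b \<otimes>\<^bsub>\<Omega>\<^esub> ring.lin \<Omega> N (\<lambda>i. \<psi> (\<alpha> i)) ?v = \<delta> (a \<otimes>\<^bsub>fst B\<^esub> b)"
    using assms d D(6) by (simp add: der_coeffs_def)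
  finally show "\<delta> (a \<otimes>\<^bsub>fst B\<^esub> b) = ring.lin \<Omega> N (\<lambda>i. \<psi> (a \<otimes>\<^bsub>fst B\<^esub> \<beta> i \<oplus>\<^bsub>fst B\<^esub> b \<otimes>\<^bsub>fst B\<^esub> \<alpha> i)) ?v" ..
qed

lemma der_coeffs_const:
  assumes "x \<in> carrier k" shows "der_coeffs (snd B x) (\<lambda>_. \<zero>\<^bsub>fst B\<^esub>)"
  unfolding der_coeffs_def
proof (intro conjI allI impI)
  fix \<Omega> \<psi> \<delta> assume d: "is_der \<Omega> \<psi> \<delta>"
  note D = is_derD[OF d]
  interpret \<Omega>: cring \<Omega> by (rule D(1))
  have "ring.lin \<Omega> N (\<lambda>i. \<psi> \<zero>\<^bsub>fst B\<^esub>) (\<lambda>i. \<delta> (z i)) = \<zero>\<^bsub>\<Omega>\<^esub>" using D(3,10) z by (intro \<Omega>.lin_zero) auto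
  then show "\<delta> (snd B x) = ring.lin \<Omega> N (\<lambda>i. \<psi> \<zero>\<^bsub>fst B\<^esub>) (\<lambda>i. \<delta> (z i))" using D(7) assms by simp
qed simp

lemma der_coeffs_gen:
  assumes "j < N" shows "der_coeffs (z j) (\<lambda>i. if j = i then \<one>\<^bsub>fst B\<^esub> else \<zero>\<^bsub>fst B\<^esub>)"
  unfolding der_coeffs_def
proof (intro conjI allI impI)
  fix \<Omega> \<psi> \<delta> assume d: "is_der \<Omega> \<psi> \<delta>"
  note D = is_derD[OF d]
  interpret \<Omega>: cring \<Omega> by (rule D(1))
  have "ring.lin \<Omega> N (\<lambda>i. \<psi> (if j = i then \<one>\<^bsub>fst B\<^esub> else \<zero>\<^bsub>fst B\<^esub>)) (\<lambda>i. \<delta> (z i))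
      = ring.lin \<Omega> N (\<lambda>i. if j = i then \<one>\<^bsub>\<Omega>\<^esub> else \<zero>\<^bsub>\<Omega>\<^esub>) (\<lambda>i. \<delta> (z i))"
    using D(3,10,11) z by (intro \<Omega>.lin_cong) auto
  also have "\<dots> = \<delta> (z j)" using D(3) z assms by (intro \<Omega>.lin_unit) auto
  finally show "\<delta> (z j) = ring.lin \<Omega> N (\<lambda>i. \<psi> (if j = i then \<one>\<^bsub>fst B\<^esub> else \<zero>\<^bsub>fst B\<^esub>)) (\<lambda>i. \<delta> (z i))" ..
qed simp

text \<open>The differentials of the generators generate all differentials: by the rules for sums
  and products, the functions with this property form a subring.\<close>

lemma ex_der_coeffs:
  assumes "b \<in> BB" shows "\<exists>\<beta>. der_coeffs b \<beta>"
proof -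
  let ?S = "{b \<in> BB. \<exists>\<beta>. der_coeffs b \<beta>}"
  have k_in: "snd B ` carrier k \<subseteq> ?S" using der_coeffs_const by auto
  have mult: "a \<otimes>\<^bsub>fst B\<^esub> b \<in> ?S" if "a \<in> ?S" "b \<in> ?S" for a b using that der_coeffs_mult by blast
  have "subring ?S (fst B)"
  proof (rule B.subringI)
    show "\<one>\<^bsub>fst B\<^esub> \<in> ?S" using subsetD[OF k_in imageI[OF k.one_closed]] unfolding s.hom_one .
    fix b assume b: "b \<in> ?S"
    have "snd B (\<ominus>\<^bsub>k\<^esub> \<one>\<^bsub>k\<^esub>) \<in> ?S" by (rule subsetD[OF k_in imageI]) simp
    from mult[OF this b] show "\<ominus>\<^bsub>fst B\<^esub> b \<in> ?S" using b by (simp add: B.l_minus)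
  next
    fix a b assume "a \<in> ?S" "b \<in> ?S"
    then show "a \<oplus>\<^bsub>fst B\<^esub> b \<in> ?S" using der_coeffs_add by blast
  qed (use mult in auto)
  moreover have "z ` {..<N} \<subseteq> ?S" using der_coeffs_gen z by auto
  ultimately have "BB \<subseteq> ?S" using gen k_in by blast
  then show ?thesis using assms by blast
qed

text \<open>In d(m z) = m dz + z dm both \<open>m\<close> and \<open>z\<close> are in
  \<open>I\<close>, so all coefficients are in \<open>I\<close>.\<close>

lemma der_coeffs_I2:
  assumes "b \<in> I2" shows "\<exists>\<beta>. der_coeffs b \<beta> \<and> (\<forall>i < N. \<beta> i \<in> I)"
proof -
  interpret I: ideal I "fst B" by (rule I_ideal)
  note Ia = additive_subgroup.a_closed[OF I.additive_subgroup_axioms]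
  obtain m where m: "\<forall>i < N. m i \<in> I" "b = B.lin N m z" using assms by (auto simp: I2_def)
  have "n \<le> N \<Longrightarrow> \<exists>\<beta>. der_coeffs (\<Oplus>\<^bsub>fst B\<^esub>i \<in> {..<n}. m i \<otimes>\<^bsub>fst B\<^esub> z i) \<beta> \<and> (\<forall>i < N. \<beta> i \<in> I)" for n
  proof (induction n)
    case 0
    have "der_coeffs \<zero>\<^bsub>fst B\<^esub> (\<lambda>_. \<zero>\<^bsub>fst B\<^esub>)" using der_coeffs_const[OF k.zero_closed] by simp
    then show ?case using additive_subgroup.zero_closed[OF I.additive_subgroup_axioms] by auto
  next
    case (Suc n)
    then obtain \<beta> where \<beta>: "der_coeffs (\<Oplus>\<^bsub>fst B\<^esub>i \<in> {..<n}. m i \<otimes>\<^bsub>fst B\<^esub> z i) \<beta>" "\<forall>i < N. \<beta> i \<in> I" by auto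
    have n: "n < N" using Suc by simp
    obtain \<mu> where \<mu>: "der_coeffs (m n) \<mu>" using ex_der_coeffs I_sub m n by blast
    obtain \<nu> where \<nu>: "der_coeffs (z n) \<nu>" using ex_der_coeffs z n by blast
    have c: "m n \<in> BB" "z n \<in> BB" using m n z I_sub by auto
    have s: "(\<Oplus>\<^bsub>fst B\<^esub>i \<in> {..<n}. m i \<otimes>\<^bsub>fst B\<^esub> z i) \<in> BB" using m z n I_sub by (intro B.finsum_closed) auto
    have e: "(\<Oplus>\<^bsub>fst B\<^esub>i \<in> {..<Suc n}. m i \<otimes>\<^bsub>fst B\<^esub> z i) = m n \<otimes>\<^bsub>fst B\<^esub> z n \<oplus>\<^bsub>fst B\<^esub> (\<Oplus>\<^bsub>fst B\<^esub>i \<in> {..<n}. m i \<otimes>\<^bsub>fst B\<^esub> z i)"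
      unfolding lessThan_Suc using m z n I_sub by (intro B.finsum_insert) auto
    have "der_coeffs (\<Oplus>\<^bsub>fst B\<^esub>i \<in> {..<Suc n}. m i \<otimes>\<^bsub>fst B\<^esub> z i)
        (\<lambda>i. (m n \<otimes>\<^bsub>fst B\<^esub> \<nu> i \<oplus>\<^bsub>fst B\<^esub> z n \<otimes>\<^bsub>fst B\<^esub> \<mu> i) \<oplus>\<^bsub>fst B\<^esub> \<beta> i)"
      unfolding e using der_coeffs_add[OF der_coeffs_mult[OF \<mu> \<nu> c] \<beta>(1) _ s] c by simp
    moreover have "(m n \<otimes>\<^bsub>fst B\<^esub> \<nu> i \<oplus>\<^bsub>fst B\<^esub> z n \<otimes>\<^bsub>fst B\<^esub> \<mu> i) \<oplus>\<^bsub>fst B\<^esub> \<beta> i \<in> I" if i: "i < N" for i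
      using Ia[OF Ia[OF I.I_r_closed I.I_r_closed]] \<mu> \<nu> \<beta> m zI[OF n] i n by (simp add: der_coeffs_def)
    ultimately show ?case by blast
  qed
  from this[of N] show ?thesis using m by (simp add: B.lin_def)
qed

text \<open>\<open>t\<close> generates \<open>I / I2\<close> over \<open>k\<close>, and it does so minimally, that is, it is linearly independent
  modulo \<open>M\<close>.\<close>

definition spans :: "nat \<Rightarrow> (nat \<Rightarrow> 'u) \<Rightarrow> bool" where
  "spans d t \<longleftrightarrow> (\<forall>i < d. t i \<in> I) \<and>
    (\<forall>j < N. \<exists>c. (\<forall>i < d. c i \<in> carrier k) \<and> z j \<ominus>\<^bsub>fst B\<^esub> B.lin d (\<lambda>i. snd B (c i)) t \<in> I2)"

definition indep :: "nat \<Rightarrow> (nat \<Rightarrow> 'u) \<Rightarrow> bool" where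
  "indep d t \<longleftrightarrow> (\<forall>c. (\<forall>i < d. c i \<in> carrier k) \<longrightarrow> B.lin d (\<lambda>i. snd B (c i)) t \<in> I2 \<longrightarrow> (\<forall>i < d. c i \<in> M))"

text \<open>A spanning family of least length is independent modulo \<open>M\<close>: a relation
  with a coefficient outside \<open>M\<close> has an invertible coefficient, and the corresponding
  member could be eliminated. This is the minimal number of generators of a module over a local
  ring.\<close>

lemma ex_coordinates: "\<exists>d t. spans d t \<and> indep d t"
proof -
  interpret I2: ideal I2 "fst B" by (rule I2_ideal)
  note I2a = additive_subgroup.a_closed[OF I2.additive_subgroup_axioms]
  have "spans N z"
    unfolding spans_def
  proof (intro conjI allI impI)
    fix j assume j: "j < N"
    have "B.lin N (\<lambda>i. snd B (if j = i then \<one>\<^bsub>k\<^esub> else \<zero>\<^bsub>k\<^esub>)) z = B.lin N (\<lambda>i. if j = i then \<one>\<^bsub>fst B\<^esub> else \<zero>\<^bsub>fst B\<^esub>) z"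
      using z by (intro B.lin_cong) auto
    also have "\<dots> = z j" using B.lin_unit[OF j, of z] z by simp
    finally have "z j \<ominus>\<^bsub>fst B\<^esub> B.lin N (\<lambda>i. snd B (if j = i then \<one>\<^bsub>k\<^esub> else \<zero>\<^bsub>k\<^esub>)) z = \<zero>\<^bsub>fst B\<^esub>"
      using z j by (simp add: B.minus_eq B.r_neg)
    then have "z j \<ominus>\<^bsub>fst B\<^esub> B.lin N (\<lambda>i. snd B (if j = i then \<one>\<^bsub>k\<^esub> else \<zero>\<^bsub>k\<^esub>)) z \<in> I2"
      using additive_subgroup.zero_closed[OF I2.additive_subgroup_axioms] by simp
    moreover have "\<forall>i < N. (if j = i then \<one>\<^bsub>k\<^esub> else \<zero>\<^bsub>k\<^esub>) \<in> carrier k" by simp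
    ultimately show "\<exists>c. (\<forall>i < N. c i \<in> carrier k) \<and> z j \<ominus>\<^bsub>fst B\<^esub> B.lin N (\<lambda>i. snd B (c i)) z \<in> I2"
      by (intro exI[of _ "\<lambda>i. if j = i then \<one>\<^bsub>k\<^esub> else \<zero>\<^bsub>k\<^esub>"] conjI)
  qed (use zI in auto)
  then have ex: "\<exists>d t. spans d t" by blast
  define d where "d = (LEAST d. \<exists>t. spans d t)"
  obtain t where t: "spans d t" unfolding d_def using LeastI_ex[OF ex] by blast
  have d_le: "d \<le> d'" if "spans d' t'" for d' t' unfolding d_def using that by (intro Least_le) blast
  have tI: "t i \<in> I" if "i < d" for i using t that by (simp add: spans_def)
  have "indep d t"
    unfolding indep_def
  proof (intro allI impI, rule ccontr)
    fix c i0 assume c: "\<forall>i < d. c i \<in> carrier k" and rel: "B.lin d (\<lambda>i. snd B (c i)) t \<in> I2"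
      and i0: "i0 < d" and "c i0 \<notin> M"
    then have u: "c i0 \<in> Units k" using local_units by blast
    define u where "u = inv\<^bsub>k\<^esub> (c i0)"
    have uc: "u \<in> carrier k" "u \<otimes>\<^bsub>k\<^esub> c i0 = \<one>\<^bsub>k\<^esub>" using u by (auto simp: u_def)
    obtain d' where d': "d = Suc d'" using i0 by (cases d) auto
    define skip where "skip = (\<lambda>i. if i < i0 then i else Suc i)"
    have sk: "skip i < d" if "i < d'" for i using that d' by (auto simp: skip_def)
    have "spans d' (t \<circ> skip)"
      unfolding spans_def
    proof (intro conjI allI impI)
      fix j assume j: "j < N"
      obtain a where a: "\<forall>i < d. a i \<in> carrier k" "z j \<ominus>\<^bsub>fst B\<^esub> B.lin d (\<lambda>i. snd B (a i)) t \<in> I2"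
        using t j by (auto simp: spans_def)
      \<comment> \<open>The multiple of the relation that, added to the representation of
        \<open>z j\<close>, cancels the coefficient at \<open>i0\<close>.\<close>
      define w where "w = \<ominus>\<^bsub>k\<^esub> (a i0 \<otimes>\<^bsub>k\<^esub> u)"
      have w: "w \<in> carrier k" using a i0 uc by (simp add: w_def)
      define a' where "a' i = a i \<oplus>\<^bsub>k\<^esub> w \<otimes>\<^bsub>k\<^esub> c i" for i
      have a'c: "a' i \<in> carrier k" if "i < d" for i using a c w that by (simp add: a'_def)
      have "a' i0 = a i0 \<oplus>\<^bsub>k\<^esub> \<ominus>\<^bsub>k\<^esub> (a i0 \<otimes>\<^bsub>k\<^esub> (u \<otimes>\<^bsub>k\<^esub> c i0))"
        unfolding a'_def w_def using a c i0 uc(1) by (simp add: k.l_minus k.m_assoc)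
      then have a'0: "a' i0 = \<zero>\<^bsub>k\<^esub>" using a i0 uc by (simp add: k.r_neg)
      have tB: "t i \<in> BB" if "i < d" for i using tI[OF that] I_sub by blast
      have la: "B.lin d (\<lambda>i. snd B (a i)) t \<in> BB" "B.lin d (\<lambda>i. snd B (c i)) t \<in> BB"
        using a c tB by (auto intro!: B.lin_closed)
      have "B.lin d (\<lambda>i. snd B (a' i)) t = B.lin d (\<lambda>i. snd B (a i) \<oplus>\<^bsub>fst B\<^esub> snd B w \<otimes>\<^bsub>fst B\<^esub> snd B (c i)) t"
        using a c w tB by (intro B.lin_cong) (auto simp: a'_def)
      also have "\<dots> = B.lin d (\<lambda>i. snd B (a i)) t \<oplus>\<^bsub>fst B\<^esub> snd B w \<otimes>\<^bsub>fst B\<^esub> B.lin d (\<lambda>i. snd B (c i)) t"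
        using a c w tB by (subst B.lin_add) (auto simp: B.lin_smult)
      finally have e1: "B.lin d (\<lambda>i. snd B (a' i)) t = B.lin d (\<lambda>i. snd B (a i)) t \<oplus>\<^bsub>fst B\<^esub> snd B w \<otimes>\<^bsub>fst B\<^esub> B.lin d (\<lambda>i. snd B (c i)) t" .
      have sc: "snd B (a' i) \<in> BB" if "i < Suc d'" for i using a'c that d' by simp
      have e2: "B.lin d (\<lambda>i. snd B (a' i)) t = B.lin d' (\<lambda>i. snd B ((a' \<circ> skip) i)) (t \<circ> skip)"
      proof -
        have "B.lin (Suc d') (\<lambda>i. snd B (a' i)) t = snd B (a' i0) \<otimes>\<^bsub>fst B\<^esub> t i0 \<oplus>\<^bsub>fst B\<^esub> B.lin d' ((\<lambda>i. snd B (a' i)) \<circ> skip) (t \<circ> skip)"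
          using i0 d' sc tB by (intro B.lin_skip) (auto simp: skip_def)
        moreover have "B.lin d' ((\<lambda>i. snd B (a' i)) \<circ> skip) (t \<circ> skip) \<in> BB"
          using sk a'c tB by (intro B.lin_closed) auto
        ultimately show ?thesis using a'0 tB[OF i0] d' by (simp add: comp_def)
      qed
      have "snd B (\<ominus>\<^bsub>k\<^esub> w) \<otimes>\<^bsub>fst B\<^esub> B.lin d (\<lambda>i. snd B (c i)) t \<in> I2"
        using rel w by (intro I2.I_l_closed) auto
      from I2a[OF a(2) this]
      have "z j \<ominus>\<^bsub>fst B\<^esub> B.lin d (\<lambda>i. snd B (a' i)) t \<in> I2"
        unfolding e1 using la w z j by (simp add: B.minus_eq B.minus_add B.l_minus B.a_ac)
      then show "\<exists>c. (\<forall>i < d'. c i \<in> carrier k) \<and> z j \<ominus>\<^bsub>fst B\<^esub> B.lin d' (\<lambda>i. snd B (c i)) (t \<circ> skip) \<in> I2"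
        unfolding e2 using sk a'c by (intro exI[of _ "a' \<circ> skip"]) auto
    qed (use sk tI in auto)
    then show False using d_le d' by fastforce
  qed
  then show ?thesis using t by blast
qed

text \<open>The locus where \<open>h\<close> is invertible is a neighbourhood of the section \<open>\<epsilon>\<close> on which \<open>t\<close> are etale
  coordinates.\<close>

lemma ex_etale_locus:
  assumes t: "spans d t"
  shows "\<exists>h \<in> BB. \<epsilon> h = \<one>\<^bsub>k\<^esub> \<and>
    (\<forall>\<Omega> \<psi> \<delta>. is_der \<Omega> \<psi> \<delta> \<longrightarrow> (\<forall>i < d. \<delta> (t i) = \<zero>\<^bsub>\<Omega>\<^esub>) \<longrightarrow> (\<forall>i < N. \<psi> h \<otimes>\<^bsub>\<Omega>\<^esub> \<delta> (z i) = \<zero>\<^bsub>\<Omega>\<^esub>))"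
proof -
  interpret I: ideal I "fst B" by (rule I_ideal)
  have tB: "t i \<in> BB" if "i < d" for i using t that I_sub by (auto simp: spans_def)
  \<comment> \<open>Up to a linear combination of \<open>t\<close> every generator lies in the
    square of \<open>I\<close>, so the remainder has its derivative coefficients in
    \<open>I\<close>.\<close>
  have "\<forall>j. \<exists>c \<beta>. j < N \<longrightarrow> (\<forall>i < d. c i \<in> carrier k) \<and> der_coeffs (z j \<ominus>\<^bsub>fst B\<^esub> B.lin d (\<lambda>i. snd B (c i)) t) \<beta> \<and> (\<forall>i < N. \<beta> i \<in> I)"
  proof
    fix j
    show "\<exists>c \<beta>. j < N \<longrightarrow> (\<forall>i < d. c i \<in> carrier k) \<and> der_coeffs (z j \<ominus>\<^bsub>fst B\<^esub> B.lin d (\<lambda>i. snd B (c i)) t) \<beta> \<and> (\<forall>i < N. \<beta> i \<in> I)"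
    proof (cases "j < N")
      case True
      then obtain c where c: "\<forall>i < d. c i \<in> carrier k" "z j \<ominus>\<^bsub>fst B\<^esub> B.lin d (\<lambda>i. snd B (c i)) t \<in> I2"
        using t unfolding spans_def by meson
      then show ?thesis using der_coeffs_I2[OF c(2)] by meson
    qed simp
  qed
  then obtain c \<beta> where c: "\<And>j i. j < N \<Longrightarrow> i < d \<Longrightarrow> c j i \<in> carrier k"
    and \<beta>: "\<And>j. j < N \<Longrightarrow> der_coeffs (z j \<ominus>\<^bsub>fst B\<^esub> B.lin d (\<lambda>i. snd B (c j i)) t) (\<beta> j)"
    and \<beta>I: "\<And>j i. j < N \<Longrightarrow> i < N \<Longrightarrow> \<beta> j i \<in> I" by metis
  have one: "\<one>\<^bsub>fst B\<^esub> \<ominus>\<^bsub>fst B\<^esub> \<one>\<^bsub>fst B\<^esub> \<in> I"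
    using additive_subgroup.zero_closed[OF I.additive_subgroup_axioms] by (simp add: B.minus_eq B.r_neg)
  \<comment> \<open>For a derivation that kills \<open>t\<close>, the vector of the values at
    \<open>z\<close> is fixed by the matrix \<open>\<beta>\<close> with entries in \<open>I\<close>.
    Nakayama's lemma then gives one \<open>h\<close> that annihilates these vectors for all such
    derivations.\<close>
  obtain h where h: "h \<in> BB" "h \<ominus>\<^bsub>fst B\<^esub> \<one>\<^bsub>fst B\<^esub> \<in> I" and
    nak: "\<And>(\<Omega> :: 'u ring) \<psi> v. cring \<Omega> \<and> \<psi> \<in> ring_hom (fst B) \<Omega> \<and> (\<forall>i < N. v i \<in> carrier \<Omega>) \<and>
      (\<forall>i < N. \<psi> \<one>\<^bsub>fst B\<^esub> \<otimes>\<^bsub>\<Omega>\<^esub> v i = (\<Oplus>\<^bsub>\<Omega>\<^esub>j \<in> {..<N}. \<psi> (\<beta> i j) \<otimes>\<^bsub>\<Omega>\<^esub> v j)) \<Longrightarrow>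
      (\<forall>i < N. \<psi> h \<otimes>\<^bsub>\<Omega>\<^esub> v i = \<zero>\<^bsub>\<Omega>\<^esub>)"
    using nakayama_elimination[OF B.is_cring I_ideal B.one_closed one, of N \<beta>, OF \<beta>I] by blast
  have "\<epsilon> h = \<one>\<^bsub>k\<^esub>"
  proof -
    have "\<epsilon> (h \<ominus>\<^bsub>fst B\<^esub> \<one>\<^bsub>fst B\<^esub>) = \<epsilon> h \<ominus>\<^bsub>k\<^esub> \<one>\<^bsub>k\<^esub>" using h(1) by (simp add: B.minus_eq k.minus_eq)
    then have "\<epsilon> h \<ominus>\<^bsub>k\<^esub> \<one>\<^bsub>k\<^esub> = \<zero>\<^bsub>k\<^esub>" using h(2) unfolding I_def by simp
    then show ?thesis using k.r_right_minus_eq[of "\<epsilon> h" "\<one>\<^bsub>k\<^esub>"] h(1) by blast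
  qed
  moreover have "\<forall>i < N. \<psi> h \<otimes>\<^bsub>\<Omega>\<^esub> \<delta> (z i) = \<zero>\<^bsub>\<Omega>\<^esub>"
    if d: "is_der \<Omega> \<psi> \<delta>" and kill: "\<forall>i < d. \<delta> (t i) = \<zero>\<^bsub>\<Omega>\<^esub>" for \<Omega> \<psi> \<delta>
  proof (rule nak, intro conjI allI impI)
    note D = is_derD[OF d]
    interpret \<Omega>: cring \<Omega> by (rule D(1))
    show "cring \<Omega>" "\<psi> \<in> ring_hom (fst B) \<Omega>" by (rule D)+
    fix j assume j: "j < N"
    show dz: "\<delta> (z j) \<in> carrier \<Omega>" using D(3) z j by blast
    have "\<delta> (\<Oplus>\<^bsub>fst B\<^esub>i \<in> {..<n}. snd B (c j i) \<otimes>\<^bsub>fst B\<^esub> t i) = \<zero>\<^bsub>\<Omega>\<^esub>" if "n \<le> d" for n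
      using that
    proof (induction n)
      case 0
      have "\<delta> (snd B \<zero>\<^bsub>k\<^esub>) = \<zero>\<^bsub>\<Omega>\<^esub>" by (rule D(7)) simp
      then show ?case by simp
    next
      case (Suc n)
      have cl: "snd B (c j n) \<in> BB" "t n \<in> BB" "(\<Oplus>\<^bsub>fst B\<^esub>i \<in> {..<n}. snd B (c j i) \<otimes>\<^bsub>fst B\<^esub> t i) \<in> BB"
        using c[OF j] tB Suc by (auto intro!: B.finsum_closed)
      have "(\<Oplus>\<^bsub>fst B\<^esub>i \<in> {..<Suc n}. snd B (c j i) \<otimes>\<^bsub>fst B\<^esub> t i)
          = snd B (c j n) \<otimes>\<^bsub>fst B\<^esub> t n \<oplus>\<^bsub>fst B\<^esub> (\<Oplus>\<^bsub>fst B\<^esub>i \<in> {..<n}. snd B (c j i) \<otimes>\<^bsub>fst B\<^esub> t i)"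
        unfolding lessThan_Suc using c[OF j] tB Suc by (intro B.finsum_insert) auto
      then show ?case
        using D(5)[OF B.m_closed[OF cl(1,2)] cl(3)] D(6)[OF cl(1,2)] D(4)[OF cl(1)] D(4)[OF cl(2)]
          D(7)[OF c[OF j, of n]] kill Suc by simp
    qed
    from this[of d] have l0: "\<delta> (B.lin d (\<lambda>i. snd B (c j i)) t) = \<zero>\<^bsub>\<Omega>\<^esub>" by (simp add: B.lin_def)
    have lB: "B.lin d (\<lambda>i. snd B (c j i)) t \<in> BB" using c[OF j] tB by (intro B.lin_closed) auto
    define w where "w = z j \<ominus>\<^bsub>fst B\<^esub> B.lin d (\<lambda>i. snd B (c j i)) t"
    have w: "w \<in> BB" using lB z j by (simp add: w_def)
    have "z j = w \<oplus>\<^bsub>fst B\<^esub> B.lin d (\<lambda>i. snd B (c j i)) t"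
      unfolding w_def using lB z[OF j] by (simp add: B.minus_eq B.a_assoc B.l_neg)
    then have "\<delta> (z j) = \<delta> w" using D(5)[OF w lB] l0 D(3)[OF w] by simp
    also have "\<dots> = \<Omega>.lin N (\<lambda>i. \<psi> (\<beta> j i)) (\<lambda>i. \<delta> (z i))"
      using \<beta>[OF j] d unfolding der_coeffs_def w_def by blast
    finally show "\<psi> \<one>\<^bsub>fst B\<^esub> \<otimes>\<^bsub>\<Omega>\<^esub> \<delta> (z j) = (\<Oplus>\<^bsub>\<Omega>\<^esub>i \<in> {..<N}. \<psi> (\<beta> j i) \<otimes>\<^bsub>\<Omega>\<^esub> \<delta> (z i))"
      using dz D(11) by (simp add: \<Omega>.lin_def)
  qed
  ultimately show ?thesis using h(1) by blast
qed

end

section \<open>Tangent vectors at the section\<close>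

lemma (in ideal) quotient_eq_iff:
  assumes "cring R" "cring Q" "\<pi> \<in> ring_hom R Q" "\<And>b. b \<in> carrier R \<Longrightarrow> \<pi> b = \<zero>\<^bsub>Q\<^esub> \<longleftrightarrow> b \<in> I"
    and "a \<in> carrier R" "b \<in> carrier R"
  shows "\<pi> a = \<pi> b \<longleftrightarrow> a \<ominus> b \<in> I"
proof -
  interpret h: ring_hom_cring R Q \<pi> using assms by (intro ring_hom_cringI)
  have "\<pi> (a \<ominus> b) = \<pi> a \<ominus>\<^bsub>Q\<^esub> \<pi> b" using assms(5,6) by (simp add: minus_eq h.S.minus_eq)
  then show ?thesis using assms(4)[of "a \<ominus> b"] h.S.r_right_minus_eq[of "\<pi> a" "\<pi> b"] assms(5,6) by simp
qed

context chart
begin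

text \<open>Extend \<open>k\<close> by \<open>d\<close> infinitesimals with zero products and send
  the i-th one to the class of \<open>t i\<close> in B/I^2. This map is onto because
  \<open>t\<close> spans, and its kernel has square zero, so the projection of \<open>B\<close>
  lifts. The infinitesimal components of the lift are derivations, and independence of
  \<open>t\<close> makes their values at \<open>t\<close> the identity matrix modulo
  \<open>M\<close>. Combining them with the coefficients \<open>Ts\<close> gives a tangent vector
  with prescribed coordinates modulo \<open>M\<close>.\<close>

lemma ex_first_order_lift:
  assumes sp: "spans d t" and ind: "indep d t" and R: "cring R" and \<rho>: "\<rho> \<in> ring_hom k R"
    and Ts: "\<And>i. i < d \<Longrightarrow> Ts i \<in> carrier R"
  shows "\<exists>\<delta>. derivation R BB (fst B) (\<lambda>b. \<rho> (\<epsilon> b)) \<delta> \<and> (\<forall>x \<in> carrier k. \<delta> (snd B x) = \<zero>\<^bsub>R\<^esub>) \<and>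
    (\<forall>l < d. \<exists>c. (\<forall>i < d. c i \<in> carrier k \<and> c i \<ominus>\<^bsub>k\<^esub> (if l = i then \<one>\<^bsub>k\<^esub> else \<zero>\<^bsub>k\<^esub>) \<in> M) \<and>
      \<delta> (t l) = ring.lin R d (\<lambda>i. \<rho> (c i)) Ts)"
proof -
  interpret R: cring R by fact
  interpret \<rho>: ring_hom_cring k R \<rho> using R \<rho> k.is_cring by (intro ring_hom_cringI)
  interpret I2: ideal I2 "fst B" by (rule I2_ideal)
  have tI: "t i \<in> I" and tB: "t i \<in> BB" if "i < d" for i using sp that I_sub by (auto simp: spans_def)
  let ?A0 = "trivial_ext k d"
  have A0: "cring ?A0" by (rule cring_trivial_ext[OF k.is_cring])
  interpret A0: cring ?A0 by (rule A0)
  let ?z = "\<lambda>i \<in> {..<d}. \<zero>\<^bsub>k\<^esub>"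
  have A0c: "x \<in> carrier ?A0 \<longleftrightarrow> fst x \<in> carrier k \<and> snd x \<in> {..<d} \<rightarrow>\<^sub>E carrier k" for x
    by (simp add: trivial_ext_def mem_Times_iff)
  have A0s: "snd x i \<in> carrier k" if "x \<in> carrier ?A0" "i < d" for x i
    using that PiE_mem[of "snd x" "{..<d}" "\<lambda>_. carrier k" i] by (simp add: A0c)
  obtain en :: "'u list \<Rightarrow> 'u" where en: "inj en" using ex_inj_list[OF inf] by blast
  have "carrier ?A0 \<subseteq> range (\<lambda>xs. (hd xs, \<lambda>i \<in> {..<d}. tl xs ! i))"
  proof
    fix x assume x: "x \<in> carrier ?A0"
    have "restrict (snd x) {..<d} = snd x" using x unfolding A0c by (blast intro: PiE_restrict)
    then have "x = (\<lambda>xs. (hd xs, \<lambda>i \<in> {..<d}. tl xs ! i)) (fst x # map (snd x) [0..<d])"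
      by (simp add: prod_eq_iff cong: restrict_cong)
    then show "x \<in> range (\<lambda>xs. (hd xs, \<lambda>i \<in> {..<d}. tl xs ! i))" by (rule range_eqI)
  qed
  then obtain A :: "'u ring" and h where A: "cring A" "h \<in> ring_hom ?A0 A" "bij_betw h (carrier ?A0) (carrier A)"
    using realize[OF A0 _ en] by blast
  interpret A: cring A by fact
  interpret h: ring_hom_cring ?A0 A h using A A0 by (intro ring_hom_cringI)
  have hs: "h ` carrier ?A0 = carrier A" and hinj: "inj_on h (carrier ?A0)" using A(3) by (auto simp: bij_betw_def)
  have "x = \<zero>\<^bsub>?A0\<^esub>" if "x \<in> carrier ?A0" "h x = \<zero>\<^bsub>A\<^esub>" for x
    using inj_onD[OF hinj, of x "\<zero>\<^bsub>?A0\<^esub>"] that by simp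
  then obtain g where g: "g \<in> ring_hom A ?A0" "\<And>x. x \<in> carrier ?A0 \<Longrightarrow> g (h x) = x"
    using hom_factor[OF A0 A(1) A0 A(2) hs[symmetric], of "\<lambda>x. x"] id_ring_hom[of ?A0] by (auto simp: id_def)
  obtain Q :: "'u ring" and \<pi> where Q: "cring Q" "\<pi> \<in> ring_hom (fst B) Q" "\<pi> ` BB = carrier Q"
    "\<forall>b \<in> BB. \<pi> b = \<zero>\<^bsub>Q\<^esub> \<longleftrightarrow> b \<in> I2"
    using realize_quotient[OF B.is_cring I2_ideal] by blast
  interpret Q: cring Q by fact
  interpret \<pi>: ring_hom_cring "fst B" Q \<pi> using Q B.is_cring by (intro ring_hom_cringI)
  have \<pi>eq: "\<pi> a = \<pi> b \<longleftrightarrow> a \<ominus>\<^bsub>fst B\<^esub> b \<in> I2" if "a \<in> BB" "b \<in> BB" for a b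
    by (rule I2.quotient_eq_iff[OF B.is_cring Q(1,2) _ that]) (use Q(4) in blast)
  define L where "L v = B.lin d (\<lambda>i. snd B (v i)) t" for v
  have LB: "L v \<in> BB" if "\<And>i. i < d \<Longrightarrow> v i \<in> carrier k" for v
    unfolding L_def using that tB by (intro B.lin_closed) auto
  have LI: "L v \<in> I" if v: "\<And>i. i < d \<Longrightarrow> v i \<in> carrier k" for v
  proof -
    interpret I: ideal I "fst B" by (rule I_ideal)
    show ?thesis unfolding L_def B.lin_def
      using v tI I.I_l_closed by (intro I.finsum_in_ideal) auto
  qed
  define p0 where "p0 x = \<pi> (snd B (fst x) \<oplus>\<^bsub>fst B\<^esub> L (snd x))" for x
  have L_add: "L (\<lambda>i \<in> {..<d}. v i \<oplus>\<^bsub>k\<^esub> w i) = L v \<oplus>\<^bsub>fst B\<^esub> L w"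
    if "\<And>i. i < d \<Longrightarrow> v i \<in> carrier k" "\<And>i. i < d \<Longrightarrow> w i \<in> carrier k" for v w
  proof -
    have "L (\<lambda>i \<in> {..<d}. v i \<oplus>\<^bsub>k\<^esub> w i) = B.lin d (\<lambda>i. snd B (v i) \<oplus>\<^bsub>fst B\<^esub> snd B (w i)) t"
      unfolding L_def using that tB by (intro B.lin_cong) auto
    then show ?thesis unfolding L_def using that tB by (simp add: B.lin_add)
  qed
  have L_comb: "L (\<lambda>i \<in> {..<d}. a \<otimes>\<^bsub>k\<^esub> w i \<oplus>\<^bsub>k\<^esub> b \<otimes>\<^bsub>k\<^esub> v i) = snd B a \<otimes>\<^bsub>fst B\<^esub> L w \<oplus>\<^bsub>fst B\<^esub> snd B b \<otimes>\<^bsub>fst B\<^esub> L v"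
    if "\<And>i. i < d \<Longrightarrow> v i \<in> carrier k" "\<And>i. i < d \<Longrightarrow> w i \<in> carrier k" "a \<in> carrier k" "b \<in> carrier k" for v w a b
  proof -
    have "L (\<lambda>i \<in> {..<d}. a \<otimes>\<^bsub>k\<^esub> w i \<oplus>\<^bsub>k\<^esub> b \<otimes>\<^bsub>k\<^esub> v i) =
        B.lin d (\<lambda>i. snd B a \<otimes>\<^bsub>fst B\<^esub> snd B (w i) \<oplus>\<^bsub>fst B\<^esub> snd B b \<otimes>\<^bsub>fst B\<^esub> snd B (v i)) t"
      unfolding L_def using that tB by (intro B.lin_cong) auto
    then show ?thesis unfolding L_def using that tB by (simp add: B.lin_add B.lin_smult)
  qed
  have p0: "p0 \<in> ring_hom ?A0 Q"
  proof (rule ring_hom_memI)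
    fix x assume x: "x \<in> carrier ?A0"
    then show "p0 x \<in> carrier Q" unfolding p0_def using LB[of "snd x"] A0s[OF x] by (simp add: A0c)
  next
    fix x y assume x: "x \<in> carrier ?A0" and y: "y \<in> carrier ?A0"
    have xk: "fst x \<in> carrier k" "fst y \<in> carrier k" using x y by (auto simp: A0c)
    note l = LB[of "snd x", OF A0s[OF x]] LB[of "snd y", OF A0s[OF y]]
    show "p0 (x \<oplus>\<^bsub>?A0\<^esub> y) = p0 x \<oplus>\<^bsub>Q\<^esub> p0 y"
      unfolding p0_def using L_add[OF A0s[OF x] A0s[OF y]] xk l
      by (simp add: trivial_ext_def B.a_ac Q.a_ac)
    have 1: "snd B (fst (x \<otimes>\<^bsub>?A0\<^esub> y)) \<oplus>\<^bsub>fst B\<^esub> L (snd (x \<otimes>\<^bsub>?A0\<^esub> y))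
        = snd B (fst x) \<otimes>\<^bsub>fst B\<^esub> snd B (fst y) \<oplus>\<^bsub>fst B\<^esub> (snd B (fst x) \<otimes>\<^bsub>fst B\<^esub> L (snd y) \<oplus>\<^bsub>fst B\<^esub> snd B (fst y) \<otimes>\<^bsub>fst B\<^esub> L (snd x))"
      using L_comb[OF A0s[OF x] A0s[OF y] xk] xk by (simp add: trivial_ext_def)
    have "\<pi> (L (snd x) \<otimes>\<^bsub>fst B\<^esub> L (snd y)) = \<zero>\<^bsub>Q\<^esub>"
      using Q(4) I_mult_I2[OF LI[of "snd x", OF A0s[OF x]] LI[of "snd y", OF A0s[OF y]]] l by blast
    then have "\<pi> (L (snd x)) \<otimes>\<^bsub>Q\<^esub> \<pi> (L (snd y)) = \<zero>\<^bsub>Q\<^esub>" using l by simp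
    then show "p0 (x \<otimes>\<^bsub>?A0\<^esub> y) = p0 x \<otimes>\<^bsub>Q\<^esub> p0 y"
      unfolding p0_def 1 using xk l
      by (simp add: Q.l_distr Q.r_distr Q.a_ac Q.m_comm)
  next
    have "L ?z = \<zero>\<^bsub>fst B\<^esub>" unfolding L_def using tB by (intro B.lin_zero) auto
    then show "p0 \<one>\<^bsub>?A0\<^esub> = \<one>\<^bsub>Q\<^esub>" by (simp add: p0_def trivial_ext_def)
  qed
  interpret p0: ring_hom_cring ?A0 Q p0 using p0 A0 Q by (intro ring_hom_cringI)
  have p0k: "p0 (x, ?z) = \<pi> (snd B x)" if "x \<in> carrier k" for x
  proof -
    have "L ?z = \<zero>\<^bsub>fst B\<^esub>" unfolding L_def using tB by (intro B.lin_zero) auto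
    then show ?thesis using that by (simp add: p0_def)
  qed
  have zA0: "(x, ?z) \<in> carrier ?A0" if "x \<in> carrier k" for x using that by (simp add: A0c restrict_PiE_iff)
  have p0_sur: "p0 ` carrier ?A0 = carrier Q"
  proof -
    let ?T = "{b \<in> BB. \<pi> b \<in> p0 ` carrier ?A0}"
    have img: "subring (p0 ` carrier ?A0) Q"
      using ring_hom_ring.img_is_subring[OF ring_hom_ringI2[OF A0.ring_axioms Q.ring_axioms p0] A0.carrier_is_subring] .
    have "subring ?T (fst B)" by (rule subring_vimage[OF B.is_cring Q(1,2) img])
    moreover have "snd B ` carrier k \<subseteq> ?T"
    proof
      fix b assume "b \<in> snd B ` carrier k"
      then obtain x where x: "x \<in> carrier k" "b = snd B x" by blast
      then show "b \<in> ?T" using imageI[OF zA0[OF x(1)], of p0] p0k[OF x(1)] by simp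
    qed
    moreover have "z ` {..<N} \<subseteq> ?T"
    proof
      fix b assume "b \<in> z ` {..<N}"
      then obtain j where j: "j < N" "b = z j" by blast
      obtain c where c: "\<forall>i < d. c i \<in> carrier k" "z j \<ominus>\<^bsub>fst B\<^esub> B.lin d (\<lambda>i. snd B (c i)) t \<in> I2"
        using sp j unfolding spans_def by meson
      have xA: "(\<zero>\<^bsub>k\<^esub>, \<lambda>i \<in> {..<d}. c i) \<in> carrier ?A0" using c by (simp add: A0c restrict_PiE_iff)
      have "L (\<lambda>i \<in> {..<d}. c i) = L c" unfolding L_def using c tB by (intro B.lin_cong) auto
      then have "p0 (\<zero>\<^bsub>k\<^esub>, \<lambda>i \<in> {..<d}. c i) = \<pi> (L c)" using LB[of c] c by (simp add: p0_def)
      also have "\<dots> = \<pi> (z j)" 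
      proof -
        have "L c \<in> BB" using LB[of c] c by blast
        then have "\<pi> (z j) = \<pi> (L c)" using \<pi>eq[OF z[OF j(1)]] c by (simp add: L_def)
        then show ?thesis ..
      qed
      finally show "b \<in> ?T" using imageI[OF xA, of p0] j z by simp
    qed
    ultimately have T: "BB \<subseteq> ?T" by (rule gen)
    show ?thesis
    proof (intro equalityI subsetI)
      fix y assume "y \<in> carrier Q"
      then obtain b where b: "y = \<pi> b" "b \<in> BB" unfolding Q(3)[symmetric] by (rule imageE)
      then show "y \<in> p0 ` carrier ?A0" using subsetD[OF T b(2)] by simp
    next
      fix y assume "y \<in> p0 ` carrier ?A0"
      then show "y \<in> carrier Q" by (rule imageE) (use p0.hom_closed in simp)
    qed
  qed
  have sq: "a \<otimes>\<^bsub>A\<^esub> b = \<zero>\<^bsub>A\<^esub>"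
    if ab: "a \<in> carrier A" "b \<in> carrier A" "(p0 \<circ> g) a = \<zero>\<^bsub>Q\<^esub>" "(p0 \<circ> g) b = \<zero>\<^bsub>Q\<^esub>" for a b
  proof -
    \<comment> \<open>The section recovers the constant part, because the infinitesimal part is sent
      into \<open>I\<close>. The kernel is therefore purely infinitesimal, and such elements
      multiply to zero.\<close>
    have fst0: "fst x = \<zero>\<^bsub>k\<^esub>" if x: "x \<in> carrier ?A0" "p0 x = \<zero>\<^bsub>Q\<^esub>" for x
    proof -
      have l: "L (snd x) \<in> BB" "L (snd x) \<in> I" using LB LI A0s[OF x(1)] by blast+
      have "snd B (fst x) \<oplus>\<^bsub>fst B\<^esub> L (snd x) \<in> BB" using x(1) l by (simp add: A0c)
      then have "snd B (fst x) \<oplus>\<^bsub>fst B\<^esub> L (snd x) \<in> I2" using x(2) Q(4) unfolding p0_def by blast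
      then have "\<epsilon> (snd B (fst x) \<oplus>\<^bsub>fst B\<^esub> L (snd x)) = \<zero>\<^bsub>k\<^esub>" using I2_sub by (auto simp: I_def)
      then show ?thesis using l x \<epsilon>k[of "fst x"] by (simp add: A0c I_def)
    qed
    obtain x y where xy: "x \<in> carrier ?A0" "a = h x" "y \<in> carrier ?A0" "b = h y"
      using ab(1,2) unfolding hs[symmetric] by (elim imageE)
    have "fst x = \<zero>\<^bsub>k\<^esub>" "fst y = \<zero>\<^bsub>k\<^esub>" using ab(3,4) fst0 xy g(2) by auto
    then have "x \<otimes>\<^bsub>?A0\<^esub> y = \<zero>\<^bsub>?A0\<^esub>"
      using A0s[OF xy(1)] A0s[OF xy(3)] by (auto simp: trivial_ext_def)
    then show ?thesis using xy h.hom_mult[OF xy(1,3)] by simp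
  qed
  have str: "(\<lambda>x. h (x, ?z)) \<in> ring_hom k A"
  proof -
    have "(\<lambda>x. (x, ?z)) \<in> ring_hom k ?A0"
      by (rule ring_hom_memI) (auto simp: trivial_ext_def)
    from ring_hom_trans[OF this A(2)] show ?thesis by (simp add: comp_def)
  qed
  have p_sur: "(p0 \<circ> g) ` carrier A = carrier Q"
  proof -
    have "g ` carrier A = carrier ?A0" unfolding hs[symmetric] image_image using g(2) by simp
    then show ?thesis unfolding image_comp[symmetric] using p0_sur by simp
  qed
  obtain F where F: "F \<in> ring_hom (fst B) A" "\<And>b. b \<in> BB \<Longrightarrow> (p0 \<circ> g) (F b) = \<pi> b"
    "\<And>x. x \<in> carrier k \<Longrightarrow> F (snd B x) = h (x, ?z)"
    using lifting_propertyD[OF lift B k.is_cring A(1) Q(1) str ring_hom_trans[OF g(1) p0] p_sur sq Q(2)] g(2) zA0 p0k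
    by auto
  define f where "f b = g (F b)" for b
  have f: "f \<in> ring_hom (fst B) ?A0" using ring_hom_trans[OF F(1) g(1)] by (simp add: f_def[abs_def] comp_def)
  have fA: "f b \<in> carrier ?A0" if "b \<in> BB" for b using ring_hom_closed[OF f that] .
  have fs: "snd (f b) i \<in> carrier k" if "b \<in> BB" "i < d" for b i using A0s[OF fA] that by blast
  have fst_f: "fst (f b) = \<epsilon> b" and snd_f: "snd B (\<epsilon> b) \<oplus>\<^bsub>fst B\<^esub> L (snd (f b)) \<ominus>\<^bsub>fst B\<^esub> b \<in> I2" if b: "b \<in> BB" for b
  proof -
    have l: "L (snd (f b)) \<in> BB" "L (snd (f b)) \<in> I" using LB LI fs[OF b] by blast+
    have fk: "fst (f b) \<in> carrier k" using fA[OF b] by (simp add: A0c)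
    have "\<pi> (snd B (fst (f b)) \<oplus>\<^bsub>fst B\<^esub> L (snd (f b))) = \<pi> b"
      using F(2)[OF b] by (simp add: f_def p0_def)
    then have in2: "snd B (fst (f b)) \<oplus>\<^bsub>fst B\<^esub> L (snd (f b)) \<ominus>\<^bsub>fst B\<^esub> b \<in> I2"
      using \<pi>eq[OF B.a_closed[OF s.hom_closed[OF fk] l(1)] b] by blast
    then have "\<epsilon> (snd B (fst (f b)) \<oplus>\<^bsub>fst B\<^esub> L (snd (f b)) \<ominus>\<^bsub>fst B\<^esub> b) = \<zero>\<^bsub>k\<^esub>" using I2_sub by (auto simp: I_def)
    then have "fst (f b) \<ominus>\<^bsub>k\<^esub> \<epsilon> b = \<zero>\<^bsub>k\<^esub>"
      using l b fk \<epsilon>k[OF fk] by (simp add: B.minus_eq k.minus_eq I_def)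
    then show e: "fst (f b) = \<epsilon> b" using k.r_right_minus_eq[of "fst (f b)" "\<epsilon> b"] fk b by simp
    show "snd B (\<epsilon> b) \<oplus>\<^bsub>fst B\<^esub> L (snd (f b)) \<ominus>\<^bsub>fst B\<^esub> b \<in> I2" using in2 unfolding e .
  qed
  define \<delta> where "\<delta> b = R.lin d (\<lambda>i. \<rho> (snd (f b) i)) Ts" for b
  have "derivation R BB (fst B) (\<lambda>b. \<rho> (\<epsilon> b)) \<delta>"
    unfolding derivation_def
  proof (intro conjI ballI)
    show "\<delta> \<in> BB \<rightarrow> carrier R" unfolding \<delta>_def using fs Ts by (auto intro!: R.lin_closed)
  next
    fix a b assume a: "a \<in> BB" and b: "b \<in> BB"
    have "R.lin d (\<lambda>i. \<rho> (snd (f (a \<oplus>\<^bsub>fst B\<^esub> b)) i)) Ts = R.lin d (\<lambda>i. \<rho> (snd (f a) i) \<oplus>\<^bsub>R\<^esub> \<rho> (snd (f b) i)) Ts"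
      unfolding ring_hom_add[OF f a b] using fs[OF a] fs[OF b] Ts by (intro R.lin_cong) (auto simp: trivial_ext_def)
    then show "\<delta> (a \<oplus>\<^bsub>fst B\<^esub> b) = \<delta> a \<oplus>\<^bsub>R\<^esub> \<delta> b"
      unfolding \<delta>_def using fs[OF a] fs[OF b] Ts by (simp add: R.lin_add)
    have "R.lin d (\<lambda>i. \<rho> (snd (f (a \<otimes>\<^bsub>fst B\<^esub> b)) i)) Ts
        = R.lin d (\<lambda>i. \<rho> (\<epsilon> a) \<otimes>\<^bsub>R\<^esub> \<rho> (snd (f b) i) \<oplus>\<^bsub>R\<^esub> \<rho> (\<epsilon> b) \<otimes>\<^bsub>R\<^esub> \<rho> (snd (f a) i)) Ts"
      unfolding ring_hom_mult[OF f a b] using fs[OF a] fs[OF b] Ts a b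
      by (intro R.lin_cong) (auto simp: trivial_ext_def fst_f)
    then show "\<delta> (a \<otimes>\<^bsub>fst B\<^esub> b) = \<rho> (\<epsilon> a) \<otimes>\<^bsub>R\<^esub> \<delta> b \<oplus>\<^bsub>R\<^esub> \<rho> (\<epsilon> b) \<otimes>\<^bsub>R\<^esub> \<delta> a"
      unfolding \<delta>_def using fs[OF a] fs[OF b] Ts a b by (simp add: R.lin_add R.lin_smult)
  qed
  moreover have "\<delta> (snd B x) = \<zero>\<^bsub>R\<^esub>" if x: "x \<in> carrier k" for x
  proof -
    have "f (snd B x) = (x, ?z)" unfolding f_def F(3)[OF x] using g(2)[OF zA0[OF x]] .
    then show ?thesis unfolding \<delta>_def using Ts by (intro R.lin_zero) auto
  qed
  moreover have "\<exists>c. (\<forall>i < d. c i \<in> carrier k \<and> c i \<ominus>\<^bsub>k\<^esub> (if l = i then \<one>\<^bsub>k\<^esub> else \<zero>\<^bsub>k\<^esub>) \<in> M) \<and>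
      \<delta> (t l) = R.lin d (\<lambda>i. \<rho> (c i)) Ts" if l: "l < d" for l
  proof -
    let ?c = "snd (f (t l))" and ?u = "\<lambda>i. if l = i then \<one>\<^bsub>k\<^esub> else \<zero>\<^bsub>k\<^esub>"
    have cc: "?c i \<in> carrier k" if "i < d" for i using fs[OF tB[OF l] that] .
    have l1: "L ?c \<in> BB" using LB cc by blast
    have "\<epsilon> (t l) = \<zero>\<^bsub>k\<^esub>" using tI[OF l] by (simp add: I_def)
    \<comment> \<open>The infinitesimal part of the lift of \<open>t l\<close> represents
      \<open>t l\<close> modulo I^2. Its difference from the l-th unit vector is a relation between
      the \<open>t i\<close>, to which independence applies.\<close>
    then have 1: "L ?c \<ominus>\<^bsub>fst B\<^esub> t l \<in> I2" using snd_f[OF tB[OF l]] l1 tB[OF l] by simp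
    have "L ?u = B.lin d (\<lambda>i. if l = i then \<one>\<^bsub>fst B\<^esub> else \<zero>\<^bsub>fst B\<^esub>) t"
      unfolding L_def using tB by (intro B.lin_cong) auto
    then have "L ?u = t l" using B.lin_unit[OF l, of t] tB by simp
    moreover have "L (\<lambda>i \<in> {..<d}. ?c i \<oplus>\<^bsub>k\<^esub> \<ominus>\<^bsub>k\<^esub> \<one>\<^bsub>k\<^esub> \<otimes>\<^bsub>k\<^esub> ?u i) = L ?c \<oplus>\<^bsub>fst B\<^esub> L (\<lambda>i. \<ominus>\<^bsub>k\<^esub> \<one>\<^bsub>k\<^esub> \<otimes>\<^bsub>k\<^esub> ?u i)"
      using cc by (intro L_add) auto
    moreover have "L (\<lambda>i. \<ominus>\<^bsub>k\<^esub> \<one>\<^bsub>k\<^esub> \<otimes>\<^bsub>k\<^esub> ?u i) = B.lin d (\<lambda>i. snd B (\<ominus>\<^bsub>k\<^esub> \<one>\<^bsub>k\<^esub>) \<otimes>\<^bsub>fst B\<^esub> snd B (?u i)) t"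
      unfolding L_def using tB by (intro B.lin_cong) auto
    moreover have "B.lin d (\<lambda>i. snd B (\<ominus>\<^bsub>k\<^esub> \<one>\<^bsub>k\<^esub>) \<otimes>\<^bsub>fst B\<^esub> snd B (?u i)) t = snd B (\<ominus>\<^bsub>k\<^esub> \<one>\<^bsub>k\<^esub>) \<otimes>\<^bsub>fst B\<^esub> L ?u"
      unfolding L_def using tB by (intro B.lin_smult) auto
    ultimately have "L (\<lambda>i \<in> {..<d}. ?c i \<oplus>\<^bsub>k\<^esub> \<ominus>\<^bsub>k\<^esub> \<one>\<^bsub>k\<^esub> \<otimes>\<^bsub>k\<^esub> ?u i) = L ?c \<ominus>\<^bsub>fst B\<^esub> t l"
      using tB[OF l] l1 by (simp add: B.minus_eq B.l_minus)
    then have "B.lin d (\<lambda>i. snd B ((\<lambda>i \<in> {..<d}. ?c i \<oplus>\<^bsub>k\<^esub> \<ominus>\<^bsub>k\<^esub> \<one>\<^bsub>k\<^esub> \<otimes>\<^bsub>k\<^esub> ?u i) i)) t \<in> I2"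
      using 1 by (simp add: L_def)
    moreover have "\<forall>i < d. (\<lambda>i \<in> {..<d}. ?c i \<oplus>\<^bsub>k\<^esub> \<ominus>\<^bsub>k\<^esub> \<one>\<^bsub>k\<^esub> \<otimes>\<^bsub>k\<^esub> ?u i) i \<in> carrier k" using cc by simp
    ultimately have "\<forall>i < d. (\<lambda>i \<in> {..<d}. ?c i \<oplus>\<^bsub>k\<^esub> \<ominus>\<^bsub>k\<^esub> \<one>\<^bsub>k\<^esub> \<otimes>\<^bsub>k\<^esub> ?u i) i \<in> M"
      using ind unfolding indep_def by blast
    moreover have "?c i \<oplus>\<^bsub>k\<^esub> \<ominus>\<^bsub>k\<^esub> \<one>\<^bsub>k\<^esub> \<otimes>\<^bsub>k\<^esub> ?u i = ?c i \<ominus>\<^bsub>k\<^esub> ?u i" if "i < d" for i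
      using cc[OF that] by (simp add: k.minus_eq k.l_minus)
    ultimately have "\<forall>i < d. ?c i \<in> carrier k \<and> ?c i \<ominus>\<^bsub>k\<^esub> ?u i \<in> M" using cc by simp
    then show ?thesis unfolding \<delta>_def by blast
  qed
  ultimately show ?thesis by blast
qed

end

section \<open>Monomials along a generic arc and the primes defined by the arc\<close>

lemma mon_replicate:
  assumes "cring R" "set ts \<subseteq> carrier R"
  shows "mon R ts (replicate (length ts) 0) = \<one>\<^bsub>R\<^esub>"
proof -
  interpret cring R by fact
  show ?thesis using assms(2) by (induction ts) auto
qed

lemma mon_unit:
  assumes "cring R" "set ts \<subseteq> carrier R" "j < length ts"
  shows "mon R ts ((replicate (length ts) 0)[j := 1]) = ts ! j"
proof -
  interpret cring R by fact
  show ?thesis using assms(2,3)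
  proof (induction ts arbitrary: j)
    case (Cons t ts)
    show ?case
    proof (cases j)
      case 0 then show ?thesis using Cons mon_replicate[OF is_cring, of ts] by simp
    next
      case (Suc i)
      then have "ts ! i \<in> carrier R" using Cons.prems nth_mem[of i ts] by auto
      then show ?thesis using Cons Suc by simp
    qed
  qed simp
qed

lemma mon_mult:
  assumes "cring R" "set ts \<subseteq> carrier R" "length a = length ts" "length b = length ts"
  shows "mon R ts a \<otimes>\<^bsub>R\<^esub> mon R ts b = mon R ts (map2 (+) a b)"
proof -
  interpret cring R by fact
  show ?thesis using assms(3) assms(4)[symmetric] assms(2)
  proof (induction a ts b rule: list_induct3)
    case (Cons x xs t ts y ys)
    have "mon R ts xs \<in> carrier R" "mon R ts ys \<in> carrier R" using mon_closed[OF is_cring] Cons.prems by auto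
    moreover have t: "t \<in> carrier R" using Cons.prems by simp
    ultimately have "t [^]\<^bsub>R\<^esub> x \<otimes>\<^bsub>R\<^esub> mon R ts xs \<otimes>\<^bsub>R\<^esub> (t [^]\<^bsub>R\<^esub> y \<otimes>\<^bsub>R\<^esub> mon R ts ys) = (t [^]\<^bsub>R\<^esub> x \<otimes>\<^bsub>R\<^esub> t [^]\<^bsub>R\<^esub> y) \<otimes>\<^bsub>R\<^esub> (mon R ts xs \<otimes>\<^bsub>R\<^esub> mon R ts ys)"
      by (simp add: m_ac)
    then show ?case using Cons t by (simp add: nat_pow_mult)
  qed simp
qed

lemma ps_hom_finsum:
  assumes "cring B" "cring R" "ps_hom B R \<phi>" "\<And>a. a \<in> A \<Longrightarrow> f a \<in> carrier B"
  shows "\<phi> (finsum B f A) i = finsum R (\<lambda>a. \<phi> (f a) i) A"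
  using assms(4)
proof (induction A rule: infinite_finite_induct)
  case (insert x F)
  interpret B: cring B by fact
  interpret R: cring R by fact
  have c: "\<phi> (f a) i \<in> carrier R" if "a \<in> insert x F" for a
    using ps_homD(1)[OF assms(3), of "f a" "f a"] insert.prems that by blast
  have fc: "finsum B f F \<in> carrier B" using insert.prems by (intro B.finsum_closed) auto
  have "finsum B f (insert x F) = f x \<oplus>\<^bsub>B\<^esub> finsum B f F" using insert by (intro B.finsum_insert) auto
  then show ?case
    using ps_homD(2)[OF assms(3) insert.prems[of x] fc] insert c by (simp add: R.finsum_insert Pi_iff)
next
  case empty
  interpret B: cring B by fact
  interpret R: cring R by fact
  show ?case using ps_hom_zero[OF assms(1-3)] by simp
next
  case (infinite A)
  interpret B: cring B by fact
  interpret R: cring R by fact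
  show ?case using infinite ps_hom_zero[OF assms(1-3)] by (simp add: finsum_def finprod_def)
qed

text \<open>The coefficient \<open>a\<close> at \<open>r\<close> may be zero. Thus the notion is
  compatible with products over any commutative ring, and no order of vanishing has to be
  defined.\<close>

definition ps_init :: "('a, 'm) ring_scheme \<Rightarrow> (nat \<Rightarrow> 'a) \<Rightarrow> nat \<Rightarrow> 'a \<Rightarrow> bool" where
  "ps_init R f r a \<longleftrightarrow> (\<forall>i < r. f i = \<zero>\<^bsub>R\<^esub>) \<and> f r = a"

lemma ps_init_mult:
  assumes "cring R" "ps_hom B R \<phi>" "x \<in> carrier B" "y \<in> carrier B"
    and x: "ps_init R (\<phi> x) r a" and y: "ps_init R (\<phi> y) s b"
  shows "ps_init R (\<phi> (x \<otimes>\<^bsub>B\<^esub> y)) (r + s) (a \<otimes>\<^bsub>R\<^esub> b)"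
proof -
  interpret R: cring R by fact
  have c: "\<phi> x i \<in> carrier R" "\<phi> y i \<in> carrier R" for i
    using ps_homD(1)[OF assms(2)] assms(3,4) by blast+
  note M = ps_homD(3)[OF assms(2-4)]
  have "\<phi> (x \<otimes>\<^bsub>B\<^esub> y) i = \<zero>\<^bsub>R\<^esub>" if i: "i < r + s" for i
  proof -
    have "\<phi> (x \<otimes>\<^bsub>B\<^esub> y) i = (\<Oplus>\<^bsub>R\<^esub>j \<in> {..i}. \<zero>\<^bsub>R\<^esub>)"
      unfolding M
    proof (rule R.finsum_cong')
      fix j assume "j \<in> {..i}"
      then have "j < r \<or> i - j < s" using i by auto
      then show "\<phi> x j \<otimes>\<^bsub>R\<^esub> \<phi> y (i - j) = \<zero>\<^bsub>R\<^esub>" using x y c by (auto simp: ps_init_def)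
    qed auto
    then show ?thesis by simp
  qed
  moreover have "\<phi> (x \<otimes>\<^bsub>B\<^esub> y) (r + s) = (\<Oplus>\<^bsub>R\<^esub>j \<in> {..r + s}. if r = j then a \<otimes>\<^bsub>R\<^esub> b else \<zero>\<^bsub>R\<^esub>)"
    unfolding M
  proof (rule R.finsum_cong')
    show "(\<lambda>j. if r = j then a \<otimes>\<^bsub>R\<^esub> b else \<zero>\<^bsub>R\<^esub>) \<in> {..r + s} \<rightarrow> carrier R"
      using c[of r] c[of s] x y by (auto simp: ps_init_def)
    fix j assume "j \<in> {..r + s}"
    moreover have "j < r \<or> j = r \<or> r + s - j < s" if "j \<le> r + s" using that by auto
    ultimately show "\<phi> x j \<otimes>\<^bsub>R\<^esub> \<phi> y (r + s - j) = (if r = j then a \<otimes>\<^bsub>R\<^esub> b else \<zero>\<^bsub>R\<^esub>)"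
      using x y c by (auto simp: ps_init_def)
  qed simp
  moreover have "\<dots> = a \<otimes>\<^bsub>R\<^esub> b"
    using c[of r] c[of s] x y R.finsum_singleton[of r "{..r + s}" "\<lambda>_. a \<otimes>\<^bsub>R\<^esub> b"] by (auto simp: ps_init_def)
  ultimately show ?thesis by (simp add: ps_init_def)
qed

lemma ps_init_one: "ps_hom B R \<phi> \<Longrightarrow> ps_init R (\<phi> \<one>\<^bsub>B\<^esub>) 0 \<one>\<^bsub>R\<^esub>"
  by (simp add: ps_hom_def ps_init_def)

lemma ps_init_mon:
  assumes "cring B" "cring R" "ps_hom B R \<phi>"
  shows "length ts = length ns \<Longrightarrow> set ts \<subseteq> carrier B \<Longrightarrow> (\<And>t. t \<in> set ts \<Longrightarrow> ps_init R (\<phi> t) 1 (\<theta> t)) \<Longrightarrow>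
    ps_init R (\<phi> (mon B ts ns)) (sum_list ns) (mon R (map \<theta> ts) ns)"
proof (induction ts ns rule: list_induct2)
  case Nil
  then show ?case using ps_init_one[OF assms(3)] by simp
next
  case (Cons t ts n ns)
  interpret B: cring B by fact
  interpret R: cring R by fact
  have t: "t \<in> carrier B" "ps_init R (\<phi> t) 1 (\<theta> t)" using Cons.prems by auto
  have "ps_init R (\<phi> (t [^]\<^bsub>B\<^esub> n)) n (\<theta> t [^]\<^bsub>R\<^esub> n)"
  proof (induction n)
    case 0
    then show ?case using ps_init_one[OF assms(3)] by simp
  next
    case (Suc n)
    then show ?case using ps_init_mult[OF assms(2,3) B.nat_pow_closed[OF t(1)] t(1) Suc t(2)] by simp
  qed
  moreover have "ps_init R (\<phi> (mon B ts ns)) (sum_list ns) (mon R (map \<theta> ts) ns)" using Cons by simp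
  ultimately show ?case
    using ps_init_mult[OF assms(2,3) B.nat_pow_closed[OF t(1)] mon_closed[OF assms(1)]] Cons.prems by simp
qed

context chart
begin

text \<open>\<open>q\<close> and \<open>p\<close> come from a formal arc through \<open>\<epsilon>\<close> in a generic direction \<open>Ts\<close>: its coordinates
  \<open>t\<close> are congruent to \<open>Ts s\<close> modulo \<open>MM\<close> and \<open>s\<^sup>2\<close>, so that the lowest form of a polynomial in \<open>t\<close>
  determines the initial coefficient of its restriction to the arc.\<close>

lemma ex_generic_primes:
  assumes sp: "spans d t" and ind: "indep d t"
  shows "\<exists>q p. primeideal q (fst B) \<and> primeideal p (fst B) \<and> q \<subseteq> p \<and>
    (\<forall>x \<in> carrier k. snd B x \<in> q \<longrightarrow> x = \<zero>\<^bsub>k\<^esub>) \<and> (\<forall>x \<in> carrier k. snd B x \<in> p \<longleftrightarrow> x \<in> M) \<and>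
    (\<forall>b \<in> BB. \<epsilon> b = \<one>\<^bsub>k\<^esub> \<longrightarrow> b \<notin> p) \<and> generic_seq k M (fst B) (snd B) p (map t [0..<d])"
proof -
  have tI: "t i \<in> I" and tB: "t i \<in> BB" if "i < d" for i using sp that I_sub by (auto simp: spans_def)
  obtain R :: "'u ring" and \<rho> MM Ts where R: "domain R" and \<rho>: "\<rho> \<in> ring_hom k R" "inj_on \<rho> (carrier k)"
    and MM: "primeideal MM R" "\<rho> ` M \<subseteq> MM" and Ts: "set Ts \<subseteq> carrier R" "length Ts = d"
    and gR: "generic_seq k M R \<rho> MM Ts"
    using ex_generic_seq[OF inf k M, of d] by blast
  interpret R: domain R by fact
  interpret \<rho>: ring_hom_cring k R \<rho> using R.is_cring \<rho>(1) k.is_cring by (intro ring_hom_cringI)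
  interpret MM: primeideal MM R by fact
  have Tc: "Ts ! i \<in> carrier R" if "i < d" for i using Ts that by auto
  obtain \<delta> where \<delta>: "derivation R BB (fst B) (\<lambda>b. \<rho> (\<epsilon> b)) \<delta>" "\<forall>x \<in> carrier k. \<delta> (snd B x) = \<zero>\<^bsub>R\<^esub>"
    and \<delta>t: "\<And>l. l < d \<Longrightarrow> \<exists>c. (\<forall>i < d. c i \<in> carrier k \<and> c i \<ominus>\<^bsub>k\<^esub> (if l = i then \<one>\<^bsub>k\<^esub> else \<zero>\<^bsub>k\<^esub>) \<in> M) \<and>
      \<delta> (t l) = R.lin d (\<lambda>i. \<rho> (c i)) ((!) Ts)"
    using ex_first_order_lift[OF sp ind R.is_cring \<rho>(1), of "(!) Ts"] Tc by blast
  have e: "(\<lambda>b. \<rho> (\<epsilon> b)) \<in> ring_hom (fst B) R" using ring_hom_trans[OF \<epsilon> \<rho>(1)] by (simp add: comp_def)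
  obtain \<phi> where \<phi>: "ps_hom (fst B) R \<phi>" "\<And>b. b \<in> BB \<Longrightarrow> \<phi> b 0 = \<rho> (\<epsilon> b)" "\<And>b. b \<in> BB \<Longrightarrow> \<phi> b 1 = \<delta> b"
    and \<phi>k: "\<And>x i. x \<in> carrier k \<Longrightarrow> \<phi> (snd B x) i = (if i = 0 then \<rho> x else \<zero>\<^bsub>R\<^esub>)"
    using ex_ps_lift[OF inf R.is_cring k.is_cring \<rho>(1) B lift e \<delta>(1)] \<epsilon>k \<delta>(2) by auto
  \<comment> \<open>\<open>q\<close> consists of the functions that vanish on the arc, and
    \<open>p\<close> of those that vanish on it modulo \<open>MM\<close>. They are the generic and
    the special point that the valuation ring will connect.\<close>
  define q where "q = {b \<in> BB. \<forall>i. \<phi> b i \<in> {\<zero>\<^bsub>R\<^esub>}}"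
  define p where "p = {b \<in> BB. \<forall>i. \<phi> b i \<in> MM}"
  have q: "primeideal q (fst B)" unfolding q_def
    by (rule ps_hom_primeideal[OF B.is_cring R.zeroprimeideal \<phi>(1)])
  have p: "primeideal p (fst B)" unfolding p_def
    by (rule ps_hom_primeideal[OF B.is_cring MM(1) \<phi>(1)])
  have qp: "q \<subseteq> p" unfolding q_def p_def using additive_subgroup.zero_closed[OF MM.additive_subgroup_axioms] by auto
  have q0: "x = \<zero>\<^bsub>k\<^esub>" if x: "x \<in> carrier k" "snd B x \<in> q" for x
  proof -
    have "\<rho> x = \<zero>\<^bsub>R\<^esub>" using x \<phi>k[OF x(1), of 0] by (auto simp: q_def)
    then show ?thesis using inj_onD[OF \<rho>(2), of x "\<zero>\<^bsub>k\<^esub>"] x by simp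
  qed
  have inM: "x \<in> M" if x: "x \<in> carrier k" "\<rho> x \<in> MM" for x
  proof -
    have "(\<Oplus>\<^bsub>R\<^esub>\<alpha> \<in> {replicate d 0}. \<rho> x \<otimes>\<^bsub>R\<^esub> mon R Ts \<alpha>) \<in> MM"
      using x mon_replicate[OF R.is_cring Ts(1)] Ts(2) by simp
    then show ?thesis using gR[unfolded generic_seq_def, rule_format, of "{replicate d 0}" "\<lambda>_. x"] x Ts(2) by simp
  qed
  have pM: "snd B x \<in> p \<longleftrightarrow> x \<in> M" if x: "x \<in> carrier k" for x
  proof
    assume "snd B x \<in> p"
    then have "\<rho> x \<in> MM" using \<phi>k[OF x, of 0] by (auto simp: p_def dest: spec[of _ 0])
    then show "x \<in> M" by (rule inM[OF x])
  next
    assume "x \<in> M"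
    then have "\<rho> x \<in> MM" using MM(2) by auto
    then show "snd B x \<in> p" using \<phi>k[OF x] x additive_subgroup.zero_closed[OF MM.additive_subgroup_axioms]
      by (auto simp: p_def)
  qed
  have p1: "b \<notin> p" if b: "b \<in> BB" "\<epsilon> b = \<one>\<^bsub>k\<^esub>" for b
  proof
    assume "b \<in> p"
    then have "\<phi> b 0 \<in> MM" by (simp add: p_def)
    then have "\<one>\<^bsub>R\<^esub> \<in> MM" using \<phi>(2)[OF b(1)] b(2) by simp
    then show False using MM.one_imp_carrier MM.I_notcarr by blast
  qed
  \<comment> \<open>In R/MM the congruence between the tangent direction and \<open>Ts\<close>
    becomes an equality, so monomials in the two agree.\<close>
  obtain Q :: "'u ring" and \<kappa> where Q: "cring Q" "\<kappa> \<in> ring_hom R Q" "\<And>b. b \<in> carrier R \<Longrightarrow> \<kappa> b = \<zero>\<^bsub>Q\<^esub> \<longleftrightarrow> b \<in> MM"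
    using realize_quotient[OF R.is_cring, of MM] MM.is_ideal by blast
  interpret Q: cring Q by fact
  interpret \<kappa>: ring_hom_cring R Q \<kappa> using Q R.is_cring by (intro ring_hom_cringI)
  have \<kappa>M: "\<kappa> (\<rho> x) = \<zero>\<^bsub>Q\<^esub>" if "x \<in> M" for x
    using Q(3)[of "\<rho> x"] MM(2) that MM.Icarr by blast
  have \<delta>c: "\<delta> b \<in> carrier R" if "b \<in> BB" for b using \<delta>(1) that by (auto simp: derivation_def)
  have \<kappa>\<delta>: "\<kappa> (\<delta> (t l)) = \<kappa> (Ts ! l)" if l: "l < d" for l
  proof -
    obtain c where c: "\<And>i. i < d \<Longrightarrow> c i \<in> carrier k" "\<And>i. i < d \<Longrightarrow> c i \<ominus>\<^bsub>k\<^esub> (if l = i then \<one>\<^bsub>k\<^esub> else \<zero>\<^bsub>k\<^esub>) \<in> M"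
      "\<delta> (t l) = R.lin d (\<lambda>i. \<rho> (c i)) ((!) Ts)" using \<delta>t[OF l] by blast
    have ci: "\<kappa> (\<rho> (c i)) = (if l = i then \<one>\<^bsub>Q\<^esub> else \<zero>\<^bsub>Q\<^esub>)" if i: "i < d" for i
    proof -
      define u where "u = (if l = i then \<one>\<^bsub>k\<^esub> else \<zero>\<^bsub>k\<^esub>)"
      have u: "u \<in> carrier k" by (simp add: u_def)
      have cu: "\<kappa> (\<rho> (c i)) \<in> carrier Q" "\<kappa> (\<rho> u) \<in> carrier Q" using c(1)[OF i] u by simp_all
      have "\<kappa> (\<rho> (c i \<ominus>\<^bsub>k\<^esub> u)) = \<kappa> (\<rho> (c i)) \<ominus>\<^bsub>Q\<^esub> \<kappa> (\<rho> u)"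
        using c(1)[OF i] u unfolding k.minus_eq Q.minus_eq
        by (simp only: \<rho>.hom_add \<rho>.hom_a_inv \<kappa>.hom_add \<kappa>.hom_a_inv \<rho>.hom_closed k.a_inv_closed R.a_inv_closed)
      then have "\<kappa> (\<rho> (c i)) \<ominus>\<^bsub>Q\<^esub> \<kappa> (\<rho> u) = \<zero>\<^bsub>Q\<^esub>" using \<kappa>M[OF c(2)[OF i]] by (simp add: u_def)
      then have "\<kappa> (\<rho> (c i)) = \<kappa> (\<rho> u)"
        by (rule iffD1[OF Q.r_right_minus_eq[OF cu]])
      then show ?thesis by (simp add: u_def)
    qed
    have "\<kappa> (\<delta> (t l)) = (\<Oplus>\<^bsub>Q\<^esub>i \<in> {..<d}. \<kappa> (\<rho> (c i) \<otimes>\<^bsub>R\<^esub> Ts ! i))"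
      unfolding c(3) R.lin_def using c(1) Tc by (intro ring_hom_finsum[OF R.is_cring Q(1,2)]) auto
    also have "\<dots> = Q.lin d (\<lambda>i. if l = i then \<one>\<^bsub>Q\<^esub> else \<zero>\<^bsub>Q\<^esub>) (\<lambda>i. \<kappa> (Ts ! i))"
      unfolding Q.lin_def using c(1) Tc ci by (intro Q.finsum_cong') auto
    also have "\<dots> = \<kappa> (Ts ! l)" using l Tc by (intro Q.lin_unit) auto
    finally show ?thesis .
  qed
  let ?ts = "map t [0..<d]"
  have tsB: "set ?ts \<subseteq> BB" using tB by auto
  have \<kappa>mon: "\<kappa> (mon R (map \<delta> ?ts) \<alpha>) = \<kappa> (mon R Ts \<alpha>)" for \<alpha>
  proof -
    have "map \<kappa> (map \<delta> ?ts) = map \<kappa> Ts" using \<kappa>\<delta> Ts(2) by (intro nth_equalityI) auto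
    moreover have "set (map \<delta> ?ts) \<subseteq> carrier R" using \<delta>c tB by auto
    ultimately show ?thesis using mon_hom[OF R.is_cring Q(1,2)] Ts(1) by simp
  qed
  have init: "ps_init R (\<phi> (mon (fst B) ?ts \<alpha>)) (sum_list \<alpha>) (mon R (map \<delta> ?ts) \<alpha>)" if "length \<alpha> = d" for \<alpha>
  proof (rule ps_init_mon[OF B.is_cring R.is_cring \<phi>(1)])
    fix x assume "x \<in> set ?ts"
    then obtain i where i: "i < d" "x = t i" by auto
    then show "ps_init R (\<phi> x) 1 (\<delta> x)"
      using \<phi>(2)[OF tB[OF i(1)]] \<phi>(3)[OF tB[OF i(1)]] tI[OF i(1)] by (simp add: ps_init_def I_def)
  qed (use that tsB in auto)
  have monB: "mon (fst B) ?ts \<alpha> \<in> BB" for \<alpha> by (rule mon_closed[OF B.is_cring tsB])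
  have monR: "mon R Ts \<alpha> \<in> carrier R" for \<alpha> by (rule mon_closed[OF R.is_cring Ts(1)])
  have \<phi>c: "\<phi> b i \<in> carrier R" if "b \<in> BB" for b i using ps_homD(1)[OF \<phi>(1) that that] .
  have \<phi>sm: "\<phi> (snd B x \<otimes>\<^bsub>fst B\<^esub> b) i = \<rho> x \<otimes>\<^bsub>R\<^esub> \<phi> b i" if x: "x \<in> carrier k" and b: "b \<in> BB" for x b i
  proof -
    have "\<phi> (snd B x \<otimes>\<^bsub>fst B\<^esub> b) i = (\<Oplus>\<^bsub>R\<^esub>j \<in> {..i}. if 0 = j then \<rho> x \<otimes>\<^bsub>R\<^esub> \<phi> b i else \<zero>\<^bsub>R\<^esub>)"
      unfolding ps_homD(3)[OF \<phi>(1) s.hom_closed[OF x] b]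
      using \<phi>k[OF x] \<phi>c[OF b] x by (intro R.finsum_cong') auto
    also have "\<dots> = \<rho> x \<otimes>\<^bsub>R\<^esub> \<phi> b i"
      using \<phi>c[OF b] x R.finsum_singleton[of 0 "{..i}" "\<lambda>_. \<rho> x \<otimes>\<^bsub>R\<^esub> \<phi> b i"] by auto
    finally show ?thesis .
  qed
  have "generic_seq k M (fst B) (snd B) p ?ts"
    unfolding generic_seq_def
  proof (intro allI impI, elim conjE, rule ccontr)
    fix A :: "nat list set" and c
    assume A: "finite A" "\<forall>\<alpha> \<in> A. length \<alpha> = length ?ts" "c \<in> A \<rightarrow> carrier k"
      and S: "(\<Oplus>\<^bsub>fst B\<^esub>\<alpha> \<in> A. snd B (c \<alpha>) \<otimes>\<^bsub>fst B\<^esub> mon (fst B) ?ts \<alpha>) \<in> p" and no: "\<not> (\<forall>\<alpha> \<in> A. c \<alpha> \<in> M)"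
    have ck: "c \<alpha> \<in> carrier k" if "\<alpha> \<in> A" for \<alpha> using A(3) that by auto
    \<comment> \<open>\<open>r\<close> is the least total degree of a term with coefficient outside
      \<open>M\<close>. At the r-th coefficient of the arc, terms of lower degree vanish modulo
      \<open>MM\<close>, and terms of higher degree start later. What remains is a form evaluated at
      the generic direction.\<close>
    define r where "r = (LEAST r. \<exists>\<alpha> \<in> A. c \<alpha> \<notin> M \<and> sum_list \<alpha> = r)"
    have ex: "\<exists>r. \<exists>\<alpha> \<in> A. c \<alpha> \<notin> M \<and> sum_list \<alpha> = r" using no by blast
    obtain \<alpha>0 where \<alpha>0: "\<alpha>0 \<in> A" "c \<alpha>0 \<notin> M" "sum_list \<alpha>0 = r"
      using LeastI_ex[OF ex] unfolding r_def by blast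
    have r_le: "c \<alpha> \<in> M" if "\<alpha> \<in> A" "sum_list \<alpha> < r" for \<alpha>
      using not_less_Least[of "sum_list \<alpha>" "\<lambda>r. \<exists>\<alpha> \<in> A. c \<alpha> \<notin> M \<and> sum_list \<alpha> = r"] that unfolding r_def by blast
    let ?f = "\<lambda>\<alpha>. snd B (c \<alpha>) \<otimes>\<^bsub>fst B\<^esub> mon (fst B) ?ts \<alpha>"
    let ?g = "\<lambda>\<alpha>. if sum_list \<alpha> = r then \<rho> (c \<alpha>) \<otimes>\<^bsub>R\<^esub> mon R Ts \<alpha> else \<zero>\<^bsub>R\<^esub>"
    have fB: "?f \<alpha> \<in> BB" if "\<alpha> \<in> A" for \<alpha> using ck[OF that] monB by simp
    have gR': "?g \<alpha> \<in> carrier R" if "\<alpha> \<in> A" for \<alpha> using ck[OF that] monR by simp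
    have fg: "\<kappa> (\<phi> (?f \<alpha>) r) = \<kappa> (?g \<alpha>)" if \<alpha>: "\<alpha> \<in> A" for \<alpha>
    proof -
      have 1: "\<phi> (?f \<alpha>) r = \<rho> (c \<alpha>) \<otimes>\<^bsub>R\<^esub> \<phi> (mon (fst B) ?ts \<alpha>) r" by (rule \<phi>sm[OF ck[OF \<alpha>] monB])
      have len: "length \<alpha> = d" using A(2) \<alpha> by simp
      note c = \<phi>c[OF monB[of \<alpha>], of r] ck[OF \<alpha>] monR[of \<alpha>]
      consider "sum_list \<alpha> < r" | "sum_list \<alpha> = r" | "r < sum_list \<alpha>" by linarith
      then show ?thesis
      proof cases
        case 1
        then show ?thesis using \<open>\<phi> (?f \<alpha>) r = _\<close> c \<kappa>M[OF r_le[OF \<alpha> 1]] by simp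
      next
        case 2
        then have "\<phi> (mon (fst B) ?ts \<alpha>) r = mon R (map \<delta> ?ts) \<alpha>" using init[OF len] by (simp add: ps_init_def)
        then show ?thesis using \<open>\<phi> (?f \<alpha>) r = _\<close> 2 c \<kappa>mon[of \<alpha>] by simp
      next
        case 3
        then have "\<phi> (mon (fst B) ?ts \<alpha>) r = \<zero>\<^bsub>R\<^esub>" using init[OF len] by (simp add: ps_init_def)
        then show ?thesis using \<open>\<phi> (?f \<alpha>) r = _\<close> 3 c by simp
      qed
    qed
    have "\<phi> (finsum (fst B) ?f A) r \<in> MM" using S by (simp add: p_def)
    then have "(\<Oplus>\<^bsub>R\<^esub>\<alpha> \<in> A. \<phi> (?f \<alpha>) r) \<in> MM"
      using ps_hom_finsum[OF B.is_cring R.is_cring \<phi>(1), of A ?f r] fB by simp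
    then have "\<kappa> (\<Oplus>\<^bsub>R\<^esub>\<alpha> \<in> A. \<phi> (?f \<alpha>) r) = \<zero>\<^bsub>Q\<^esub>" using Q(3) MM.Icarr by blast
    also have "\<kappa> (\<Oplus>\<^bsub>R\<^esub>\<alpha> \<in> A. \<phi> (?f \<alpha>) r) = (\<Oplus>\<^bsub>Q\<^esub>\<alpha> \<in> A. \<kappa> (\<phi> (?f \<alpha>) r))"
      using \<phi>c fB by (intro ring_hom_finsum[OF R.is_cring Q(1,2)]) auto
    also have "\<dots> = (\<Oplus>\<^bsub>Q\<^esub>\<alpha> \<in> A. \<kappa> (?g \<alpha>))"
      using fg gR' by (intro Q.finsum_cong') (auto intro!: \<kappa>.hom_closed)
    also have "\<dots> = \<kappa> (\<Oplus>\<^bsub>R\<^esub>\<alpha> \<in> A. ?g \<alpha>)"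
      using gR' by (intro ring_hom_finsum[OF R.is_cring Q(1,2), symmetric]) auto
    finally have "(\<Oplus>\<^bsub>R\<^esub>\<alpha> \<in> A. ?g \<alpha>) \<in> MM" using Q(3) R.finsum_closed[of ?g A] gR' by blast
    moreover have "(\<Oplus>\<^bsub>R\<^esub>\<alpha> \<in> A. ?g \<alpha>) = (\<Oplus>\<^bsub>R\<^esub>\<alpha> \<in> {\<alpha> \<in> A. sum_list \<alpha> = r}. \<rho> (c \<alpha>) \<otimes>\<^bsub>R\<^esub> mon R Ts \<alpha>)"
      using A(1) ck monR by (intro R.add.finprod_mono_neutral_cong_right) auto
    ultimately have "(\<Oplus>\<^bsub>R\<^esub>\<alpha> \<in> {\<alpha> \<in> A. sum_list \<alpha> = r}. \<rho> (c \<alpha>) \<otimes>\<^bsub>R\<^esub> mon R Ts \<alpha>) \<in> MM" by simp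
    then have "\<forall>\<alpha> \<in> {\<alpha> \<in> A. sum_list \<alpha> = r}. c \<alpha> \<in> M"
      using gR[unfolded generic_seq_def, rule_format, of "{\<alpha> \<in> A. sum_list \<alpha> = r}" c] A ck Ts(2) by auto
    then show False using \<alpha>0 by blast
  qed
  then show ?thesis using q p qp q0 pM p1 by blast
qed

text \<open>The subring \<open>k[ts]\<close>, described as a span of monomials because genericity is
  a statement about coefficients of monomials.\<close>

definition polys :: "'u list \<Rightarrow> 'u set" where
  "polys ts = B.span_mod (snd B ` carrier k) {\<zero>\<^bsub>fst B\<^esub>} (mon (fst B) ts ` {\<alpha>. length \<alpha> = length ts})"

lemma subring_k: "subring (snd B ` carrier k) (fst B)"
  using ring_hom_ring.img_is_subring[OF ring_hom_ringI2[OF k.ring_axioms B.ring_axioms algebrasD(2)[OF B]] k.carrier_is_subring] .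

lemma polys_subring:
  assumes ts: "set ts \<subseteq> BB"
  shows "subring (polys ts) (fst B)" "snd B ` carrier k \<subseteq> polys ts" "set ts \<subseteq> polys ts"
proof -
  let ?S = "snd B ` carrier k" and ?N = "{\<zero>\<^bsub>fst B\<^esub>}" and ?G = "mon (fst B) ts ` {\<alpha>. length \<alpha> = length ts}"
  have Z: "ideal ?N (fst B)" by (rule B.zeroideal)
  have G: "?G \<subseteq> BB" using mon_closed[OF B.is_cring ts] by auto
  note add = B.span_mod_add[OF subring_k Z G] and smult = B.span_mod_smult[OF subring_k Z G]
    and gen = B.span_mod_gen[OF subring_k Z G] and closed = B.span_mod_closed[OF subring_k Z G]
  have one: "\<one>\<^bsub>fst B\<^esub> \<in> ?G"
    using mon_replicate[OF B.is_cring ts] by (intro image_eqI[of _ _ "replicate (length ts) 0"]) auto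
  show kp: "?S \<subseteq> polys ts"
  proof
    fix b assume b: "b \<in> ?S"
    then have "b \<otimes>\<^bsub>fst B\<^esub> \<one>\<^bsub>fst B\<^esub> \<in> polys ts" unfolding polys_def by (rule smult) (rule gen[OF one])
    then show "b \<in> polys ts" using b by auto
  qed
  show "set ts \<subseteq> polys ts"
  proof
    fix b assume "b \<in> set ts"
    then obtain j where j: "j < length ts" "b = ts ! j" by (auto simp: in_set_conv_nth)
    then have "b \<in> ?G" using mon_unit[OF B.is_cring ts j(1)]
      by (intro image_eqI[of _ _ "(replicate (length ts) 0)[j := 1]"]) auto
    then show "b \<in> polys ts" unfolding polys_def by (rule gen)
  qed
  have gmult: "g \<otimes>\<^bsub>fst B\<^esub> e \<in> polys ts" if g: "g \<in> ?G" and e: "e \<in> polys ts" for g e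
    using e unfolding polys_def
  proof (induction rule: B.span_mod.induct)
    case (span_mod_base n)
    then have "g \<otimes>\<^bsub>fst B\<^esub> n = \<zero>\<^bsub>fst B\<^esub>" using g G by auto
    then show ?case using B.span_mod_zero[OF subring_k Z] by simp
  next
    case (span_mod_step s g' e)
    have c: "s \<in> BB" "g' \<in> BB" "g \<in> BB" "e \<in> BB" using span_mod_step g G closed subring_k subringE(1) by blast+
    obtain a a' where a: "length a = length ts" "g = mon (fst B) ts a" "length a' = length ts" "g' = mon (fst B) ts a'"
      using g span_mod_step(2) by auto
    have "g \<otimes>\<^bsub>fst B\<^esub> g' \<in> ?G" using mon_mult[OF B.is_cring ts a(1,3)] a
      by (intro image_eqI[of _ _ "map2 (+) a a'"]) auto
    moreover have "g \<otimes>\<^bsub>fst B\<^esub> (s \<otimes>\<^bsub>fst B\<^esub> g' \<oplus>\<^bsub>fst B\<^esub> e) = s \<otimes>\<^bsub>fst B\<^esub> (g \<otimes>\<^bsub>fst B\<^esub> g') \<oplus>\<^bsub>fst B\<^esub> g \<otimes>\<^bsub>fst B\<^esub> e"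
      using c by (simp add: B.r_distr B.m_lcomm)
    ultimately show ?case using span_mod_step by (auto intro: B.span_mod.span_mod_step)
  qed
  have mult: "a \<otimes>\<^bsub>fst B\<^esub> b \<in> polys ts" if a: "a \<in> polys ts" and b: "b \<in> polys ts" for a b
    using a unfolding polys_def
  proof (induction rule: B.span_mod.induct)
    case (span_mod_base n)
    then have "n \<otimes>\<^bsub>fst B\<^esub> b = \<zero>\<^bsub>fst B\<^esub>" using b closed by (auto simp: polys_def)
    then show ?case using B.span_mod_zero[OF subring_k Z] by simp
  next
    case (span_mod_step s g e)
    have c: "s \<in> BB" "g \<in> BB" "b \<in> BB" "e \<in> BB"
      using span_mod_step b G closed subring_k subringE(1) unfolding polys_def by blast+
    have "(s \<otimes>\<^bsub>fst B\<^esub> g \<oplus>\<^bsub>fst B\<^esub> e) \<otimes>\<^bsub>fst B\<^esub> b = s \<otimes>\<^bsub>fst B\<^esub> (g \<otimes>\<^bsub>fst B\<^esub> b) \<oplus>\<^bsub>fst B\<^esub> e \<otimes>\<^bsub>fst B\<^esub> b"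
      using c by (simp add: B.l_distr B.m_assoc)
    moreover have "s \<otimes>\<^bsub>fst B\<^esub> (g \<otimes>\<^bsub>fst B\<^esub> b) \<in> polys ts"
      using smult[OF span_mod_step(1)] gmult[OF span_mod_step(2) b] unfolding polys_def by blast
    ultimately show ?case using span_mod_step add unfolding polys_def by simp
  qed
  show "subring (polys ts) (fst B)"
  proof (rule B.subringI)
    show "polys ts \<subseteq> BB" using closed unfolding polys_def by blast
    show "\<one>\<^bsub>fst B\<^esub> \<in> polys ts" unfolding polys_def by (rule gen[OF one])
    fix b assume b: "b \<in> polys ts"
    have "\<ominus>\<^bsub>fst B\<^esub> \<one>\<^bsub>fst B\<^esub> \<in> polys ts" using kp subringE(5)[OF subring_k subringE(3)[OF subring_k]] by blast
    from mult[OF this b] show "\<ominus>\<^bsub>fst B\<^esub> b \<in> polys ts"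
      using b closed unfolding polys_def by (simp add: B.l_minus)
  qed (use mult add in \<open>auto simp: polys_def\<close>)
qed

text \<open>An element of a span may use a monomial several times, while genericity refers to one
  coefficient per exponent. The induction merges each new summand with the coefficient already
  present.\<close>

lemma polys_normal_form:
  assumes ts: "set ts \<subseteq> BB" and w: "w \<in> polys ts"
  shows "\<exists>A c. finite A \<and> (\<forall>\<alpha> \<in> A. length \<alpha> = length ts) \<and> c \<in> A \<rightarrow> carrier k \<and>
    w = (\<Oplus>\<^bsub>fst B\<^esub>\<alpha> \<in> A. snd B (c \<alpha>) \<otimes>\<^bsub>fst B\<^esub> mon (fst B) ts \<alpha>)"
  using w unfolding polys_def
proof (induction rule: B.span_mod.induct)
  case (span_mod_base n)
  then show ?case by (intro exI[of _ "{}"]) auto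
next
  case (span_mod_step s g e)
  obtain x \<beta> where x: "x \<in> carrier k" "s = snd B x" "length \<beta> = length ts" "g = mon (fst B) ts \<beta>"
    using span_mod_step(1,2) by auto
  obtain A c where A: "finite A" "\<forall>\<alpha> \<in> A. length \<alpha> = length ts" "c \<in> A \<rightarrow> carrier k"
    "e = (\<Oplus>\<^bsub>fst B\<^esub>\<alpha> \<in> A. snd B (c \<alpha>) \<otimes>\<^bsub>fst B\<^esub> mon (fst B) ts \<alpha>)" using span_mod_step.IH by blast
  have mB: "mon (fst B) ts \<alpha> \<in> BB" for \<alpha> by (rule mon_closed[OF B.is_cring ts])
  let ?f = "\<lambda>c \<alpha>. snd B (c \<alpha>) \<otimes>\<^bsub>fst B\<^esub> mon (fst B) ts \<alpha>"
  \<comment> \<open>The coefficient already present at \<open>\<beta>\<close>, or zero when this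
    exponent is new; this treats both cases at once.\<close>
  define y where "y = (if \<beta> \<in> A then c \<beta> else \<zero>\<^bsub>k\<^esub>)"
  have y: "y \<in> carrier k" using A(3) by (auto simp: y_def)
  define c' where "c' = c(\<beta> := x \<oplus>\<^bsub>k\<^esub> y)"
  let ?r = "finsum (fst B) (?f c) (A - {\<beta>})"
  have r: "?r \<in> BB" using A(3) mB by (intro B.finsum_closed) auto
  have e: "e = ?f (\<lambda>_. y) \<beta> \<oplus>\<^bsub>fst B\<^esub> ?r"
  proof (cases "\<beta> \<in> A")
    case True
    then have "e = finsum (fst B) (?f c) (insert \<beta> (A - {\<beta>}))" using A(4) by (simp add: insert_absorb)
    also have "\<dots> = ?f c \<beta> \<oplus>\<^bsub>fst B\<^esub> ?r" using A(1,3) True mB by (intro B.finsum_insert) (auto simp: Pi_iff)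
    finally show ?thesis using True by (simp add: y_def)
  next
    case False
    then show ?thesis using A(4) r mB[of \<beta>] by (simp add: y_def)
  qed
  have ck: "c \<alpha> \<in> carrier k" if "\<alpha> \<in> A" for \<alpha> using A(3) that by auto
  have "finsum (fst B) (?f c') (insert \<beta> (A - {\<beta>})) = ?f c' \<beta> \<oplus>\<^bsub>fst B\<^esub> finsum (fst B) (?f c') (A - {\<beta>})"
    using A(1) ck mB x(1) y by (intro B.finsum_insert) (auto simp: c'_def)
  also have "finsum (fst B) (?f c') (A - {\<beta>}) = ?r"
    using A(3) mB by (intro B.finsum_cong') (auto simp: c'_def)
  also have "?f c' \<beta> = s \<otimes>\<^bsub>fst B\<^esub> g \<oplus>\<^bsub>fst B\<^esub> ?f (\<lambda>_. y) \<beta>"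
    using x y mB by (simp add: c'_def B.l_distr)
  also have "\<dots> \<oplus>\<^bsub>fst B\<^esub> ?r = s \<otimes>\<^bsub>fst B\<^esub> g \<oplus>\<^bsub>fst B\<^esub> e"
    unfolding e using x y mB r by (simp add: B.a_assoc)
  finally have "s \<otimes>\<^bsub>fst B\<^esub> g \<oplus>\<^bsub>fst B\<^esub> e = finsum (fst B) (?f c') (insert \<beta> (A - {\<beta>}))" ..
  moreover have "finite (insert \<beta> (A - {\<beta>}))" "\<forall>\<alpha> \<in> insert \<beta> (A - {\<beta>}). length \<alpha> = length ts"
    "c' \<in> insert \<beta> (A - {\<beta>}) \<rightarrow> carrier k" using A x y by (auto simp: c'_def)
  ultimately show ?case by blast
qed

text \<open>Gauss's content over a valuation ring: among finitely many coefficients one divides all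
  others. After it is factored out, a coefficient is equal to 1, so by genericity the remaining
  polynomial is not in \<open>p\<close>.\<close>

lemma polys_content:
  assumes val: "valuation_domain k" and ts: "set ts \<subseteq> BB" and p: "primeideal p (fst B)"
    and gen: "generic_seq k M (fst B) (snd B) p ts" and w: "w \<in> polys ts"
  shows "\<exists>c \<in> carrier k. \<exists>q \<in> BB - p. w = snd B c \<otimes>\<^bsub>fst B\<^esub> q"
proof -
  interpret p: primeideal p "fst B" by fact
  obtain A c where A: "finite A" "\<forall>\<alpha> \<in> A. length \<alpha> = length ts" "c \<in> A \<rightarrow> carrier k"
    "w = (\<Oplus>\<^bsub>fst B\<^esub>\<alpha> \<in> A. snd B (c \<alpha>) \<otimes>\<^bsub>fst B\<^esub> mon (fst B) ts \<alpha>)" using polys_normal_form[OF ts w] by blast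
  have mB: "mon (fst B) ts \<alpha> \<in> BB" for \<alpha> by (rule mon_closed[OF B.is_cring ts])
  show ?thesis
  proof (cases "A = {}")
    case True
    have "\<one>\<^bsub>fst B\<^esub> \<in> BB - p" using p.I_notcarr p.one_imp_carrier by auto
    moreover have "w = snd B \<zero>\<^bsub>k\<^esub> \<otimes>\<^bsub>fst B\<^esub> \<one>\<^bsub>fst B\<^esub>" using A(4) True by simp
    ultimately show ?thesis using k.zero_closed by blast
  next
    case False
    have min: "\<exists>\<alpha>0 \<in> F. \<forall>\<alpha> \<in> F. \<exists>e \<in> carrier k. c \<alpha> = c \<alpha>0 \<otimes>\<^bsub>k\<^esub> e" if "finite F" "F \<noteq> {}" "F \<subseteq> A" for F
      using that
    proof (induction F rule: finite_ne_induct)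
      case (singleton x)
      then have "c x = c x \<otimes>\<^bsub>k\<^esub> \<one>\<^bsub>k\<^esub>" using funcset_mem[OF A(3), of x] by simp
      then show ?case using k.one_closed by blast
    next
      case (insert x F)
      then obtain a where a: "a \<in> F" "\<forall>\<alpha> \<in> F. \<exists>e \<in> carrier k. c \<alpha> = c a \<otimes>\<^bsub>k\<^esub> e" by auto
      have xa: "c x \<in> carrier k" "c a \<in> carrier k" using A(3) a insert.prems by auto
      then have "c a divides\<^bsub>k\<^esub> c x \<or> c x divides\<^bsub>k\<^esub> c a" using val unfolding valuation_domain_def by blast
      then show ?case
      proof
        assume "c a divides\<^bsub>k\<^esub> c x"
        then show ?thesis using a by (auto simp: factor_def)
      next
        assume "c x divides\<^bsub>k\<^esub> c a"
        then obtain e where e: "e \<in> carrier k" "c a = c x \<otimes>\<^bsub>k\<^esub> e" by (auto simp: factor_def)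
        have "\<exists>e' \<in> carrier k. c \<alpha> = c x \<otimes>\<^bsub>k\<^esub> e'" if \<alpha>: "\<alpha> \<in> F" for \<alpha>
        proof -
          obtain e' where e': "e' \<in> carrier k" "c \<alpha> = c a \<otimes>\<^bsub>k\<^esub> e'" using a \<alpha> by blast
          then have "c \<alpha> = c x \<otimes>\<^bsub>k\<^esub> (e \<otimes>\<^bsub>k\<^esub> e')" using e xa by (simp add: k.m_assoc)
          then show ?thesis using e e' by blast
        qed
        moreover have "c x = c x \<otimes>\<^bsub>k\<^esub> \<one>\<^bsub>k\<^esub>" using xa by simp
        ultimately show ?thesis using k.one_closed by blast
      qed
    qed
    obtain \<alpha>0 where \<alpha>0: "\<alpha>0 \<in> A" "\<forall>\<alpha> \<in> A. \<exists>e \<in> carrier k. c \<alpha> = c \<alpha>0 \<otimes>\<^bsub>k\<^esub> e" using min[OF A(1) False] by blast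
    then obtain e' where e': "\<And>\<alpha>. \<alpha> \<in> A \<Longrightarrow> e' \<alpha> \<in> carrier k" "\<And>\<alpha>. \<alpha> \<in> A \<Longrightarrow> c \<alpha> = c \<alpha>0 \<otimes>\<^bsub>k\<^esub> e' \<alpha>" by metis
    \<comment> \<open>The quotient at \<open>\<alpha>0\<close> is set to 1 by hand, because it is
      not determined when the coefficient there is zero.\<close>
    define e where "e = e'(\<alpha>0 := \<one>\<^bsub>k\<^esub>)"
    have c0: "c \<alpha>0 \<in> carrier k" using A(3) \<alpha>0 by auto
    have e: "e \<alpha> \<in> carrier k" "c \<alpha> = c \<alpha>0 \<otimes>\<^bsub>k\<^esub> e \<alpha>" if "\<alpha> \<in> A" for \<alpha>
      using e'[OF that] c0 by (auto simp: e_def)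
    define q where "q = (\<Oplus>\<^bsub>fst B\<^esub>\<alpha> \<in> A. snd B (e \<alpha>) \<otimes>\<^bsub>fst B\<^esub> mon (fst B) ts \<alpha>)"
    have q: "q \<in> BB" unfolding q_def using e(1) mB by (intro B.finsum_closed) auto
    have "q \<notin> p"
    proof
      assume "q \<in> p"
      then have "\<forall>\<alpha> \<in> A. e \<alpha> \<in> M"
        using gen[unfolded generic_seq_def, rule_format, of A e] A(1,2) e(1) unfolding q_def by blast
      then have "\<one>\<^bsub>k\<^esub> \<in> M" using \<alpha>0(1) by (auto simp: e_def)
      then show False using M.one_imp_carrier M.I_notcarr by blast
    qed
    moreover have "w = snd B (c \<alpha>0) \<otimes>\<^bsub>fst B\<^esub> q"
    proof -
      have "w = (\<Oplus>\<^bsub>fst B\<^esub>\<alpha> \<in> A. snd B (c \<alpha>0) \<otimes>\<^bsub>fst B\<^esub> (snd B (e \<alpha>) \<otimes>\<^bsub>fst B\<^esub> mon (fst B) ts \<alpha>))"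
        unfolding A(4)
      proof (rule B.finsum_cong')
        fix \<alpha> assume \<alpha>: "\<alpha> \<in> A"
        show "snd B (c \<alpha>) \<otimes>\<^bsub>fst B\<^esub> mon (fst B) ts \<alpha> = snd B (c \<alpha>0) \<otimes>\<^bsub>fst B\<^esub> (snd B (e \<alpha>) \<otimes>\<^bsub>fst B\<^esub> mon (fst B) ts \<alpha>)"
          unfolding e(2)[OF \<alpha>] using e(1)[OF \<alpha>] c0 mB by (simp add: B.m_assoc)
      qed (use e(1) c0 mB in auto)
      also have "\<dots> = snd B (c \<alpha>0) \<otimes>\<^bsub>fst B\<^esub> q"
        unfolding q_def using e(1) c0 mB by (intro B.finsum_rdistr[symmetric]) (auto simp: A(1))
      finally show ?thesis .
    qed
    ultimately show ?thesis using c0 q by blast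
  qed
qed

end

section \<open>Valuation points\<close>

text \<open>The residue field at \<open>Q\<close>, that is, the fraction field of B/Q realized on
  the type \<open>'u\<close>.\<close>

lemma ex_residue_field:
  fixes B :: "'u ring"
  assumes inf: "infinite (UNIV :: 'u set)" and B: "cring B" and Q: "primeideal Q B"
  shows "\<exists>(\<Omega> :: 'u ring) \<psi>. field \<Omega> \<and> \<psi> \<in> ring_hom B \<Omega> \<and> (\<forall>b \<in> carrier B. \<psi> b = \<zero>\<^bsub>\<Omega>\<^esub> \<longleftrightarrow> b \<in> Q)"
proof -
  interpret B: cring B by fact
  interpret Q: primeideal Q B by fact
  obtain C :: "'u ring" and \<pi> where C: "cring C" "\<pi> \<in> ring_hom B C" "\<pi> ` carrier B = carrier C"
    "\<And>b. b \<in> carrier B \<Longrightarrow> \<pi> b = \<zero>\<^bsub>C\<^esub> \<longleftrightarrow> b \<in> Q"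
    using realize_quotient[OF B Q.is_ideal] by blast
  interpret C: cring C by fact
  have "domain C"
  proof (intro domain.intro domain_axioms.intro C.is_cring)
    show "\<one>\<^bsub>C\<^esub> \<noteq> \<zero>\<^bsub>C\<^esub>"
      using C(4)[OF B.one_closed] ring_hom_one[OF C(2)] Q.one_imp_carrier Q.I_notcarr by auto
  next
    fix a b assume ab: "a \<otimes>\<^bsub>C\<^esub> b = \<zero>\<^bsub>C\<^esub>" "a \<in> carrier C" "b \<in> carrier C"
    then have "a \<in> \<pi> ` carrier B" "b \<in> \<pi> ` carrier B" using C(3) by simp_all
    then obtain x y where x: "a = \<pi> x" "x \<in> carrier B" "b = \<pi> y" "y \<in> carrier B" by (elim imageE)
    then have "x \<otimes>\<^bsub>B\<^esub> y \<in> Q" using ab(1) ring_hom_mult[OF C(2), of x y] C(4) by auto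
    then show "a = \<zero>\<^bsub>C\<^esub> \<or> b = \<zero>\<^bsub>C\<^esub>" using Q.I_prime[OF x(2,4)] C(4) x by auto
  qed
  then obtain L :: "'u ring" and l where L: "field L" "is_localization C (carrier C - {\<zero>\<^bsub>C\<^esub>}) L l" "inj_on l (carrier C)"
    using ex_fraction_field[OF inf] by blast
  interpret L: field L by fact
  have l: "l \<in> ring_hom C L" using L(2) by (auto simp: is_localization_def)
  interpret l: ring_hom_cring C L l by (intro ring_hom_cringI C.is_cring L.is_cring l)
  have "l (\<pi> b) = \<zero>\<^bsub>L\<^esub> \<longleftrightarrow> b \<in> Q" if b: "b \<in> carrier B" for b
  proof -
    have "\<pi> b \<in> carrier C" by (rule ring_hom_closed[OF C(2) b])
    then have "l (\<pi> b) = l \<zero>\<^bsub>C\<^esub> \<longleftrightarrow> \<pi> b = \<zero>\<^bsub>C\<^esub>" by (intro inj_on_eq_iff[OF L(3)]) auto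
    then show ?thesis using C(4)[OF b] unfolding l.hom_zero by blast
  qed
  then show ?thesis using L(1) ring_hom_trans[OF C(2) l] by (intro exI[of _ L] exI[of _ "l \<circ> \<pi>"]) auto
qed

context chart
begin

text \<open>If \<open>f\<close> were transcendental over \<open>polys (map t [0..<d])\<close> modulo \<open>Q\<close>, some derivation would vanish
  on the latter and not on \<open>f\<close>, but a derivation that kills \<open>t\<close> is zero where \<open>t\<close> are etale coordinates.\<close>

lemma algebraic_dependence:
  assumes t: "spans d t" and Q: "primeideal Q (fst B)" and hQ: "\<And>h. h \<in> BB \<Longrightarrow> \<epsilon> h = \<one>\<^bsub>k\<^esub> \<Longrightarrow> h \<notin> Q"
    and f: "f \<in> BB"
  shows "\<exists>n w. (\<forall>j \<le> n. w j \<in> polys (map t [0..<d])) \<and> (\<exists>j \<le> n. w j \<notin> Q) \<and>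
    (\<Oplus>\<^bsub>fst B\<^esub>j \<in> {..n::nat}. w j \<otimes>\<^bsub>fst B\<^esub> f [^]\<^bsub>fst B\<^esub> j) \<in> Q"
proof -
  let ?ts = "map t [0..<d]"
  have tB: "set ?ts \<subseteq> BB" using t I_sub by (auto simp: spans_def)
  note ps = polys_subring[OF tB]
  have psB: "polys ?ts \<subseteq> BB" by (rule subringE(1)[OF ps(1)])
  obtain \<Omega> :: "'u ring" and \<psi> where \<Omega>: "field \<Omega>" and \<psi>: "\<psi> \<in> ring_hom (fst B) \<Omega>"
    and \<psi>Q: "\<And>b. b \<in> BB \<Longrightarrow> \<psi> b = \<zero>\<^bsub>\<Omega>\<^esub> \<longleftrightarrow> b \<in> Q"
    using ex_residue_field[OF inf B.is_cring Q] by blast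
  interpret \<Omega>: field \<Omega> by fact
  interpret \<psi>: ring_hom_cring "fst B" \<Omega> \<psi> by (intro ring_hom_cringI B.is_cring \<Omega>.is_cring \<psi>)
  let ?S = "\<psi> ` polys ?ts"
  have S: "subring ?S \<Omega>" by (rule ring_hom_ring.img_is_subring[OF ring_hom_ringI2[OF B.ring_axioms \<Omega>.ring_axioms \<psi>] ps(1)])
  have y: "\<psi> f \<in> carrier \<Omega>" using f by simp
  interpret pd: poly_derivation \<Omega> ?S "\<psi> f"
    by (intro poly_derivation.intro poly_derivation_axioms.intro \<Omega>.is_cring S y)
  have "\<exists>P \<in> carrier pd.P. pd.ev P = \<zero>\<^bsub>\<Omega>\<^esub> \<and> P \<noteq> \<zero>\<^bsub>pd.P\<^esub>"
  proof (rule ccontr)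
    assume "\<not> ?thesis"
    then obtain S1 \<delta>1 where 1: "subring S1 \<Omega>" "?S \<subseteq> S1" "\<psi> f \<in> S1" "derivation \<Omega> S1 \<Omega> (\<lambda>x. x) \<delta>1"
      "\<forall>s \<in> ?S. \<delta>1 s = \<zero>\<^bsub>\<Omega>\<^esub>" "\<delta>1 (\<psi> f) = \<one>\<^bsub>\<Omega>\<^esub>"
      using pd.ex_derivation_transcendental by auto
    let ?zs = "map (\<lambda>i. \<psi> (z i)) [0..<N]"
    \<comment> \<open>The derivation is pushed up to a ring that contains the images of all
      generators \<open>z\<close>, so that it becomes a derivation of \<open>B\<close>. It stays
      nonzero at the image of \<open>f\<close> or at some generator. Etaleness forces it to vanish
      at the generators, hence also at \<open>f\<close>, whose differential they generate.\<close>
    have "{\<psi> f} \<subseteq> S1" "\<exists>g \<in> {\<psi> f}. \<delta>1 g \<noteq> \<zero>\<^bsub>\<Omega>\<^esub>" "set ?zs \<subseteq> carrier \<Omega>" using 1 z by auto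
    from \<Omega>.extend_derivation_list[OF 1(1,2) this(1) 1(4) _ this(2,3)] 1(5)
    obtain S' \<delta> where S': "subring S' \<Omega>" "S1 \<subseteq> S'" "set ?zs \<subseteq> S'" "derivation \<Omega> S' \<Omega> (\<lambda>x. x) \<delta>"
      "\<forall>s \<in> ?S. \<delta> s = \<zero>\<^bsub>\<Omega>\<^esub>" "\<exists>g \<in> {\<psi> f} \<union> set ?zs. \<delta> g \<noteq> \<zero>\<^bsub>\<Omega>\<^esub>" by blast
    have \<psi>k: "\<psi> (snd B x) \<in> ?S" if "x \<in> carrier k" for x using ps(2) that by blast
    have "BB \<subseteq> {b \<in> BB. \<psi> b \<in> S'}"
    proof (rule gen)
      show "subring {b \<in> BB. \<psi> b \<in> S'} (fst B)"
        by (rule subring_vimage[OF B.is_cring \<Omega>.is_cring \<psi> S'(1)])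
      show "snd B ` carrier k \<subseteq> {b \<in> BB. \<psi> b \<in> S'}" using \<psi>k 1(2) S'(2) by auto
      show "z ` {..<N} \<subseteq> {b \<in> BB. \<psi> b \<in> S'}" using z S'(3) by auto
    qed
    then have in_S': "\<psi> b \<in> S'" if "b \<in> BB" for b using that by blast
    have der: "is_der \<Omega> \<psi> (\<lambda>b. \<delta> (\<psi> b))"
      unfolding is_der_def
    proof (intro conjI ballI)
      show "derivation \<Omega> BB (fst B) \<psi> (\<lambda>b. \<delta> (\<psi> b))"
        using S'(4) in_S' unfolding derivation_def by (auto simp: Pi_iff)
      show "\<delta> (\<psi> (snd B x)) = \<zero>\<^bsub>\<Omega>\<^esub>" if "x \<in> carrier k" for x using \<psi>k[OF that] S'(5) by blast
    qed (rule \<Omega>.is_cring \<psi>)+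
    note dc = is_derD(3)[OF der]
    obtain h where h: "h \<in> BB" "\<epsilon> h = \<one>\<^bsub>k\<^esub>"
      "\<And>\<Omega> \<psi> \<delta> i. is_der \<Omega> \<psi> \<delta> \<Longrightarrow> (\<forall>i < d. \<delta> (t i) = \<zero>\<^bsub>\<Omega>\<^esub>) \<Longrightarrow> i < N \<Longrightarrow> \<psi> h \<otimes>\<^bsub>\<Omega>\<^esub> \<delta> (z i) = \<zero>\<^bsub>\<Omega>\<^esub>"
      using ex_etale_locus[OF t] by blast
    have "\<forall>i < d. \<delta> (\<psi> (t i)) = \<zero>\<^bsub>\<Omega>\<^esub>" using subsetD[OF ps(3)] S'(5) by auto
    from h(3)[OF der this] have "\<psi> h \<otimes>\<^bsub>\<Omega>\<^esub> \<delta> (\<psi> (z i)) = \<zero>\<^bsub>\<Omega>\<^esub>" if "i < N" for i using that .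
    moreover have "\<psi> h \<noteq> \<zero>\<^bsub>\<Omega>\<^esub>" using \<psi>Q[OF h(1)] hQ[OF h(1,2)] by blast
    ultimately have dz: "\<delta> (\<psi> (z i)) = \<zero>\<^bsub>\<Omega>\<^esub>" if "i < N" for i
      using \<Omega>.integral[of "\<psi> h" "\<delta> (\<psi> (z i))"] h(1) dc[OF z[OF that]] that by auto
    obtain \<beta> where \<beta>: "der_coeffs f \<beta>" using ex_der_coeffs[OF f] by blast
    then have \<beta>c: "\<psi> (\<beta> i) \<in> carrier \<Omega>" if "i < N" for i using that unfolding der_coeffs_def by simp
    from \<beta> have "\<delta> (\<psi> f) = \<Omega>.lin N (\<lambda>i. \<psi> (\<beta> i)) (\<lambda>i. \<delta> (\<psi> (z i)))"
      using der unfolding der_coeffs_def by blast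
    also have "\<dots> = \<Omega>.lin N (\<lambda>i. \<psi> (\<beta> i)) (\<lambda>i. \<zero>\<^bsub>\<Omega>\<^esub>)" using dz \<beta>c by (intro \<Omega>.lin_cong) auto
    also have "\<dots> = (\<Oplus>\<^bsub>\<Omega>\<^esub>i \<in> {..<N}. \<zero>\<^bsub>\<Omega>\<^esub>)"
      using \<beta>c unfolding \<Omega>.lin_def by (intro \<Omega>.finsum_cong') auto
    finally have "\<delta> (\<psi> f) = \<zero>\<^bsub>\<Omega>\<^esub>" by simp
    then show False using S'(6) dz by auto
  qed
  then obtain P where P: "P \<in> carrier pd.P" "pd.ev P = \<zero>\<^bsub>\<Omega>\<^esub>" "P \<noteq> \<zero>\<^bsub>pd.P\<^esub>" by blast
  let ?c = "up_ring.coeff pd.P P" and ?n = "deg (\<Omega>\<lparr>carrier := ?S\<rparr>) P"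
  have cS: "?c j \<in> ?S" for j using pd.P.coeff_closed[OF P(1), of j] by simp
  then have "\<forall>j. \<exists>w \<in> polys ?ts. ?c j = \<psi> w" by blast
  then obtain w where w: "\<And>j. w j \<in> polys ?ts" "\<And>j. \<psi> (w j) = ?c j" by metis
  have wB: "w j \<in> BB" for j using w(1) psB by blast
  have "?c ?n \<noteq> \<zero>\<^bsub>\<Omega>\<^esub>" using pd.P.lcoeff_nonzero[OF P(3,1)] by simp
  then have "w ?n \<notin> Q" using w(2) \<psi>Q[OF wB] by metis
  moreover have "(\<Oplus>\<^bsub>fst B\<^esub>j \<in> {..?n}. w j \<otimes>\<^bsub>fst B\<^esub> f [^]\<^bsub>fst B\<^esub> j) \<in> Q"
  proof -
    have "\<psi> (\<Oplus>\<^bsub>fst B\<^esub>j \<in> {..?n}. w j \<otimes>\<^bsub>fst B\<^esub> f [^]\<^bsub>fst B\<^esub> j) = (\<Oplus>\<^bsub>\<Omega>\<^esub>j \<in> {..?n}. \<psi> (w j \<otimes>\<^bsub>fst B\<^esub> f [^]\<^bsub>fst B\<^esub> j))"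
      using wB f by (intro ring_hom_finsum[OF B.is_cring \<Omega>.is_cring \<psi>]) auto
    also have "\<dots> = (\<Oplus>\<^bsub>\<Omega>\<^esub>j \<in> {..?n}. ?c j \<otimes>\<^bsub>\<Omega>\<^esub> \<psi> f [^]\<^bsub>\<Omega>\<^esub> j)"
      using wB f y cS w(2) by (intro \<Omega>.finsum_cong') auto
    also have "\<dots> = pd.ev P" using P(1) by (simp add: pd.ev_def UnivPoly.eval_def)
    finally have "\<psi> (\<Oplus>\<^bsub>fst B\<^esub>j \<in> {..?n}. w j \<otimes>\<^bsub>fst B\<^esub> f [^]\<^bsub>fst B\<^esub> j) = \<zero>\<^bsub>\<Omega>\<^esub>" using P(2) by simp
    then show ?thesis using wB f by (intro iffD1[OF \<psi>Q] B.finsum_closed) auto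
  qed
  ultimately show ?thesis using w(1) by (intro exI[of _ ?n] exI[of _ w]) blast
qed

text \<open>\<open>L\<close> is the fraction field of B/q and \<open>S0\<close> the local ring of
  B/q at \<open>p\<close>. If an element x of \<open>M\<close> had an inverse b/g there, x b - g
  would be in \<open>q\<close> and thus g in \<open>p\<close>, which is excluded. Chevalley's
  theorem then applies to the image of \<open>M\<close>, which is totally ordered by divisibility,
  and functions outside \<open>p\<close> are invertible in \<open>S0\<close> already.\<close>

lemma ex_valuation_point:
  assumes val: "valuation_domain k" and q: "primeideal q (fst B)" and p: "primeideal p (fst B)" and qp: "q \<subseteq> p"
    and qk: "\<And>x. x \<in> carrier k \<Longrightarrow> snd B x \<in> q \<Longrightarrow> x = \<zero>\<^bsub>k\<^esub>"
    and pk: "\<And>x. x \<in> carrier k \<Longrightarrow> snd B x \<in> p \<longleftrightarrow> x \<in> M"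
  shows "\<exists>(L :: 'u ring) S \<pi>. valuation_subring L S \<and> \<pi> \<in> ring_hom (fst B) L \<and> \<pi> ` BB \<subseteq> S \<and>
    (\<forall>b \<in> BB - p. \<pi> b \<in> S - nonunits L S) \<and> (\<forall>x \<in> M. \<pi> (snd B x) \<in> nonunits L S) \<and>
    (\<forall>x \<in> carrier k. \<pi> (snd B x) = \<zero>\<^bsub>L\<^esub> \<longrightarrow> x = \<zero>\<^bsub>k\<^esub>)"
proof -
  interpret q: primeideal q "fst B" by fact
  interpret p: primeideal p "fst B" by fact
  obtain L :: "'u ring" and \<pi> where L: "field L" and \<pi>: "\<pi> \<in> ring_hom (fst B) L"
    and \<pi>q: "\<And>b. b \<in> BB \<Longrightarrow> \<pi> b = \<zero>\<^bsub>L\<^esub> \<longleftrightarrow> b \<in> q"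
    using ex_residue_field[OF inf B.is_cring q] by blast
  interpret L: field L by fact
  interpret \<pi>: ring_hom_cring "fst B" L \<pi> by (intro ring_hom_cringI B.is_cring L.is_cring \<pi>)
  define S0 where "S0 = {c \<in> carrier L. \<exists>b \<in> BB. \<exists>g \<in> BB - p. c \<otimes>\<^bsub>L\<^esub> \<pi> g = \<pi> b}"
  have one: "\<one>\<^bsub>fst B\<^esub> \<in> BB - p" using p.one_imp_carrier p.I_notcarr by auto
  have mult: "g \<otimes>\<^bsub>fst B\<^esub> h \<in> BB - p" if "g \<in> BB - p" "h \<in> BB - p" for g h
    using that p.I_prime[of g h] by auto
  have \<pi>S0: "\<pi> b \<in> S0" if "b \<in> BB" for b
    unfolding S0_def using that one by (intro CollectI conjI bexI[of _ b] bexI[of _ "\<one>\<^bsub>fst B\<^esub>"]) auto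
  have S0c: "S0 \<subseteq> carrier L" by (auto simp: S0_def)
  have S0: "subring S0 L"
  proof (rule L.subringI)
    show "\<one>\<^bsub>L\<^esub> \<in> S0" using \<pi>S0[OF B.one_closed] by simp
    fix x assume x: "x \<in> S0"
    then obtain b g where bg: "x \<in> carrier L" "b \<in> BB" "g \<in> BB - p" "x \<otimes>\<^bsub>L\<^esub> \<pi> g = \<pi> b" by (auto simp: S0_def)
    then have "\<ominus>\<^bsub>L\<^esub> x \<otimes>\<^bsub>L\<^esub> \<pi> g = \<pi> (\<ominus>\<^bsub>fst B\<^esub> b)" by (simp add: L.l_minus)
    then show "\<ominus>\<^bsub>L\<^esub> x \<in> S0" unfolding S0_def using bg by blast
    fix x' assume "x' \<in> S0"
    then obtain b' g' where bg': "x' \<in> carrier L" "b' \<in> BB" "g' \<in> BB - p" "x' \<otimes>\<^bsub>L\<^esub> \<pi> g' = \<pi> b'" by (auto simp: S0_def)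
    have c: "\<pi> g \<in> carrier L" "\<pi> g' \<in> carrier L" "g \<in> BB" "g' \<in> BB" using bg bg' by auto
    have "x \<otimes>\<^bsub>L\<^esub> x' \<otimes>\<^bsub>L\<^esub> \<pi> (g \<otimes>\<^bsub>fst B\<^esub> g') = (x \<otimes>\<^bsub>L\<^esub> \<pi> g) \<otimes>\<^bsub>L\<^esub> (x' \<otimes>\<^bsub>L\<^esub> \<pi> g')"
      using bg(1) bg'(1) c by (simp add: L.m_ac)
    then have "x \<otimes>\<^bsub>L\<^esub> x' \<otimes>\<^bsub>L\<^esub> \<pi> (g \<otimes>\<^bsub>fst B\<^esub> g') = \<pi> (b \<otimes>\<^bsub>fst B\<^esub> b')" using bg bg' by simp
    moreover have "x \<otimes>\<^bsub>L\<^esub> x' \<in> carrier L" "b \<otimes>\<^bsub>fst B\<^esub> b' \<in> BB" using bg bg' by auto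
    ultimately show "x \<otimes>\<^bsub>L\<^esub> x' \<in> S0" unfolding S0_def using mult[OF bg(3) bg'(3)] by blast
    have "(x \<oplus>\<^bsub>L\<^esub> x') \<otimes>\<^bsub>L\<^esub> \<pi> (g \<otimes>\<^bsub>fst B\<^esub> g') = (x \<otimes>\<^bsub>L\<^esub> \<pi> g) \<otimes>\<^bsub>L\<^esub> \<pi> g' \<oplus>\<^bsub>L\<^esub> (x' \<otimes>\<^bsub>L\<^esub> \<pi> g') \<otimes>\<^bsub>L\<^esub> \<pi> g"
      using bg(1) bg'(1) c by (simp add: L.l_distr L.r_distr L.m_ac)
    then have "(x \<oplus>\<^bsub>L\<^esub> x') \<otimes>\<^bsub>L\<^esub> \<pi> (g \<otimes>\<^bsub>fst B\<^esub> g') = \<pi> (b \<otimes>\<^bsub>fst B\<^esub> g' \<oplus>\<^bsub>fst B\<^esub> b' \<otimes>\<^bsub>fst B\<^esub> g)"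
      using bg bg' c by simp
    moreover have "x \<oplus>\<^bsub>L\<^esub> x' \<in> carrier L" "b \<otimes>\<^bsub>fst B\<^esub> g' \<oplus>\<^bsub>fst B\<^esub> b' \<otimes>\<^bsub>fst B\<^esub> g \<in> BB" using bg bg' by auto
    ultimately show "x \<oplus>\<^bsub>L\<^esub> x' \<in> S0" unfolding S0_def using mult[OF bg(3) bg'(3)] by blast
  qed (rule S0c)
  let ?M = "(\<lambda>x. \<pi> (snd B x)) ` M"
  have Mk: "x \<in> carrier k" if "x \<in> M" for x using that M.Icarr by blast
  have sn: "snd B x \<in> BB" if "x \<in> carrier k" for x using algebrasD(3)[OF B that] .
  have chain: "\<exists>c \<in> S0. m = m' \<otimes>\<^bsub>L\<^esub> c \<or> m' = m \<otimes>\<^bsub>L\<^esub> c" if "m \<in> ?M" "m' \<in> ?M" for m m'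
  proof -
    obtain x x' where x: "x \<in> carrier k" "m = \<pi> (snd B x)" "x' \<in> carrier k" "m' = \<pi> (snd B x')"
      
    proof -
      from \<open>m \<in> ?M\<close> obtain x where "m = \<pi> (snd B x)" "x \<in> M" by (rule imageE)
      moreover from \<open>m' \<in> ?M\<close> obtain x' where "m' = \<pi> (snd B x')" "x' \<in> M" by (rule imageE)
      ultimately show thesis by (intro that[OF Mk _ Mk])
    qed
    then have "x divides\<^bsub>k\<^esub> x' \<or> x' divides\<^bsub>k\<^esub> x" using val unfolding valuation_domain_def by blast
    then obtain y where y: "y \<in> carrier k" "x' = x \<otimes>\<^bsub>k\<^esub> y \<or> x = x' \<otimes>\<^bsub>k\<^esub> y" by (auto simp: factor_def)
    have "m' = m \<otimes>\<^bsub>L\<^esub> \<pi> (snd B y) \<or> m = m' \<otimes>\<^bsub>L\<^esub> \<pi> (snd B y)" using y x sn by auto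
    then show ?thesis using \<pi>S0[OF sn[OF y(1)]] by blast
  qed
  have nu: "m \<otimes>\<^bsub>L\<^esub> s \<noteq> \<one>\<^bsub>L\<^esub>" if "m \<in> ?M" "s \<in> S0" for m s
  proof
    assume ms: "m \<otimes>\<^bsub>L\<^esub> s = \<one>\<^bsub>L\<^esub>"
    obtain x where x: "x \<in> M" "m = \<pi> (snd B x)" using \<open>m \<in> ?M\<close> by blast
    have xk: "x \<in> carrier k" using Mk[OF x(1)] .
    obtain b g where bg: "s \<in> carrier L" "b \<in> BB" "g \<in> BB - p" "s \<otimes>\<^bsub>L\<^esub> \<pi> g = \<pi> b" using \<open>s \<in> S0\<close> by (auto simp: S0_def)
    have gB: "g \<in> BB" using bg by blast
    have "\<pi> (snd B x \<otimes>\<^bsub>fst B\<^esub> b) = m \<otimes>\<^bsub>L\<^esub> (s \<otimes>\<^bsub>L\<^esub> \<pi> g)" using bg sn[OF xk] x by simp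
    also have "\<dots> = (m \<otimes>\<^bsub>L\<^esub> s) \<otimes>\<^bsub>L\<^esub> \<pi> g" using bg sn[OF xk] x gB by (simp add: L.m_assoc)
    also have "\<dots> = \<pi> g" using ms gB by simp
    finally have 0: "\<pi> (snd B x \<otimes>\<^bsub>fst B\<^esub> b \<ominus>\<^bsub>fst B\<^esub> g) = \<zero>\<^bsub>L\<^esub>"
      using bg sn[OF xk] gB by (simp add: B.minus_eq L.r_neg)
    then have 1: "snd B x \<otimes>\<^bsub>fst B\<^esub> b \<ominus>\<^bsub>fst B\<^esub> g \<in> p" using bg sn[OF xk] gB by (intro subsetD[OF qp] iffD1[OF \<pi>q 0]) simp
    have 2: "snd B x \<otimes>\<^bsub>fst B\<^esub> b \<in> p" using pk[OF xk] x p.I_r_closed bg by blast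
    have "g = snd B x \<otimes>\<^bsub>fst B\<^esub> b \<oplus>\<^bsub>fst B\<^esub> \<ominus>\<^bsub>fst B\<^esub> (snd B x \<otimes>\<^bsub>fst B\<^esub> b \<ominus>\<^bsub>fst B\<^esub> g)"
      using sn[OF xk] bg gB by (simp add: B.minus_eq B.minus_add B.a_assoc[symmetric] B.r_neg)
    moreover have "\<dots> \<in> p"
      using additive_subgroup.a_closed[OF p.additive_subgroup_axioms 2 additive_subgroup.a_inv_closed[OF p.additive_subgroup_axioms 1]] .
    ultimately show False using bg(3) by auto
  qed
  have "?M \<subseteq> S0" using \<pi>S0 sn Mk by auto
  from L.ex_valuation_overring[OF S0 this chain nu]
  obtain S where S: "subring S L" "S0 \<subseteq> S" "\<forall>m \<in> ?M. \<forall>s \<in> S. m \<otimes>\<^bsub>L\<^esub> s \<noteq> \<one>\<^bsub>L\<^esub>"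
    "\<forall>x \<in> carrier L. x \<in> S \<or> (\<exists>y \<in> S. x \<otimes>\<^bsub>L\<^esub> y = \<one>\<^bsub>L\<^esub>)" by blast
  have "valuation_subring L S"
    by (intro valuation_subring.intro valuation_subring_axioms.intro L S(1)) (use S(4) in blast)
  moreover have \<pi>S: "\<pi> ` BB \<subseteq> S" using \<pi>S0 S(2) by auto
  moreover have "\<pi> b \<in> S - nonunits L S" if b: "b \<in> BB - p" for b
  proof -
    have "\<pi> b \<noteq> \<zero>\<^bsub>L\<^esub>" using \<pi>q[of b] qp b by blast
    then have u: "\<pi> b \<in> Units L" using L.field_Units b by auto
    then have "inv\<^bsub>L\<^esub> \<pi> b \<otimes>\<^bsub>L\<^esub> \<pi> b = \<pi> \<one>\<^bsub>fst B\<^esub>" "inv\<^bsub>L\<^esub> \<pi> b \<in> carrier L" by simp_all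
    then have "inv\<^bsub>L\<^esub> \<pi> b \<in> S0" unfolding S0_def using b B.one_closed by blast
    moreover have "\<pi> b \<otimes>\<^bsub>L\<^esub> inv\<^bsub>L\<^esub> \<pi> b = \<one>\<^bsub>L\<^esub>" using u by simp
    ultimately show ?thesis using \<pi>S b S(2) by (auto simp: nonunits_def)
  qed
  moreover have "\<pi> (snd B x) \<in> nonunits L S" if "x \<in> M" for x
    using S(3) that \<pi>S sn[OF Mk[OF that]] by (auto simp: nonunits_def)
  moreover have "x = \<zero>\<^bsub>k\<^esub>" if "x \<in> carrier k" "\<pi> (snd B x) = \<zero>\<^bsub>L\<^esub>" for x
    using \<pi>q[OF sn[OF that(1)]] qk that by blast
  ultimately show ?thesis by blast
qed

end

section \<open>Schemes as functors of points\<close>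

lemma alg_hom_compose:
  assumes "A \<in> algebras k" "f \<in> alg_hom k A B" "g \<in> alg_hom k B C"
  shows "compose (carrier (fst A)) g f \<in> alg_hom k A C"
proof -
  interpret A: cring "fst A" by (rule algebrasD(1)[OF assms(1)])
  have "compose (carrier (fst A)) g f = restrict (g \<circ> f) (carrier (fst A))" by (simp add: compose_def comp_def)
  moreover have "restrict (g \<circ> f) (carrier (fst A)) \<in> alg_hom k A C"
    using assms ring_hom_trans[OF alg_homD(1) alg_homD(1)] alg_homD(2)
    by (intro alg_hom_restrictI) (simp_all add: alg_homD)
  ultimately show ?thesis by simp
qed

lemma alg_hom_id: "A \<in> algebras k \<Longrightarrow> (\<lambda>a \<in> carrier (fst A). a) \<in> alg_hom k A A"
  using alg_hom_restrictI[of A k "\<lambda>a. a" A] by (auto simp: ring_hom_def)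

lemma kfunctorD:
  assumes "kfunctor k F"
  shows "A \<in> algebras k \<Longrightarrow> B \<in> algebras k \<Longrightarrow> f \<in> alg_hom k A B \<Longrightarrow> x \<in> obj F A \<Longrightarrow> arr F A B f x \<in> obj F B"
    "A \<in> algebras k \<Longrightarrow> x \<in> obj F A \<Longrightarrow> arr F A A (\<lambda>a \<in> carrier (fst A). a) x = x"
    "A \<in> algebras k \<Longrightarrow> B \<in> algebras k \<Longrightarrow> C \<in> algebras k \<Longrightarrow> f \<in> alg_hom k A B \<Longrightarrow> g \<in> alg_hom k B C \<Longrightarrow> x \<in> obj F A \<Longrightarrow>
      arr F A C (compose (carrier (fst A)) g f) x = arr F B C g (arr F A B f x)"
proof -
  note D = assms[unfolded kfunctor_def]
  show "A \<in> algebras k \<Longrightarrow> B \<in> algebras k \<Longrightarrow> f \<in> alg_hom k A B \<Longrightarrow> x \<in> obj F A \<Longrightarrow> arr F A B f x \<in> obj F B"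
    using D by blast
  show "A \<in> algebras k \<Longrightarrow> x \<in> obj F A \<Longrightarrow> arr F A A (\<lambda>a \<in> carrier (fst A). a) x = x"
    using D by blast
  show "A \<in> algebras k \<Longrightarrow> B \<in> algebras k \<Longrightarrow> C \<in> algebras k \<Longrightarrow> f \<in> alg_hom k A B \<Longrightarrow> g \<in> alg_hom k B C \<Longrightarrow> x \<in> obj F A \<Longrightarrow>
      arr F A C (compose (carrier (fst A)) g f) x = arr F B C g (arr F A B f x)"
    using D by blast
qed

lemma open_subfunctorD:
  assumes "open_subfunctor k F U"
  shows "A \<in> algebras k \<Longrightarrow> x \<in> U A \<Longrightarrow> x \<in> obj F A"
    "A \<in> algebras k \<Longrightarrow> B \<in> algebras k \<Longrightarrow> f \<in> alg_hom k A B \<Longrightarrow> x \<in> U A \<Longrightarrow> arr F A B f x \<in> U B"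
    "A \<in> algebras k \<Longrightarrow> x \<in> obj F A \<Longrightarrow> \<exists>I. ideal I (fst A) \<and>
        (\<forall>B \<in> algebras k. \<forall>f \<in> alg_hom k A B. arr F A B f x \<in> U B \<longleftrightarrow> Idl\<^bsub>fst B\<^esub> (f ` I) = carrier (fst B))"
  using assms unfolding open_subfunctor_def subfunctor_def by blast+

lemma represented_byD:
  assumes "represented_by k F U B"
  shows "B \<in> algebras k" "\<exists>u \<in> U B. (\<forall>A \<in> algebras k. \<forall>y \<in> U A. \<exists>f \<in> alg_hom k B A. arr F B A f u = y) \<and>
    (\<forall>A \<in> algebras k. \<forall>f \<in> alg_hom k B A. \<forall>g \<in> alg_hom k B A. arr F B A f u = arr F B A g u \<longrightarrow> f = g)"
proof -
  show "B \<in> algebras k" using assms by (simp add: represented_by_def)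
  from assms obtain u where u: "u \<in> U B" "\<And>A. A \<in> algebras k \<Longrightarrow> bij_betw (\<lambda>f. arr F B A f u) (alg_hom k B A) (U A)"
    unfolding represented_by_def by blast
  have "\<exists>f \<in> alg_hom k B A. arr F B A f u = y" if "A \<in> algebras k" "y \<in> U A" for A y
    using u(2)[OF that(1)] that(2) unfolding bij_betw_def by (metis (no_types, lifting) imageE)
  moreover have "f = g" if "A \<in> algebras k" "f \<in> alg_hom k B A" "g \<in> alg_hom k B A" "arr F B A f u = arr F B A g u" for A f g
    using u(2)[OF that(1)] that(2-4) unfolding bij_betw_def by (auto dest: inj_onD)
  ultimately show "\<exists>u \<in> U B. (\<forall>A \<in> algebras k. \<forall>y \<in> U A. \<exists>f \<in> alg_hom k B A. arr F B A f u = y) \<and>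
    (\<forall>A \<in> algebras k. \<forall>f \<in> alg_hom k B A. \<forall>g \<in> alg_hom k B A. arr F B A f u = arr F B A g u \<longrightarrow> f = g)"
    using u(1) by blast
qed

lemma (in cring) Idl_eq_carrier_if_unit:
  assumes "T \<subseteq> carrier R" "t \<in> T" "t \<in> Units R" shows "Idl T = carrier R"
proof -
  interpret I: ideal "Idl T" R by (rule genideal_ideal[OF assms(1)])
  have "t \<in> Idl T" using genideal_self[OF assms(1)] assms(2) by blast
  then have "inv t \<otimes> t \<in> Idl T" using I.I_l_closed[of t "inv t"] assms(3) by blast
  then have "\<one> \<in> Idl T" using assms(3) by simp
  then show ?thesis by (rule I.one_imp_carrier)
qed

lemma (in cring) Idl_eq_carrier_not_sub:
  assumes "Idl T = carrier R" "primeideal P R" shows "\<exists>t \<in> T. t \<notin> P"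
proof (rule ccontr)
  assume "\<not> ?thesis"
  then have "T \<subseteq> P" by blast
  then have "carrier R \<subseteq> P" using genideal_minimal[OF primeideal.axioms(1)[OF assms(2)]] assms(1) by metis
  then show False using primeideal.I_notcarr[OF assms(2)] ideal.Icarr[OF primeideal.axioms(1)[OF assms(2)]] by blast
qed

text \<open>An open subfunctor is given at \<open>x\<close> by an ideal, and it contains the point
  exactly where this ideal generates the unit ideal. So membership descends along
  \<open>\<pi>\<close> whenever the ideals of \<open>A\<close> that generate the unit ideal over
  \<open>A'\<close> are trivial.\<close>

lemma open_subfunctor_reflects:
  assumes F: "kfunctor k F" and U: "open_subfunctor k F U" and A: "A \<in> algebras k" "A' \<in> algebras k" "\<pi> \<in> alg_hom k A A'"
    and x: "x \<in> obj F A" "arr F A A' \<pi> x \<in> U A'"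
    and I: "\<And>I. ideal I (fst A) \<Longrightarrow> Idl\<^bsub>fst A'\<^esub> (\<pi> ` I) = carrier (fst A') \<Longrightarrow> \<one>\<^bsub>fst A\<^esub> \<in> I"
  shows "x \<in> U A"
proof -
  interpret A: cring "fst A" by (rule algebrasD(1)[OF A(1)])
  obtain I where I': "ideal I (fst A)" "\<And>B f. B \<in> algebras k \<Longrightarrow> f \<in> alg_hom k A B \<Longrightarrow>
      arr F A B f x \<in> U B \<longleftrightarrow> Idl\<^bsub>fst B\<^esub> (f ` I) = carrier (fst B)"
    using open_subfunctorD(3)[OF U A(1) x(1)] by blast
  have 1: "\<one>\<^bsub>fst A\<^esub> \<in> I" using I[OF I'(1)] I'(2)[OF A(2,3)] x(2) by blast
  have "(\<lambda>a \<in> carrier (fst A). a) ` I = I" using ideal.Icarr[OF I'(1)] by force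
  then have "Idl\<^bsub>fst A\<^esub> ((\<lambda>a \<in> carrier (fst A). a) ` I) = carrier (fst A)"
    using A.Idl_eq_carrier_if_unit[of I, OF _ 1] ideal.Icarr[OF I'(1)] by auto
  then show ?thesis using I'(2)[OF A(1) alg_hom_id[OF A(1)]] kfunctorD(2)[OF F A(1) x(1)] by simp
qed

text \<open>An element i that maps to 1 satisfies (1 - i)^2 = 0, hence i (2 - i) = 1. An open set is
  therefore not affected by a square-zero thickening.\<close>

lemma open_subfunctor_thickening:
  assumes F: "kfunctor k F" and U: "open_subfunctor k F U" and A: "A \<in> algebras k" "A' \<in> algebras k" "\<pi> \<in> alg_hom k A A'"
    and sur: "\<pi> ` carrier (fst A) = carrier (fst A')"
    and sq: "\<forall>a \<in> a_kernel (fst A) (fst A') \<pi>. \<forall>b \<in> a_kernel (fst A) (fst A') \<pi>. a \<otimes>\<^bsub>fst A\<^esub> b = \<zero>\<^bsub>fst A\<^esub>"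
    and x: "x \<in> obj F A" "arr F A A' \<pi> x \<in> U A'"
  shows "x \<in> U A"
proof (rule open_subfunctor_reflects[OF F U A x])
  interpret A: cring "fst A" by (rule algebrasD(1)[OF A(1)])
  interpret A': cring "fst A'" by (rule algebrasD(1)[OF A(2)])
  interpret \<pi>: ring_hom_cring "fst A" "fst A'" \<pi> by (intro ring_hom_cringI A.is_cring A'.is_cring alg_homD(1)[OF A(3)])
  fix I assume "ideal I (fst A)" and I1: "Idl\<^bsub>fst A'\<^esub> (\<pi> ` I) = carrier (fst A')"
  interpret I: ideal I "fst A" by fact
  have Ic: "i \<in> carrier (fst A)" if "i \<in> I" for i using I.Icarr that by blast
  have idl: "ideal (\<pi> ` I) (fst A')"
    by (rule ideal_image[OF A.is_cring A'.is_cring alg_homD(1)[OF A(3)] sur I.is_ideal])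
  have "\<one>\<^bsub>fst A'\<^esub> \<in> \<pi> ` I" using subsetD[OF A'.genideal_minimal[OF idl order.refl]] I1 by simp
  then obtain i where i: "\<one>\<^bsub>fst A'\<^esub> = \<pi> i" "i \<in> I" by (rule imageE)
  have ic: "i \<in> carrier (fst A)" using Ic[OF i(2)] .
  let ?e = "\<one>\<^bsub>fst A\<^esub> \<ominus>\<^bsub>fst A\<^esub> i"
  have "\<pi> ?e = \<zero>\<^bsub>fst A'\<^esub>" using ic i(1) by (simp add: A.minus_eq A'.r_neg)
  then have "?e \<in> a_kernel (fst A) (fst A') \<pi>" unfolding a_kernel_def' using ic by (intro CollectI conjI) simp_all
  then have "?e \<otimes>\<^bsub>fst A\<^esub> ?e = \<zero>\<^bsub>fst A\<^esub>" using sq by blast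
  moreover have "?e \<otimes>\<^bsub>fst A\<^esub> ?e = \<one>\<^bsub>fst A\<^esub> \<ominus>\<^bsub>fst A\<^esub> i \<otimes>\<^bsub>fst A\<^esub> (\<one>\<^bsub>fst A\<^esub> \<oplus>\<^bsub>fst A\<^esub> ?e)"
    using ic by algebra
  ultimately have "i \<otimes>\<^bsub>fst A\<^esub> (\<one>\<^bsub>fst A\<^esub> \<oplus>\<^bsub>fst A\<^esub> ?e) = \<one>\<^bsub>fst A\<^esub>"
    using ic A.r_right_minus_eq[of "\<one>\<^bsub>fst A\<^esub>" "i \<otimes>\<^bsub>fst A\<^esub> (\<one>\<^bsub>fst A\<^esub> \<oplus>\<^bsub>fst A\<^esub> ?e)"] by simp
  then show "\<one>\<^bsub>fst A\<^esub> \<in> I" using I.I_r_closed[OF i(2), of "\<one>\<^bsub>fst A\<^esub> \<oplus>\<^bsub>fst A\<^esub> ?e"] ic by simp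
qed

text \<open>Covers are tested on points with values in fields. The residue field of the local ring
  \<open>A\<close> picks the member of the cover, and an ideal that is nonzero in the residue field
  contains a unit of \<open>A\<close>.\<close>

lemma local_point_covered:
  fixes k :: "'u ring" and F :: "('u, 'g) kfun"
  assumes inf: "infinite (UNIV :: 'u set)" and k: "cring k" and F: "kfunctor k F"
    and \<U>: "covers k \<U> (obj F)" "\<And>U. U \<in> \<U> \<Longrightarrow> open_subfunctor k F U"
    and A: "A \<in> algebras k" and P: "primeideal P (fst A)"
    and u: "\<And>a. a \<in> carrier (fst A) \<Longrightarrow> a \<notin> P \<Longrightarrow> a \<in> Units (fst A)" and x: "x \<in> obj F A"
  shows "\<exists>U \<in> \<U>. x \<in> U A"
proof -
  interpret A: cring "fst A" by (rule algebrasD(1)[OF A])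
  obtain \<Omega> :: "'u ring" and \<psi> where \<Omega>: "field \<Omega>" and \<psi>: "\<psi> \<in> ring_hom (fst A) \<Omega>"
    and \<psi>P: "\<And>b. b \<in> carrier (fst A) \<Longrightarrow> \<psi> b = \<zero>\<^bsub>\<Omega>\<^esub> \<longleftrightarrow> b \<in> P"
    using ex_residue_field[OF inf A.is_cring P] by blast
  interpret \<Omega>: field \<Omega> by fact
  let ?A' = "(\<Omega>, restrict (\<psi> \<circ> snd A) (carrier k))" and ?\<pi> = "restrict \<psi> (carrier (fst A))"
  have A': "?A' \<in> algebras k"
    by (rule algebras_restrictI[OF \<Omega>.is_cring ring_hom_trans[OF algebrasD(2)[OF A] \<psi>] k])
  have \<pi>: "?\<pi> \<in> alg_hom k A ?A'" by (rule alg_hom_restrictI[OF A]) (use \<psi> in simp_all)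
  have "arr F A ?A' ?\<pi> x \<in> obj F ?A'" by (rule kfunctorD(1)[OF F A A' \<pi> x])
  moreover have "obj F ?A' \<subseteq> (\<Union>U \<in> \<U>. U ?A')"
    using \<U>(1)[unfolded covers_def, rule_format, OF A'] \<Omega> by simp
  ultimately obtain U where U: "U \<in> \<U>" "arr F A ?A' ?\<pi> x \<in> U ?A'" by blast
  have "x \<in> U A"
  proof (rule open_subfunctor_reflects[OF F \<U>(2)[OF U(1)] A A' \<pi> x U(2)])
    fix I assume I: "ideal I (fst A)" and I1: "Idl\<^bsub>fst ?A'\<^esub> (?\<pi> ` I) = carrier (fst ?A')"
    have "\<exists>t \<in> ?\<pi> ` I. t \<notin> {\<zero>\<^bsub>\<Omega>\<^esub>}"
      by (rule \<Omega>.Idl_eq_carrier_not_sub[OF _ \<Omega>.zeroprimeideal]) (use I1 in simp)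
    then obtain i where i: "i \<in> I" "?\<pi> i \<noteq> \<zero>\<^bsub>\<Omega>\<^esub>" by blast
    have ic: "i \<in> carrier (fst A)" using ideal.Icarr[OF I i(1)] .
    then have "i \<in> Units (fst A)" using u i(2) \<psi>P by auto
    then have "inv\<^bsub>fst A\<^esub> i \<otimes>\<^bsub>fst A\<^esub> i = \<one>\<^bsub>fst A\<^esub>" "inv\<^bsub>fst A\<^esub> i \<in> carrier (fst A)" by simp_all
    then show "\<one>\<^bsub>fst A\<^esub> \<in> I" using ideal.I_l_closed[OF I i(1)] by metis
  qed
  then show ?thesis using U(1) by blast
qed

text \<open>Formal smoothness lifts a point of the chart only to a point of \<open>F\<close>. The
  lift lies in the chart because the chart is open, and then it corresponds to a homomorphism out of
  \<open>B\<close>.\<close>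

lemma lifting_property_chart:
  assumes F: "kfunctor k F" and fs: "formally_smooth k F" and U: "open_subfunctor k F U" and r: "represented_by k F U B"
  shows "lifting_property k B"
  unfolding lifting_property_def
proof (intro ballI impI)
  fix A A' p f assume A: "A \<in> algebras k" "A' \<in> algebras k" "p \<in> alg_hom k A A'" and f: "f \<in> alg_hom k B A'"
    and p: "p ` carrier (fst A) = carrier (fst A') \<and>
        (\<forall>a \<in> a_kernel (fst A) (fst A') p. \<forall>b \<in> a_kernel (fst A) (fst A') p. a \<otimes>\<^bsub>fst A\<^esub> b = \<zero>\<^bsub>fst A\<^esub>)"
  have B: "B \<in> algebras k" by (rule represented_byD(1)[OF r])
  obtain u where u: "u \<in> U B" "\<And>A y. A \<in> algebras k \<Longrightarrow> y \<in> U A \<Longrightarrow> \<exists>f \<in> alg_hom k B A. arr F B A f u = y"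
    "\<And>A f g. A \<in> algebras k \<Longrightarrow> f \<in> alg_hom k B A \<Longrightarrow> g \<in> alg_hom k B A \<Longrightarrow> arr F B A f u = arr F B A g u \<Longrightarrow> f = g"
    using represented_byD(2)[OF r] by blast
  have uF: "u \<in> obj F B" by (rule open_subfunctorD(1)[OF U B u(1)])
  have x': "arr F B A' f u \<in> U A'" by (rule open_subfunctorD(2)[OF U B A(2) f u(1)])
  have "arr F A A' p ` obj F A = obj F A'"
    using fs[unfolded formally_smooth_def, rule_format, OF A] p by blast
  then have "arr F B A' f u \<in> arr F A A' p ` obj F A" using open_subfunctorD(1)[OF U A(2) x'] by simp
  then obtain y where y: "arr F B A' f u = arr F A A' p y" "y \<in> obj F A" by (rule imageE)
  have "y \<in> U A" using open_subfunctor_thickening[OF F U A _ _ y(2)] p x' y(1) by simp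
  then obtain g where g: "g \<in> alg_hom k B A" "arr F B A g u = y" using u(2)[OF A(1)] by blast
  have "arr F B A' (compose (carrier (fst B)) p g) u = arr F B A' f u"
    using kfunctorD(3)[OF F B A(1,2) g(1) A(3) uF] g(2) y(1) by simp
  from u(3)[OF A(2) alg_hom_compose[OF B g(1) A(3)] f this]
  have "compose (carrier (fst B)) p g = f" .
  then have "p (g b) = f b" if "b \<in> carrier (fst B)" for b using that by (auto simp: compose_def)
  then show "\<exists>g \<in> alg_hom k B A. \<forall>b \<in> carrier (fst B). p (g b) = f b" using g(1) by blast
qed

text \<open>The images of the variables generate. Polynomial algebras are known by their universal
  property alone: a subring containing the constants and the variables receives a map from
  \<open>P\<close> that fixes the variables, and its composite with the inclusion must be the
  identity.\<close>

lemma fp_generators: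
  assumes k: "cring k" and fp: "finitely_presented_algebra k B" and B: "B \<in> algebras k"
  shows "\<exists>ys. set ys \<subseteq> carrier (fst B) \<and>
    (\<forall>S. subring S (fst B) \<longrightarrow> snd B ` carrier k \<subseteq> S \<longrightarrow> set ys \<subseteq> S \<longrightarrow> carrier (fst B) \<subseteq> S)"
proof -
  interpret B: cring "fst B" by (rule algebrasD(1)[OF B])
  obtain P xs f where P: "is_polynomial_algebra k P xs" and f: "f \<in> alg_hom k P B" "f ` carrier (fst P) = carrier (fst B)"
    using fp unfolding finitely_presented_algebra_def by blast
  have PA: "P \<in> algebras k" "set xs \<subseteq> carrier (fst P)"
    and un: "\<And>A as. A \<in> algebras k \<Longrightarrow> set as \<subseteq> carrier (fst A) \<Longrightarrow> length as = length xs \<Longrightarrow>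
      \<exists>!f. f \<in> alg_hom k P A \<and> map f xs = as"
    using P unfolding is_polynomial_algebra_def by blast+
  interpret P: cring "fst P" by (rule algebrasD(1)[OF PA(1)])
  interpret f: ring_hom_cring "fst P" "fst B" f by (intro ring_hom_cringI P.is_cring B.is_cring alg_homD(1)[OF f(1)])
  have "carrier (fst B) \<subseteq> S" if S: "subring S (fst B)" "snd B ` carrier k \<subseteq> S" "set (map f xs) \<subseteq> S" for S
  proof -
    let ?T = "{p \<in> carrier (fst P). f p \<in> S}"
    have T: "subring ?T (fst P)" by (rule subring_vimage[OF P.is_cring B.is_cring alg_homD(1)[OF f(1)] S(1)])
    have cT: "cring ((fst P)\<lparr>carrier := ?T\<rparr>)"
      using P.subcring_iff[of ?T] P.subcringI'[OF T] by auto
    have sn: "snd P x \<in> ?T" if "x \<in> carrier k" for x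
      using algebrasD(3)[OF PA(1) that] alg_homD(2)[OF f(1) that] S(2) that by auto
    let ?A = "((fst P)\<lparr>carrier := ?T\<rparr>, snd P)"
    have A: "?A \<in> algebras k"
      using PA(1) cT sn by (auto simp: algebras_def ring_hom_def)
    have xs: "set xs \<subseteq> ?T" using PA(2) S(3) by auto
    then obtain g where g: "g \<in> alg_hom k P ?A" "map g xs = xs" using un[OF A, of xs] by auto
    have gP: "g \<in> alg_hom k P P" using g(1) by (auto simp: alg_hom_def ring_hom_def)
    have "(\<lambda>a \<in> carrier (fst P). a) \<in> alg_hom k P P" "map (\<lambda>a \<in> carrier (fst P). a) xs = xs"
      using alg_hom_id[OF PA(1)] PA(2) by (auto intro!: map_idI)
    then have "g = (\<lambda>a \<in> carrier (fst P). a)" using un[OF PA] gP g(2) by blast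
    then have "f p \<in> S" if "p \<in> carrier (fst P)" for p using alg_homD(3)[OF g(1), of p] that by simp
    then show ?thesis unfolding f(2)[symmetric] by (rule image_subsetI)
  qed
  moreover have "set (map f xs) \<subseteq> carrier (fst B)" using PA(2) by auto
  ultimately show ?thesis by blast
qed

text \<open>The elements that are sent into \<open>P\<close> by almost all \<open>\<xi> n\<close> are generated by finitely many of them
  and by elements that all \<open>\<xi> n\<close> send into \<open>P\<close>, hence a single \<open>\<xi> m\<close> sends all of them into \<open>P\<close>.\<close>

lemma finite_type_recurrence:
  fixes \<xi> :: "nat \<Rightarrow> 'a \<Rightarrow> 'b"
  assumes UU: "\<And>P. eventually P UU \<or> eventually (\<lambda>n. \<not> P n) UU" "UU \<noteq> bot"
    and C: "cring C" and E: "cring E" and P: "primeideal P E"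
    and \<sigma>: "\<sigma> \<in> ring_hom k C" and k: "cring k" and ys: "set ys \<subseteq> carrier C"
    and gen: "\<And>S. subring S C \<Longrightarrow> \<sigma> ` carrier k \<subseteq> S \<Longrightarrow> set ys \<subseteq> S \<Longrightarrow> carrier C \<subseteq> S"
    and loc: "\<And>x. x \<in> carrier k \<Longrightarrow> x \<notin> M \<Longrightarrow> x \<in> Units k"
    and H: "eventually (\<lambda>n. n \<in> H) UU" "\<And>n. n \<in> H \<Longrightarrow> \<xi> n \<in> ring_hom C E"
    and \<xi>M: "\<And>n x. n \<in> H \<Longrightarrow> x \<in> carrier k \<Longrightarrow> x \<in> M \<Longrightarrow> \<xi> n (\<sigma> x) \<in> P"
  shows "\<exists>m \<in> H. \<forall>b \<in> carrier C. \<xi> m b \<notin> P \<longrightarrow> eventually (\<lambda>n. n \<in> H \<and> \<xi> n b \<notin> P) UU"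
proof -
  interpret C: cring C by fact
  interpret E: cring E by fact
  interpret P: primeideal P E by fact
  interpret \<sigma>: ring_hom_cring k C \<sigma> by (intro ring_hom_cringI) fact+
  note Pa = additive_subgroup.a_closed[OF P.additive_subgroup_axioms]
  have \<xi>: "ring_hom_cring C E (\<xi> n)" if "n \<in> H" for n by (intro ring_hom_cringI C E H(2) that)
  \<comment> \<open>\<open>N\<close> serves as the ideal of the special fibre. All
    \<open>\<xi> n\<close> send \<open>M\<close> into \<open>P\<close>, so the elements of
    \<open>k\<close> are zero or invertible modulo \<open>N\<close>, and the finite type algebra is
    noetherian modulo \<open>N\<close>, although \<open>k\<close> need not be noetherian.\<close>
  define N where "N = {b \<in> carrier C. \<forall>n \<in> H. \<xi> n b \<in> P}"
  have N: "ideal N C"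
  proof (rule C.ideal_commI)
    show "\<zero>\<^bsub>C\<^esub> \<in> N"
      using ring_hom_zero[OF H(2) C.ring_axioms E.ring_axioms] additive_subgroup.zero_closed[OF P.additive_subgroup_axioms]
      by (auto simp: N_def)
  qed (use ring_hom_add[OF H(2)] ring_hom_mult[OF H(2)] ring_hom_closed[OF H(2)] Pa P.I_l_closed in \<open>auto simp: N_def\<close>)
  have k_sub: "subring (\<sigma> ` carrier k) C"
    using ring_hom_ring.img_is_subring[OF ring_hom_ringI2[OF \<sigma>.R.ring_axioms C.ring_axioms \<sigma>] \<sigma>.R.carrier_is_subring] .
  have "C.noetherian_mod N (\<sigma> ` carrier k)"
  proof (rule C.noetherian_mod_base[OF k_sub N])
    fix s assume "s \<in> \<sigma> ` carrier k"
    then obtain x where x: "s = \<sigma> x" "x \<in> carrier k" by (rule imageE)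
    show "s \<in> N \<or> (\<exists>t \<in> \<sigma> ` carrier k. s \<otimes>\<^bsub>C\<^esub> t = \<one>\<^bsub>C\<^esub>)"
    proof (cases "x \<in> M")
      case True
      then show ?thesis using x \<xi>M by (auto simp: N_def)
    next
      case False
      then have u: "x \<in> Units k" using loc x by blast
      then have "s \<otimes>\<^bsub>C\<^esub> \<sigma> (inv\<^bsub>k\<^esub> x) = \<one>\<^bsub>C\<^esub>" unfolding x(1)
        using \<sigma>.R.Units_r_inv[OF u] \<sigma>.hom_mult[of x "inv\<^bsub>k\<^esub> x"] \<sigma>.R.Units_inv_closed[OF u] x(2) \<sigma>.hom_one by simp
      then show ?thesis using \<sigma>.R.Units_inv_closed[OF u] by blast
    qed
  qed
  from C.noetherian_mod_adjoin_list[OF k_sub N ys this]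
  obtain T where T: "subring T C" "\<sigma> ` carrier k \<union> set ys \<subseteq> T" "C.noetherian_mod N T" by blast
  have "carrier C \<subseteq> T" using gen[OF T(1)] T(2) by blast
  moreover have "T \<subseteq> carrier C" by (rule subringE(1)[OF T(1)])
  ultimately have noeth: "C.noetherian_mod N (carrier C)" using T(3) by simp
  define Q where "Q = {b \<in> carrier C. eventually (\<lambda>n. n \<in> H \<and> \<xi> n b \<in> P) UU}"
  have "Q \<subseteq> carrier C" by (auto simp: Q_def)
  from noeth[unfolded C.noetherian_mod_def, rule_format, OF this]
  obtain D where D: "D \<subseteq> Q" "finite D" "Q \<subseteq> C.span_mod (carrier C) N D" by blast
  have "eventually (\<lambda>n. \<forall>b \<in> D. n \<in> H \<and> \<xi> n b \<in> P) UU"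
    using D(1,2) by (intro eventually_ball_finite) (auto simp: Q_def)
  then have "eventually (\<lambda>n. n \<in> H \<and> (\<forall>b \<in> D. \<xi> n b \<in> P)) UU" using H(1) by eventually_elim blast
  then obtain m where m: "m \<in> H" "\<forall>b \<in> D. \<xi> m b \<in> P" using eventually_happens'[OF UU(2)] by blast
  interpret h: ring_hom_cring C E "\<xi> m" by (rule \<xi>[OF m(1)])
  have Dc: "b \<in> carrier C" if "b \<in> D" for b using D(1) that by (auto simp: Q_def)
  have span: "b \<in> carrier C \<and> \<xi> m b \<in> P" if "b \<in> C.span_mod (carrier C) N D" for b
    using that
  proof (induction rule: C.span_mod.induct)
    case (span_mod_base n)
    then show ?case using m(1) by (auto simp: N_def)
  next
    case (span_mod_step s g d)
    then show ?case using m(2) Dc P.I_l_closed Pa by auto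
  qed
  have "eventually (\<lambda>n. n \<in> H \<and> \<xi> n b \<notin> P) UU" if b: "b \<in> carrier C" "\<xi> m b \<notin> P" for b
  proof -
    have "b \<notin> Q" using span D(3) b(2) by blast
    then have "eventually (\<lambda>n. \<not> (n \<in> H \<and> \<xi> n b \<in> P)) UU"
      using b(1) UU(1)[of "\<lambda>n. n \<in> H \<and> \<xi> n b \<in> P"] by (auto simp: Q_def)
    then show ?thesis using H(1) by eventually_elim blast
  qed
  then show ?thesis using m(1) by blast
qed

lemma structure_alg_hom: "A \<in> algebras k \<Longrightarrow> snd A \<in> alg_hom k (base_alg k) A"
  by (auto simp: algebras_def alg_hom_def base_alg_def)

lemma compose_structure:
  assumes "A \<in> algebras k" "B \<in> algebras k" "f \<in> alg_hom k A B"
  shows "compose (carrier k) f (snd A) = snd B"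
proof
  fix x show "compose (carrier k) f (snd A) x = snd B x"
    using assms alg_homD(2)[OF assms(3), of x] by (cases "x \<in> carrier k") (auto simp: compose_def algebras_def extensional_def)
qed

text \<open>Most points x g^n lie in one chart Spec C of the finite cover, perhaps a chart other
  than \<open>U\<close>. Recurrence provides \<open>m\<close> such that functions invertible at the
  point number \<open>m\<close> are invertible at most others. Translation by the inverse of g^m
  moves that point to x, which is in \<open>U\<close>; on a neighbourhood the translate still has
  values in \<open>U\<close>, and most of the points lie in this neighbourhood.\<close>

lemma ex_recurrent_points:
  fixes k :: "'u ring" and G :: "('u, 'g) gfun"
  assumes inf: "infinite (UNIV :: 'u set)" and k: "cring k"
    and loc: "\<And>x. x \<in> carrier k \<Longrightarrow> x \<notin> M \<Longrightarrow> x \<in> Units k"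
    and G: "group_functor k G"
    and \<V>: "finite \<V>" "covers k \<V> (obj (underlying G))" "\<And>V. V \<in> \<V> \<Longrightarrow> open_subfunctor k (underlying G) V"
      "\<And>V. V \<in> \<V> \<Longrightarrow> \<exists>C. represented_by k (underlying G) V C \<and> finitely_presented_algebra k C"
    and U: "open_subfunctor k (underlying G) U" and B: "B \<in> algebras k" and u: "u \<in> U B"
    and un: "\<And>A y. A \<in> algebras k \<Longrightarrow> y \<in> U A \<Longrightarrow> \<exists>f \<in> alg_hom k B A. garr G B A f u = y"
      "\<And>A f g. A \<in> algebras k \<Longrightarrow> f \<in> alg_hom k B A \<Longrightarrow> g \<in> alg_hom k B A \<Longrightarrow> garr G B A f u = garr G B A g u \<Longrightarrow> f = g"
    and A: "A \<in> algebras k" and P: "primeideal P (fst A)"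
    and AP: "\<And>a. a \<in> carrier (fst A) \<Longrightarrow> a \<notin> P \<Longrightarrow> a \<in> Units (fst A)" "\<And>x. x \<in> carrier k \<Longrightarrow> x \<in> M \<Longrightarrow> snd A x \<in> P"
    and \<pi>: "\<pi> \<in> alg_hom k B A" and g: "g \<in> carrier (gobj G (base_alg k))"
    and UU: "\<And>P. eventually P UU \<or> eventually (\<lambda>n. \<not> P n) UU" "UU \<noteq> bot" "UU \<le> sequentially"
  shows "\<exists>m \<zeta>. \<forall>b \<in> carrier (fst B). \<pi> b \<notin> P \<longrightarrow> eventually (\<lambda>n. m \<le> n \<and> \<zeta> n \<in> alg_hom k B A \<and>
    garr G B A (\<zeta> n) u = garr G B A \<pi> u \<otimes>\<^bsub>gobj G A\<^esub> garr G (base_alg k) A (snd A) g [^]\<^bsub>gobj G A\<^esub> (n - m) \<and> \<zeta> n b \<notin> P) UU"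
proof -
  let ?F = "underlying G" and ?O = "base_alg k"
  have [simp]: "arr ?F = garr G" "obj ?F A = carrier (gobj G A)" for A by (simp_all add: underlying_def)
  have F: "kfunctor k ?F" and gr: "\<And>A. A \<in> algebras k \<Longrightarrow> group (gobj G A)"
    and hom: "\<And>A B f. A \<in> algebras k \<Longrightarrow> B \<in> algebras k \<Longrightarrow> f \<in> alg_hom k A B \<Longrightarrow> group_hom (gobj G A) (gobj G B) (garr G A B f)"
    using G by (auto simp: group_functor_def group_hom_def group_hom_axioms_def)
  note Fc = kfunctorD(1)[OF F, simplified] and Fcomp = kfunctorD(3)[OF F, simplified]
  have O: "?O \<in> algebras k" by (rule base_alg_in_algebras[OF k])
  interpret A: cring "fst A" by (rule algebrasD(1)[OF A])
  interpret P: primeideal P "fst A" by fact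
  interpret GA: group "gobj G A" by (rule gr[OF A])
  interpret GO: group "gobj G ?O" by (rule gr[OF O])
  let ?x = "garr G B A \<pi> u" and ?g = "garr G ?O A (snd A) g"
  have uB: "u \<in> carrier (gobj G B)" using open_subfunctorD(1)[OF U B u] by simp
  have x: "?x \<in> carrier (gobj G A)" by (rule Fc[OF B A \<pi> uB])
  have gA: "?g \<in> carrier (gobj G A)" by (rule Fc[OF O A structure_alg_hom[OF A] g])
  define y where "y n = ?x \<otimes>\<^bsub>gobj G A\<^esub> ?g [^]\<^bsub>gobj G A\<^esub> n" for n :: nat
  have y: "y n \<in> carrier (gobj G A)" for n using x gA by (simp add: y_def)
  have "\<exists>V \<in> \<V>. y n \<in> V A" for n
    using local_point_covered[OF inf k F \<V>(2,3) A P AP(1), of "y n"] y by simp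
  then have "eventually (\<lambda>n. \<exists>V \<in> \<V>. y n \<in> V A) UU" by simp
  from ultrafilter_bex[OF UU(1) \<V>(1) this UU(2)]
  obtain V where V: "V \<in> \<V>" "eventually (\<lambda>n. y n \<in> V A) UU" by blast
  obtain C where C: "represented_by k ?F V C" "finitely_presented_algebra k C" using \<V>(4)[OF V(1)] by blast
  have CA: "C \<in> algebras k" by (rule represented_byD(1)[OF C(1)])
  interpret C: cring "fst C" by (rule algebrasD(1)[OF CA])
  interpret GC: group "gobj G C" by (rule gr[OF CA])
  obtain v where v: "v \<in> V C" "\<And>A y. A \<in> algebras k \<Longrightarrow> y \<in> V A \<Longrightarrow> \<exists>f \<in> alg_hom k C A. garr G C A f v = y"
    using represented_byD(2)[OF C(1)] by auto
  have vC: "v \<in> carrier (gobj G C)" using open_subfunctorD(1)[OF \<V>(3)[OF V(1)] CA v(1)] by simp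
  define H where "H = {n. y n \<in> V A}"
  have "\<forall>n. \<exists>f. n \<in> H \<longrightarrow> f \<in> alg_hom k C A \<and> garr G C A f v = y n" using v(2)[OF A] by (auto simp: H_def)
  then obtain \<xi> where \<xi>: "\<And>n. n \<in> H \<Longrightarrow> \<xi> n \<in> alg_hom k C A" "\<And>n. n \<in> H \<Longrightarrow> garr G C A (\<xi> n) v = y n" by metis
  have HU: "eventually (\<lambda>n. n \<in> H) UU" using V(2) by (simp add: H_def)
  obtain ys where ys: "set ys \<subseteq> carrier (fst C)"
    "\<And>S. subring S (fst C) \<Longrightarrow> snd C ` carrier k \<subseteq> S \<Longrightarrow> set ys \<subseteq> S \<Longrightarrow> carrier (fst C) \<subseteq> S"
    using fp_generators[OF k C(2) CA] by blast
  have \<xi>M: "\<xi> n (snd C x) \<in> P" if "n \<in> H" "x \<in> carrier k" "x \<in> M" for n x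
    using alg_homD(2)[OF \<xi>(1)[OF that(1)] that(2)] AP(2)[OF that(2,3)] by simp
  have "\<exists>m \<in> H. \<forall>b \<in> carrier (fst C). \<xi> m b \<notin> P \<longrightarrow> eventually (\<lambda>n. n \<in> H \<and> \<xi> n b \<notin> P) UU"
    by (rule finite_type_recurrence[OF UU(1,2) C.is_cring A.is_cring P algebrasD(2)[OF CA] k ys loc HU alg_homD(1)[OF \<xi>(1)] \<xi>M])
  then obtain m where m: "m \<in> H" "\<And>b. b \<in> carrier (fst C) \<Longrightarrow> \<xi> m b \<notin> P \<Longrightarrow> eventually (\<lambda>n. n \<in> H \<and> \<xi> n b \<notin> P) UU"
    by blast
  \<comment> \<open>The universal point of the chart, translated by the inverse of g^m. It
    specializes at \<open>\<xi> n\<close> to x g^(n-m), and at \<open>\<xi> m\<close> to x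
    itself.\<close>
  define w where "w = v \<otimes>\<^bsub>gobj G C\<^esub> garr G ?O C (snd C) (inv\<^bsub>gobj G ?O\<^esub> (g [^]\<^bsub>gobj G ?O\<^esub> m))"
  have gm: "inv\<^bsub>gobj G ?O\<^esub> (g [^]\<^bsub>gobj G ?O\<^esub> m) \<in> carrier (gobj G ?O)" using g by simp
  have sC: "garr G ?O C (snd C) (inv\<^bsub>gobj G ?O\<^esub> (g [^]\<^bsub>gobj G ?O\<^esub> m)) \<in> carrier (gobj G C)"
    by (rule Fc[OF O CA structure_alg_hom[OF CA] gm])
  have wC: "w \<in> carrier (gobj G C)" using vC sC by (simp add: w_def)
  have \<xi>w: "garr G C A (\<xi> n) w = ?x \<otimes>\<^bsub>gobj G A\<^esub> ?g [^]\<^bsub>gobj G A\<^esub> (n - m)" if n: "n \<in> H" "m \<le> n" for n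
  proof -
    interpret h: group_hom "gobj G C" "gobj G A" "garr G C A (\<xi> n)" by (rule hom[OF CA A \<xi>(1)[OF n(1)]])
    interpret s: group_hom "gobj G ?O" "gobj G A" "garr G ?O A (snd A)" by (rule hom[OF O A structure_alg_hom[OF A]])
    have "garr G C A (\<xi> n) (garr G ?O C (snd C) (inv\<^bsub>gobj G ?O\<^esub> (g [^]\<^bsub>gobj G ?O\<^esub> m))) =
        garr G ?O A (snd A) (inv\<^bsub>gobj G ?O\<^esub> (g [^]\<^bsub>gobj G ?O\<^esub> m))"
      using Fcomp[OF O CA A structure_alg_hom[OF CA] \<xi>(1)[OF n(1)] gm] compose_structure[OF CA A \<xi>(1)[OF n(1)]]
      by (simp add: base_alg_def)
    also have "\<dots> = inv\<^bsub>gobj G A\<^esub> (?g [^]\<^bsub>gobj G A\<^esub> m)" using g by (simp add: s.hom_inv s.hom_nat_pow)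
    finally have "garr G C A (\<xi> n) w = y n \<otimes>\<^bsub>gobj G A\<^esub> inv\<^bsub>gobj G A\<^esub> (?g [^]\<^bsub>gobj G A\<^esub> m)"
      using vC sC \<xi>(2)[OF n(1)] by (simp add: w_def)
    moreover have "?g [^]\<^bsub>gobj G A\<^esub> n = ?g [^]\<^bsub>gobj G A\<^esub> (n - m) \<otimes>\<^bsub>gobj G A\<^esub> ?g [^]\<^bsub>gobj G A\<^esub> m"
      using gA n(2) by (simp add: GA.nat_pow_mult)
    ultimately show ?thesis using x gA by (simp add: y_def GA.m_assoc)
  qed
  obtain J where J: "ideal J (fst C)" "\<And>B f. B \<in> algebras k \<Longrightarrow> f \<in> alg_hom k C B \<Longrightarrow>
      garr G C B f w \<in> U B \<longleftrightarrow> Idl\<^bsub>fst B\<^esub> (f ` J) = carrier (fst B)"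
    using open_subfunctorD(3)[OF U CA, of w] wC by auto
  have "garr G C A (\<xi> m) w = ?x" using \<xi>w[OF m(1)] x by simp
  moreover have "?x \<in> U A" using open_subfunctorD(2)[OF U B A \<pi> u] by simp
  ultimately have "Idl\<^bsub>fst A\<^esub> (\<xi> m ` J) = carrier (fst A)" using J(2)[OF A \<xi>(1)[OF m(1)]] by simp
  from A.Idl_eq_carrier_not_sub[OF this P] obtain j where j: "j \<in> J" "\<xi> m j \<notin> P" by blast
  have jC: "j \<in> carrier (fst C)" using ideal.Icarr[OF J(1) j(1)] .
  \<comment> \<open>Inverting \<open>j\<close> gives a neighbourhood of the point
    \<open>\<xi> m\<close> on which the translated universal point lies in \<open>U\<close>. There
    it is given by a single homomorphism out of \<open>B\<close>, independent of n.\<close>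
  let ?S = "range (\<lambda>r :: nat. j [^]\<^bsub>fst C\<^esub> r)"
  have "?S \<subseteq> carrier (fst C)" "\<one>\<^bsub>fst C\<^esub> \<in> ?S" using jC by (auto intro: image_eqI[of _ _ 0])
  moreover have "s \<otimes>\<^bsub>fst C\<^esub> t \<in> ?S" if "s \<in> ?S" "t \<in> ?S" for s t using that jC by (auto simp: C.nat_pow_mult)
  ultimately obtain D :: "'u ring" and l where Dl: "is_localization (fst C) ?S D l" using ex_localization[OF inf C.is_cring] by metis
  have D: "cring D" "l \<in> ring_hom (fst C) D" "l ` ?S \<subseteq> Units D"
    "\<And>c. c \<in> carrier D \<Longrightarrow> \<exists>b \<in> carrier (fst C). \<exists>s \<in> ?S. c \<otimes>\<^bsub>D\<^esub> l s = l b"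
    using Dl by (auto simp: is_localization_def)
  interpret D: cring D by fact
  let ?D = "(D, restrict (l \<circ> snd C) (carrier k))" and ?l = "restrict l (carrier (fst C))"
  have DA: "?D \<in> algebras k" by (rule algebras_restrictI[OF D(1) ring_hom_trans[OF algebrasD(2)[OF CA] D(2)] k])
  have l: "?l \<in> alg_hom k C ?D" by (rule alg_hom_restrictI[OF CA]) (use D in simp_all)
  have "j \<in> ?S" using jC by (intro image_eqI[of _ _ 1]) simp_all
  then have "?l j \<in> Units D" using D(3) jC by auto
  then have "Idl\<^bsub>fst ?D\<^esub> (?l ` J) = carrier (fst ?D)"
    using D.Idl_eq_carrier_if_unit[of "?l ` J" "?l j"] j(1) ideal.Icarr[OF J(1)] ring_hom_closed[OF D(2)] by auto
  then have "garr G C ?D ?l w \<in> U ?D" using J(2)[OF DA l] by blast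
  then obtain f where f: "f \<in> alg_hom k B ?D" "garr G B ?D f u = garr G C ?D ?l w" using un(1)[OF DA] by blast
  have powP: "\<xi> n s \<notin> P" if n: "n \<in> H" "\<xi> n j \<notin> P" and "s \<in> ?S" for n s
  proof -
    interpret h: ring_hom_cring "fst C" "fst A" "\<xi> n"
      by (intro ring_hom_cringI C.is_cring A.is_cring alg_homD(1)[OF \<xi>(1)[OF n(1)]])
    have "\<xi> n (j [^]\<^bsub>fst C\<^esub> r) \<notin> P" for r :: nat
    proof (induction r)
      case 0 then show ?case using P.one_imp_carrier P.I_notcarr by auto
    next
      case (Suc r)
      then show ?case using P.I_prime[of "\<xi> n (j [^]\<^bsub>fst C\<^esub> r)" "\<xi> n j"] jC n(2) by auto
    qed
    then show ?thesis using that(3) by blast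
  qed
  \<comment> \<open>The last clause writes values of \<open>\<zeta>\<close> as fractions of values
    of \<open>\<xi> n\<close>, with numerator and denominator independent of n. Through it
    invertibility passes from \<open>B\<close> to \<open>C\<close>, where recurrence is known, and
    back.\<close>
  define good where "good n \<zeta> \<longleftrightarrow> \<zeta> \<in> alg_hom k B A \<and> garr G B A \<zeta> u = ?x \<otimes>\<^bsub>gobj G A\<^esub> ?g [^]\<^bsub>gobj G A\<^esub> (n - m) \<and>
    (\<forall>b \<in> carrier (fst B). \<forall>c \<in> carrier (fst C). \<forall>s \<in> ?S. f b \<otimes>\<^bsub>D\<^esub> l s = l c \<longrightarrow> \<zeta> b \<otimes>\<^bsub>fst A\<^esub> \<xi> n s = \<xi> n c)" for n \<zeta>
  have "\<exists>\<zeta>. good n \<zeta>" if n: "n \<in> H" "m \<le> n" "\<xi> n j \<notin> P" for n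
  proof -
    have \<xi>n: "\<xi> n \<in> ring_hom (fst C) (fst A)" by (rule alg_homD(1)[OF \<xi>(1)[OF n(1)]])
    have "\<xi> n ` ?S \<subseteq> Units (fst A)"
    proof
      fix a assume "a \<in> \<xi> n ` ?S"
      then obtain s where s: "a = \<xi> n s" "s \<in> ?S" by (rule imageE)
      then have "s \<in> carrier (fst C)" using jC by auto
      then show "a \<in> Units (fst A)" using s powP[OF n(1,3) s(2)] AP(1) ring_hom_closed[OF \<xi>n] by simp
    qed
    from localization_lift[OF Dl A.is_cring \<xi>n this]
    obtain \<theta> where \<theta>: "\<theta> \<in> ring_hom D (fst A)" "\<And>c. c \<in> carrier (fst C) \<Longrightarrow> \<theta> (l c) = \<xi> n c" by blast
    let ?\<theta> = "restrict \<theta> (carrier D)"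
    have \<theta>A: "?\<theta> \<in> alg_hom k ?D A"
      using alg_hom_restrictI[OF DA, of \<theta> A] \<theta> algebrasD(3)[OF CA] alg_homD(2)[OF \<xi>(1)[OF n(1)]] by simp
    have \<theta>l: "compose (carrier (fst C)) ?\<theta> ?l = \<xi> n"
    proof
      fix c show "compose (carrier (fst C)) ?\<theta> ?l c = \<xi> n c"
        using \<theta>(2)[of c] ring_hom_closed[OF D(2), of c] \<xi>(1)[OF n(1)]
        by (cases "c \<in> carrier (fst C)") (auto simp: compose_def alg_hom_def extensional_def)
    qed
    let ?\<zeta> = "compose (carrier (fst B)) ?\<theta> f"
    have "garr G B A ?\<zeta> u = garr G ?D A ?\<theta> (garr G B ?D f u)" by (rule Fcomp[OF B DA A f(1) \<theta>A uB])
    also have "\<dots> = garr G C A (\<xi> n) w" unfolding f(2) Fcomp[OF CA DA A l \<theta>A wC, symmetric] \<theta>l ..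
    finally have 1: "garr G B A ?\<zeta> u = ?x \<otimes>\<^bsub>gobj G A\<^esub> ?g [^]\<^bsub>gobj G A\<^esub> (n - m)" using \<xi>w[OF n(1,2)] by simp
    have "?\<zeta> b \<otimes>\<^bsub>fst A\<^esub> \<xi> n s = \<xi> n c"
      if b: "b \<in> carrier (fst B)" "c \<in> carrier (fst C)" "s \<in> ?S" "f b \<otimes>\<^bsub>D\<^esub> l s = l c" for b c s
    proof -
      have s: "s \<in> carrier (fst C)" using b(3) jC by auto
      have fb: "f b \<in> carrier D" using alg_homD(3)[OF f(1) b(1)] by simp
      have "\<theta> (f b) \<otimes>\<^bsub>fst A\<^esub> \<theta> (l s) = \<theta> (l c)"
        unfolding b(4)[symmetric] using ring_hom_mult[OF \<theta>(1) fb ring_hom_closed[OF D(2) s]] by simp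
      then show ?thesis using \<theta>(2) b s fb by (simp add: compose_def)
    qed
    then show ?thesis using 1 alg_hom_compose[OF B f(1) \<theta>A] unfolding good_def by blast
  qed
  then obtain \<zeta> where \<zeta>: "\<And>n. n \<in> H \<Longrightarrow> m \<le> n \<Longrightarrow> \<xi> n j \<notin> P \<Longrightarrow> good n (\<zeta> n)" by metis
  \<comment> \<open>At n = m both homomorphisms represent the point x, and the representing
    homomorphism is unique. This links units at x with units at the point number \<open>m\<close> of
    the other chart.\<close>
  have \<zeta>m: "\<zeta> m = \<pi>" using \<zeta>[OF m(1) order.refl j(2)] un(2)[OF A _ \<pi>] x by (simp add: good_def)
  have ev: "eventually (\<lambda>n. m \<le> n \<and> n \<in> H \<and> \<xi> n j \<notin> P) UU"
    using m(2)[OF jC j(2)] filter_leD[OF UU(3) eventually_ge_at_top[of m]] by eventually_elim blast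
  have "eventually (\<lambda>n. m \<le> n \<and> \<zeta> n \<in> alg_hom k B A \<and> garr G B A (\<zeta> n) u = ?x \<otimes>\<^bsub>gobj G A\<^esub> ?g [^]\<^bsub>gobj G A\<^esub> (n - m) \<and> \<zeta> n b \<notin> P) UU"
    if b: "b \<in> carrier (fst B)" "\<pi> b \<notin> P" for b
  proof -
    have "f b \<in> carrier D" using alg_homD(3)[OF f(1) b(1)] by simp
    then obtain c s where c: "c \<in> carrier (fst C)" "s \<in> ?S" "f b \<otimes>\<^bsub>D\<^esub> l s = l c" using D(4) by blast
    have s: "s \<in> carrier (fst C)" using c(2) jC by auto
    have "\<pi> b \<otimes>\<^bsub>fst A\<^esub> \<xi> m s = \<xi> m c"
      using \<zeta>[OF m(1) order.refl j(2)] b(1) c unfolding good_def \<zeta>m by blast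
    then have "\<xi> m c \<notin> P"
      using P.I_prime[of "\<pi> b" "\<xi> m s"] powP[OF m(1) j(2) c(2)] b alg_homD(3)[OF \<pi> b(1)] alg_homD(3)[OF \<xi>(1)[OF m(1)] s] by auto
    from ev m(2)[OF c(1) this] show ?thesis
    proof eventually_elim
      case (elim n)
      then have gd: "good n (\<zeta> n)" and n: "n \<in> H" "\<xi> n c \<notin> P" using \<zeta> by blast+
      have "\<zeta> n b \<otimes>\<^bsub>fst A\<^esub> \<xi> n s = \<xi> n c" using gd b(1) c unfolding good_def by blast
      then have "\<zeta> n b \<notin> P" using P.I_r_closed[of "\<zeta> n b" "\<xi> n s"] n(2) alg_homD(3)[OF \<xi>(1)[OF n(1)] s] by auto
      then show ?case using gd elim unfolding good_def by blast
    qed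
  qed
  then show ?thesis by blast
qed

section \<open>Values of characters\<close>

lemma fraction_field_localization:
  assumes "domain k" "is_fraction_field k (K, \<iota>)"
  shows "is_localization k (carrier k - {\<zero>\<^bsub>k\<^esub>}) K \<iota>"
proof -
  interpret domain k by fact
  interpret K: field K using assms(2) by (simp add: is_fraction_field_def)
  have \<iota>: "\<iota> \<in> ring_hom k K" "inj_on \<iota> (carrier k)" using assms(2) by (auto simp: is_fraction_field_def algebras_def)
  interpret \<iota>: ring_hom_cring k K \<iota> by (intro ring_hom_cringI is_cring K.is_cring \<iota>)
  have z: "\<iota> b = \<zero>\<^bsub>K\<^esub> \<longleftrightarrow> b = \<zero>\<^bsub>k\<^esub>" if "b \<in> carrier k" for b
    using inj_on_eq_iff[OF \<iota>(2) that zero_closed] by simp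
  have "\<iota> ` (carrier k - {\<zero>\<^bsub>k\<^esub>}) \<subseteq> Units K" using z by (auto simp: K.field_Units)
  moreover have "\<exists>s \<in> carrier k - {\<zero>\<^bsub>k\<^esub>}. s \<otimes>\<^bsub>k\<^esub> \<zero>\<^bsub>k\<^esub> = \<zero>\<^bsub>k\<^esub>" using one_not_zero by (intro bexI[of _ "\<one>\<^bsub>k\<^esub>"]) auto
  ultimately show ?thesis
    using assms(2) z \<iota> is_cring K.is_cring unfolding is_localization_def is_fraction_field_def
    by (auto simp: integral_iff)
qed

text \<open>Evaluate \<open>\<chi>\<close> at the universal point of the generic fibre of Spec B.
  The ring of this fibre inverts just the nonzero constants of \<open>k\<close>, so a constant
  \<open>d0\<close> suffices as denominator. Naturality of \<open>\<chi>\<close> carries the formula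
  to every point.\<close>

lemma character_formula:
  fixes k K :: "'u ring" and G :: "('u, 'g) gfun"
  assumes inf: "infinite (UNIV :: 'u set)" and k: "domain k" and K: "is_fraction_field k (K, \<iota>)"
    and G: "group_functor k G" and \<chi>: "\<chi> \<in> group_functor_hom K (base_change k \<iota> G) Gm"
    and B: "B \<in> algebras k" and u: "u \<in> carrier (gobj G B)"
  shows "\<exists>F0 \<in> carrier (fst B). \<exists>d0 \<in> carrier k - {\<zero>\<^bsub>k\<^esub>}. \<forall>A \<in> algebras K. \<forall>f \<in> alg_hom k B (restrict_scalars k \<iota> A).
    \<chi> A (garr G B (restrict_scalars k \<iota> A) f u) \<otimes>\<^bsub>fst A\<^esub> f (snd B d0) = f F0"
proof -
  interpret k: domain k by fact
  interpret B: cring "fst B" by (rule algebrasD(1)[OF B])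
  interpret K: field K using K by (simp add: is_fraction_field_def)
  interpret s: ring_hom_cring k "fst B" "snd B" by (intro ring_hom_cringI k.is_cring B.is_cring algebrasD(2)[OF B])
  have KA: "(K, \<iota>) \<in> algebras k" using K by (simp add: is_fraction_field_def)
  have F: "kfunctor k (underlying G)" using G by (simp add: group_functor_def)
  note Fc = kfunctorD(1)[OF F, unfolded underlying_def, simplified] and Fcomp = kfunctorD(3)[OF F, unfolded underlying_def, simplified]
  note Kloc = fraction_field_localization[OF k K]
  let ?k = "carrier k - {\<zero>\<^bsub>k\<^esub>}" and ?S = "snd B ` (carrier k - {\<zero>\<^bsub>k\<^esub>})"
  have "?S \<subseteq> carrier (fst B)" "\<one>\<^bsub>fst B\<^esub> \<in> ?S" by (auto intro: image_eqI[of _ _ "\<one>\<^bsub>k\<^esub>"])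
  moreover have "s \<otimes>\<^bsub>fst B\<^esub> t \<in> ?S" if "s \<in> ?S" "t \<in> ?S" for s t
  proof -
    from that(1) obtain x where x: "s = snd B x" "x \<in> ?k" by (rule imageE)
    from that(2) obtain y where y: "t = snd B y" "y \<in> ?k" by (rule imageE)
    show ?thesis using x y k.integral_iff by (intro image_eqI[of _ _ "x \<otimes>\<^bsub>k\<^esub> y"]) auto
  qed
  ultimately obtain D :: "'u ring" and l where Dl: "is_localization (fst B) ?S D l" using ex_localization[OF inf B.is_cring] by metis
  have D: "cring D" "l \<in> ring_hom (fst B) D" "l ` ?S \<subseteq> Units D"
    "\<And>c. c \<in> carrier D \<Longrightarrow> \<exists>b \<in> carrier (fst B). \<exists>s \<in> ?S. c \<otimes>\<^bsub>D\<^esub> l s = l b"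
    using Dl by (auto simp: is_localization_def)
  interpret D: cring D by fact
  have ls: "l \<circ> snd B \<in> ring_hom k D" by (rule ring_hom_trans[OF algebrasD(2)[OF B] D(2)])
  have "(l \<circ> snd B) ` ?k \<subseteq> Units D" using D(3) by (simp add: image_comp)
  from localization_lift[OF Kloc D(1) ls this]
  obtain \<tau> where \<tau>: "\<tau> \<in> ring_hom K D" "\<And>x. x \<in> carrier k \<Longrightarrow> \<tau> (\<iota> x) = l (snd B x)" by auto
  let ?D = "(D, restrict \<tau> (carrier K))" and ?l = "restrict l (carrier (fst B))"
  let ?r = "restrict_scalars k \<iota>"
  have DA: "?D \<in> algebras K" by (rule algebras_restrictI[OF D(1) \<tau>(1) K.is_cring])
  have rDA: "?r ?D \<in> algebras k" by (rule restrict_scalars_algebras[OF k.is_cring KA DA])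
  have fst_r: "fst (?r A) = fst A" for A by (simp add: restrict_scalars_def)
  have snd_r: "snd (?r A) x = snd A (\<iota> x)" if "x \<in> carrier k" for A x using that by (simp add: restrict_scalars_def compose_def)
  have \<iota>c: "\<iota> x \<in> carrier K" if "x \<in> carrier k" for x using algebrasD(3)[OF KA that] by simp
  have l: "?l \<in> alg_hom k B (?r ?D)"
    using alg_hom_restrictI[OF B, of l "?r ?D"] D(2) \<tau>(2) \<iota>c by (simp add: fst_r snd_r)
  let ?u = "garr G B (?r ?D) ?l u"
  have uD: "?u \<in> carrier (gobj G (?r ?D))" by (rule Fc[OF B rDA l u])
  then have uD': "?u \<in> carrier (gobj (base_change k \<iota> G) ?D)" by (simp add: base_change_def)
  have "\<chi> ?D ?u \<in> carrier D" using group_functor_homD[OF \<chi> DA uD'] by (auto simp: Units_def)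
  then obtain F0 d0 where F0: "F0 \<in> carrier (fst B)" "d0 \<in> ?k" "\<chi> ?D ?u \<otimes>\<^bsub>D\<^esub> l (snd B d0) = l F0" using D(4) by blast
  have "\<chi> A (garr G B (?r A) f u) \<otimes>\<^bsub>fst A\<^esub> f (snd B d0) = f F0"
    if A: "A \<in> algebras K" and f: "f \<in> alg_hom k B (?r A)" for A f
  proof -
    have rA: "?r A \<in> algebras k" by (rule restrict_scalars_algebras[OF k.is_cring KA A])
    interpret A: cring "fst A" by (rule algebrasD(1)[OF A])
    have fr: "f \<in> ring_hom (fst B) (fst A)" using alg_homD(1)[OF f] by (simp add: fst_r)
    have fs: "f (snd B x) = snd A (\<iota> x)" if "x \<in> carrier k" for x using alg_homD(2)[OF f that] snd_r[OF that] by simp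
    have "f ` ?S \<subseteq> Units (fst A)"
    proof
      fix a assume "a \<in> f ` ?S"
      then obtain x where x: "a = f (snd B x)" "x \<in> ?k" by auto
      then have "\<iota> x \<in> Units K" using Kloc by (auto simp: is_localization_def)
      then show "a \<in> Units (fst A)" using ring_hom_Units[OF algebrasD(2)[OF A]] x fs by auto
    qed
    from localization_lift[OF Dl A.is_cring fr this]
    obtain \<theta> where \<theta>: "\<theta> \<in> ring_hom D (fst A)" "\<And>b. b \<in> carrier (fst B) \<Longrightarrow> \<theta> (l b) = f b" by blast
    let ?\<theta> = "restrict \<theta> (carrier D)"
    \<comment> \<open>\<open>\<theta>\<close> is obtained from \<open>B\<close> only. It respects
      the structure over \<open>K\<close> because homomorphisms out of a fraction field are
      determined by their values on \<open>k\<close>.\<close>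
    have "(\<theta> \<circ> \<tau>) y = snd A y" if "y \<in> carrier K" for y
      by (rule localization_hom_eq[OF Kloc A.is_cring ring_hom_trans[OF \<tau>(1) \<theta>(1)] algebrasD(2)[OF A] _ that])
        (simp add: \<tau>(2) \<theta>(2) fs)
    then have \<theta>A: "?\<theta> \<in> alg_hom K ?D A"
      using alg_hom_restrictI[OF DA, of \<theta> A] \<theta>(1) by simp
    have \<theta>r: "?\<theta> \<in> alg_hom k (?r ?D) (?r A)" by (rule restrict_scalars_alg_hom[OF KA \<theta>A])
    have "compose (carrier (fst B)) ?\<theta> ?l = f"
    proof
      fix b show "compose (carrier (fst B)) ?\<theta> ?l b = f b"
        using \<theta>(2)[of b] ring_hom_closed[OF D(2), of b] f
        by (cases "b \<in> carrier (fst B)") (auto simp: compose_def alg_hom_def extensional_def)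
    qed
    then have "garr G B (?r A) f u = garr (base_change k \<iota> G) ?D A ?\<theta> ?u"
      using Fcomp[OF B rDA rA l \<theta>r u] by (simp add: base_change_def)
    moreover have "\<chi> A (garr (base_change k \<iota> G) ?D A ?\<theta> ?u) = garr Gm ?D A ?\<theta> (\<chi> ?D ?u)"
      using \<chi> DA A \<theta>A uD' unfolding group_functor_hom_def by blast
    moreover have "garr Gm ?D A ?\<theta> (\<chi> ?D ?u) = \<theta> (\<chi> ?D ?u)"
      using \<open>\<chi> ?D ?u \<in> carrier D\<close> by (simp add: Gm_def)
    ultimately have "\<chi> A (garr G B (?r A) f u) \<otimes>\<^bsub>fst A\<^esub> f (snd B d0) = \<theta> (\<chi> ?D ?u) \<otimes>\<^bsub>fst A\<^esub> \<theta> (l (snd B d0))"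
      using \<theta>(2) F0(2) by simp
    also have "\<dots> = \<theta> (l F0)"
      using ring_hom_mult[OF \<theta>(1) \<open>\<chi> ?D ?u \<in> carrier D\<close>, of "l (snd B d0)"] F0(2,3) ring_hom_closed[OF D(2)] by simp
    finally show ?thesis using \<theta>(2) F0(1) by simp
  qed
  then show ?thesis using F0(1,2) by blast
qed

section \<open>Valuation subrings as test algebras, and powers confined by relations\<close>

context valuation_subring
begin

lemma cring_subring: "cring (R\<lparr>carrier := S\<rparr>)"
  using subcring_iff[of S] subringE(1)[OF S] subcringI'[OF S] by simp

lemma Units_subring: "Units (R\<lparr>carrier := S\<rparr>) = S - nonunits R S"
  using m_comm S_closed by (auto simp: Units_def nonunits_def)

lemma primeideal_nonunits: "primeideal (nonunits R S) (R\<lparr>carrier := S\<rparr>)"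
proof -
  interpret E: cring "R\<lparr>carrier := S\<rparr>" by (rule cring_subring)
  have ns: "nonunits R S \<subseteq> S" by (auto simp: nonunits_def)
  show ?thesis
  proof (rule primeidealI)
    show "ideal (nonunits R S) (R\<lparr>carrier := S\<rparr>)"
      by (rule E.ideal_commI) (use ns zero_nonunit nonunits_add nonunits_mult m_comm in auto)
    show "carrier (R\<lparr>carrier := S\<rparr>) \<noteq> nonunits R S" using one_not_nonunit E.one_closed by auto
    show "a \<in> nonunits R S \<or> b \<in> nonunits R S"
      if "a \<in> carrier (R\<lparr>carrier := S\<rparr>)" "b \<in> carrier (R\<lparr>carrier := S\<rparr>)" "a \<otimes>\<^bsub>R\<lparr>carrier := S\<rparr>\<^esub> b \<in> nonunits R S" for a b
      using nonunits_prime that by simp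
  qed (rule E.is_cring)
qed

lemma nonunits_pow:
  assumes "a \<in> nonunits R S" "r > 0" shows "a [^] (r :: nat) \<in> nonunits R S"
  using assms(2)
proof (induction r)
  case (Suc r)
  have aS: "a \<in> S" using assms(1) by (simp add: nonunits_def)
  have "a [^] r \<in> S" using aS by (induction r) (use subringE(3,6)[OF S] in auto)
  then have "a \<otimes> a [^] r \<in> nonunits R S" by (rule nonunits_mult[OF assms(1)])
  then show ?case using aS by (simp add: m_comm)
qed simp

lemma unit_quotient:
  assumes "w \<in> S - nonunits R S" "w' \<in> S - nonunits R S" "x \<in> carrier R" "x \<noteq> \<zero>" "y \<in> carrier R" "w \<otimes> x = w' \<otimes> (x \<otimes> y)"
  shows "y \<in> S - nonunits R S"
proof -
  obtain t where t: "t \<in> S" "w' \<otimes> t = \<one>" using assms(2) by (auto simp: nonunits_def)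
  have c: "w \<in> carrier R" "w' \<in> carrier R" "t \<in> carrier R" using assms(1,2) t by auto
  have "x \<otimes> w = x \<otimes> (w' \<otimes> y)" using assms(3,5,6) c by (simp add: m_ac)
  then have w: "w = w' \<otimes> y" using m_lcancel[OF assms(4,3)] c assms(5) by simp
  then have "w \<otimes> t = y \<otimes> (w' \<otimes> t)" using c assms(5) by (simp add: m_ac)
  then have "y = w \<otimes> t" using t(2) assms(5) by simp
  then have "y \<in> S" using subringE(6)[OF S] assms(1) t(1) by blast
  moreover have "y \<notin> nonunits R S" using nonunits_mult[of y w'] w assms(1,2,5) c m_comm[of y w'] by auto
  ultimately show ?thesis by blast
qed

text \<open>Equality of valuations of the summands i and j at one exponent still involves
  \<open>e\<close> and \<open>a\<close>. A second exponent with the same i and j cancels them and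
  leaves the power of \<open>\<mu>\<close> with exponent (n2 - n1)(i - j), up to sign.\<close>

lemma recurrent_unit_power:
  fixes N :: nat
  assumes UU: "\<And>P. eventually P UU \<or> eventually (\<lambda>n. \<not> P n) UU" "UU \<noteq> bot" "UU \<le> sequentially"
    and \<mu>: "\<mu> \<in> carrier R" "\<mu> \<noteq> \<zero>" and a: "a \<in> carrier R" "a \<noteq> \<zero>"
    and e: "\<And>j. j \<le> N \<Longrightarrow> e j \<in> carrier R" "\<exists>j \<le> N. e j \<noteq> \<zero>"
    and ev: "eventually (\<lambda>n. m \<le> n \<and> (\<exists>s. (\<forall>j \<le> N. s j \<in> S - nonunits R S) \<and>
      (\<Oplus>j \<in> {..N}. (e j \<otimes> s j) \<otimes> (a \<otimes> \<mu> [^] (n - m)) [^] j) = \<zero>)) UU"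
  shows "\<exists>r > (0 :: nat). \<mu> [^] r \<in> S - nonunits R S"
proof -
  define b where "b n = a \<otimes> \<mu> [^] (n - m)" for n
  have pow0: "x [^] (i :: nat) \<noteq> \<zero>" if "x \<in> carrier R" "x \<noteq> \<zero>" for x i
    using that by (induction i) (auto simp: integral_iff)
  have b: "b n \<in> carrier R" "b n \<noteq> \<zero>" for n using a \<mu> pow0[OF \<mu>] by (auto simp: b_def integral_iff)
  \<comment> \<open>The units of the relation vary with n. They are absorbed into \<open>w\<close>
    and \<open>w'\<close>, so that the compared terms depend on n through \<open>b n\<close>
    alone.\<close>
  define rel where "rel ij n \<longleftrightarrow> (case ij of (i, j) \<Rightarrow> m \<le> n \<and> e j \<noteq> \<zero> \<and>
    (\<exists>w \<in> S - nonunits R S. \<exists>w' \<in> S - nonunits R S. w \<otimes> (e i \<otimes> b n [^] i) = w' \<otimes> (e j \<otimes> b n [^] j)))" for ij n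
  let ?T = "{(i, j). i \<le> N \<and> j \<le> N \<and> i \<noteq> j}"
  have evT: "eventually (\<lambda>n. \<exists>ij \<in> ?T. rel ij n) UU"
    using ev
  proof eventually_elim
    case (elim n)
    then obtain s where s: "m \<le> n" "\<And>j. j \<le> N \<Longrightarrow> s j \<in> S - nonunits R S" "(\<Oplus>j \<in> {..N}. (e j \<otimes> s j) \<otimes> b n [^] j) = \<zero>"
      unfolding b_def by blast
    have sc: "s j \<in> carrier R" "s j \<noteq> \<zero>" if "j \<le> N" for j using s(2)[OF that] zero_nonunit by auto
    let ?f = "\<lambda>j. (e j \<otimes> s j) \<otimes> b n [^] j"
    have "?f \<in> {..N} \<rightarrow> carrier R" using e(1) sc b by auto
    moreover have "\<exists>j \<in> {..N}. ?f j \<noteq> \<zero>"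
    proof -
      obtain j where j: "j \<le> N" "e j \<noteq> \<zero>" using e(2) by blast
      then have "?f j \<noteq> \<zero>" using sc[OF j(1)] e(1)[OF j(1)] b[of n] pow0[OF b] by (simp add: integral_iff)
      then show ?thesis using j by blast
    qed
    ultimately obtain i j w where ij: "i \<le> N" "j \<le> N" "i \<noteq> j" "?f j \<noteq> \<zero>" "w \<in> S - nonunits R S" "?f i = w \<otimes> ?f j"
      using zero_sum_associates[OF _ _ s(3)] by auto
    have wc: "w \<in> carrier R" using ij(5) by auto
    have "s i \<otimes> (e i \<otimes> b n [^] i) = (w \<otimes> s j) \<otimes> (e j \<otimes> b n [^] j)"
      using ij(6) e(1)[OF ij(1)] e(1)[OF ij(2)] sc[OF ij(1)] sc[OF ij(2)] b[of n] wc by (simp add: m_ac)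
    moreover have "e j \<noteq> \<zero>" using ij(4) e(1)[OF ij(2)] sc[OF ij(2)] b[of n] by auto
    moreover have "w \<otimes> s j \<in> S - nonunits R S"
      using ij(5) s(2)[OF ij(2)] subringE(6)[OF S] nonunits_prime by blast
    ultimately show ?case using s(1) s(2)[OF ij(1)] ij(1-3) unfolding rel_def by (intro bexI[of _ "(i, j)"]) auto
  qed
  have "finite ?T" by (rule finite_subset[of _ "{..N} \<times> {..N}"]) auto
  from ultrafilter_bex[OF UU(1) this evT UU(2)]
  obtain ij where ij: "ij \<in> ?T" "eventually (rel ij) UU" by blast
  obtain i j where ij': "ij = (i, j)" "i \<le> N" "j \<le> N" "i \<noteq> j" using ij(1) by auto
  obtain n1 where n1: "rel ij n1" using eventually_happens'[OF UU(2) ij(2)] by blast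
  have "eventually (\<lambda>n. rel ij n \<and> Suc n1 \<le> n) UU"
    using ij(2) filter_leD[OF UU(3) eventually_ge_at_top[of "Suc n1"]] by eventually_elim blast
  then obtain n2 where n2: "rel ij n2" "n1 < n2" using eventually_happens'[OF UU(2)] by fastforce
  define r where "r = n2 - n1"
  have r: "r > 0" using n2 by (simp add: r_def)
  have m: "m \<le> n1" using n1 ij'(1) by (simp add: rel_def)
  have b2: "b n2 = b n1 \<otimes> \<mu> [^] r"
  proof -
    have "n2 - m = (n1 - m) + r" using m n2 by (simp add: r_def)
    then show ?thesis using a \<mu> by (simp add: b_def m_assoc nat_pow_mult)
  qed
  let ?c = "\<lambda>i. e i \<otimes> b n1 [^] i" and ?l = "\<lambda>i. \<mu> [^] (r * i)"
  obtain w1 w1' where w1: "w1 \<in> S - nonunits R S" "w1' \<in> S - nonunits R S" "w1 \<otimes> ?c i = w1' \<otimes> ?c j" and ej: "e j \<noteq> \<zero>"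
    using n1 ij'(1) by (auto simp: rel_def)
  obtain w2 w2' where w2: "w2 \<in> S - nonunits R S" "w2' \<in> S - nonunits R S" "w2 \<otimes> (e i \<otimes> b n2 [^] i) = w2' \<otimes> (e j \<otimes> b n2 [^] j)"
    using n2 ij'(1) by (auto simp: rel_def)
  have ec: "e i \<in> carrier R" "e j \<in> carrier R" using e ij' by auto
  have wc: "w1 \<in> carrier R" "w1' \<in> carrier R" "w2 \<in> carrier R" "w2' \<in> carrier R" using w1 w2 by auto
  have cc: "?c i \<in> carrier R" "?c j \<in> carrier R" "?l i \<in> carrier R" "?l j \<in> carrier R" using ec b \<mu> by auto
  have w2'': "w2 \<otimes> (?c i \<otimes> ?l i) = w2' \<otimes> (?c j \<otimes> ?l j)"
    using w2(3) b2 b(1)[of n1] \<mu>(1) ec wc by (simp add: nat_pow_distrib nat_pow_pow m_assoc)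
  have c0: "?c j \<noteq> \<zero>" using ej pow0[OF b] ec b by (simp add: integral_iff)
  \<comment> \<open>The equality at \<open>n1\<close> replaces the i-th coefficient by the j-th one
    in the equality at \<open>n2\<close>. Then both sides share a nonzero factor, and only powers of
    \<open>\<mu>\<close> and units are left.\<close>
  have "(w2 \<otimes> w1') \<otimes> (?c j \<otimes> ?l i) = w2 \<otimes> (w1' \<otimes> ?c j) \<otimes> ?l i" using wc cc by (simp add: m_assoc)
  also have "\<dots> = w1 \<otimes> (w2 \<otimes> (?c i \<otimes> ?l i))" using wc cc unfolding w1(3)[symmetric] by (simp add: m_ac)
  also have "\<dots> = (w1 \<otimes> w2') \<otimes> (?c j \<otimes> ?l j)" unfolding w2'' using wc cc by (simp add: m_assoc)
  finally have E: "(w2 \<otimes> w1') \<otimes> (?c j \<otimes> ?l i) = (w1 \<otimes> w2') \<otimes> (?c j \<otimes> ?l j)" .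
  have W: "w2 \<otimes> w1' \<in> S - nonunits R S" "w1 \<otimes> w2' \<in> S - nonunits R S"
    using w1 w2 subringE(6)[OF S] nonunits_prime by blast+
  have nz: "?c j \<otimes> ?l i \<noteq> \<zero>" "?c j \<otimes> ?l j \<noteq> \<zero>" using c0 cc pow0[OF \<mu>] by (simp_all add: integral_iff)
  show ?thesis
  proof (cases "i < j")
    case True
    have lj: "?l j = ?l i \<otimes> \<mu> [^] (r * (j - i))"
      using \<mu>(1) True by (simp add: nat_pow_mult distrib_left[symmetric] del: nat_pow_mult[symmetric])
    have "\<mu> [^] (r * (j - i)) \<in> S - nonunits R S"
      by (rule unit_quotient[OF W _ nz(1)]) (use cc \<mu>(1) E lj in \<open>simp_all add: m_assoc\<close>)
    then show ?thesis using r True by (intro exI[of _ "r * (j - i)"]) auto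
  next
    case False
    then have ji: "j < i" using ij'(4) by simp
    have li: "?l i = ?l j \<otimes> \<mu> [^] (r * (i - j))"
      using \<mu>(1) ji by (simp add: nat_pow_mult distrib_left[symmetric] del: nat_pow_mult[symmetric])
    have "\<mu> [^] (r * (i - j)) \<in> S - nonunits R S"
      by (rule unit_quotient[OF W(2,1) _ nz(2)]) (use cc \<mu>(1) E li in \<open>simp_all add: m_assoc\<close>)
    then show ?thesis using r ji by (intro exI[of _ "r * (i - j)"]) auto
  qed
qed

end

text \<open>Gathers the geometric input in a form that no longer mentions coordinates.
  \<open>Q\<close> is arbitrary because the prime ideal to be used is defined by the recurrent
  points, which can be found only after the valuation point has been fixed.\<close>

lemma (in chart) ex_generic_valuation_point:
  assumes val: "valuation_domain k"
  shows "\<exists>(L :: 'u ring) S \<pi>. valuation_subring L S \<and> \<pi> \<in> ring_hom (fst B) L \<and> \<pi> ` BB \<subseteq> S \<and>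
    (\<forall>x \<in> M. \<pi> (snd B x) \<in> nonunits L S) \<and> (\<forall>x \<in> carrier k. \<pi> (snd B x) = \<zero>\<^bsub>L\<^esub> \<longrightarrow> x = \<zero>\<^bsub>k\<^esub>) \<and>
    (\<forall>Q f. primeideal Q (fst B) \<longrightarrow> (\<forall>b \<in> BB. \<pi> b \<notin> nonunits L S \<longrightarrow> b \<notin> Q) \<longrightarrow> f \<in> BB \<longrightarrow>
      (\<exists>n c v. (\<forall>j \<le> n. c j \<in> carrier k \<and> v j \<in> BB \<and> \<pi> (v j) \<notin> nonunits L S) \<and> (\<exists>j \<le> n. c j \<noteq> \<zero>\<^bsub>k\<^esub>) \<and>
        (\<Oplus>\<^bsub>fst B\<^esub>j \<in> {..n::nat}. snd B (c j) \<otimes>\<^bsub>fst B\<^esub> v j \<otimes>\<^bsub>fst B\<^esub> f [^]\<^bsub>fst B\<^esub> j) \<in> Q))"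
proof -
  obtain d t where t: "spans d t" "indep d t" using ex_coordinates by blast
  let ?ts = "map t [0..<d]"
  have tsB: "set ?ts \<subseteq> BB" using t(1) I_sub by (auto simp: spans_def)
  obtain q p where q: "primeideal q (fst B)" and p: "primeideal p (fst B)" and qp: "q \<subseteq> p"
    and qk: "\<And>x. x \<in> carrier k \<Longrightarrow> snd B x \<in> q \<Longrightarrow> x = \<zero>\<^bsub>k\<^esub>" and pk: "\<And>x. x \<in> carrier k \<Longrightarrow> snd B x \<in> p \<longleftrightarrow> x \<in> M"
    and p1: "\<And>b. b \<in> BB \<Longrightarrow> \<epsilon> b = \<one>\<^bsub>k\<^esub> \<Longrightarrow> b \<notin> p" and gs: "generic_seq k M (fst B) (snd B) p ?ts"
    using ex_generic_primes[OF t] by blast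
  obtain L :: "'u ring" and S \<pi> where L: "valuation_subring L S" and \<pi>: "\<pi> \<in> ring_hom (fst B) L" "\<pi> ` BB \<subseteq> S"
    and \<pi>p: "\<And>b. b \<in> BB - p \<Longrightarrow> \<pi> b \<in> S - nonunits L S" and \<pi>M: "\<forall>x \<in> M. \<pi> (snd B x) \<in> nonunits L S"
    and \<pi>k: "\<forall>x \<in> carrier k. \<pi> (snd B x) = \<zero>\<^bsub>L\<^esub> \<longrightarrow> x = \<zero>\<^bsub>k\<^esub>"
    using ex_valuation_point[OF val q p qp qk pk] by blast
  have "\<exists>n c v. (\<forall>j \<le> n. c j \<in> carrier k \<and> v j \<in> BB \<and> \<pi> (v j) \<notin> nonunits L S) \<and> (\<exists>j \<le> n. c j \<noteq> \<zero>\<^bsub>k\<^esub>) \<and>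
        (\<Oplus>\<^bsub>fst B\<^esub>j \<in> {..n::nat}. snd B (c j) \<otimes>\<^bsub>fst B\<^esub> v j \<otimes>\<^bsub>fst B\<^esub> f [^]\<^bsub>fst B\<^esub> j) \<in> Q"
    if Q: "primeideal Q (fst B)" "\<forall>b \<in> BB. \<pi> b \<notin> nonunits L S \<longrightarrow> b \<notin> Q" and f: "f \<in> BB" for Q f
  proof -
    have "h \<notin> Q" if "h \<in> BB" "\<epsilon> h = \<one>\<^bsub>k\<^esub>" for h
      using Q(2) \<pi>p[of h] p1[OF that] that(1) by blast
    from algebraic_dependence[OF t(1) Q(1) this f]
    obtain n w where w: "\<And>j. j \<le> n \<Longrightarrow> w j \<in> polys ?ts" "\<exists>j \<le> n. w j \<notin> Q"
      "(\<Oplus>\<^bsub>fst B\<^esub>j \<in> {..n::nat}. w j \<otimes>\<^bsub>fst B\<^esub> f [^]\<^bsub>fst B\<^esub> j) \<in> Q" by blast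
    have "\<forall>j. \<exists>c v. j \<le> n \<longrightarrow> c \<in> carrier k \<and> v \<in> BB - p \<and> w j = snd B c \<otimes>\<^bsub>fst B\<^esub> v"
      using polys_content[OF val tsB p gs w(1)] by blast
    then obtain c v where cv: "\<And>j. j \<le> n \<Longrightarrow> c j \<in> carrier k" "\<And>j. j \<le> n \<Longrightarrow> v j \<in> BB - p"
      "\<And>j. j \<le> n \<Longrightarrow> w j = snd B (c j) \<otimes>\<^bsub>fst B\<^esub> v j" by metis
    obtain j where j: "j \<le> n" "w j \<notin> Q" using w(2) by blast
    have "c j \<noteq> \<zero>\<^bsub>k\<^esub>"
    proof
      assume "c j = \<zero>\<^bsub>k\<^esub>"
      then have "w j = \<zero>\<^bsub>fst B\<^esub>" using cv(2,3)[OF j(1)] by simp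
      then show False
        using j(2) additive_subgroup.zero_closed[OF ideal.axioms(1)[OF primeideal.axioms(1)[OF Q(1)]]] by simp
    qed
    moreover have "(\<Oplus>\<^bsub>fst B\<^esub>j \<in> {..n}. snd B (c j) \<otimes>\<^bsub>fst B\<^esub> v j \<otimes>\<^bsub>fst B\<^esub> f [^]\<^bsub>fst B\<^esub> j) =
        (\<Oplus>\<^bsub>fst B\<^esub>j \<in> {..n}. w j \<otimes>\<^bsub>fst B\<^esub> f [^]\<^bsub>fst B\<^esub> j)"
    proof (rule B.finsum_cong')
      show "(\<lambda>j. w j \<otimes>\<^bsub>fst B\<^esub> f [^]\<^bsub>fst B\<^esub> j) \<in> {..n} \<rightarrow> BB"
        using w(1) subringE(1)[OF polys_subring(1)[OF tsB]] f by auto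
    qed (simp_all add: cv(3))
    ultimately show ?thesis
      using w(3) cv(1,2) \<pi>p j(1) by (intro exI[of _ n] exI[of _ c] exI[of _ v]) auto
  qed
  then show ?thesis using L \<pi> \<pi>M \<pi>k by blast
qed

section \<open>Valuation domains, their fraction fields and the value of one character\<close>

lemma valuation_domain_primeideal:
  assumes "valuation_domain k" shows "primeideal (carrier k - Units k) k"
proof -
  interpret domain k using assms by (simp add: valuation_domain_def)
  let ?M = "carrier k - Units k"
  have mult: "x \<otimes>\<^bsub>k\<^esub> a \<in> ?M" if "a \<in> ?M" "x \<in> carrier k" for a x
    using that prod_unit_r[of x a] unit_factor[of a x] m_comm[of x a] by auto
  have add: "a \<oplus>\<^bsub>k\<^esub> b \<in> ?M" if ab: "a \<in> ?M" "b \<in> ?M" for a b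
  proof -
    have "a divides\<^bsub>k\<^esub> b \<or> b divides\<^bsub>k\<^esub> a" using assms ab by (auto simp: valuation_domain_def)
    then obtain c where c: "c \<in> carrier k" "b = a \<otimes>\<^bsub>k\<^esub> c \<or> a = b \<otimes>\<^bsub>k\<^esub> c" by (auto simp: factor_def)
    have "a \<oplus>\<^bsub>k\<^esub> b = (\<one>\<^bsub>k\<^esub> \<oplus>\<^bsub>k\<^esub> c) \<otimes>\<^bsub>k\<^esub> a" if "b = a \<otimes>\<^bsub>k\<^esub> c"
      using that ab c(1) by (simp add: l_distr r_distr m_comm)
    moreover have "a \<oplus>\<^bsub>k\<^esub> b = (\<one>\<^bsub>k\<^esub> \<oplus>\<^bsub>k\<^esub> c) \<otimes>\<^bsub>k\<^esub> b" if "a = b \<otimes>\<^bsub>k\<^esub> c"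
      using that ab c(1) by (simp add: l_distr r_distr m_comm a_comm)
    ultimately have "a \<oplus>\<^bsub>k\<^esub> b = (\<one>\<^bsub>k\<^esub> \<oplus>\<^bsub>k\<^esub> c) \<otimes>\<^bsub>k\<^esub> a \<or> a \<oplus>\<^bsub>k\<^esub> b = (\<one>\<^bsub>k\<^esub> \<oplus>\<^bsub>k\<^esub> c) \<otimes>\<^bsub>k\<^esub> b"
      using c(2) by blast
    moreover have "\<one>\<^bsub>k\<^esub> \<oplus>\<^bsub>k\<^esub> c \<in> carrier k" using c(1) by simp
    ultimately show ?thesis using mult[OF ab(1)] mult[OF ab(2)] by metis
  qed
  show ?thesis
  proof (rule primeidealI)
    show "ideal ?M k"
    proof (rule ideal_commI)
      show "\<zero>\<^bsub>k\<^esub> \<in> ?M" using one_not_zero by (auto simp: Units_def)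
    qed (use add mult in auto)
    show "carrier k \<noteq> ?M" using Units_one_closed by blast
    show "a \<in> ?M \<or> b \<in> ?M" if "a \<in> carrier k" "b \<in> carrier k" "a \<otimes>\<^bsub>k\<^esub> b \<in> ?M" for a b
      using that Units_m_closed[of a b] by auto
  qed (rule is_cring)
qed

lemma fraction_field_cases:
  assumes "valuation_domain k" "is_fraction_field k (K, \<iota>)" "y \<in> carrier K"
  shows "\<exists>c \<in> carrier k. y = \<iota> c \<or> y \<otimes>\<^bsub>K\<^esub> \<iota> c = \<one>\<^bsub>K\<^esub>"
proof -
  interpret domain k using assms(1) by (simp add: valuation_domain_def)
  interpret K: field K using assms(2) by (simp add: is_fraction_field_def)
  have \<iota>: "\<iota> \<in> ring_hom k K" "inj_on \<iota> (carrier k)" using assms(2) by (auto simp: is_fraction_field_def algebras_def)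
  interpret \<iota>: ring_hom_cring k K \<iota> by (intro ring_hom_cringI is_cring K.is_cring \<iota>)
  have z: "\<iota> b = \<zero>\<^bsub>K\<^esub> \<longleftrightarrow> b = \<zero>\<^bsub>k\<^esub>" if "b \<in> carrier k" for b
    using inj_on_eq_iff[OF \<iota>(2) that zero_closed] by simp
  have "\<forall>y \<in> carrier K. \<exists>a \<in> carrier k. \<exists>b \<in> carrier k - {\<zero>\<^bsub>k\<^esub>}. y \<otimes>\<^bsub>K\<^esub> \<iota> b = \<iota> a"
    using assms(2) by (simp add: is_fraction_field_def)
  then obtain a b where ab: "a \<in> carrier k" "b \<in> carrier k" "b \<noteq> \<zero>\<^bsub>k\<^esub>" "y \<otimes>\<^bsub>K\<^esub> \<iota> b = \<iota> a"
    using assms(3) by blast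
  show ?thesis
  proof (cases "y = \<zero>\<^bsub>K\<^esub>")
    case True
    then show ?thesis by (intro bexI[of _ "\<zero>\<^bsub>k\<^esub>"]) auto
  next
    case y0: False
    have a0: "\<iota> a \<noteq> \<zero>\<^bsub>K\<^esub>" and b0: "\<iota> b \<noteq> \<zero>\<^bsub>K\<^esub>"
      using ab y0 assms(3) z[OF ab(2)] K.integral[of y "\<iota> b"] by auto
    have "b divides\<^bsub>k\<^esub> a \<or> a divides\<^bsub>k\<^esub> b" using assms(1) ab by (auto simp: valuation_domain_def)
    then show ?thesis
    proof
      assume "b divides\<^bsub>k\<^esub> a"
      then obtain c where c: "c \<in> carrier k" "a = b \<otimes>\<^bsub>k\<^esub> c" by (auto simp: factor_def)
      then have "\<iota> b \<otimes>\<^bsub>K\<^esub> y = \<iota> b \<otimes>\<^bsub>K\<^esub> \<iota> c" using ab assms(3) by (simp add: K.m_comm)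
      then have "y = \<iota> c" using K.m_lcancel[OF b0] ab(2) c(1) assms(3) by simp
      then show ?thesis using c(1) by blast
    next
      assume "a divides\<^bsub>k\<^esub> b"
      then obtain c where c: "c \<in> carrier k" "b = a \<otimes>\<^bsub>k\<^esub> c" by (auto simp: factor_def)
      have ia: "\<iota> a \<in> carrier K" and yc: "y \<otimes>\<^bsub>K\<^esub> \<iota> c \<in> carrier K" using ab(1) c(1) assms(3) by simp_all
      from c have "\<iota> a \<otimes>\<^bsub>K\<^esub> (y \<otimes>\<^bsub>K\<^esub> \<iota> c) = \<iota> a \<otimes>\<^bsub>K\<^esub> \<one>\<^bsub>K\<^esub>" using ab assms(3) by (simp add: K.m_ac)
      then have "y \<otimes>\<^bsub>K\<^esub> \<iota> c = \<one>\<^bsub>K\<^esub>" by (simp only: K.m_lcancel[OF a0 ia yc K.one_closed])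
      then show ?thesis using c(1) by blast
    qed
  qed
qed

lemma unit_fraction_mem:
  assumes "cring k" "cring K" "\<iota> \<in> ring_hom k K" "x \<in> Units k" "c \<in> carrier K" "c = \<iota> x \<or> c \<otimes>\<^bsub>K\<^esub> \<iota> x = \<one>\<^bsub>K\<^esub>"
  shows "c \<in> \<iota> ` Units k"
proof -
  interpret k: cring k by fact
  interpret K: cring K by fact
  note \<iota> = assms(3)
  from assms(6) show ?thesis
  proof
    assume "c = \<iota> x" then show ?thesis using assms(4) by simp
  next
    assume 1: "c \<otimes>\<^bsub>K\<^esub> \<iota> x = \<one>\<^bsub>K\<^esub>"
    have x: "x \<in> carrier k" "inv\<^bsub>k\<^esub> x \<in> carrier k" "inv\<^bsub>k\<^esub> x \<in> Units k"
      using k.Units_closed[OF assms(4)] assms(4) by simp_all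
    have "\<iota> x \<otimes>\<^bsub>K\<^esub> \<iota> (inv\<^bsub>k\<^esub> x) = \<one>\<^bsub>K\<^esub>"
      using ring_hom_mult[OF \<iota> x(1,2)] ring_hom_one[OF \<iota>] assms(4) by simp
    then have "c = c \<otimes>\<^bsub>K\<^esub> \<iota> x \<otimes>\<^bsub>K\<^esub> \<iota> (inv\<^bsub>k\<^esub> x)"
      using assms(5) ring_hom_closed[OF \<iota> x(1)] ring_hom_closed[OF \<iota> x(2)] by (simp add: K.m_assoc)
    also have "\<dots> = \<iota> (inv\<^bsub>k\<^esub> x)" using 1 ring_hom_closed[OF \<iota> x(2)] by simp
    finally show ?thesis using x(3) by simp
  qed
qed

text \<open>This is the kernel of the map from \<open>C\<close> to the ultraproduct of the quotients
  by \<open>V n\<close>, and an ultraproduct of domains is a domain.\<close>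

lemma ultrafilter_primeideal:
  assumes C: "cring C" and UU: "\<And>P. eventually P UU \<or> eventually (\<lambda>n. \<not> P n) UU" "UU \<noteq> bot"
    and V: "eventually (\<lambda>n. primeideal (V n) C) UU"
  shows "primeideal {b. eventually (\<lambda>n. b \<in> V n) UU} C"
proof -
  interpret C: cring C by fact
  have const: "Q" if "eventually (\<lambda>_. Q) UU" for Q using eventually_happens'[OF UU(2) that] by blast
  have car: "b \<in> carrier C" if "eventually (\<lambda>n. b \<in> V n) UU" for b
  proof (rule const)
    show "eventually (\<lambda>_. b \<in> carrier C) UU"
      using V that by eventually_elim (rule ideal.Icarr[OF primeideal.axioms(1)])
  qed
  show ?thesis
  proof (rule primeidealI)
    show "ideal {b. eventually (\<lambda>n. b \<in> V n) UU} C"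
    proof (rule C.ideal_commI)
      show "\<zero>\<^bsub>C\<^esub> \<in> {b. eventually (\<lambda>n. b \<in> V n) UU}"
        unfolding mem_Collect_eq using V
        by eventually_elim (blast intro: additive_subgroup.zero_closed ideal.axioms(1) primeideal.axioms(1))
      fix a assume "a \<in> {b. eventually (\<lambda>n. b \<in> V n) UU}"
      then have a: "eventually (\<lambda>n. a \<in> V n) UU" by simp
      show "a \<oplus>\<^bsub>C\<^esub> b \<in> {b. eventually (\<lambda>n. b \<in> V n) UU}" if b: "b \<in> {b. eventually (\<lambda>n. b \<in> V n) UU}" for b
        unfolding mem_Collect_eq using V a b[unfolded mem_Collect_eq]
        by eventually_elim (blast intro: additive_subgroup.a_closed ideal.axioms(1) primeideal.axioms(1))
      show "x \<otimes>\<^bsub>C\<^esub> a \<in> {b. eventually (\<lambda>n. b \<in> V n) UU}" if "x \<in> carrier C" for x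
        unfolding mem_Collect_eq using V a
        by eventually_elim (rule ideal.I_l_closed[OF primeideal.axioms(1) _ that])
    qed (use car in blast)
    have "\<not> eventually (\<lambda>n. \<one>\<^bsub>C\<^esub> \<in> V n) UU"
    proof
      assume "eventually (\<lambda>n. \<one>\<^bsub>C\<^esub> \<in> V n) UU"
      with V have "eventually (\<lambda>_. False) UU"
        by eventually_elim (metis ideal.one_imp_carrier primeideal.I_notcarr primeideal.axioms(1))
      then show False by (rule const)
    qed
    then show "carrier C \<noteq> {b. eventually (\<lambda>n. b \<in> V n) UU}" using C.one_closed by blast
    fix a b assume ab: "a \<in> carrier C" "b \<in> carrier C" "a \<otimes>\<^bsub>C\<^esub> b \<in> {b. eventually (\<lambda>n. b \<in> V n) UU}"
    have E: "eventually (\<lambda>n. a \<in> V n \<or> b \<in> V n) UU"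
      using V ab(3)[unfolded mem_Collect_eq] by eventually_elim (rule primeideal.I_prime[OF _ ab(1,2)])
    have "eventually (\<lambda>n. b \<in> V n) UU" if "eventually (\<lambda>n. a \<notin> V n) UU" using E that by eventually_elim blast
    then show "a \<in> {b. eventually (\<lambda>n. b \<in> V n) UU} \<or> b \<in> {b. eventually (\<lambda>n. b \<in> V n) UU}"
      using UU(1)[of "\<lambda>n. a \<in> V n"] by blast
  qed (rule C)
qed

lemma character_value_unit:
  fixes k K :: "'u ring" and G :: "('u, 'g) gfun"
  assumes inf: "infinite (UNIV :: 'u set)" and val: "valuation_domain k" and K: "is_fraction_field k (K, \<iota>)"
    and G: "group_functor k G" and fp: "finitely_presented k (underlying G)" and sm: "formally_smooth k (underlying G)"
    and \<chi>: "\<chi> \<in> group_functor_hom K (base_change k \<iota> G) Gm" and g: "g \<in> carrier (gobj G (base_alg k))"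
  shows "\<chi> (base_alg K) (garr G (base_alg k) (K, \<iota>) \<iota> g) \<in> \<iota> ` Units k"
proof -
  let ?F = "underlying G" and ?O = "base_alg k" and ?r = "restrict_scalars k \<iota>"
  have [simp]: "arr ?F = garr G" "obj ?F A = carrier (gobj G A)" for A by (simp_all add: underlying_def)
  have F: "kfunctor k ?F" using G by (simp add: group_functor_def)
  note Fc = kfunctorD(1)[OF F, simplified] and Fcomp = kfunctorD(3)[OF F, simplified]
  have gr: "\<And>A. A \<in> algebras k \<Longrightarrow> group (gobj G A)"
    and hom: "\<And>A B f. A \<in> algebras k \<Longrightarrow> B \<in> algebras k \<Longrightarrow> f \<in> alg_hom k A B \<Longrightarrow> group_hom (gobj G A) (gobj G B) (garr G A B f)"
    using G by (auto simp: group_functor_def group_hom_def group_hom_axioms_def)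
  interpret k: domain k using val by (simp add: valuation_domain_def)
  interpret K: field K using K by (simp add: is_fraction_field_def)
  have KA: "(K, \<iota>) \<in> algebras k" using K by (simp add: is_fraction_field_def)
  define M where "M = carrier k - Units k"
  have M: "primeideal M k" unfolding M_def by (rule valuation_domain_primeideal[OF val])
  have loc: "x \<in> Units k" if "x \<in> carrier k" "x \<notin> M" for x using that by (auto simp: M_def)
  have O: "?O \<in> algebras k" by (rule base_alg_in_algebras[OF k.is_cring])
  obtain \<W> where \<W>: "covers k \<W> (obj ?F)" "\<forall>U \<in> \<W>. open_subfunctor k ?F U \<and>
      (\<exists>B. represented_by k ?F U B \<and> finitely_presented_algebra k B)"
    using fp unfolding finitely_presented_def locally_finitely_presented_def by blast
  obtain \<V> where \<V>: "\<V> \<subseteq> \<W>" "finite \<V>" "covers k \<V> (obj ?F)"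
    using fp \<W> unfolding finitely_presented_def quasi_compact_def by blast
  have Vo: "open_subfunctor k ?F V" "\<exists>C. represented_by k ?F V C \<and> finitely_presented_algebra k C" if "V \<in> \<V>" for V
    using \<W>(2) \<V>(1) that by blast+
  interpret GO: group "gobj G ?O" by (rule gr[OF O])
  have fstO: "fst ?O = k" and sndO: "\<And>x. x \<in> carrier k \<Longrightarrow> snd ?O x = x" by (simp_all add: base_alg_def)
  \<comment> \<open>As \<open>k\<close> is local, the chart that contains the closed point of the
    unit section contains the entire section.\<close>
  have "\<exists>U \<in> \<V>. \<one>\<^bsub>gobj G ?O\<^esub> \<in> U ?O"
    by (rule local_point_covered[OF inf k.is_cring F \<V>(3) Vo(1) O, where P = M]) (use M loc in \<open>simp_all add: fstO\<close>)
  then obtain U where U: "U \<in> \<V>" "\<one>\<^bsub>gobj G ?O\<^esub> \<in> U ?O" by blast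
  note Uo = Vo(1)[OF U(1)]
  obtain B where Br: "represented_by k ?F U B" "finitely_presented_algebra k B" using Vo(2)[OF U(1)] by blast
  have B: "B \<in> algebras k" by (rule represented_byD(1)[OF Br(1)])
  interpret B: cring "fst B" by (rule algebrasD(1)[OF B])
  interpret s: ring_hom_cring k "fst B" "snd B" by (intro ring_hom_cringI k.is_cring B.is_cring algebrasD(2)[OF B])
  obtain u where u: "u \<in> U B" and un: "\<And>A y. A \<in> algebras k \<Longrightarrow> y \<in> U A \<Longrightarrow> \<exists>f \<in> alg_hom k B A. garr G B A f u = y"
    "\<And>A f g. A \<in> algebras k \<Longrightarrow> f \<in> alg_hom k B A \<Longrightarrow> g \<in> alg_hom k B A \<Longrightarrow> garr G B A f u = garr G B A g u \<Longrightarrow> f = g"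
    using represented_byD(2)[OF Br(1)] by auto
  have uB: "u \<in> carrier (gobj G B)" using open_subfunctorD(1)[OF Uo B u] by simp
  obtain \<epsilon> where \<epsilon>: "\<epsilon> \<in> alg_hom k B ?O" using un(1)[OF O U(2)] by blast
  have \<epsilon>h: "\<epsilon> \<in> ring_hom (fst B) k" "\<And>x. x \<in> carrier k \<Longrightarrow> \<epsilon> (snd B x) = x"
    using alg_homD(1)[OF \<epsilon>] alg_homD(2)[OF \<epsilon>] by (simp_all add: fstO sndO)
  interpret \<epsilon>: ring_hom_cring "fst B" k \<epsilon> by (intro ring_hom_cringI k.is_cring B.is_cring \<epsilon>h(1))
  obtain ys where ys: "set ys \<subseteq> carrier (fst B)"
    "\<And>S. subring S (fst B) \<Longrightarrow> snd B ` carrier k \<subseteq> S \<Longrightarrow> set ys \<subseteq> S \<Longrightarrow> carrier (fst B) \<subseteq> S"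
    using fp_generators[OF k.is_cring Br(2) B] by blast
  define z where "z i = ys ! i \<ominus>\<^bsub>fst B\<^esub> snd B (\<epsilon> (ys ! i))" for i
  have yB: "ys ! i \<in> carrier (fst B)" if "i < length ys" for i using ys(1) that by auto
  have ch: "chart k M B \<epsilon> (length ys) z"
  proof (rule chart.intro)
    show "\<epsilon> (z i) = \<zero>\<^bsub>k\<^esub>" if "i < length ys" for i
      using yB[OF that] \<epsilon>h(2) by (simp add: z_def B.minus_eq k.r_neg)
    show "z i \<in> carrier (fst B)" if "i < length ys" for i using yB[OF that] by (simp add: z_def)
    show "lifting_property k B" by (rule lifting_property_chart[OF F sm Uo Br(1)])
    show "carrier (fst B) \<subseteq> S" if S: "subring S (fst B)" "snd B ` carrier k \<subseteq> S" "z ` {..<length ys} \<subseteq> S" for S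
    proof (rule ys(2)[OF S(1,2)])
      show "set ys \<subseteq> S"
      proof
        fix y assume "y \<in> set ys"
        then obtain i where i: "i < length ys" "y = ys ! i" by (auto simp: in_set_conv_nth)
        have "y = z i \<oplus>\<^bsub>fst B\<^esub> snd B (\<epsilon> (ys ! i))"
          using yB[OF i(1)] by (simp add: i(2) z_def B.minus_eq B.a_assoc B.l_neg)
        moreover have "z i \<in> S" "snd B (\<epsilon> (ys ! i)) \<in> S" using S(2,3) i(1) yB[OF i(1)] by auto
        ultimately show "y \<in> S" using subringE(7)[OF S(1)] by simp
      qed
    qed
  qed (use inf M loc B \<epsilon>h k.domain_axioms in auto)
  obtain L :: "'u ring" and S \<pi>0 where L: "valuation_subring L S" and \<pi>0: "\<pi>0 \<in> ring_hom (fst B) L" "\<pi>0 ` carrier (fst B) \<subseteq> S"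
    and \<pi>M': "\<forall>x \<in> M. \<pi>0 (snd B x) \<in> nonunits L S"
    and \<pi>k': "\<forall>x \<in> carrier k. \<pi>0 (snd B x) = \<zero>\<^bsub>L\<^esub> \<longrightarrow> x = \<zero>\<^bsub>k\<^esub>"
    and dep: "\<forall>Q f. primeideal Q (fst B) \<longrightarrow> (\<forall>b \<in> carrier (fst B). \<pi>0 b \<notin> nonunits L S \<longrightarrow> b \<notin> Q) \<longrightarrow> f \<in> carrier (fst B) \<longrightarrow>
      (\<exists>n c v. (\<forall>j \<le> n. c j \<in> carrier k \<and> v j \<in> carrier (fst B) \<and> \<pi>0 (v j) \<notin> nonunits L S) \<and> (\<exists>j \<le> n. c j \<noteq> \<zero>\<^bsub>k\<^esub>) \<and>
        (\<Oplus>\<^bsub>fst B\<^esub>j \<in> {..n::nat}. snd B (c j) \<otimes>\<^bsub>fst B\<^esub> v j \<otimes>\<^bsub>fst B\<^esub> f [^]\<^bsub>fst B\<^esub> j) \<in> Q)"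
    using chart.ex_generic_valuation_point[OF ch val] by (elim exE conjE) (rule that)
  have \<pi>M: "\<pi>0 (snd B x) \<in> nonunits L S" if "x \<in> M" for x using \<pi>M' that by blast
  have \<pi>k: "x = \<zero>\<^bsub>k\<^esub>" if "x \<in> carrier k" "\<pi>0 (snd B x) = \<zero>\<^bsub>L\<^esub>" for x using \<pi>k' that by blast
  interpret L: valuation_subring L S by fact
  interpret \<pi>0: ring_hom_cring "fst B" L \<pi>0 by (intro ring_hom_cringI L.is_cring B.is_cring \<pi>0(1))
  \<comment> \<open>Two test algebras with the same structure map: recurrence takes place over the
    valuation ring, where units make sense, while the character can be evaluated only over the
    field.\<close>
  let ?E = "L\<lparr>carrier := S\<rparr>" and ?P = "nonunits L S" and ?\<sigma> = "restrict (\<pi>0 \<circ> snd B) (carrier k)"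
  let ?A = "(?E, ?\<sigma>)" and ?LA = "(L, ?\<sigma>)"
  have \<pi>E: "\<pi>0 \<in> ring_hom (fst B) ?E" using \<pi>0 by (auto simp: ring_hom_def)
  have A: "?A \<in> algebras k"
    by (rule algebras_restrictI[OF L.cring_subring ring_hom_trans[OF algebrasD(2)[OF B] \<pi>E] k.is_cring])
  have LA: "?LA \<in> algebras k"
    by (rule algebras_restrictI[OF L.is_cring ring_hom_trans[OF algebrasD(2)[OF B] \<pi>0(1)] k.is_cring])
  let ?\<pi> = "restrict \<pi>0 (carrier (fst B))" and ?i = "\<lambda>a \<in> S. a"
  have \<pi>: "?\<pi> \<in> alg_hom k B ?A" by (rule alg_hom_restrictI[OF B]) (use \<pi>E in simp_all)
  have i: "?i \<in> alg_hom k ?A ?LA"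
    using alg_hom_restrictI[OF A, of "\<lambda>a. a" ?LA] by (simp add: ring_hom_def)
  obtain UU :: "nat filter" where UU: "UU \<noteq> bot" "UU \<le> sequentially"
    "\<And>P. eventually P UU \<or> eventually (\<lambda>n. \<not> P n) UU" using ex_ultrafilter by blast
  have P: "primeideal ?P (fst ?A)" using L.primeideal_nonunits by simp
  have AP: "a \<in> Units (fst ?A)" if "a \<in> carrier (fst ?A)" "a \<notin> ?P" for a using that L.Units_subring by simp
  have \<sigma>M: "snd ?A x \<in> ?P" if "x \<in> carrier k" "x \<in> M" for x using that \<pi>M by simp
  let ?x = "garr G B ?A ?\<pi> u" and ?g = "garr G ?O ?A (snd ?A) g"
  have "\<exists>m \<zeta>. \<forall>b \<in> carrier (fst B). ?\<pi> b \<notin> ?P \<longrightarrow> eventually (\<lambda>n. m \<le> n \<and> \<zeta> n \<in> alg_hom k B ?A \<and>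
      garr G B ?A (\<zeta> n) u = ?x \<otimes>\<^bsub>gobj G ?A\<^esub> ?g [^]\<^bsub>gobj G ?A\<^esub> (n - m) \<and> \<zeta> n b \<notin> ?P) UU"
    by (rule ex_recurrent_points[OF inf k.is_cring loc G \<V>(2,3) Vo Uo B u un A P AP \<sigma>M \<pi> g UU(3,1,2)])
  then obtain m \<zeta> where \<zeta>: "\<forall>b \<in> carrier (fst B). ?\<pi> b \<notin> ?P \<longrightarrow> eventually (\<lambda>n. m \<le> n \<and> \<zeta> n \<in> alg_hom k B ?A \<and>
      garr G B ?A (\<zeta> n) u = ?x \<otimes>\<^bsub>gobj G ?A\<^esub> ?g [^]\<^bsub>gobj G ?A\<^esub> (n - m) \<and> \<zeta> n b \<notin> ?P) UU"
    by (elim exE) (rule that)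
  define good where "good n \<longleftrightarrow> m \<le> n \<and> \<zeta> n \<in> alg_hom k B ?A \<and>
      garr G B ?A (\<zeta> n) u = ?x \<otimes>\<^bsub>gobj G ?A\<^esub> ?g [^]\<^bsub>gobj G ?A\<^esub> (n - m)" for n
  have ev: "eventually (\<lambda>n. good n \<and> \<zeta> n b \<notin> ?P) UU" if "b \<in> carrier (fst B)" "\<pi>0 b \<notin> ?P" for b
    using bspec[OF \<zeta>, of b] that by (simp add: good_def conj_assoc)
  have "\<pi>0 \<one>\<^bsub>fst B\<^esub> \<notin> ?P" using L.one_not_nonunit by simp
  from ev[OF B.one_closed this] have evg: "eventually good UU" by eventually_elim blast
  have \<zeta>hom: "ring_hom_cring (fst B) L (\<zeta> n)" "\<zeta> n \<in> alg_hom k B ?LA" "\<And>b. b \<in> carrier (fst B) \<Longrightarrow> \<zeta> n b \<in> S" if "good n" for n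
  proof -
    have z: "\<zeta> n \<in> alg_hom k B ?A" using that by (simp add: good_def)
    show z1: "\<And>b. b \<in> carrier (fst B) \<Longrightarrow> \<zeta> n b \<in> S" using alg_homD(3)[OF z] by simp
    have zr: "\<zeta> n \<in> ring_hom (fst B) L" using alg_homD(1)[OF z] by (auto simp: ring_hom_def Pi_iff)
    show "ring_hom_cring (fst B) L (\<zeta> n)" by (intro ring_hom_cringI L.is_cring B.is_cring zr)
    show "\<zeta> n \<in> alg_hom k B ?LA" using z zr by (auto simp: alg_hom_def)
  qed
  \<comment> \<open>\<open>V n\<close> collects the functions vanishing at the n-th recurrent point,
    and \<open>Q\<close> those vanishing at most of them. A function invertible at x is invertible
    at most recurrent points and so is not in \<open>Q\<close>, as the relation requires. The
    exponents n with a given relation may then vary, but its coefficients do not.\<close>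
  define V where "V n = {b \<in> carrier (fst B). \<zeta> n b \<in> {\<zero>\<^bsub>L\<^esub>}}" for n
  define Q where "Q = {b. eventually (\<lambda>n. b \<in> V n) UU}"
  have "eventually (\<lambda>n. primeideal (V n) (fst B)) UU"
    using evg
  proof eventually_elim
    case (elim n)
    interpret z: ring_hom_cring "fst B" L "\<zeta> n" by (rule \<zeta>hom(1)[OF elim])
    show ?case unfolding V_def
      by (rule ring_hom_ring.primeideal_vimage[OF ring_hom_ringI2[OF B.ring_axioms L.ring_axioms z.homh] B.is_cring L.zeroprimeideal])
  qed
  then have Q: "primeideal Q (fst B)" unfolding Q_def by (rule ultrafilter_primeideal[OF B.is_cring UU(3,1)])
  have hQ: "b \<notin> Q" if "b \<in> carrier (fst B)" "\<pi>0 b \<notin> ?P" for b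
  proof
    assume "b \<in> Q"
    then have "eventually (\<lambda>n. b \<in> V n) UU" by (simp add: Q_def)
    with ev[OF that] have "eventually (\<lambda>n. False) UU" by eventually_elim (use L.zero_nonunit in \<open>auto simp: V_def\<close>)
    then show False using UU(1) by simp
  qed
  obtain F0 d0 where F0: "F0 \<in> carrier (fst B)" "d0 \<in> carrier k" "d0 \<noteq> \<zero>\<^bsub>k\<^esub>"
    "\<And>A f. A \<in> algebras K \<Longrightarrow> f \<in> alg_hom k B (?r A) \<Longrightarrow> \<chi> A (garr G B (?r A) f u) \<otimes>\<^bsub>fst A\<^esub> f (snd B d0) = f F0"
    using character_formula[OF inf k.domain_axioms K G \<chi> B uB] by blast
  note Kloc = fraction_field_localization[OF k.domain_axioms K]
  \<comment> \<open>Nonzero constants stay nonzero in \<open>L\<close>, so \<open>L\<close> is an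
    algebra over \<open>K\<close> and its points are points of the generic fibre.\<close>
  have "(\<pi>0 \<circ> snd B) ` (carrier k - {\<zero>\<^bsub>k\<^esub>}) \<subseteq> Units L" using \<pi>k by (auto simp: L.field_Units)
  from localization_lift[OF Kloc L.is_cring ring_hom_trans[OF algebrasD(2)[OF B] \<pi>0(1)] this]
  obtain \<tau> where \<tau>: "\<tau> \<in> ring_hom K L" "\<And>x. x \<in> carrier k \<Longrightarrow> \<tau> (\<iota> x) = \<pi>0 (snd B x)" by auto
  interpret \<tau>: ring_hom_cring K L \<tau> by (intro ring_hom_cringI L.is_cring K.is_cring \<tau>(1))
  let ?LK = "(L, restrict \<tau> (carrier K))"
  have LK: "?LK \<in> algebras K" by (rule algebras_restrictI[OF L.is_cring \<tau>(1) K.is_cring])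
  have \<iota>c: "\<iota> x \<in> carrier K" if "x \<in> carrier k" for x using algebrasD(3)[OF KA that] by simp
  have rLK: "?r ?LK = ?LA" using \<tau>(2) \<iota>c by (auto simp: restrict_scalars_def compose_def fun_eq_iff)
  let ?BK = "base_alg K" and ?gK = "garr G ?O (K, \<iota>) \<iota> g"
  have BK: "?BK \<in> algebras K" by (rule base_alg_in_algebras[OF K.is_cring])
  have rBK: "?r ?BK = (K, \<iota>)" by (rule restrict_scalars_base_alg[OF KA])
  have \<iota>h: "\<iota> \<in> alg_hom k ?O (K, \<iota>)" using structure_alg_hom[OF KA] by simp
  have gK: "?gK \<in> carrier (gobj G (K, \<iota>))" by (rule Fc[OF O KA \<iota>h g])
  define c0 where "c0 = \<chi> ?BK ?gK"
  have gK': "?gK \<in> carrier (gobj (base_change k \<iota> G) ?BK)" using gK by (simp add: base_change_def rBK)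
  have fstK: "fst ?BK = K" by (simp add: base_alg_def)
  have c0: "c0 \<in> Units K"
    using group_functor_homD[OF \<chi> BK gK'] by (simp add: c0_def fstK)
  have c0K: "c0 \<in> carrier K" "c0 \<noteq> \<zero>\<^bsub>K\<^esub>" using c0 K.field_Units by auto
  let ?gL = "garr G ?O ?LA (snd ?LA) g" and ?xL = "garr G ?A ?LA ?i ?x"
  have xA: "?x \<in> carrier (gobj G ?A)" by (rule Fc[OF B A \<pi> uB])
  have gA: "?g \<in> carrier (gobj G ?A)" by (rule Fc[OF O A structure_alg_hom[OF A] g])
  have xL: "?xL \<in> carrier (gobj G ?LA)" by (rule Fc[OF A LA i xA])
  have gL: "?gL \<in> carrier (gobj G ?LA)" by (rule Fc[OF O LA structure_alg_hom[OF LA] g])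
  have \<tau>h: "restrict \<tau> (carrier K) \<in> alg_hom K ?BK ?LK" using structure_alg_hom[OF LK] by simp
  have "garr G (K, \<iota>) ?LA (restrict \<tau> (carrier K)) ?gK = garr G ?O ?LA (compose (carrier k) (restrict \<tau> (carrier K)) \<iota>) g"
    using Fcomp[OF O KA LA \<iota>h _ g] restrict_scalars_alg_hom[OF KA \<tau>h] by (simp add: rBK rLK fstO)
  also have "compose (carrier k) (restrict \<tau> (carrier K)) \<iota> = snd ?LA"
    using \<tau>(2) \<iota>c by (auto simp: compose_def fun_eq_iff)
  finally have gKL: "garr G (K, \<iota>) ?LA (restrict \<tau> (carrier K)) ?gK = ?gL" .
  have "\<chi> ?LK (garr (base_change k \<iota> G) ?BK ?LK (restrict \<tau> (carrier K)) ?gK) = garr Gm ?BK ?LK (restrict \<tau> (carrier K)) (\<chi> ?BK ?gK)"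
    using \<chi> BK LK \<tau>h gK' unfolding group_functor_hom_def by blast
  then have \<chi>g: "\<chi> ?LK ?gL = \<tau> c0" using gKL c0K by (simp add: base_change_def rBK rLK Gm_def c0_def)
  have \<chi>hom: "\<chi> ?LK \<in> hom (gobj G ?LA) (units_of L)"
  proof -
    have "\<chi> ?LK \<in> hom (gobj (base_change k \<iota> G) ?LK) (gobj Gm ?LK)" using \<chi> LK unfolding group_functor_hom_def by blast
    then show ?thesis by (simp add: Gm_def base_change_def rLK)
  qed
  define \<mu> where "\<mu> = \<tau> c0"
  have \<mu>: "\<mu> \<in> carrier L" "\<mu> \<noteq> \<zero>\<^bsub>L\<^esub>" using c0 ring_hom_Units[OF \<tau>(1) c0] L.field_Units by (auto simp: \<mu>_def)
  \<comment> \<open>The value of the character at x times the denominator. The denominator is a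
    constant of \<open>k\<close>, so it is the same at all recurrent points.\<close>
  define a where "a = \<chi> ?LK ?xL \<otimes>\<^bsub>L\<^esub> \<pi>0 (snd B d0)"
  have \<chi>xL: "\<chi> ?LK ?xL \<in> carrier L" "\<chi> ?LK ?xL \<noteq> \<zero>\<^bsub>L\<^esub>"
    using hom_in_carrier[OF \<chi>hom xL] L.field_Units by (auto simp: units_of_def)
  have \<sigma>c: "\<pi>0 (snd B x) \<in> carrier L" if "x \<in> carrier k" for x using that by simp
  have a: "a \<in> carrier L" "a \<noteq> \<zero>\<^bsub>L\<^esub>" using \<chi>xL \<sigma>c[OF F0(2)] \<pi>k[OF F0(2)] F0(3) by (auto simp: a_def L.integral_iff)
  have \<zeta>F: "\<zeta> n F0 = a \<otimes>\<^bsub>L\<^esub> \<mu> [^]\<^bsub>L\<^esub> (n - m)" and \<zeta>k: "\<And>x. x \<in> carrier k \<Longrightarrow> \<zeta> n (snd B x) = \<pi>0 (snd B x)" if n: "good n" for n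
  proof -
    have z: "\<zeta> n \<in> alg_hom k B ?A" "garr G B ?A (\<zeta> n) u = ?x \<otimes>\<^bsub>gobj G ?A\<^esub> ?g [^]\<^bsub>gobj G ?A\<^esub> (n - m)"
      using n by (simp_all add: good_def)
    show \<zeta>k: "\<And>x. x \<in> carrier k \<Longrightarrow> \<zeta> n (snd B x) = \<pi>0 (snd B x)" using alg_homD(2)[OF z(1)] by simp
    interpret h: group_hom "gobj G ?A" "gobj G ?LA" "garr G ?A ?LA ?i" by (rule hom[OF A LA i])
    have "compose (carrier (fst B)) ?i (\<zeta> n) = \<zeta> n"
      using \<zeta>hom(3)[OF n] z(1) by (auto simp: compose_def fun_eq_iff alg_hom_def extensional_def)
    then have "garr G B ?LA (\<zeta> n) u = garr G ?A ?LA ?i (garr G B ?A (\<zeta> n) u)"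
      using Fcomp[OF B A LA z(1) i uB] by simp
    also have "\<dots> = ?xL \<otimes>\<^bsub>gobj G ?LA\<^esub> (garr G ?A ?LA ?i ?g) [^]\<^bsub>gobj G ?LA\<^esub> (n - m)"
      unfolding z(2) using xA gA by (simp add: h.hom_nat_pow)
    also have "garr G ?A ?LA ?i ?g = ?gL"
      using Fcomp[OF O A LA structure_alg_hom[OF A] i g] compose_structure[OF A LA i] by (simp add: fstO)
    finally have y: "garr G B ?LA (\<zeta> n) u = ?xL \<otimes>\<^bsub>gobj G ?LA\<^esub> ?gL [^]\<^bsub>gobj G ?LA\<^esub> (n - m)" .
    interpret GL: group "gobj G ?LA" by (rule gr[OF LA])
    interpret c: group_hom "gobj G ?LA" "units_of L" "\<chi> ?LK"
      by (intro group_hom.intro group_hom_axioms.intro gr[OF LA] \<chi>hom L.units_group)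
    have pow: "x [^]\<^bsub>units_of L\<^esub> (r :: nat) = x [^]\<^bsub>L\<^esub> r" for x r by (induction r) (simp_all add: units_of_def nat_pow_def)
    have "\<chi> ?LK (garr G B ?LA (\<zeta> n) u) = \<chi> ?LK ?xL \<otimes>\<^bsub>units_of L\<^esub> \<chi> ?LK ?gL [^]\<^bsub>units_of L\<^esub> (n - m)"
      unfolding y using xL gL by (simp add: c.hom_nat_pow)
    also have "\<dots> = \<chi> ?LK ?xL \<otimes>\<^bsub>L\<^esub> \<mu> [^]\<^bsub>L\<^esub> (n - m)" unfolding pow \<chi>g \<mu>_def by (simp add: units_of_def)
    finally have "\<chi> ?LK (garr G B ?LA (\<zeta> n) u) = \<chi> ?LK ?xL \<otimes>\<^bsub>L\<^esub> \<mu> [^]\<^bsub>L\<^esub> (n - m)" .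
    moreover have "\<chi> ?LK (garr G B ?LA (\<zeta> n) u) \<otimes>\<^bsub>L\<^esub> \<zeta> n (snd B d0) = \<zeta> n F0"
      using F0(4)[OF LK, of "\<zeta> n"] \<zeta>hom(2)[OF n] by (simp add: rLK)
    ultimately show "\<zeta> n F0 = a \<otimes>\<^bsub>L\<^esub> \<mu> [^]\<^bsub>L\<^esub> (n - m)"
      using \<zeta>k[OF F0(2)] \<chi>xL \<mu> \<sigma>c[OF F0(2)] by (simp add: a_def L.m_ac)
  qed
  have hQ': "\<forall>b \<in> carrier (fst B). \<pi>0 b \<notin> ?P \<longrightarrow> b \<notin> Q" using hQ by blast
  obtain N :: nat and c v where cv': "\<forall>j \<le> N. c j \<in> carrier k \<and> v j \<in> carrier (fst B) \<and> \<pi>0 (v j) \<notin> ?P"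
    "\<exists>j \<le> N. c j \<noteq> \<zero>\<^bsub>k\<^esub>"
    "(\<Oplus>\<^bsub>fst B\<^esub>j \<in> {..N}. snd B (c j) \<otimes>\<^bsub>fst B\<^esub> v j \<otimes>\<^bsub>fst B\<^esub> F0 [^]\<^bsub>fst B\<^esub> j) \<in> Q"
    using dep[THEN spec, THEN spec, THEN mp, THEN mp, THEN mp, OF Q hQ' F0(1)] by (elim exE conjE) (rule that, assumption, intro exI conjI)
  have cv: "c j \<in> carrier k" "v j \<in> carrier (fst B)" "\<pi>0 (v j) \<notin> ?P" if "j \<le> N" for j using cv'(1) that by blast+
  let ?e = "\<lambda>j. \<pi>0 (snd B (c j))"
  have "eventually (\<lambda>n. \<forall>j \<in> {..N}. good n \<and> \<zeta> n (v j) \<notin> ?P) UU"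
    using ev cv(2,3) by (intro eventually_ball_finite) auto
  moreover have "eventually (\<lambda>n. (\<Oplus>\<^bsub>fst B\<^esub>j \<in> {..N}. snd B (c j) \<otimes>\<^bsub>fst B\<^esub> v j \<otimes>\<^bsub>fst B\<^esub> F0 [^]\<^bsub>fst B\<^esub> j) \<in> V n) UU"
    using cv'(3) by (simp add: Q_def)
  ultimately have evs: "eventually (\<lambda>n. m \<le> n \<and> (\<exists>s. (\<forall>j \<le> N. s j \<in> S - ?P) \<and>
      (\<Oplus>\<^bsub>L\<^esub>j \<in> {..N}. (?e j \<otimes>\<^bsub>L\<^esub> s j) \<otimes>\<^bsub>L\<^esub> (a \<otimes>\<^bsub>L\<^esub> \<mu> [^]\<^bsub>L\<^esub> (n - m)) [^]\<^bsub>L\<^esub> j) = \<zero>\<^bsub>L\<^esub>)) UU"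
  proof eventually_elim
    case (elim n)
    then have n: "good n" by blast
    interpret z: ring_hom_cring "fst B" L "\<zeta> n" by (rule \<zeta>hom(1)[OF n])
    have "\<zero>\<^bsub>L\<^esub> = (\<Oplus>\<^bsub>L\<^esub>j \<in> {..N}. \<zeta> n (snd B (c j) \<otimes>\<^bsub>fst B\<^esub> v j \<otimes>\<^bsub>fst B\<^esub> F0 [^]\<^bsub>fst B\<^esub> j))"
    proof -
      have "\<zeta> n (\<Oplus>\<^bsub>fst B\<^esub>j \<in> {..N}. snd B (c j) \<otimes>\<^bsub>fst B\<^esub> v j \<otimes>\<^bsub>fst B\<^esub> F0 [^]\<^bsub>fst B\<^esub> j) =
          (\<Oplus>\<^bsub>L\<^esub>j \<in> {..N}. \<zeta> n (snd B (c j) \<otimes>\<^bsub>fst B\<^esub> v j \<otimes>\<^bsub>fst B\<^esub> F0 [^]\<^bsub>fst B\<^esub> j))"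
        using cv(1,2) F0(1) by (intro ring_hom_finsum[OF B.is_cring L.is_cring z.homh]) auto
      then show ?thesis using elim by (simp add: V_def)
    qed
    also have "\<dots> = (\<Oplus>\<^bsub>L\<^esub>j \<in> {..N}. (?e j \<otimes>\<^bsub>L\<^esub> \<zeta> n (v j)) \<otimes>\<^bsub>L\<^esub> (a \<otimes>\<^bsub>L\<^esub> \<mu> [^]\<^bsub>L\<^esub> (n - m)) [^]\<^bsub>L\<^esub> j)"
    proof (rule L.finsum_cong')
      show "(\<lambda>j. (?e j \<otimes>\<^bsub>L\<^esub> \<zeta> n (v j)) \<otimes>\<^bsub>L\<^esub> (a \<otimes>\<^bsub>L\<^esub> \<mu> [^]\<^bsub>L\<^esub> (n - m)) [^]\<^bsub>L\<^esub> j) \<in> {..N} \<rightarrow> carrier L"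
        using cv(1,2) a \<mu> by auto
      show "\<zeta> n (snd B (c j) \<otimes>\<^bsub>fst B\<^esub> v j \<otimes>\<^bsub>fst B\<^esub> F0 [^]\<^bsub>fst B\<^esub> j) = (?e j \<otimes>\<^bsub>L\<^esub> \<zeta> n (v j)) \<otimes>\<^bsub>L\<^esub> (a \<otimes>\<^bsub>L\<^esub> \<mu> [^]\<^bsub>L\<^esub> (n - m)) [^]\<^bsub>L\<^esub> j"
        if "j \<in> {..N}" for j
        using cv(1,2)[of j] that F0(1) \<zeta>F[OF n] \<zeta>k[OF n] by simp
    qed simp
    finally have "(\<Oplus>\<^bsub>L\<^esub>j \<in> {..N}. (?e j \<otimes>\<^bsub>L\<^esub> \<zeta> n (v j)) \<otimes>\<^bsub>L\<^esub> (a \<otimes>\<^bsub>L\<^esub> \<mu> [^]\<^bsub>L\<^esub> (n - m)) [^]\<^bsub>L\<^esub> j) = \<zero>\<^bsub>L\<^esub>" ..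
    moreover have "\<forall>j \<le> N. \<zeta> n (v j) \<in> S - ?P" using elim \<zeta>hom(3)[OF n] cv(2) by auto
    moreover have "m \<le> n" using n by (simp add: good_def)
    ultimately show ?case by (intro conjI exI[of _ "\<lambda>j. \<zeta> n (v j)"])
  qed
  have e: "?e j \<in> carrier L" if "j \<le> N" for j using cv(1)[OF that] by simp
  have "\<exists>j \<le> N. ?e j \<noteq> \<zero>\<^bsub>L\<^esub>" using cv(1) cv'(2) \<pi>k by blast
  from L.recurrent_unit_power[OF UU(3,1,2) \<mu> a e this evs]
  obtain r :: nat where r: "r > 0" "\<mu> [^]\<^bsub>L\<^esub> r \<in> S - ?P" by blast
  obtain x where x: "x \<in> carrier k" "c0 = \<iota> x \<or> c0 \<otimes>\<^bsub>K\<^esub> \<iota> x = \<one>\<^bsub>K\<^esub>"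
    using fraction_field_cases[OF val K c0K(1)] by blast
  \<comment> \<open>Either \<open>c0\<close> or its inverse comes from an element x of
    \<open>k\<close>. If x were in \<open>M\<close>, its image would be a nonunit together with all
    its positive powers, while some positive power of \<open>\<mu>\<close> is a unit.\<close>
  have "x \<in> Units k"
  proof (rule ccontr)
    assume "x \<notin> Units k"
    then have xP: "\<pi>0 (snd B x) \<in> ?P" using \<pi>M x(1) by (simp add: M_def)
    have xP': "\<pi>0 (snd B x) [^]\<^bsub>L\<^esub> r \<in> ?P" by (rule L.nonunits_pow[OF xP r(1)])
    from x(2) show False
    proof
      assume "c0 = \<iota> x"
      then have "\<mu> = \<pi>0 (snd B x)" using \<tau>(2)[OF x(1)] by (simp add: \<mu>_def)
      then show False using xP' r(2) by simp
    next
      assume "c0 \<otimes>\<^bsub>K\<^esub> \<iota> x = \<one>\<^bsub>K\<^esub>"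
      then have "\<mu> \<otimes>\<^bsub>L\<^esub> \<pi>0 (snd B x) = \<one>\<^bsub>L\<^esub>"
        using \<tau>.hom_mult[OF c0K(1) \<iota>c[OF x(1)]] \<tau>(2)[OF x(1)] by (simp add: \<mu>_def)
      then have "(\<pi>0 (snd B x) \<otimes>\<^bsub>L\<^esub> \<mu>) [^]\<^bsub>L\<^esub> r = \<one>\<^bsub>L\<^esub>" using \<mu> \<sigma>c[OF x(1)] by (simp add: L.m_comm)
      then have "\<pi>0 (snd B x) [^]\<^bsub>L\<^esub> r \<otimes>\<^bsub>L\<^esub> \<mu> [^]\<^bsub>L\<^esub> r = \<one>\<^bsub>L\<^esub>"
        using \<mu> \<sigma>c[OF x(1)] by (simp add: L.nat_pow_distrib)
      then show False using L.nonunits_mult[OF xP', of "\<mu> [^]\<^bsub>L\<^esub> r"] r(2) L.one_not_nonunit by simp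
    qed
  qed
  then show ?thesis
    using unit_fraction_mem[of k K \<iota> x c0] k.is_cring K.is_cring c0K(1) x(2) algebrasD(2)[OF KA] by (simp add: c0_def)
qed

text \<open>Covers the case of a finite type \<open>'u\<close>, on which polynomial rings have no
  room: multiplication by a nonzero element is injective, hence onto.\<close>

lemma (in domain) Units_if_finite:
  assumes "finite (carrier R)" "a \<in> carrier R" "a \<noteq> \<zero>" shows "a \<in> Units R"
proof -
  have "inj_on ((\<otimes>) a) (carrier R)" using assms(2,3) m_lcancel by (auto intro: inj_onI)
  moreover have "(\<otimes>) a ` carrier R \<subseteq> carrier R" using assms(2) by auto
  ultimately have "(\<otimes>) a ` carrier R = carrier R" using endo_inj_surj[OF assms(1)] by blast
  then have "\<one> \<in> (\<otimes>) a ` carrier R" by simp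
  then obtain b where "\<one> = a \<otimes> b" "b \<in> carrier R" by (rule imageE)
  then show ?thesis using assms(2) m_comm[of a b] by (auto simp: Units_def)
qed

theorem mainTheorem3:
  fixes \<O> K :: "'u ring" and \<iota> :: "'u \<Rightarrow> 'u" and G :: "('u, 'g) gfun"
  assumes "valuation_domain \<O>"
    and "is_fraction_field \<O> (K, \<iota>)"
    and "group_scheme \<O> G"
    and "finitely_presented \<O> (underlying G)"
    and "smooth \<O> (underlying G)"
  shows "garr G (base_alg \<O>) (K, \<iota>) \<iota> ` carrier (gobj G (base_alg \<O>))
    \<subseteq> kernel (gobj G (K, \<iota>))
        (hom_group (char_group K (base_change \<O> \<iota> G)) (value_group \<O> K \<iota>))
        (nu \<O> K \<iota> G)"
proof
  fix h assume "h \<in> garr G (base_alg \<O>) (K, \<iota>) \<iota> ` carrier (gobj G (base_alg \<O>))"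
  then obtain g where g: "g \<in> carrier (gobj G (base_alg \<O>))" and h: "h = garr G (base_alg \<O>) (K, \<iota>) \<iota> g" by blast
  interpret O: domain \<O> using assms(1) by (simp add: valuation_domain_def)
  interpret K: field K using assms(2) by (simp add: is_fraction_field_def)
  have G: "group_functor \<O> G" using assms(3) by (simp add: group_scheme_def)
  have KA: "(K, \<iota>) \<in> algebras \<O>" using assms(2) by (simp add: is_fraction_field_def)
  have \<iota>: "\<iota> \<in> ring_hom \<O> K" using algebrasD(2)[OF KA] by simp
  have O: "base_alg \<O> \<in> algebras \<O>" and BK: "base_alg K \<in> algebras K"
    by (rule base_alg_in_algebras, rule O.is_cring K.is_cring)+
  have F: "kfunctor \<O> (underlying G)" using G by (simp add: group_functor_def)
  have "\<iota> \<in> alg_hom \<O> (base_alg \<O>) (K, \<iota>)" using structure_alg_hom[OF KA] by simp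
  then have hK: "h \<in> carrier (gobj G (K, \<iota>))"
    using kfunctorD(1)[OF F O KA] g by (simp add: underlying_def h)
  have unit: "\<chi> (base_alg K) h \<in> \<iota> ` Units \<O>" if \<chi>: "\<chi> \<in> group_functor_hom K (base_change \<O> \<iota> G) Gm" for \<chi>
  proof (cases "finite (UNIV :: 'u set)")
    case False
    then show ?thesis
      unfolding h using character_value_unit[OF _ assms(1,2) G assms(4) _ \<chi> g] assms(5) by (simp add: smooth_def)
  next
    \<comment> \<open>Here \<open>\<O>\<close> is a finite domain and so a field. The value of the
      character or its inverse comes from a nonzero element of \<open>\<O>\<close>, which is then a
      unit.\<close>
    case True
    have "h \<in> carrier (gobj (base_change \<O> \<iota> G) (base_alg K))"
      using hK restrict_scalars_base_alg[OF KA] by (simp add: base_change_def)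
    from group_functor_homD[OF \<chi> BK this] have c: "\<chi> (base_alg K) h \<in> Units K" by (simp add: base_alg_def)
    then have cK: "\<chi> (base_alg K) h \<in> carrier K" "\<chi> (base_alg K) h \<noteq> \<zero>\<^bsub>K\<^esub>" using K.field_Units by auto
    obtain x where x: "x \<in> carrier \<O>" "\<chi> (base_alg K) h = \<iota> x \<or> \<chi> (base_alg K) h \<otimes>\<^bsub>K\<^esub> \<iota> x = \<one>\<^bsub>K\<^esub>"
      using fraction_field_cases[OF assms(1,2) cK(1)] by blast
    have "x \<noteq> \<zero>\<^bsub>\<O>\<^esub>" using x(2) cK ring_hom_zero[OF \<iota> O.ring_axioms K.ring_axioms] by auto
    then have "x \<in> Units \<O>" using O.Units_if_finite x(1) finite_subset[OF subset_UNIV True] by blast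
    then show ?thesis using unit_fraction_mem[of \<O> K \<iota> x, OF O.is_cring K.is_cring \<iota> _ cK(1) x(2)] by simp
  qed
  have sg: "subgroup (\<iota> ` Units \<O>) (units_of K)" and gK: "group (units_of K)"
    using comm_group_value_group[OF O.is_cring assms(2)] by blast+
  have "valuation \<O> K \<iota> (\<chi> (base_alg K) h) = \<one>\<^bsub>value_group \<O> K \<iota>\<^esub>"
    if "\<chi> \<in> carrier (char_group K (base_change \<O> \<iota> G))" for \<chi>
  proof -
    have c: "\<chi> (base_alg K) h \<in> \<iota> ` Units \<O>" using unit that by (simp add: char_group_def)
    then have "\<chi> (base_alg K) h \<in> carrier (units_of K)" using subgroup.subset[OF sg] by blast
    then show ?thesis
      using group.coset_join2[OF gK _ sg c] by (simp add: valuation_def value_group_def)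
  qed
  then have "nu \<O> K \<iota> G h = \<one>\<^bsub>hom_group (char_group K (base_change \<O> \<iota> G)) (value_group \<O> K \<iota>)\<^esub>"
    by (auto simp: nu_def hom_group_def intro!: restrict_ext)
  then show "h \<in> kernel (gobj G (K, \<iota>)) (hom_group (char_group K (base_change \<O> \<iota> G)) (value_group \<O> K \<iota>)) (nu \<O> K \<iota> G)"
    using hK by (simp add: kernel_def)
qed

end
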